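(* Let $c_1,c_2>0$ satisfy $0<c_1<c_2\le 2$ and $c_1^{-1}-c_2^{-1}\le 1$, let $c:\mathbb{R}\to\mathbb{R}$ be $(c_1,c_2)$-admissible, and set $m_1=c_1^{-1}$. Fix $x_0\in\mathbb{R}$ and let $\varepsilon>0$ be sufficiently small. Put $I_\varepsilon=(x_0-\varepsilon,x_0+\varepsilon)$, $$c_\varepsilon^+=\sup_{x\in I_\varepsilon}c(x)+\varepsilon,\qquad c_\varepsilon^-=\inf_{x\in I_\varepsilon}c(x)-\varepsilon,\qquad s_-:=-1/c_\varepsilon^-,\qquad s_+:=-1/c_\varepsilon^+.$$ Then there exists $T\in(0,1]$ such that for every smooth bump function $\chi_\varepsilon(x)$ supported on $I_\varepsilon$ there exist constants $C_0,C_1,C_2>0$ such that $$C_1\|\chi_\varepsilon f\|_{H^{s_-}_t(\mathbb{R})}-tC_0\|f\|_{H^{-m_1}_t(\mathbb{R})}\le\big\|\chi_\varepsilon(x)\,p^{-1}(x,tD)f\big\|_{L^2}\le C_2\|\chi_\varepsilon f\|_{H^{s_+}_t(\mathbb{R})}+tC_0\|f\|_{H^{-m_1}_t(\mathbb{R})}$$ for every $f\in H^{-m_1}_t(\mathbb{R})$ and every $0<t\le T$.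
   Context: Fourier transform: $\widehat f(\xi)=\int_{\mathbb{R}}e^{-2\pi i x\xi}f(x)\,dx$. For a symbol $a(x,\xi)$ and $t>0$, the semiclassical quantization is $a(x,tD)f(x)=\int_{\mathbb{R}}e^{2\pi i x\xi}a(x,t\xi)\widehat f(\xi)\,d\xi$ (for Schwartz $f$, extended by continuity). Semiclassical Sobolev spaces: for $s\in\mathbb{R}$, $t\in(0,1]$, $H^s_t(\mathbb{R})$ is the space of distributions $f$ with $(1+it\xi)^s\widehat f(\xi)\in L^2(\mathbb{R})$, with norm $\|f\|_{H^s_t}=\|(1+it\xi)^s\widehat f\|_{L^2}$. Symbol: $p^{-1}(x,\xi)=(1+c(x)|\xi|)^{-1/c(x)}$ (the reciprocal of $p(x,\xi)=(1+c(x)|\xi|)^{1/c(x)}$); $p^{-1}(x,tD)$ is its semiclassical quantization. Admissibility: for $c_1,c_2>0$ with $0<c_1<c_2\le 2$ and $c_1^{-1}-c_2^{-1}\le1$, a function $c:\mathbb{R}\to\mathbb{R}$ is $(c_1,c_2)$-admissible if (C1) $c_1<\inf_{\mathbb{R}}c\le\sup_{\mathbb{R}}c<c_2$, and at least one of the following holds: (C2) $c\in W^{N,\infty}(\mathbb{R})$ for some $N\in\mathbb{N}$ with $N>3/2+c_1^{-1}$ and $N\ge 1+\lceil c_1^{-1}\rceil$; (C2') there is $c_0\in(c_1,c_2)$ such that $v_1:=c-c_0$ and $v_2:=c^{-1}-c_0^{-1}$ both belong to $H^s(\mathbb{R})$ for some $s$ with $s>3/2+c_1^{-1}$ and $s\ge1+\lceil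 c_1^{-1}\rceil$. *)

theory Defs
  imports "HOL-Analysis.Analysis"
begin

section \<open>Smooth functions, Schwartz functions, tempered distributions\<close>

definition iter_deriv :: "nat \<Rightarrow> (real \<Rightarrow> 'a::real_normed_vector) \<Rightarrow> real \<Rightarrow> 'a" where
  "iter_deriv k f = ((\<lambda>g x. vector_derivative g (at x)) ^^ k) f"

definition smooth :: "(real \<Rightarrow> 'a::real_normed_vector) \<Rightarrow> bool" where
  "smooth f \<longleftrightarrow> (\<forall>k x. iter_deriv k f differentiable (at x))"

text \<open>For a bounded open interval \<open>U\<close> the closed support is automatically compact.\<close>

definition bump_function_on :: "real set \<Rightarrow> (real \<Rightarrow> real) \<Rightarrow> bool" where
  "bump_function_on U \<phi> \<longleftrightarrow>
     smooth \<phi> \<and> compact (closure {x. \<phi> x \<noteq> 0}) \<and> closure {x. \<phi> x \<noteq> 0} \<subseteq> U"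

definition schwartz :: "(real \<Rightarrow> complex) set" where
  "schwartz = {f. smooth f \<and>
     (\<forall>j k. bdd_above (range (\<lambda>x. \<bar>x\<bar> ^ j * cmod (iter_deriv k f x))))}"

definition schwartz_seminorm :: "nat \<Rightarrow> nat \<Rightarrow> (real \<Rightarrow> complex) \<Rightarrow> real" where
  "schwartz_seminorm j k f = (SUP x. \<bar>x\<bar> ^ j * cmod (iter_deriv k f x))"

text \<open>Distributions are functionals on all functions, but only their values on Schwartz
  functions are ever used: two functionals agreeing on \<open>schwartz\<close> are the same distribution.
  The pairing is bilinear (no complex conjugation).\<close>

type_synonym distribution = "(real \<Rightarrow> complex) \<Rightarrow> complex"

definition tempered :: "distribution \<Rightarrow> bool" where
  "tempered u \<longleftrightarrow>
     (\<forall>\<phi>\<in>schwartz. \<forall>\<psi>\<in>schwartz. u (\<lambda>x. \<phi> x + \<psi> x) = u \<phi> + u \<psi>) \<and>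
     (\<forall>a. \<forall>\<phi>\<in>schwartz. u (\<lambda>x. a * \<phi> x) = a * u \<phi>) \<and>
     (\<exists>C N. \<forall>\<phi>\<in>schwartz. cmod (u \<phi>) \<le> C * (\<Sum>j\<le>N. \<Sum>k\<le>N. schwartz_seminorm j k \<phi>))"

definition distr_of_fun :: "(real \<Rightarrow> complex) \<Rightarrow> distribution" where
  "distr_of_fun g = (\<lambda>\<phi>. LINT x|lebesgue. g x * \<phi> x)"

definition distr_diff :: "distribution \<Rightarrow> distribution \<Rightarrow> distribution" where
  "distr_diff u v = (\<lambda>\<phi>. u \<phi> - v \<phi>)"

definition distr_mult :: "(real \<Rightarrow> complex) \<Rightarrow> distribution \<Rightarrow> distribution" where
  "distr_mult m u = (\<lambda>\<phi>. u (\<lambda>x. m x * \<phi> x))"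

definition fourier :: "(real \<Rightarrow> complex) \<Rightarrow> real \<Rightarrow> complex" where
  "fourier f \<xi> = (LINT x|lebesgue. exp (- 2 * pi * \<i> * x * \<xi>) * f x)"

definition distr_fourier :: "distribution \<Rightarrow> distribution" where
  "distr_fourier u = (\<lambda>\<phi>. u (fourier \<phi>))"


section \<open>Semiclassical Sobolev spaces\<close>

definition square_integrable :: "(real \<Rightarrow> complex) \<Rightarrow> bool" where
  "square_integrable g \<longleftrightarrow>
     g \<in> borel_measurable lebesgue \<and> integrable lebesgue (\<lambda>x. (cmod (g x))\<^sup>2)"

text \<open>The extended \<open>L\<^sup>2\<close> norm of a distribution. A representing function is unique up to null
  sets, so the infimum is over at most one value; it is \<open>\<infinity>\<close> if the distribution is not given
  by an \<open>L\<^sup>2\<close> function.\<close>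

definition l2_norm :: "distribution \<Rightarrow> ereal" where
  "l2_norm u =
     (INF g\<in>{g. square_integrable g \<and> (\<forall>\<phi>\<in>schwartz. u \<phi> = distr_of_fun g \<phi>)}.
        ereal (sqrt (LINT x|lebesgue. (cmod (g x))\<^sup>2)))"

definition sobolev_norm :: "real \<Rightarrow> real \<Rightarrow> distribution \<Rightarrow> ereal" where
  "sobolev_norm t s f =
     l2_norm (distr_mult (\<lambda>\<xi>. (1 + \<i> * t * \<xi>) powr (of_real s)) (distr_fourier f))"

definition sobolev_space :: "real \<Rightarrow> real \<Rightarrow> distribution set" where
  "sobolev_space t s = {f. tempered f \<and> sobolev_norm t s f < \<infinity>}"


section \<open>Semiclassical quantization\<close>

definition quant_schwartz ::
    "(real \<Rightarrow> real \<Rightarrow> complex) \<Rightarrow> real \<Rightarrow> (real \<Rightarrow> complex) \<Rightarrow> real \<Rightarrow> complex" where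
  "quant_schwartz a t f x =
     (LINT \<xi>|lebesgue. exp (2 * pi * \<i> * x * \<xi>) * a x (t * \<xi>) * fourier f \<xi>)"

text \<open>The filter of Schwartz functions converging to \<open>f\<close> in the norm of order \<open>s\<close>.\<close>

definition schwartz_approx :: "real \<Rightarrow> real \<Rightarrow> distribution \<Rightarrow> (real \<Rightarrow> complex) filter" where
  "schwartz_approx t s f =
     inf (principal schwartz)
         (filtercomap (\<lambda>g. sobolev_norm t s (distr_diff (distr_of_fun g) f)) (nhds 0))"

text \<open>Extension by continuity from Schwartz functions to the Sobolev space of order \<open>s\<close>, the
  values being taken in tempered distributions with the weak topology. As this is a Hausdorff
  topology coarser than that of every Sobolev space, it gives the same extension as continuity
  into any Sobolev space into which the operator is bounded.\<close>

definition quant :: "(real \<Rightarrow> real \<Rightarrow> complex) \<Rightarrow> real \<Rightarrow> real \<Rightarrow> distribution \<Rightarrow> distribution" where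
  "quant a t s f =
     (\<lambda>\<phi>. Lim (schwartz_approx t s f) (\<lambda>g. distr_of_fun (quant_schwartz a t g) \<phi>))"

definition p_inv :: "(real \<Rightarrow> real) \<Rightarrow> real \<Rightarrow> real \<Rightarrow> complex" where
  "p_inv c x \<xi> = complex_of_real ((1 + c x * \<bar>\<xi>\<bar>) powr (- 1 / c x))"


section \<open>Admissible functions\<close>

definition ess_bounded :: "(real \<Rightarrow> real) \<Rightarrow> bool" where
  "ess_bounded f \<longleftrightarrow>
     f \<in> borel_measurable lebesgue \<and> (\<exists>B. AE x in lebesgue. \<bar>f x\<bar> \<le> B)"

definition weak_deriv :: "nat \<Rightarrow> (real \<Rightarrow> real) \<Rightarrow> (real \<Rightarrow> real) \<Rightarrow> bool" where
  "weak_deriv k f g \<longleftrightarrow>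
     (\<forall>\<phi>. bump_function_on UNIV \<phi> \<longrightarrow>
        (LINT x|lebesgue. f x * iter_deriv k \<phi> x) = (-1) ^ k * (LINT x|lebesgue. g x * \<phi> x))"

definition sobolev_W_inf :: "nat \<Rightarrow> (real \<Rightarrow> real) set" where
  "sobolev_W_inf N =
     {f. ess_bounded f \<and> (\<forall>k\<le>N. \<exists>g. ess_bounded g \<and> weak_deriv k f g)}"

text \<open>Real functions in the Sobolev space of order \<open>s\<close> (that is, \<open>t = 1\<close>). Integrability against
  Schwartz functions makes \<open>distr_of_fun\<close> meaningful.\<close>

definition sobolev_H :: "real \<Rightarrow> (real \<Rightarrow> real) set" where
  "sobolev_H s =
     {v. v \<in> borel_measurable lebesgue \<and>
         (\<forall>\<phi>\<in>schwartz. integrable lebesgue (\<lambda>x. complex_of_real (v x) * \<phi> x)) \<and>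
         distr_of_fun (\<lambda>x. complex_of_real (v x)) \<in> sobolev_space 1 s}"

definition admissible :: "real \<Rightarrow> real \<Rightarrow> (real \<Rightarrow> real) \<Rightarrow> bool" where
  "admissible c1 c2 c \<longleftrightarrow>
     ereal c1 < (INF x. ereal (c x)) \<and> (INF x. ereal (c x)) \<le> (SUP x. ereal (c x)) \<and>
     (SUP x. ereal (c x)) < ereal c2 \<and>
     ((\<exists>N::nat. real N > 3/2 + 1 / c1 \<and> int N \<ge> 1 + \<lceil>1 / c1\<rceil> \<and> c \<in> sobolev_W_inf N) \<or>
      (\<exists>c0\<in>{c1<..<c2}. \<exists>s::real. s > 3/2 + 1 / c1 \<and> s \<ge> 1 + real_of_int \<lceil>1 / c1\<rceil> \<and>
         (\<lambda>x. c x - c0) \<in> sobolev_H s \<and> (\<lambda>x. 1 / c x - 1 / c0) \<in> sobolev_H s))"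

definition c_plus :: "(real \<Rightarrow> real) \<Rightarrow> real \<Rightarrow> real \<Rightarrow> real" where
  "c_plus c x0 \<epsilon> = (SUP x\<in>{x0 - \<epsilon><..<x0 + \<epsilon>}. c x) + \<epsilon>"

definition c_minus :: "(real \<Rightarrow> real) \<Rightarrow> real \<Rightarrow> real \<Rightarrow> real" where
  "c_minus c x0 \<epsilon> = (INF x\<in>{x0 - \<epsilon><..<x0 + \<epsilon>}. c x) - \<epsilon>"

end

theory Submission
  imports Defs "HOL-Probability.Probability"
begin

text \<open>Near \<open>x\<^sub>0\<close> the function \<open>c\<close> agrees almost everywhere with a \<open>C\<^sup>1\<close> function \<open>V\<close> whose derivative is
 Lipschitz in the \<open>L\<^sup>2\<close> mean. Let \<open>F(g,\<xi>) = (1 + g\<bar>\<xi>\<bar>)\<^bsup>-1/g\<^esup>\<close>, let \<open>w\<close> be the Fourier transform of \<open>f\<close>, and let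
 \<open>z\<close> be that of the localization \<open>\<chi> f\<close>, the convolution of \<open>w\<close> with the transform of the cutoff \<open>\<chi>\<close>. For a
 Schwartz function \<open>\<psi>\<close> the localized operator pairs with \<open>\<psi>\<close> to
 \<open>\<Lambda>(\<psi>) = \<integral> w(\<eta>) FT[\<chi> \<psi> F(V, t\<eta>)](-\<eta>) d\<eta>\<close>. Taylor's formula in \<open>g\<close> expresses functions of \<open>V\<close> through
 truncated powers of \<open>V\<close>, so the transforms of \<open>B F(V, p) / F(V, q)\<close> are dominated by the symbol's size times a
 majorant not depending on \<open>p\<close> and \<open>q\<close>, and exchanging \<open>t\<eta>\<close> for \<open>t\<xi>\<close> costs \<open>t\<bar>\<xi> - \<eta>\<bar>\<close>, which Young's
 inequality absorbs into \<open>t C\<^sub>0 \<parallel>f\<parallel>\<close>. The upper bound replaces \<open>F(V, t\<eta>)\<close> by \<open>F(V, t\<xi>)\<close> and represents \<open>\<Lambda>\<close>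
 by the Riesz theorem. For the lower bound \<open>\<Lambda>\<close> is tested with the quantization of \<open>1/F\<close> applied to an amplitude
 \<open>h\<close>: since \<open>F(V, t\<eta>)/F(V, t\<xi>) = 1 + O(t\<bar>\<xi> - \<eta>\<bar>)\<close> up to powers of the frequencies, this returns
 \<open>\<integral> h \<langle>t\<xi>\<rangle>\<^bsup>s\<^esup> z\<close> with \<open>s = s\<^sub>-\<close> up to \<open>O(t)\<close>, and \<open>h\<close> is taken to be a truncation of the conjugate
 of \<open>\<langle>t\<xi>\<rangle>\<^bsup>s\<^esup> z\<close>.\<close>

text \<open>The order \<open>-1/c(x)\<close> of the symbol varies with \<open>x\<close> and
  \<open>c\<close> has only finitely many derivatives, so in place of a symbol calculus the proof
  uses one exact identity: the ratio of the symbol at two frequencies is the symbol at one times the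
  reciprocal symbol at the other. Each derivative in \<open>g\<close> costs a logarithm of the
  frequency; the room that \<epsilon> makes between \<open>-1/c\<close> on the interval and the
  exponents \<open>s_plus\<close>, \<open>s_minus\<close> pays for all of them. Taylor's formula is
  used at two depths. At depth three the remainder kernel has a Lipschitz derivative, so the
  transforms for a fixed amplitude are integrable, and a leading term with a coefficient independent
  of \<open>x\<close> splits off; the comparison in the lower bound needs this. Depth one asks
  nothing of the amplitude but its \<open>L2\<close> norm, as amplitudes containing an arbitrary
  test function require. The condition \<open>1/c1 - 1/c2 \<le> 1\<close> says that the source
  weight of order \<open>m1\<close> costs no more than the decay of the symbol plus the one power of
  frequency gained by subtracting two symbol values. All bounds are uniform for
  \<open>0 < t \<le> 1\<close>.\<close>

abbreviation BM :: "('a::topological_space => 'b::topological_space) set" where "BM \<equiv> borel_measurable borel"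

abbreviation BM2 :: "(real \<times> real => 'b::topological_space) set" where
  "BM2 \<equiv> borel_measurable (borel \<Otimes>\<^sub>M borel)"

abbreviation intl :: "(real => 'a::{banach, second_countable_topology}) => bool" where "intl \<equiv> integrable lborel"

abbreviation lint :: "(real => 'a::{banach, second_countable_topology}) => 'a" (binder "LI " 60) where
  "lint f \<equiv> integral\<^sup>L lborel f"

abbreviation nint :: "(real => ennreal) => ennreal" (binder "NI " 60) where "nint f \<equiv> integral\<^sup>N lborel f"

abbreviation seqlim :: "(nat => 'a::topological_space) => 'a => bool" ("((_)/ ----> (_))" [60, 60] 60) where
 "X ----> L \<equiv> X \<longlonglongrightarrow> L"

type_synonym cfun = "real => complex"

lemmas lintegrable_add = Bochner_Integration.integrable_add
  and lintegrable_bound = Bochner_Integration.integrable_bound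
  and lintegrable_diff = Bochner_Integration.integrable_diff
  and lintegrable_sum = Bochner_Integration.integrable_sum
  and lintegral_add = Bochner_Integration.integral_add
  and lintegral_cnj = Bochner_Integration.integral_cnj
  and lintegral_cong = Bochner_Integration.integral_cong
  and lintegral_diff = Bochner_Integration.integral_diff
  and lintegral_nonneg = Bochner_Integration.integral_nonneg


section \<open>Square-integrable functions\<close>

text \<open>Borel rather than Lebesgue measurability keeps shifts, products and integrals with
  parameters measurable; the passage from \<open>lebesgue\<close> is confined to lemmas such as
  \<open>square_integrable_borel_version\<close>.\<close>

definition L2 :: "(real => 'a::{banach, second_countable_topology}) => bool" where
 "L2 f \<longleftrightarrow> f \<in> BM \<and> intl (\<lambda>x. (norm (f x))\<^sup>2)"

definition L2norm :: "(real => 'a::{banach, second_countable_topology}) => real" where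
 "L2norm f = sqrt (LI x. (norm (f x))\<^sup>2)"

lemma L2_measurable [measurable_dest]: "L2 f ==> f \<in> BM" by (simp add: L2_def)

lemma L2norm_nonneg [simp]: "0 \<le> L2norm f" by (simp add: L2norm_def)

lemma L2norm_square: "(L2norm f)\<^sup>2 = (LI x. (norm (f x))\<^sup>2)" by (simp add: L2norm_def)

lemma nn_integral_L2:
 assumes "L2 f"
 shows "(NI x. (ennreal (norm (f x)))\<^sup>2) = ennreal ((L2norm f)\<^sup>2)"
 using assms unfolding L2_def L2norm_square by (simp add: ennreal_power nn_integral_eq_integral)

lemma L2I_nn:
 assumes [measurable]: "f \<in> BM" and "0 \<le> C"
  and le: "(NI x. (ennreal (norm (f x)))\<^sup>2) \<le> ennreal (C\<^sup>2)"
 shows "L2 f" "L2norm f \<le> C"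
proof -
 have le': "(NI x. ennreal ((norm (f x))\<^sup>2)) \<le> ennreal (C\<^sup>2)"
  using le by (simp add: ennreal_power)
 have int: "intl (\<lambda>x. (norm (f x))\<^sup>2)"
  by (rule integrableI_bounded) (use le' in \<open>auto intro: le_less_trans\<close>)
 then show "L2 f" by (simp add: L2_def)
 have "ennreal (LI x. (norm (f x))\<^sup>2) \<le> ennreal (C\<^sup>2)"
  using le' int by (subst nn_integral_eq_integral[symmetric]) auto
 then have "(LI x. (norm (f x))\<^sup>2) \<le> C\<^sup>2" by simp
 then show "L2norm f \<le> C" unfolding L2norm_def using \<open>0 \<le> C\<close> real_le_lsqrt by blast
qed

lemma L2_bound:
 assumes "L2 f" and [measurable]: "g \<in> BM" and "0 \<le> C"
  and le: "\<And>x. norm (g x) \<le> C * norm (f x)"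
 shows "L2 g" "L2norm g \<le> C * L2norm f"
proof -
 have [measurable]: "f \<in> BM" using assms(1) by measurable
 have "(NI x. (ennreal (norm (g x)))\<^sup>2) \<le> (NI x. ennreal (C\<^sup>2) * (ennreal (norm (f x)))\<^sup>2)"
 proof (rule nn_integral_mono)
  fix x
  have "(norm (g x))\<^sup>2 \<le> C\<^sup>2 * (norm (f x))\<^sup>2"
   using power_mono[OF le, of x 2] by (simp add: power_mult_distrib)
  then show "(ennreal (norm (g x)))\<^sup>2 \<le> ennreal (C\<^sup>2) * (ennreal (norm (f x)))\<^sup>2"
   by (simp add: ennreal_power ennreal_mult[symmetric] ennreal_leI)
 qed
 also have "... = ennreal ((C * L2norm f)\<^sup>2)"
  by (simp add: nn_integral_cmult nn_integral_L2[OF assms(1)] ennreal_mult[symmetric] power_mult_distrib)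
 finally show "L2 g" "L2norm g \<le> C * L2norm f"
  using L2I_nn[of g "C * L2norm f"] \<open>0 \<le> C\<close> by auto
qed

lemma L2_mult_nn:
 assumes "L2 f" "L2 g"
 shows "(NI x. ennreal (norm (f x)) * ennreal (norm (g x))) \<le> ennreal (L2norm f * L2norm g)"
proof -
 have [measurable]: "f \<in> BM" "g \<in> BM" using assms by measurable
 let ?I = "NI x. ennreal (norm (f x)) * ennreal (norm (g x))"
 have sq: "?I\<^sup>2 \<le> ennreal ((L2norm f * L2norm g)\<^sup>2)"
  using Cauchy_Schwarz_nn_integral[of "\<lambda>x. ennreal (norm (f x))" lborel "\<lambda>x. ennreal (norm (g x))"]
  by (simp add: nn_integral_L2 assms ennreal_mult[symmetric] power_mult_distrib)
 then have "?I < top" by (metis ennreal_less_top le_less_trans less_top power_eq_top_ennreal zero_neq_numeral)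
 then obtain r where r: "0 \<le> r" "?I = ennreal r" by (metis ennreal_cases less_irrefl infinity_ennreal_def)
 with sq have "r\<^sup>2 \<le> (L2norm f * L2norm g)\<^sup>2" by (simp add: ennreal_power)
 then have "r \<le> L2norm f * L2norm g" by (rule power2_le_imp_le) auto
 with r show ?thesis by (simp add: ennreal_leI)
qed

lemma
 fixes f g :: "real => 'a::{banach, second_countable_topology, real_normed_algebra}"
 assumes "L2 f" "L2 g"
 shows L2_mult_integrable: "intl (\<lambda>x. f x * g x)"
  and L2_mult_integral_le: "norm (LI x. f x * g x) \<le> L2norm f * L2norm g"
proof -
 have [measurable]: "f \<in> BM" "g \<in> BM" using assms by measurable
 have le: "(NI x. ennreal (norm (f x * g x))) \<le> ennreal (L2norm f * L2norm g)"
  by (rule order_trans[OF nn_integral_mono L2_mult_nn[OF assms]])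
   (auto simp: ennreal_mult[symmetric] ennreal_leI norm_mult_ineq)
 show int: "intl (\<lambda>x. f x * g x)"
  by (rule integrableI_bounded) (use le in \<open>auto intro: le_less_trans\<close>)
 show "norm (LI x. f x * g x) \<le> L2norm f * L2norm g"
  using order_trans[OF integral_norm_bound_ennreal[OF int] le] by simp
qed

lemma L2_norm_mult_integral_le:
 assumes "L2 f" "L2 g"
 shows "intl (\<lambda>x. norm (f x) * norm (g x))"
  and "(LI x. norm (f x) * norm (g x)) \<le> L2norm f * L2norm g"
proof -
 have a: "L2 (\<lambda>x. norm (f x))" "L2 (\<lambda>x. norm (g x))" using assms by (auto simp: L2_def)
 show "intl (\<lambda>x. norm (f x) * norm (g x))" using L2_mult_integrable[OF a] .
 show "(LI x. norm (f x) * norm (g x)) \<le> L2norm f * L2norm g"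
  using L2_mult_integral_le[OF a] by (simp add: L2norm_def)
qed

lemma
 assumes "L2 f" "L2 g"
 shows L2_add: "L2 (\<lambda>x. f x + g x)"
  and L2norm_triangle: "L2norm (\<lambda>x. f x + g x) \<le> L2norm f + L2norm g"
proof -
 have [measurable]: "f \<in> BM" "g \<in> BM" using assms by measurable
 have i: "intl (\<lambda>x. (norm (f x))\<^sup>2)" "intl (\<lambda>x. (norm (g x))\<^sup>2)"
  using assms by (auto simp: L2_def)
 have int: "intl (\<lambda>x. (norm (f x))\<^sup>2 + 2 * (norm (f x) * norm (g x)) + (norm (g x))\<^sup>2)"
  using i L2_norm_mult_integral_le(1)[OF assms] by auto
 have le: "(norm (f x + g x))\<^sup>2 \<le> (norm (f x))\<^sup>2 + 2 * (norm (f x) * norm (g x)) + (norm (g x))\<^sup>2" for x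
  using power_mono[OF norm_triangle_ineq[of "f x" "g x"], of 2] by (simp add: power2_sum)
 have int2: "intl (\<lambda>x. (norm (f x + g x))\<^sup>2)"
  by (rule lintegrable_bound[OF int]) (auto intro: order_trans[OF le])
 then show L: "L2 (\<lambda>x. f x + g x)" by (simp add: L2_def)
 have "(L2norm (\<lambda>x. f x + g x))\<^sup>2 \<le> (LI x. (norm (f x))\<^sup>2 + 2 * (norm (f x) * norm (g x)) + (norm (g x))\<^sup>2)"
  unfolding L2norm_square by (intro integral_mono int int2 le)
 also have "... = (L2norm f)\<^sup>2 + 2 * (LI x. norm (f x) * norm (g x)) + (L2norm g)\<^sup>2"
  using i L2_norm_mult_integral_le(1)[OF assms] by (simp add: L2norm_square)
 also have "... \<le> (L2norm f + L2norm g)\<^sup>2"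
  using L2_norm_mult_integral_le(2)[OF assms] by (simp add: power2_sum)
 finally show "L2norm (\<lambda>x. f x + g x) \<le> L2norm f + L2norm g" by (rule power2_le_imp_le) auto
qed

lemma
 fixes f :: "real => 'a::{banach, second_countable_topology, real_normed_div_algebra}"
 assumes "L2 f"
 shows L2_cmult: "L2 (\<lambda>x. a * f x)" and L2norm_cmult: "L2norm (\<lambda>x. a * f x) = norm a * L2norm f"
 using assms by (auto simp: L2_def L2norm_def norm_mult power_mult_distrib real_sqrt_mult)

lemma
 assumes "L2 f"
 shows L2_minus: "L2 (\<lambda>x. - f x)" and L2norm_minus: "L2norm (\<lambda>x. - f x) = L2norm f"
 using assms by (auto simp: L2_def L2norm_def)

lemma
 assumes "L2 f" "L2 g"
 shows L2_diff: "L2 (\<lambda>x. f x - g x)"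
  and L2norm_triangle_diff: "L2norm (\<lambda>x. f x - g x) \<le> L2norm f + L2norm g"
 using L2_add[OF assms(1) L2_minus[OF assms(2)]] L2norm_triangle[OF assms(1) L2_minus[OF assms(2)]]
 by (simp_all add: L2norm_minus[OF assms(2)])

lemma cnj_measurable [measurable]: "cnj \<in> BM" by (intro borel_measurable_continuous_onI continuous_intros)

lemma
 assumes "L2 (f :: real => complex)"
 shows L2_cnj: "L2 (\<lambda>x. cnj (f x))" and L2norm_cnj: "L2norm (\<lambda>x. cnj (f x)) = L2norm f"
 using assms measurable_compose[OF _ cnj_measurable, of f borel] by (auto simp: L2_def L2norm_def)

lemma
 assumes "L2 f"
 shows L2_norm: "L2 (\<lambda>x. norm (f x))" and L2norm_norm: "L2norm (\<lambda>x. norm (f x)) = L2norm f"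
 using assms by (auto simp: L2_def L2norm_def)

lemma
 assumes "L2 f"
 shows L2_shift: "L2 (\<lambda>x. f (x + a))" and L2norm_shift: "L2norm (\<lambda>x. f (x + a)) = L2norm f"
proof -
 have [measurable]: "f \<in> BM" using assms by measurable
 have 1: "intl (\<lambda>x. (norm (f (a + 1 * x)))\<^sup>2)"
  by (rule lborel_integrable_real_affine) (use assms in \<open>auto simp: L2_def\<close>)
 then show "L2 (\<lambda>x. f (x + a))" by (simp add: L2_def add.commute)
 have "(LI x. (norm (f x))\<^sup>2) = (LI x. (norm (f (a + 1 * x)))\<^sup>2)"
  by (subst lborel_integral_real_affine[of 1 _ a]) simp_all
 then show "L2norm (\<lambda>x. f (x + a)) = L2norm f" by (simp add: L2norm_def add.commute)
qed

lemma L2norm_cong_AE: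
 assumes "f \<in> BM" "g \<in> BM" "AE x in lborel. f x = g x"
 shows "L2norm f = L2norm g" unfolding L2norm_def using assms
 by (intro arg_cong[of _ _ sqrt] integral_cong_AE) auto

text \<open>Fatou's lemma for the squares. It serves whenever a bound is uniform along approximants
  but the limit is not yet known to be square integrable: Gaussian damping, difference quotients,
  truncation.\<close>

lemma L2_fatou:
 fixes F :: "nat => real => 'a::{banach, second_countable_topology}"
 assumes F: "\<And>n. L2 (F n)" "\<And>n. L2norm (F n) \<le> C"
  and [measurable]: "g \<in> BM"
  and lim: "AE x in lborel. (\<lambda>n. F n x) ----> g x"
 shows "L2 g" "L2norm g \<le> C"
proof -
 have [measurable]: "F n \<in> BM" for n using F(1)[of n] by measurable
 have C: "0 \<le> C" using F(2)[of 0] L2norm_nonneg[of "F 0"] by linarith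
 have "(NI x. (ennreal (norm (g x)))\<^sup>2) = (NI x. liminf (\<lambda>n. (ennreal (norm (F n x)))\<^sup>2))"
 proof (rule nn_integral_cong_AE, use lim in eventually_elim)
  case (elim x)
  have "(\<lambda>n. (ennreal (norm (F n x)))\<^sup>2) ----> (ennreal (norm (g x)))\<^sup>2"
   unfolding ennreal_power[OF norm_ge_zero] by (intro tendsto_ennrealI tendsto_power tendsto_norm elim)
  then show ?case by (metis lim_imp_Liminf trivial_limit_sequentially)
 qed
 also have "... \<le> liminf (\<lambda>n. NI x. (ennreal (norm (F n x)))\<^sup>2)"
  by (rule nn_integral_liminf) measurable
 also have "... \<le> ennreal (C\<^sup>2)"
 proof -
  have "(NI x. (ennreal (norm (F n x)))\<^sup>2) \<le> ennreal (C\<^sup>2)" for n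
   using nn_integral_L2[OF F(1)] F(2)[of n] by (simp add: ennreal_leI power_mono)
  then have "liminf (\<lambda>n. NI x. (ennreal (norm (F n x)))\<^sup>2) \<le> liminf (\<lambda>n. ennreal (C\<^sup>2))"
   by (intro Liminf_mono always_eventually allI)
  then show ?thesis by (simp add: Liminf_const)
 qed
 finally show "L2 g" "L2norm g \<le> C" using L2I_nn[of g C] C by auto
qed

lemma L2_sum:
 assumes "\<And>i. i \<in> I ==> L2 (F i)" "finite I"
 shows "L2 (\<lambda>x. \<Sum>i\<in>I. F i x)" "L2norm (\<lambda>x. \<Sum>i\<in>I. F i x) \<le> (\<Sum>i\<in>I. L2norm (F i))"
 using assms(2,1)
proof (induction I rule: finite_induct)
 case empty
 { case 1 show ?case by (simp add: L2_def) }
 { case 2 show ?case by (simp add: L2norm_def) }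
next
 case (insert i I)
 { case 1 then show ?case using insert by (auto intro: L2_add) }
 { case 2
  then have a: "L2 (F i)" "L2 (\<lambda>x. \<Sum>i\<in>I. F i x)" "L2norm (\<lambda>x. \<Sum>i\<in>I. F i x) \<le> (\<Sum>i\<in>I. L2norm (F i))"
   using insert by auto
  show ?case using L2norm_triangle[OF a(1,2)] a(3) insert(1,2) by simp }
qed

lemma L2_complete:
 fixes F :: "nat => real => 'a::{banach, second_countable_topology}"
 assumes F: "\<And>n. L2 (F n)"
  and Cau: "\<And>e. 0 < e ==> \<exists>N. \<forall>m\<ge>N. \<forall>n\<ge>N. L2norm (\<lambda>x. F m x - F n x) < e"
 obtains g where "L2 g" "(\<lambda>n. L2norm (\<lambda>x. F n x - g x)) ----> 0"
proof -
 have [measurable]: "F n \<in> BM" for n using F[of n] by measurable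
 have "\<exists>N. \<forall>m\<ge>N. \<forall>n\<ge>N. L2norm (\<lambda>x. F m x - F n x) < (1/2)^k" for k :: nat
  using Cau[of "(1/2)^k"] by simp
 then obtain N where N: "\<And>k m n. m \<ge> N k ==> n \<ge> N k ==> L2norm (\<lambda>x. F m x - F n x) < (1/2)^k"
  by metis
 \<comment> \<open>The sum makes \<open>r\<close> nondecreasing while \<open>N k \<le> r k\<close>;
   consecutive terms along \<open>r\<close> then differ by at most \<open>(1/2)^k\<close> in norm,
   so the series of differences converges almost everywhere.\<close>
 define r where "r k = k + (\<Sum>i\<le>k. N i)" for k
 have rN: "N k \<le> r k" for k unfolding r_def by (rule trans_le_add2) (auto intro: member_le_sum)
 have rmono: "r k \<le> r (Suc k)" for k by (simp add: r_def)
 have rk: "k \<le> r k" for k by (simp add: r_def)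
 define d where "d k x = norm (F (r (Suc k)) x - F (r k) x)" for k x
 have d: "L2 (d k)" "L2norm (d k) \<le> (1/2)^k" for k
 proof -
  have "L2 (\<lambda>x. F (r (Suc k)) x - F (r k) x)" by (rule L2_diff[OF F F])
  from L2_norm[OF this] L2norm_norm[OF this] show "L2 (d k)" "L2norm (d k) \<le> (1/2)^k"
   using N[of k "r (Suc k)" "r k"] rN[of k] rmono[of k] by (auto simp: d_def[abs_def])
 qed
 have [measurable]: "d k \<in> BM" for k using d(1)[of k] by measurable
 have d0: "0 \<le> d k x" for k x by (simp add: d_def)
 define S where "S n x = (\<Sum>k<n. d k x)" for n x
 have S: "L2 (S n)" "L2norm (S n) \<le> 2" for n
 proof -
  show "L2 (S n)" unfolding S_def[abs_def] by (rule L2_sum) (auto simp: d)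
  have "L2norm (S n) \<le> (\<Sum>k<n. L2norm (d k))" unfolding S_def[abs_def] by (rule L2_sum) (auto simp: d)
  also have "... \<le> (\<Sum>k<n. (1/2)^k)" by (intro sum_mono d)
  also have "... = 2 - 2 * (1/2)^n" by (induct n) auto
  also have "... \<le> 2" by simp
  finally show "L2norm (S n) \<le> 2" .
 qed
 have [measurable]: "S k \<in> BM" for k using S(1)[of k] by measurable
 have S0: "0 \<le> S n x" for n x by (simp add: S_def sum_nonneg d0)
 have Sm: "incseq (\<lambda>n. (ennreal (S n x))\<^sup>2)" for x
  by (intro incseq_SucI power_mono) (auto simp: S_def d0 intro: ennreal_leI)
 have "(NI x. (SUP n. (ennreal (S n x))\<^sup>2)) = (SUP n. NI x. (ennreal (S n x))\<^sup>2)"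
  by (rule nn_integral_monotone_convergence_SUP) (use Sm in \<open>auto simp: incseq_def le_fun_def\<close>)
 also have "... \<le> ennreal 4"
 proof (rule SUP_least)
  fix n
  have "(NI x. (ennreal (S n x))\<^sup>2) = ennreal ((L2norm (S n))\<^sup>2)"
   using nn_integral_L2[OF S(1)[of n]] S0 by simp
  also have "... \<le> ennreal 4" using power_mono[OF S(2)[of n], of 2] by (intro ennreal_leI) simp
  finally show "(NI x. (ennreal (S n x))\<^sup>2) \<le> ennreal 4" .
 qed
 finally have "(NI x. (SUP n. (ennreal (S n x))\<^sup>2)) < \<infinity>" by (auto intro: le_less_trans)
 then have "AE x in lborel. (SUP n. (ennreal (S n x))\<^sup>2) \<noteq> \<infinity>"
  by (intro nn_integral_PInf_AE) (auto simp: less_top)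
 then have AE: "AE x in lborel. convergent (\<lambda>n. F (r n) x)"
 proof eventually_elim
  case (elim x)
  then obtain B where B: "0 \<le> B" "(SUP n. (ennreal (S n x))\<^sup>2) = ennreal B"
   by (metis ennreal_cases infinity_ennreal_def)
  have "S n x \<le> sqrt B" for n
  proof -
   have "(ennreal (S n x))\<^sup>2 \<le> ennreal B" unfolding B(2)[symmetric] by (rule SUP_upper) simp
   then have "(S n x)\<^sup>2 \<le> B" using S0 B by (simp add: ennreal_power)
   then show ?thesis by (rule real_le_rsqrt)
  qed
  then have "summable (\<lambda>k. d k x)"
   by (intro summableI_nonneg_bounded[of _ "sqrt B"]) (auto simp: d0 S_def)
  then have "summable (\<lambda>k. F (r (Suc k)) x - F (r k) x)"
   unfolding d_def by (rule summable_norm_cancel)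
  then have "convergent (\<lambda>n. \<Sum>k<n. F (r (Suc k)) x - F (r k) x)"
   by (simp add: summable_iff_convergent)
  then have "convergent (\<lambda>n. F (r n) x - F (r 0) x)"
   using sum_lessThan_telescope[of "\<lambda>n. F (r n) x"] by simp
  then have "convergent (\<lambda>n. (F (r n) x - F (r 0) x) + F (r 0) x)"
   by (intro convergent_add convergent_const)
  then show ?case by simp
 qed
 define g where "g x = lim (\<lambda>n. F (r n) x)" for x
 have gm [measurable]: "g \<in> BM" unfolding g_def[abs_def] by measurable
 have lim: "AE x in lborel. (\<lambda>n. F (r n) x) ----> g x"
  using AE by eventually_elim (simp add: g_def convergent_LIMSEQ_iff)
 \<comment> \<open>Fatou in \<open>j\<close> along the subsequence turns the Cauchy estimate for the
   whole sequence into its distance from \<open>g\<close>.\<close>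
 have le: "L2 (\<lambda>x. F n x - g x) \<and> L2norm (\<lambda>x. F n x - g x) \<le> (1/2)^k" if "n \<ge> N k" for n k
 proof -
  have 1: "L2 (\<lambda>x. F n x - F (r (j + k)) x)" for j by (rule L2_diff[OF F F])
  have 2: "L2norm (\<lambda>x. F n x - F (r (j + k)) x) \<le> (1/2)^k" for j
  proof -
   have "r k \<le> r (j + k)" by (induction j) (auto intro: order_trans[OF _ rmono])
   then show ?thesis using N[of k n "r (j+k)"] that rN[of k] by simp
  qed
  have 3: "AE x in lborel. (\<lambda>j. F n x - F (r (j + k)) x) ----> F n x - g x"
   using lim
  proof eventually_elim
   case (elim x)
   show ?case by (intro tendsto_diff tendsto_const LIMSEQ_ignore_initial_segment elim)
  qed
  show ?thesis using L2_fatou[OF 1 2 _ 3] by auto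
 qed
 have "L2 (\<lambda>x. F (N 0) x - (F (N 0) x - g x))" by (rule L2_diff[OF F]) (use le[of 0 "N 0"] in simp)
 then have g: "L2 g" by simp
 have "(\<lambda>n. L2norm (\<lambda>x. F n x - g x)) ----> 0"
 proof (rule LIMSEQ_I)
  fix e :: real assume "0 < e"
  then obtain k where k: "(1/2)^k < e" using real_arch_pow_inv[of e "1/2"] by auto
  show "\<exists>no. \<forall>n\<ge>no. norm (L2norm (\<lambda>x. F n x - g x) - 0) < e"
   by (rule exI[of _ "N k"]) (use le k in \<open>auto intro: le_less_trans\<close>)
 qed
 with g show ?thesis by (rule that)
qed

lemma L2norm_parallelogram:
 fixes f g :: cfun
 assumes "L2 f" "L2 g"
 shows "(L2norm (\<lambda>x. f x - g x))\<^sup>2 = 2 * (L2norm f)\<^sup>2 + 2 * (L2norm g)\<^sup>2 - (L2norm (\<lambda>x. f x + g x))\<^sup>2"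
proof -
 have i: "intl (\<lambda>x. (norm (f x))\<^sup>2)" "intl (\<lambda>x. (norm (g x))\<^sup>2)"
  "intl (\<lambda>x. (norm (f x + g x))\<^sup>2)" "intl (\<lambda>x. (norm (f x - g x))\<^sup>2)"
  using assms L2_add[OF assms] L2_diff[OF assms] by (auto simp: L2_def)
 have "(norm (f x - g x))\<^sup>2 = 2 * (norm (f x))\<^sup>2 + 2 * (norm (g x))\<^sup>2 - (norm (f x + g x))\<^sup>2" for x
  unfolding cmod_power2 by (simp add: power2_eq_square algebra_simps)
 then show ?thesis unfolding L2norm_square using i by simp
qed

lemma L2norm_add_expand:
 fixes f g :: cfun
 assumes "L2 f" "L2 g"
 shows "(L2norm (\<lambda>x. f x + of_real s * g x))\<^sup>2 =
  (L2norm f)\<^sup>2 + 2 * s * Re (LI x. g x * cnj (f x)) + s\<^sup>2 * (L2norm g)\<^sup>2"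
proof -
 have m: "intl (\<lambda>x. g x * cnj (f x))" by (rule L2_mult_integrable[OF assms(2) L2_cnj[OF assms(1)]])
 have i: "intl (\<lambda>x. (norm (f x))\<^sup>2)" "intl (\<lambda>x. (norm (g x))\<^sup>2)"
  using assms by (auto simp: L2_def)
 define P where "P x = Re (g x * cnj (f x))" for x
 have P: "intl P" "(LI x. P x) = Re (LI x. g x * cnj (f x))"
  unfolding P_def[abs_def] by (rule integrable_Re[OF m], rule integral_Re[OF m])
 have e: "(norm (f x + of_real s * g x))\<^sup>2 = (norm (f x))\<^sup>2 + 2 * s * P x + s\<^sup>2 * (norm (g x))\<^sup>2" for x
  unfolding P_def cmod_power2 by (simp add: power2_eq_square algebra_simps)
 have "(LI x. (norm (f x))\<^sup>2 + 2 * s * P x + s\<^sup>2 * (norm (g x))\<^sup>2)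
  = (LI x. (norm (f x))\<^sup>2) + 2 * s * (LI x. P x) + s\<^sup>2 * (LI x. (norm (g x))\<^sup>2)"
  using i P(1) by simp
 then show ?thesis unfolding L2norm_square e P(2) .
qed

lemma L2_tendsto_integral:
 fixes F :: "nat => real => complex"
 assumes "\<And>n. L2 (F n)" "L2 g" "L2 h" "(\<lambda>n. L2norm (\<lambda>x. F n x - g x)) ----> 0"
 shows "(\<lambda>n. LI x. h x * F n x) ----> (LI x. h x * g x)"
proof -
 have "(\<lambda>n. (LI x. h x * F n x) - (LI x. h x * g x)) ----> 0"
 proof (rule Lim_null_comparison)
  show "(\<lambda>n. L2norm h * L2norm (\<lambda>x. F n x - g x)) ----> 0"
   using tendsto_mult_left[OF assms(4), of "L2norm h"] by simp
  show "\<forall>\<^sub>F n in sequentially. norm ((LI x. h x * F n x) - (LI x. h x * g x)) \<le> L2norm h * L2norm (\<lambda>x. F n x - g x)"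
  proof (intro always_eventually allI)
   fix n
   have "(LI x. h x * F n x) - (LI x. h x * g x) = (LI x. h x * (F n x - g x))"
    using L2_mult_integrable[OF assms(3,1)] L2_mult_integrable[OF assms(3,2)]
    by (simp add: right_diff_distrib)
   then show "norm ((LI x. h x * F n x) - (LI x. h x * g x)) \<le> L2norm h * L2norm (\<lambda>x. F n x - g x)"
    using L2_mult_integral_le[OF assms(3) L2_diff[OF assms(1,2)]] by simp
  qed
 qed
 then show ?thesis by (rule LIM_zero_cancel)
qed

lemma L2norm_tendsto:
 assumes "\<And>n. L2 (F n)" "L2 g" "(\<lambda>n. L2norm (\<lambda>x. F n x - g x)) ----> 0"
 shows "(\<lambda>n. L2norm (F n)) ----> L2norm g"
proof -
 have "(\<lambda>n. L2norm (F n) - L2norm g) ----> 0"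
 proof (rule Lim_null_comparison[OF _ assms(3)], intro always_eventually allI)
  fix n
  have a: "L2norm (F n) \<le> L2norm (\<lambda>x. F n x - g x) + L2norm g"
   using L2norm_triangle[OF L2_diff[OF assms(1)[of n] assms(2)] assms(2)] by simp
  have "L2norm g \<le> L2norm (\<lambda>x. F n x - g x) + L2norm (F n)"
   using L2norm_triangle_diff[OF assms(1)[of n] L2_diff[OF assms(1)[of n] assms(2)]] by simp
  with a show "norm (L2norm (F n) - L2norm g) \<le> L2norm (\<lambda>x. F n x - g x)" by auto
 qed
 then show ?thesis by (rule LIM_zero_cancel)
qed

text \<open>The representing function is found by minimising \<open>\<parallel>psi\<parallel>\<^sup>2 - 2 Re (\<Lambda> psi)\<close>; this also
 exhibits it as a limit of elements of \<open>S\<close>.\<close>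

lemma riesz_L2:
 fixes S :: "(real => complex) set" and \<Lambda> :: "(real => complex) => complex"
 assumes S: "\<And>phi. phi \<in> S ==> L2 phi" and S0: "(\<lambda>x. 0) \<in> S"
  and S_add: "\<And>phi psi. phi \<in> S ==> psi \<in> S ==> (\<lambda>x. phi x + psi x) \<in> S"
  and S_mult: "\<And>a phi. phi \<in> S ==> (\<lambda>x. a * phi x) \<in> S"
  and add: "\<And>phi psi. phi \<in> S ==> psi \<in> S ==> \<Lambda> (\<lambda>x. phi x + psi x) = \<Lambda> phi + \<Lambda> psi"
  and mult: "\<And>a phi. phi \<in> S ==> \<Lambda> (\<lambda>x. a * phi x) = a * \<Lambda> phi"
  and bd: "\<And>phi. phi \<in> S ==> norm (\<Lambda> phi) \<le> M * L2norm phi" and M: "0 \<le> M"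
 obtains u F where "L2 u" "L2norm u \<le> M" "\<And>phi. phi \<in> S ==> \<Lambda> phi = (LI x. u x * phi x)"
  "\<And>n::nat. F n \<in> S" "(\<lambda>n. L2norm (\<lambda>x. F n x - cnj (u x))) ----> 0"
proof -
 define J where "J phi = (L2norm phi)\<^sup>2 - 2 * Re (\<Lambda> phi)" for phi
 have Jge: "- M\<^sup>2 \<le> J phi" if "phi \<in> S" for phi
 proof -
  have "Re (\<Lambda> phi) \<le> M * L2norm phi" using bd[OF that] complex_Re_le_cmod[of "\<Lambda> phi"] by linarith
  moreover have "0 \<le> (L2norm phi - M)\<^sup>2" by simp
  ultimately show ?thesis unfolding J_def by (simp add: power2_diff algebra_simps)
 qed
 define D where "D = Inf (J ` S)"
 have bdd: "bdd_below (J ` S)" using Jge by (rule bdd_belowI2)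
 have ne: "J ` S \<noteq> {}" using S0 by auto
 have DJ: "D \<le> J phi" if "phi \<in> S" for phi unfolding D_def using bdd that by (auto intro: cInf_lower)
 have "\<exists>phi\<in>S. J phi < D + 1 / real (Suc n)" for n
  using cInf_lessD[OF ne, of "D + 1 / real (Suc n)"] by (auto simp: D_def)
 then obtain F where F: "\<And>n. F n \<in> S" "\<And>n. J (F n) < D + 1 / real (Suc n)" by metis
 have L: "L2 (F n)" for n using F S by auto
 \<comment> \<open>The midpoint of two near-minimizers cannot fall below \<open>D\<close>, so the
   parallelogram law bounds their distance: a minimizing sequence is Cauchy.\<close>
 have diff: "(L2norm (\<lambda>x. F m x - F n x))\<^sup>2 \<le> 2 / real (Suc m) + 2 / real (Suc n)" for m n
 proof -
  let ?h = "\<lambda>x. (1/2) * (F m x + F n x)"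
  have hS: "?h \<in> S" by (intro S_mult S_add F)
  have L3: "L2norm ?h = L2norm (\<lambda>x. F m x + F n x) / 2"
   using L2norm_cmult[OF L2_add[OF L L], of "1/2"] by simp
  have e: "\<Lambda> ?h = (1/2) * (\<Lambda> (F m) + \<Lambda> (F n))"
   using mult[OF S_add[OF F(1) F(1)], of "1/2" m n] add[OF F(1) F(1), of m n] by (simp only:)
  have "J ?h = (L2norm (\<lambda>x. F m x + F n x))\<^sup>2 / 4 - (Re (\<Lambda> (F m)) + Re (\<Lambda> (F n)))"
   unfolding J_def L3 e by (simp add: power_divide add_divide_distrib)
  then show ?thesis
   using DJ[OF hS] F(2)[of m] F(2)[of n] L2norm_parallelogram[OF L L, of m n] unfolding J_def by simp
 qed
 have "\<exists>N. \<forall>m\<ge>N. \<forall>n\<ge>N. L2norm (\<lambda>x. F m x - F n x) < e" if "0 < e" for e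
 proof -
  obtain N where N: "4 / real (Suc N) < e\<^sup>2"
   using reals_Archimedean[of "e\<^sup>2 / 4"] \<open>0 < e\<close> by (auto simp: field_simps)
  have "L2norm (\<lambda>x. F m x - F n x) < e" if "m \<ge> N" "n \<ge> N" for m n
  proof -
   have "2 / real (Suc m) \<le> 2 / real (Suc N)" "2 / real (Suc n) \<le> 2 / real (Suc N)"
    using that by (auto intro!: divide_left_mono)
   then have "(L2norm (\<lambda>x. F m x - F n x))\<^sup>2 < e\<^sup>2" using diff[of m n] N by linarith
   then show ?thesis using \<open>0 < e\<close> by (simp add: power2_less_imp_less)
  qed
  then show ?thesis by blast
 qed
 then obtain g where g: "L2 g" "(\<lambda>n. L2norm (\<lambda>x. F n x - g x)) ----> 0"
  by (rule L2_complete[OF L])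
 have cg: "(\<lambda>n. L2norm (\<lambda>x. cnj (F n x) - cnj (g x))) ----> 0"
  using g(2) L2norm_cnj[OF L2_diff[OF L g(1)]] by simp
 have JF: "(\<lambda>n. J (F n)) ----> D"
 proof (rule tendsto_sandwich)
  show "\<forall>\<^sub>F n in sequentially. D \<le> J (F n)" using DJ F by auto
  show "\<forall>\<^sub>F n in sequentially. J (F n) \<le> D + 1 / real (Suc n)"
   using F(2) by (intro always_eventually allI less_imp_le)
  show "(\<lambda>n. D + 1 / real (Suc n)) ----> D"
   using tendsto_add[OF tendsto_const LIMSEQ_Suc[OF lim_1_over_n], of D] by simp
 qed simp
 have Rep: "Re (\<Lambda> psi) = Re (LI x. psi x * cnj (g x))" if psi: "psi \<in> S" for psi
 proof -
  let ?b = "Re (LI x. psi x * cnj (g x)) - Re (\<Lambda> psi)"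
  \<comment> \<open>Minimality along the line \<open>F n + s psi\<close>, in the limit of large
    \<open>n\<close>: a quadratic in \<open>s\<close> without constant term is nonnegative, which
    forces its linear coefficient to vanish.\<close>
  have pos: "0 \<le> 2 * s * ?b + s\<^sup>2 * (L2norm psi)\<^sup>2" for s
  proof -
   have "D \<le> J (F n) + 2 * s * (Re (LI x. psi x * cnj (F n x)) - Re (\<Lambda> psi)) + s\<^sup>2 * (L2norm psi)\<^sup>2" for n
   proof -
    have "D \<le> J (\<lambda>x. F n x + of_real s * psi x)" by (intro DJ S_add S_mult F psi)
    also have "... = J (F n) + 2 * s * (Re (LI x. psi x * cnj (F n x)) - Re (\<Lambda> psi)) + s\<^sup>2 * (L2norm psi)\<^sup>2"
     unfolding J_def L2norm_add_expand[OF L S[OF psi]]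
     using add[OF F(1) S_mult[OF psi], of n "of_real s"] mult[OF psi, of "of_real s"]
     by (simp add: algebra_simps)
    finally show ?thesis .
   qed
   moreover have "(\<lambda>n. J (F n) + 2 * s * (Re (LI x. psi x * cnj (F n x)) - Re (\<Lambda> psi)) + s\<^sup>2 * (L2norm psi)\<^sup>2)
    ----> D + 2 * s * ?b + s\<^sup>2 * (L2norm psi)\<^sup>2"
    by (intro tendsto_add tendsto_mult tendsto_diff tendsto_const tendsto_Re JF
      L2_tendsto_integral[OF L2_cnj[OF L] L2_cnj[OF g(1)] S[OF psi] cg])
   ultimately have "D \<le> D + 2 * s * ?b + s\<^sup>2 * (L2norm psi)\<^sup>2" by (intro LIMSEQ_le_const) auto
   then show ?thesis by simp
  qed
  \<comment> \<open>The added 1 keeps the step \<open>s = - b / P\<close> meaningful when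
    \<open>psi\<close> has norm zero.\<close>
  define P where "P = (L2norm psi)\<^sup>2 + 1"
  have P: "P > 0" "(L2norm psi)\<^sup>2 \<le> P" by (auto simp: P_def add_nonneg_pos)
  define b where "b = ?b"
  have "0 \<le> 2 * (- b / P) * b + (- b / P)\<^sup>2 * (L2norm psi)\<^sup>2" using pos[of "- b / P"] unfolding b_def .
  also have "... \<le> 2 * (- b / P) * b + (- b / P)\<^sup>2 * P"
   using P by (intro add_left_mono mult_left_mono) auto
  also have "... = - (b\<^sup>2 / P)" using P by (simp add: power2_eq_square)
  finally have "b\<^sup>2 \<le> 0" using P by (simp add: divide_le_0_iff)
  then have "b = 0" by simp
  then show ?thesis unfolding b_def by linarith
 qed
 define u where "u x = cnj (g x)" for x
 have u: "L2 u" unfolding u_def[abs_def] by (rule L2_cnj[OF g(1)])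
 have rep: "\<Lambda> psi = (LI x. u x * psi x)" if psi: "psi \<in> S" for psi
 proof (rule complex_eqI)
  have e: "(LI x. psi x * cnj (g x)) = (LI x. u x * psi x)" by (simp add: u_def mult.commute)
  show "Re (\<Lambda> psi) = Re (LI x. u x * psi x)" using Rep[OF psi] e by simp
  \<comment> \<open>Minimization controls real parts; the imaginary part is read off from the real
    part at \<open>\<i> * psi\<close>.\<close>
  have "Re (\<Lambda> (\<lambda>x. \<i> * psi x)) = Re (LI x. \<i> * (psi x * cnj (g x)))"
   using Rep[OF S_mult[OF psi], of \<i>] by (simp add: mult.assoc)
  then show "Im (\<Lambda> psi) = Im (LI x. u x * psi x)"
   using mult[OF psi, of \<i>] e L2_mult_integrable[OF S[OF psi] L2_cnj[OF g(1)]] by simp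
 qed
 \<comment> \<open>The minimizers converge to the conjugate of \<open>u\<close>, so testing with
   them recovers the full norm of \<open>u\<close>.\<close>
 have "L2norm u \<le> M"
 proof (cases "L2norm u = 0")
  case False
  have "(\<lambda>n. norm (\<Lambda> (F n))) ----> norm (LI x. u x * g x)"
   unfolding rep[OF F(1)] by (intro tendsto_norm L2_tendsto_integral[OF L g(1) u g(2)])
  moreover have "(\<lambda>n. M * L2norm (F n)) ----> M * L2norm g"
   by (intro tendsto_mult tendsto_const L2norm_tendsto[OF L g])
  ultimately have "norm (LI x. u x * g x) \<le> M * L2norm g" by (rule LIMSEQ_le) (use bd F in auto)
  moreover have "(LI x. u x * g x) = of_real ((L2norm g)\<^sup>2)"
   unfolding L2norm_square integral_complex_of_real[symmetric]
   by (intro lintegral_cong) (simp_all only: u_def complex_norm_square mult.commute)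
  moreover have "L2norm u = L2norm g" unfolding u_def[abs_def] by (rule L2norm_cnj[OF g(1)])
  ultimately have "L2norm u * L2norm u \<le> M * L2norm u" by (simp add: power2_eq_square norm_mult)
  then show ?thesis using False L2norm_nonneg[of u] by (simp add: mult_le_cancel_right)
 qed (use M in simp)
 moreover have "(\<lambda>n. L2norm (\<lambda>x. F n x - cnj (u x))) ----> 0" using g(2) by (simp add: u_def)
 ultimately show ?thesis by (intro that[OF u _ rep F(1)])
qed

lemma L2_of_real:
 assumes "L2 (f :: real => real)"
 shows "L2 (\<lambda>x. complex_of_real (f x))"
 using assms by (auto simp: L2_def)

section \<open>Young's inequality\<close>

text \<open>After the substitution \<open>z = xi - eta\<close> the kernel depends on
  \<open>z\<close> alone, and for fixed \<open>z\<close> Cauchy-Schwarz applies to a translate of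
  \<open>a\<close> and \<open>b\<close>, the norm being invariant under translation.\<close>

lemma young_nn:
 fixes k :: "real => real"
 assumes a: "L2 a" and b: "L2 b" and k: "intl k"
 shows "(NI xi. NI eta. ennreal (norm (a xi) * \<bar>k (xi - eta)\<bar> * norm (b eta)))
  \<le> ennreal ((LI z. \<bar>k z\<bar>) * L2norm a * L2norm b)"
proof -
 have [measurable]: "a \<in> BM" "b \<in> BM" "k \<in> BM" using a b k by (auto dest: L2_measurable)
 have "(NI xi. NI eta. ennreal (norm (a xi) * \<bar>k (xi - eta)\<bar> * norm (b eta)))
  = (NI eta. NI xi. ennreal (norm (a xi) * \<bar>k (xi - eta)\<bar> * norm (b eta)))"
  by (rule lborel_pair.Fubini') measurable
 also have "... = (NI eta. NI z. ennreal (norm (a (z + eta)) * \<bar>k z\<bar> * norm (b eta)))"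
 proof (rule nn_integral_cong)
  fix eta
  have "(NI xi. ennreal (norm (a xi) * \<bar>k (xi - eta)\<bar> * norm (b eta)))
   = ennreal \<bar>1\<bar> * (NI z. ennreal (norm (a (eta + 1 * z)) * \<bar>k (eta + 1 * z - eta)\<bar> * norm (b eta)))"
   by (rule nn_integral_real_affine) auto
  then show "(NI xi. ennreal (norm (a xi) * \<bar>k (xi - eta)\<bar> * norm (b eta)))
   = (NI z. ennreal (norm (a (z + eta)) * \<bar>k z\<bar> * norm (b eta)))" by (simp add: add.commute)
 qed
 also have "... = (NI z. NI eta. ennreal (norm (a (z + eta)) * \<bar>k z\<bar> * norm (b eta)))"
  by (rule lborel_pair.Fubini') measurable
 also have "... \<le> (NI z. ennreal \<bar>k z\<bar> * ennreal (L2norm a * L2norm b))"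
 proof (rule nn_integral_mono)
  fix z
  have "(NI eta. ennreal (norm (a (z + eta)) * \<bar>k z\<bar> * norm (b eta)))
   = (NI eta. ennreal \<bar>k z\<bar> * (ennreal (norm (a (eta + z))) * ennreal (norm (b eta))))"
   by (intro nn_integral_cong) (simp add: ennreal_mult[symmetric] ac_simps)
  also have "... = ennreal \<bar>k z\<bar> * (NI eta. ennreal (norm (a (eta + z))) * ennreal (norm (b eta)))"
   by (rule nn_integral_cmult) measurable
  also have "... \<le> ennreal \<bar>k z\<bar> * ennreal (L2norm a * L2norm b)"
   using L2_mult_nn[OF L2_shift[OF a, of z] b] L2norm_shift[OF a, of z] by (intro mult_left_mono) auto
  finally show "(NI eta. ennreal (norm (a (z + eta)) * \<bar>k z\<bar> * norm (b eta))) \<le> ennreal \<bar>k z\<bar> * ennreal (L2norm a * L2norm b)" .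
 qed
 also have "... = (NI z. ennreal \<bar>k z\<bar>) * ennreal (L2norm a * L2norm b)"
  by (rule nn_integral_multc) measurable
 also have "(NI z. ennreal \<bar>k z\<bar>) = ennreal (LI z. \<bar>k z\<bar>)"
  using k by (intro nn_integral_eq_integral) auto
 finally show ?thesis by (simp add: ennreal_mult[symmetric] ac_simps)
qed

text \<open>The common form of the error terms below: a kernel in two frequencies dominated by an
  integrable function of their difference between two square integrable factors. Integrability,
  bound and exchange of the integrals come from one estimate of the absolute value.\<close>

lemma
 fixes G :: "real => real => complex" and k :: "real => real"
 assumes a: "L2 a" and b: "L2 b" and k: "intl k"
  and G [measurable]: "(\<lambda>(xi, eta). G xi eta) \<in> BM2"
  and le: "\<And>xi eta. norm (G xi eta) \<le> norm (a xi) * \<bar>k (xi - eta)\<bar> * norm (b eta)"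
 shows young_integrable: "integrable (lborel \<Otimes>\<^sub>M lborel) (\<lambda>(xi, eta). G xi eta)"
  and young_integral_le: "norm (LI xi. LI eta. G xi eta) \<le> (LI z. \<bar>k z\<bar>) * L2norm a * L2norm b"
  and young_Fubini: "(LI xi. LI eta. G xi eta) = (LI eta. LI xi. G xi eta)"
proof -
 have G' [measurable]: "(\<lambda>(xi, eta). G xi eta) \<in> borel_measurable (lborel \<Otimes>\<^sub>M lborel)"
  using G by (simp cong: measurable_cong_sets)
 have "(\<integral>\<^sup>+p. ennreal (norm (case p of (xi, eta) => G xi eta)) \<partial>(lborel \<Otimes>\<^sub>M lborel))
  = (NI xi. NI eta. ennreal (norm (G xi eta)))" by (subst lborel.nn_integral_fst[symmetric]) auto
 also have "... \<le> (NI xi. NI eta. ennreal (norm (a xi) * \<bar>k (xi - eta)\<bar> * norm (b eta)))"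
  by (intro nn_integral_mono ennreal_leI le)
 also have "... \<le> ennreal ((LI z. \<bar>k z\<bar>) * L2norm a * L2norm b)"
  by (rule young_nn[OF a b k])
 finally have nn: "(\<integral>\<^sup>+p. ennreal (norm (case p of (xi, eta) => G xi eta)) \<partial>(lborel \<Otimes>\<^sub>M lborel))
  \<le> ennreal ((LI z. \<bar>k z\<bar>) * L2norm a * L2norm b)" .
 show int: "integrable (lborel \<Otimes>\<^sub>M lborel) (\<lambda>(xi, eta). G xi eta)"
  by (rule integrableI_bounded) (use nn in \<open>auto intro: le_less_trans\<close>)
 have "norm (LINT p|(lborel \<Otimes>\<^sub>M lborel). (case p of (xi, eta) => G xi eta)) \<le> (LI z. \<bar>k z\<bar>) * L2norm a * L2norm b"
  using order_trans[OF integral_norm_bound_ennreal[OF int] nn] by simp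
 then show "norm (LI xi. LI eta. G xi eta) \<le> (LI z. \<bar>k z\<bar>) * L2norm a * L2norm b"
  using lborel_pair.integral_fst'[OF int] by simp
 show "(LI xi. LI eta. G xi eta) = (LI eta. LI xi. G xi eta)"
  using lborel_pair.Fubini_integral[of G] int by simp
qed

text \<open>Minkowski's inequality over a compact interval, through Cauchy-Schwarz in
  \<open>s\<close> against the indicator, which produces one factor \<open>q - p\<close>; the
  integration in \<open>s\<close> produces the other. Boundedness in \<open>s\<close> for each
  \<open>z\<close> ensures that the Bochner integral is the nonnegative one and not the default
  0.\<close>

lemma L2_set_integral:
 fixes u :: "real => real => real"
 assumes [measurable]: "(\<lambda>(s, z). u s z) \<in> BM2"
  and u0: "\<And>s z. 0 \<le> u s z" and B: "\<And>z. \<exists>B. \<forall>s\<in>{p..q}. u s z \<le> B"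
  and L: "\<And>s. s \<in> {p..q} ==> L2 (u s)" "\<And>s. s \<in> {p..q} ==> L2norm (u s) \<le> C"
  and "p \<le> q" "0 \<le> C"
 shows "L2 (\<lambda>z. LINT s:{p..q}|lborel. u s z)" "L2norm (\<lambda>z. LINT s:{p..q}|lborel. u s z) \<le> (q - p) * C"
proof -
 define om where "om z = (LINT s:{p..q}|lborel. u s z)" for z
 have [measurable]: "om \<in> BM" unfolding om_def[abs_def] set_lebesgue_integral_def by measurable
 have om0: "0 \<le> om z" for z
  unfolding om_def set_lebesgue_integral_def by (intro integral_nonneg_AE AE_I2) (auto simp: u0)
 have omnn: "ennreal (om z) = (NI s. indicator {p..q} s * ennreal (u s z))" for z
 proof -
  obtain B where B: "\<forall>s\<in>{p..q}. u s z \<le> B" using B by blast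
  have "intl (\<lambda>s. indicator {p..q} s *\<^sub>R u s z)"
   by (rule integrableI_bounded_set_indicator[where B=B]) (use B u0 in \<open>auto simp: emeasure_lborel_Icc_eq\<close>)
  then have "ennreal (om z) = (NI s. ennreal (indicator {p..q} s *\<^sub>R u s z))"
   unfolding om_def set_lebesgue_integral_def by (subst nn_integral_eq_integral) (auto simp: u0)
  also have "... = (NI s. indicator {p..q} s * ennreal (u s z))"
   by (intro nn_integral_cong) (auto simp: indicator_def)
  finally show ?thesis .
 qed
 have "(NI z. (ennreal (norm (om z)))\<^sup>2)
  \<le> (NI z. NI s. ennreal (q - p) * (indicator {p..q} s * (ennreal (u s z))\<^sup>2))"
 proof (rule nn_integral_mono)
  fix z
  have "(ennreal (norm (om z)))\<^sup>2 = (NI s. indicator {p..q} s * (indicator {p..q} s * ennreal (u s z)))\<^sup>2"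
   using om0 omnn by (simp add: indicator_inter_arith[symmetric] mult.assoc[symmetric])
  also have "... \<le> (NI s. (indicator {p..q} s)\<^sup>2) * (NI s. (indicator {p..q} s * ennreal (u s z))\<^sup>2)"
   by (rule Cauchy_Schwarz_nn_integral) measurable
  also have "(NI s. (indicator {p..q} s)\<^sup>2) = ennreal (q - p)"
  proof -
   have "(NI s. (indicator {p..q} s :: ennreal)\<^sup>2) = (NI s. indicator {p..q} s)"
    by (intro nn_integral_cong) (auto simp: indicator_def)
   then show ?thesis using \<open>p \<le> q\<close> by simp
  qed
  also have "ennreal (q - p) * (NI s. (indicator {p..q} s * ennreal (u s z))\<^sup>2)
   = (NI s. ennreal (q - p) * (indicator {p..q} s * ennreal (u s z))\<^sup>2)"
   by (rule nn_integral_cmult[symmetric]) measurable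
  also have "... = (NI s. ennreal (q - p) * (indicator {p..q} s * (ennreal (u s z))\<^sup>2))"
   by (intro nn_integral_cong) (auto simp: indicator_def)
  finally show "(ennreal (norm (om z)))\<^sup>2 \<le> (NI s. ennreal (q - p) * (indicator {p..q} s * (ennreal (u s z))\<^sup>2))" .
 qed
 also have "... = (NI s. NI z. ennreal (q - p) * (indicator {p..q} s * (ennreal (u s z))\<^sup>2))"
  by (rule lborel_pair.Fubini') measurable
 also have "... \<le> (NI s. ennreal (q - p) * (indicator {p..q} s * ennreal (C\<^sup>2)))"
 proof (rule nn_integral_mono)
  fix s
  have [measurable]: "u s \<in> BM" by measurable
  show "(NI z. ennreal (q - p) * (indicator {p..q} s * (ennreal (u s z))\<^sup>2))
   \<le> ennreal (q - p) * (indicator {p..q} s * ennreal (C\<^sup>2))"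
  proof (cases "s \<in> {p..q}")
   case True
   have "(NI z. (ennreal (u s z))\<^sup>2) \<le> ennreal (C\<^sup>2)"
    using nn_integral_L2[OF L(1)[OF True]] L(2)[OF True] u0 by (simp add: ennreal_leI power_mono)
   then show ?thesis using True by (subst nn_integral_cmult) (auto intro: mult_left_mono)
  qed auto
 qed
 also have "... = ennreal (q - p) * (ennreal (q - p) * ennreal (C\<^sup>2))"
  using \<open>p \<le> q\<close> by (simp add: nn_integral_cmult nn_integral_multc)
 also have "... = ennreal (((q - p) * C)\<^sup>2)"
 proof -
  have "((q - p) * C)\<^sup>2 = (q - p) * ((q - p) * C\<^sup>2)" by (simp add: power2_eq_square)
  then show ?thesis using \<open>p \<le> q\<close>
   by (simp only: ennreal_mult zero_le_power2 diff_ge_0_iff_ge mult_nonneg_nonneg)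
 qed
 finally have le: "(NI z. (ennreal (norm (om z)))\<^sup>2) \<le> ennreal (((q - p) * C)\<^sup>2)" .
 have "0 \<le> (q - p) * C" using \<open>p \<le> q\<close> \<open>0 \<le> C\<close> by simp
 from L2I_nn[OF _ this le]
 show "L2 (\<lambda>z. LINT s:{p..q}|lborel. u s z)" "L2norm (\<lambda>z. LINT s:{p..q}|lborel. u s z) \<le> (q - p) * C"
  unfolding om_def[abs_def, symmetric] by simp_all
qed

lemma integrable_inverse_1_plus_square': "intl (\<lambda>x::real. 1 / (1 + x\<^sup>2))"
 using integrable_inverse_1_plus_square by (simp add: set_integrable_def inverse_eq_divide)

lemma one_plus_abs_square_le:
 fixes z :: real
 shows "(1 + \<bar>z\<bar>)\<^sup>2 \<le> 2 * (1 + z\<^sup>2)" "1 + \<bar>z\<bar> \<le> 2 * (1 + z\<^sup>2)" "1 + z\<^sup>2 \<le> (1 + \<bar>z\<bar>)\<^sup>2"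
proof -
 show 1: "(1 + \<bar>z\<bar>)\<^sup>2 \<le> 2 * (1 + z\<^sup>2)" 
 proof -
  have "0 \<le> (1 - \<bar>z\<bar>)\<^sup>2" by simp
  then show ?thesis by (simp add: power2_eq_square algebra_simps)
 qed
 have "1 + \<bar>z\<bar> \<le> (1 + \<bar>z\<bar>)\<^sup>2" by (simp add: self_le_power)
 then show "1 + \<bar>z\<bar> \<le> 2 * (1 + z\<^sup>2)" using 1 by (rule order_trans)
 show "1 + z\<^sup>2 \<le> (1 + \<bar>z\<bar>)\<^sup>2" by (simp add: power2_sum)
qed

lemma L2_inverse_weight:
 shows "L2 (\<lambda>z::real. (1 + \<bar>z\<bar>) / (1 + z\<^sup>2))" and "L2 (\<lambda>z::real. 1 / (1 + \<bar>z\<bar>))"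
proof -
 have p: "0 < 1 + z\<^sup>2" for z :: real by (simp add: add_pos_nonneg)
 have *: "2 * u / u\<^sup>2 = 2 / u" if "0 < u" for u :: real using that by (simp add: power2_eq_square)
 have "intl (\<lambda>z::real. 2 * (1 / (1 + z\<^sup>2)))"
  by (intro integrable_mult_right integrable_inverse_1_plus_square')
 then have "intl (\<lambda>z::real. (norm ((1 + \<bar>z\<bar>) / (1 + z\<^sup>2)))\<^sup>2)"
 proof (rule lintegrable_bound)
  show "AE z in lborel. norm ((norm ((1 + \<bar>z::real\<bar>) / (1 + z\<^sup>2)))\<^sup>2) \<le> norm (2 * (1 / (1 + z\<^sup>2)))"
  proof (rule AE_I2)
   fix z :: real
   have "(1 + \<bar>z\<bar>)\<^sup>2 / (1 + z\<^sup>2)\<^sup>2 \<le> 2 * (1 + z\<^sup>2) / (1 + z\<^sup>2)\<^sup>2"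
    by (intro divide_right_mono one_plus_abs_square_le) auto
   also have "... = 2 / (1 + z\<^sup>2)" by (rule *[OF p])
   finally show "norm ((norm ((1 + \<bar>z\<bar>) / (1 + z\<^sup>2)))\<^sup>2) \<le> norm (2 * (1 / (1 + z\<^sup>2)))"
    using p[of z] by (simp add: power_divide)
  qed
 qed simp
 then show 1: "L2 (\<lambda>z::real. (1 + \<bar>z\<bar>) / (1 + z\<^sup>2))" by (simp add: L2_def)
 show "L2 (\<lambda>z::real. 1 / (1 + \<bar>z\<bar>))"
 proof (rule L2_bound(1)[OF 1, where C=1])
  show "0 \<le> (1::real)" by simp
  show "(\<lambda>z::real. 1 / (1 + \<bar>z\<bar>)) \<in> BM" by measurable
  fix z :: real
  have "1 + z\<^sup>2 \<le> (1 + \<bar>z\<bar>)\<^sup>2" by (simp add: power2_eq_square algebra_simps)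
  then have "1 / (1 + \<bar>z\<bar>) \<le> (1 + \<bar>z\<bar>) / (1 + z\<^sup>2)"
   using p[of z] by (simp add: divide_simps power2_eq_square)
  then show "norm (1 / (1 + \<bar>z\<bar>)) \<le> 1 * norm ((1 + \<bar>z\<bar>) / (1 + z\<^sup>2))"
   using p[of z] by simp
 qed
qed

text \<open>Cauchy-Schwarz against \<open>(1 + |z|) / (1 + z^2)\<close>, which is square integrable.
  Two powers of decay in mean square thus leave one integrable power: the one that pays for a factor
  \<open>|xi - eta|\<close> when frequencies are compared.\<close>

lemma integrable_of_weighted_L2:
 fixes om :: cfun
 assumes "L2 (\<lambda>z. of_real (1 + z\<^sup>2) * om z)"
 shows "intl (\<lambda>z. of_real (1 + \<bar>z\<bar>) * om z)"
proof -
 have "intl (\<lambda>z. of_real ((1 + \<bar>z\<bar>) / (1 + z\<^sup>2)) * (of_real (1 + z\<^sup>2) * om z))"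
  by (rule L2_mult_integrable[OF L2_of_real[OF L2_inverse_weight(1)] assms])
 moreover have "of_real ((1 + \<bar>z\<bar>) / (1 + z\<^sup>2)) * (of_real (1 + z\<^sup>2) * om z) = of_real (1 + \<bar>z\<bar>) * om z" for z
 proof -
  have "1 + z\<^sup>2 \<noteq> 0" using zero_le_power2[of z] by linarith
  then have "(1 + \<bar>z\<bar>) / (1 + z\<^sup>2) * (1 + z\<^sup>2) = 1 + \<bar>z\<bar>" by (rule nonzero_eq_divide_eq[THEN iffD1, OF _ refl])
  then show ?thesis by (simp only: mult.assoc[symmetric] of_real_mult[symmetric])
 qed
 ultimately show ?thesis by (simp only:)
qed

section \<open>The Fourier transform\<close>

definition e2 :: cfun where "e2 y = cis (2 * pi * y)"

lemma e2_add: "e2 (a + b) = e2 a * e2 b" by (simp add: e2_def cis_mult ring_distribs)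

lemma e2_0 [simp]: "e2 0 = 1" by (simp add: e2_def)

lemma norm_e2 [simp]: "norm (e2 a) = 1" by (simp add: e2_def)

lemma e2_minus: "e2 (- a) = cnj (e2 a)" by (simp add: e2_def cis_cnj)

lemma e2_mult_minus [simp]: "e2 a * e2 (- a) = 1" "e2 (- a) * e2 a = 1" by (simp_all add: e2_add[symmetric])

lemma continuous_on_e2 [continuous_intros]:
 "continuous_on A f ==> continuous_on A (\<lambda>x. e2 (f x))" unfolding e2_def by (intro continuous_intros)

lemma e2_measurable [measurable]: "e2 \<in> BM" by (intro borel_measurable_continuous_onI continuous_intros)

lemma e2_has_vector_derivative:
 "((\<lambda>x. e2 (a * x)) has_vector_derivative (2 * pi * \<i> * a) * e2 (a * x)) (at x within A)"
proof -
 have e: "e2 (a * x) = exp (x *\<^sub>R (2 * pi * \<i> * a))" for x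
  by (simp add: e2_def cis_conv_exp scaleR_conv_of_real mult_ac)
 show ?thesis unfolding e
  by (rule has_vector_derivative_eq_rhs[OF exp_scaleR_has_vector_derivative_right]) (simp add: mult.commute)
qed

lemma norm_e2_diff_le: "norm (e2 a - 1) \<le> 2 * pi * \<bar>a\<bar>"
 using iexp_approx1[of "2 * pi * a" 0] by (simp add: e2_def cis_conv_exp abs_mult)

lemma fourier_eq:
 assumes [measurable]: "f \<in> BM"
 shows "fourier f xi = (LI x. e2 (- (x * xi)) * f x)"
proof -
 have e: "exp (- 2 * pi * \<i> * x * xi) = e2 (- (x * xi))" for x :: real
  by (simp add: e2_def cis_conv_exp algebra_simps)
 show ?thesis unfolding fourier_def e by (subst integral_completion) simp_all
qed

lemma fourier_measurable [measurable]:
 assumes [measurable]: "f \<in> BM"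
 shows "fourier f \<in> BM"
proof -
 have "(\<lambda>xi. LI x. e2 (- (x * xi)) * f x) \<in> BM" by measurable
 moreover have "fourier f = (\<lambda>xi. LI x. e2 (- (x * xi)) * f x)" by (intro ext fourier_eq assms)
 ultimately show ?thesis by simp
qed

lemma integrable_e2_mult:
 assumes "intl f" and [measurable]: "g \<in> BM"
 shows "intl (\<lambda>x. e2 (g x) * f x)"
 by (rule lintegrable_bound[OF assms(1)]) (use assms in \<open>auto simp: norm_mult\<close>)

lemma borel_of_integrable: "intl f ==> f \<in> BM" by (drule borel_measurable_integrable) simp

lemma norm_fourier_le:
 assumes "intl f"
 shows "norm (fourier f xi) \<le> (LI x. norm (f x))"
proof -
 have "norm (LI x. e2 (- (x * xi)) * f x) \<le> (LI x. norm (e2 (- (x * xi)) * f x))"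
  by (rule integral_norm_bound)
 then show ?thesis using borel_of_integrable[OF assms] by (simp add: fourier_eq norm_mult)
qed

lemma fourier_add:
 assumes "intl f" "intl g"
 shows "fourier (\<lambda>x. f x + g x) xi = fourier f xi + fourier g xi"
proof -
 have [measurable]: "f \<in> BM" "g \<in> BM" using assms by (auto intro: borel_of_integrable)
 show ?thesis
  using integrable_e2_mult[OF assms(1), of "\<lambda>x. - (x * xi)"] integrable_e2_mult[OF assms(2), of "\<lambda>x. - (x * xi)"]
  by (simp add: fourier_eq ring_distribs)
qed

lemma fourier_cmult:
 assumes [measurable]: "f \<in> BM"
 shows "fourier (\<lambda>x. a * f x) xi = a * fourier f xi" by (simp add: fourier_eq mult.left_commute)

lemma fourier_diff:
 assumes "intl f" "intl g"
 shows "fourier (\<lambda>x. f x - g x) xi = fourier f xi - fourier g xi"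
 using fourier_add[OF assms(1), of "\<lambda>x. (-1) * g x"] fourier_cmult[OF borel_of_integrable[OF assms(2)], of "-1"] assms(2)
 by simp

lemma fourier_shift:
 assumes [measurable]: "f \<in> BM"
 shows "fourier (\<lambda>x. f (x + k)) xi = e2 (k * xi) * fourier f xi"
proof -
 have "fourier f xi = (LI x. e2 (- ((k + 1 * x) * xi)) * f (k + 1 * x))"
  unfolding fourier_eq[OF assms] by (subst lborel_integral_real_affine[of 1 _ k]) simp_all
 also have "... = (LI x. e2 (- (k * xi)) * (e2 (- (x * xi)) * f (x + k)))"
 proof (rule lintegral_cong[OF refl])
  fix x
  have "e2 (- ((k + 1 * x) * xi)) = e2 (- (k * xi)) * e2 (- (x * xi))"
   unfolding e2_add[symmetric] by (simp add: algebra_simps)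
  then show "e2 (- ((k + 1 * x) * xi)) * f (k + 1 * x) = e2 (- (k * xi)) * (e2 (- (x * xi)) * f (x + k))"
   by (simp add: add.commute)
 qed
 also have "... = e2 (- (k * xi)) * fourier (\<lambda>x. f (x + k)) xi" by (simp add: fourier_eq)
 finally show ?thesis by (simp add: mult.assoc[symmetric])
qed

lemma fourier_modulate:
 assumes [measurable]: "f \<in> BM"
 shows "fourier (\<lambda>x. e2 (x * a) * f x) xi = fourier f (xi - a)"
proof -
 have e: "e2 (- (x * xi)) * (e2 (x * a) * f x) = e2 (- (x * (xi - a))) * f x" for x
  unfolding mult.assoc[symmetric] e2_add[symmetric] by (simp add: algebra_simps)
 have "fourier (\<lambda>x. e2 (x * a) * f x) xi = (LI x. e2 (- (x * xi)) * (e2 (x * a) * f x))"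
  by (rule fourier_eq) measurable
 also have "... = fourier f (xi - a)" unfolding e by (rule fourier_eq[symmetric]) measurable
 finally show ?thesis .
qed

lemma fourier_cnj:
 assumes [measurable]: "f \<in> BM"
 shows "fourier (\<lambda>x. cnj (f x)) xi = cnj (fourier f (- xi))"
proof -
 have [measurable]: "(\<lambda>x. cnj (f x)) \<in> BM" using measurable_compose[OF assms cnj_measurable] .
 have "cnj (fourier f (- xi)) = (LI x. cnj (e2 (- (x * - xi)) * f x))"
  unfolding fourier_eq[OF assms] by (rule lintegral_cnj[symmetric])
 then show ?thesis by (simp add: fourier_eq e2_minus)
qed

lemma fourier_reflect:
 assumes [measurable]: "f \<in> BM"
 shows "fourier (\<lambda>x. f (- x)) xi = fourier f (- xi)"
 using lborel_integral_real_affine[of "-1" "\<lambda>x. e2 (- (x * - xi)) * f x" 0] by (simp add: fourier_eq)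

lemma integrable_lborel_prod:
 fixes f g :: cfun
 assumes f: "intl f" and g: "intl g"
  and G: "(\<lambda>(x, y). G x y) \<in> BM2"
  and le: "\<And>x y. norm (G x y) \<le> C * norm (f x) * norm (g y)"
 shows "integrable (lborel \<Otimes>\<^sub>M lborel) (\<lambda>(x, y). G x y :: complex)"
proof -
 have 1: "integrable (lborel \<Otimes>\<^sub>M lborel) (\<lambda>(x, y). of_real C * f x * g y)"
 proof (rule lborel_pair.Fubini_integrable)
  have [measurable]: "f \<in> BM" "g \<in> BM" using assms by (auto intro: borel_of_integrable)
  show "(\<lambda>(x, y). of_real C * f x * g y) \<in> borel_measurable (lborel \<Otimes>\<^sub>M lborel)" by measurable
  show "intl (\<lambda>x. LI y. norm (case (x, y) of (x, y) => of_real C * f x * g y))"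
   using f by (simp add: norm_mult)
  show "AE x in lborel. intl (\<lambda>y. case (x, y) of (x, y) => of_real C * f x * g y)" using g by simp
 qed
 have "norm (G x y) \<le> norm (of_real C * f x * g y)" for x y
 proof -
  have "norm (G x y) \<le> C * norm (f x) * norm (g y)" by (rule le)
  also have "... \<le> \<bar>C\<bar> * norm (f x) * norm (g y)" by (intro mult_right_mono) auto
  finally show ?thesis by (simp add: norm_mult)
 qed
 moreover have "(\<lambda>(x, y). G x y) \<in> borel_measurable (lborel \<Otimes>\<^sub>M lborel)"
  using G by (simp cong: measurable_cong_sets)
 ultimately show ?thesis by (intro lintegrable_bound[OF 1]) auto
qed

lemma fourier_pairing:
 assumes f: "intl f" and g: "intl g"
 shows "(LI xi. fourier f xi * g xi) = (LI x. f x * fourier g x)"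
proof -
 have [measurable]: "f \<in> BM" "g \<in> BM" using assms by (auto intro: borel_of_integrable)
 have int: "integrable (lborel \<Otimes>\<^sub>M lborel) (\<lambda>(x, xi). e2 (- (x * xi)) * f x * g xi)"
  by (rule integrable_lborel_prod[OF f g, where C=1]) (auto simp: norm_mult)
 have "(LI xi. fourier f xi * g xi) = (LI xi. LI x. e2 (- (x * xi)) * f x * g xi)" by (simp add: fourier_eq)
 also have "... = (LI x. LI xi. e2 (- (x * xi)) * f x * g xi)"
  using lborel_pair.Fubini_integral[OF int] by simp
 also have "... = (LI x. f x * fourier g x)"
 proof (rule lintegral_cong[OF refl])
  fix x
  have "(LI xi. e2 (- (x * xi)) * f x * g xi) = (LI xi. f x * (e2 (- (xi * x)) * g xi))"
   by (simp add: ac_simps)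
  then show "(LI xi. e2 (- (x * xi)) * f x * g xi) = f x * fourier g x" by (simp add: fourier_eq)
 qed
 finally show ?thesis .
qed

section \<open>Gaussian regularization, inversion and Bessel's inequality\<close>

definition gs :: "real => real => real" where "gs d xi = exp (- ((2 * pi * d * xi)\<^sup>2 / 2))"
text \<open>\<open>gk d\<close> is the normal density of standard deviation \<open>d\<close>, and
  \<open>gs d\<close> its Fourier transform.\<close>

definition gk :: "real => real => real" where "gk d v = std_normal_density (v / d) / d"

lemma gs_measurable [measurable]: "gs d \<in> BM" unfolding gs_def[abs_def] by measurable
lemma gk_measurable [measurable]: "gk d \<in> BM" unfolding gk_def[abs_def] by measurable

lemma gs_pos: "0 < gs d xi" and gs_le: "gs d xi \<le> 1" by (auto simp: gs_def)

lemma gk_nonneg: "0 < d ==> 0 \<le> gk d v" by (simp add: gk_def)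

lemma gk_even: "gk d (- v) = gk d v" by (simp add: gk_def std_normal_density_def)

lemma std_normal_integrable: "intl std_normal_density"
 and std_normal_integral: "(LI x. std_normal_density x) = 1"
 using integrable_normal_density[of 1 0] integral_normal_density[of 1 0] by auto

lemma gk_integrable: "0 < d ==> intl (gk d)"
 using lborel_integrable_real_affine[OF std_normal_integrable, of "1 / d" 0] by (simp add: gk_def[abs_def])

lemma gk_integral: "0 < d ==> (LI x. gk d x) = 1"
 using lborel_integral_real_affine[of "1 / d" std_normal_density 0] by (simp add: gk_def std_normal_integral)

lemma gs_eq: "gs d xi = sqrt (2 * pi) * std_normal_density (2 * pi * d * xi)"
 by (simp add: gs_def std_normal_density_def)

lemma gs_integrable:
 assumes "0 < d"
 shows "intl (gs d)"
proof -
 have "intl (\<lambda>xi. std_normal_density (0 + (2 * pi * d) * xi))"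
  by (rule lborel_integrable_real_affine[OF std_normal_integrable]) (use assms in simp)
 then show ?thesis unfolding gs_eq[abs_def] by simp
qed

lemma std_normal_char:
 "(LI x. of_real (std_normal_density x) * cis (t * x)) = of_real (exp (- t\<^sup>2 / 2))"
proof -
 have "char std_normal_distribution t = (LI x. std_normal_density x *\<^sub>R iexp (t * x))"
  unfolding char_def by (subst integral_density) auto
 then show ?thesis by (simp add: char_std_normal_distribution scaleR_conv_of_real cis_conv_exp)
qed

lemma fourier_gs:
 assumes "0 < d"
 shows "fourier (\<lambda>xi. of_real (gs d xi)) v = of_real (gk d v)"
proof -
 let ?h = "\<lambda>s. of_real (std_normal_density s) * cis (- v / d * s) :: complex"
 have "(LI s. ?h s) = \<bar>2 * pi * d\<bar> *\<^sub>R (LI xi. ?h (0 + (2 * pi * d) * xi))"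
  by (rule lborel_integral_real_affine) (use assms in simp)
 moreover have "?h (0 + (2 * pi * d) * xi) = of_real (1 / sqrt (2 * pi)) * (e2 (- (xi * v)) * of_real (gs d xi))" for xi
 proof -
  have "- v / d * (0 + (2 * pi * d) * xi) = 2 * pi * (- (xi * v))" using assms by simp
  then show ?thesis unfolding gs_eq e2_def by (simp add: mult.commute)
 qed
 ultimately have "of_real (exp (- (- v / d)\<^sup>2 / 2)) = of_real (2 * pi * d / sqrt (2 * pi)) * fourier (\<lambda>xi. of_real (gs d xi)) v"
  using assms unfolding std_normal_char by (simp add: fourier_eq scaleR_conv_of_real)
 also have "2 * pi * d / sqrt (2 * pi) = d * sqrt (2 * pi)"
 proof -
  have "2 * pi / sqrt (2 * pi) = sqrt (2 * pi)" by (rule real_div_sqrt) simp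
  then have "d * (2 * pi / sqrt (2 * pi)) = d * sqrt (2 * pi)" by (simp only:)
  then show ?thesis by (simp only: times_divide_eq_right mult_ac)
 qed
 finally have "fourier (\<lambda>xi. of_real (gs d xi)) v = of_real (exp (- (- v / d)\<^sup>2 / 2) / (d * sqrt (2 * pi)))"
  using assms by (simp add: field_simps)
 then show ?thesis by (simp add: gk_def std_normal_density_def mult.commute)
qed

text \<open>The damped inversion integral equals, by \<open>fourier_pairing\<close>, the average of
  \<open>f\<close> around \<open>x\<close> against a normal density of width \<open>d n\<close>. As
  the width tends to 0 both sides converge by dominated convergence; integrability of
  \<open>fourier f\<close> serves the one side, continuity and boundedness of \<open>f\<close> the
  other.\<close>

theorem fourier_inversion:
 assumes f: "intl f" and f': "intl (fourier f)"
  and cont: "continuous_on UNIV f" and bd: "\<And>x. norm (f x) \<le> B"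
 shows "fourier (fourier f) (- x) = f x"
proof -
 have [measurable]: "f \<in> BM" using f by (rule borel_of_integrable)
 define d where "d n = 1 / real (Suc n)" for n
 have d: "0 < d n" for n by (simp add: d_def)
 have d0: "d ----> 0" unfolding d_def[abs_def] using LIMSEQ_Suc[OF lim_1_over_n] by simp
 have eq: "(LI xi. fourier f xi * (e2 (xi * x) * of_real (gs (d n) xi)))
   = (LI y. of_real (std_normal_density y) * f (x + d n * y))" for n
 proof -
  have g: "intl (\<lambda>xi. e2 (xi * x) * of_real (gs (d n) xi))"
   by (intro integrable_e2_mult integrable_of_real gs_integrable d) measurable
  have "(LI xi. fourier f xi * (e2 (xi * x) * of_real (gs (d n) xi)))
   = (LI y. f y * of_real (gk (d n) (y - x)))"
   unfolding fourier_pairing[OF f g] by (simp add: fourier_modulate fourier_gs d)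
  also have "... = d n *\<^sub>R (LI y. f (x + d n * y) * of_real (gk (d n) (d n * y)))"
   using d[of n] by (subst lborel_integral_real_affine[of "d n" _ x]) simp_all
  also have "... = (LI y. of_real (std_normal_density y) * f (x + d n * y))"
  proof -
   have "f (x + d n * y) * of_real (gk (d n) (d n * y)) = of_real (1 / d n) * (of_real (std_normal_density y) * f (x + d n * y))" for y
    using d[of n] by (simp add: gk_def)
   then have "(LI y. f (x + d n * y) * of_real (gk (d n) (d n * y)))
    = of_real (1 / d n) * (LI y. of_real (std_normal_density y) * f (x + d n * y))"
    by (simp only: integral_mult_right_zero)
   then show ?thesis using d[of n] by (simp add: scaleR_conv_of_real)
  qed
  finally show ?thesis .
 qed
 have "(\<lambda>n. LI xi. fourier f xi * (e2 (xi * x) * of_real (gs (d n) xi)))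
  ----> (LI xi. fourier f xi * (e2 (xi * x) * of_real 1))"
 proof (rule integral_dominated_convergence[where w="\<lambda>xi. norm (fourier f xi)"])
  show "AE xi in lborel. (\<lambda>n. fourier f xi * (e2 (xi * x) * of_real (gs (d n) xi))) ----> fourier f xi * (e2 (xi * x) * of_real 1)"
  proof (rule AE_I2)
   fix xi
   have "(\<lambda>n. exp (- ((2 * pi * d n * xi)\<^sup>2 / 2))) ----> exp (- ((2 * pi * 0 * xi)\<^sup>2 / 2))"
    by (intro tendsto_intros d0) auto
   then have "(\<lambda>n. gs (d n) xi) ----> 1" by (simp add: gs_def)
   then show "(\<lambda>n. fourier f xi * (e2 (xi * x) * of_real (gs (d n) xi))) ----> fourier f xi * (e2 (xi * x) * of_real 1)"
    by (intro tendsto_intros)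
  qed
  show "AE xi in lborel. norm (fourier f xi * (e2 (xi * x) * of_real (gs (d n) xi))) \<le> norm (fourier f xi)" for n
   using gs_pos gs_le by (auto simp: norm_mult abs_of_pos mult_left_le)
 qed (use f' in auto)
 moreover have "(\<lambda>n. LI y. of_real (std_normal_density y) * f (x + d n * y))
  ----> (LI y. of_real (std_normal_density y) * f x)"
 proof (rule integral_dominated_convergence[where w="\<lambda>y. std_normal_density y * B"])
  show "AE y in lborel. (\<lambda>n. of_real (std_normal_density y) * f (x + d n * y)) ----> of_real (std_normal_density y) * f x"
  proof (rule AE_I2)
   fix y
   have "isCont f x" using cont by (simp add: continuous_on_eq_continuous_at)
   moreover have "(\<lambda>n. x + d n * y) ----> x + 0 * y" by (intro tendsto_intros d0)
   ultimately have "(\<lambda>n. f (x + d n * y)) ----> f x" by (auto intro: isCont_tendsto_compose)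
   then show "(\<lambda>n. of_real (std_normal_density y) * f (x + d n * y)) ----> of_real (std_normal_density y) * f x"
    by (intro tendsto_intros)
  qed
  show "AE y in lborel. norm (of_real (std_normal_density y) * f (x + d n * y)) \<le> std_normal_density y * B" for n
   using bd by (auto simp: norm_mult intro!: mult_left_mono)
  show "intl (\<lambda>y. std_normal_density y * B)" by (intro integrable_mult_left std_normal_integrable)
 qed auto
 moreover have "(LI y. of_real (std_normal_density y) * f x) = f x"
  using std_normal_integral std_normal_integrable by simp
 moreover have "(LI xi. fourier f xi * (e2 (xi * x) * of_real 1)) = fourier (fourier f) (- x)"
  by (simp add: fourier_eq[of "fourier f"] mult.commute)
 ultimately show ?thesis unfolding eq by (simp only: LIMSEQ_unique)
qed

text \<open>One half of Plancherel's theorem, the half that upper bounds use. The squared norm of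
  the damped transform is a double integral of \<open>f\<close> against its conjugate with kernel
  \<open>gk\<close>, of total mass one, so Young's inequality bounds it; Fatou removes the
  damping.\<close>

theorem bessel_fourier:
 assumes f: "intl f" and f2: "L2 f"
 shows "L2 (fourier f)" "L2norm (fourier f) \<le> L2norm f"
proof -
 have [measurable]: "f \<in> BM" using f by (rule borel_of_integrable)
 have cf: "intl (\<lambda>x. cnj (f x))" using f by simp
 have [measurable]: "(\<lambda>x. cnj (f x)) \<in> BM" using cf by (rule borel_of_integrable)
 define d where "d n = 1 / real (Suc n)" for n
 have d: "0 < d n" for n by (simp add: d_def)
 have d0: "d ----> 0" unfolding d_def[abs_def] using LIMSEQ_Suc[OF lim_1_over_n] by simp
 \<comment> \<open>The square root is taken so that the square of the modulus carries exactly
   \<open>gs\<close>, whose transform is known.\<close>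
 define F where "F n xi = of_real (sqrt (gs (d n) xi)) * fourier f xi" for n xi
 have [measurable]: "F n \<in> BM" for n unfolding F_def[abs_def] by measurable
 define B where "B = (LI x. norm (f x))"
 have B: "norm (fourier f xi) \<le> B" for xi unfolding B_def by (rule norm_fourier_le[OF f])
 have B0: "0 \<le> B" using B[of 0] norm_ge_zero order_trans by blast
 have L: "L2 (F n) \<and> L2norm (F n) \<le> L2norm f" for n
 proof -
  have FF: "of_real ((norm (F n xi))\<^sup>2) = fourier f xi * (of_real (gs (d n) xi) * cnj (fourier f xi))" for xi
   using gs_pos[of "d n" xi] unfolding complex_norm_square F_def
   by (simp add: mult.commute mult.left_commute of_real_mult[symmetric] del: of_real_mult)
  have "intl (\<lambda>xi. gs (d n) xi * B\<^sup>2)" by (intro integrable_mult_left gs_integrable d)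
  then have int: "intl (\<lambda>xi. (norm (F n xi))\<^sup>2)"
  proof (rule lintegrable_bound)
   show "AE xi in lborel. norm ((norm (F n xi))\<^sup>2) \<le> norm (gs (d n) xi * B\<^sup>2)"
    using gs_pos B B0 by (auto simp: F_def norm_mult power_mult_distrib abs_of_pos less_imp_le intro!: mult_left_mono power_mono)
  qed auto
  then have L: "L2 (F n)" by (simp add: L2_def)
  have gi: "intl (\<lambda>xi. complex_of_real (gs (d n) xi))" by (intro integrable_of_real gs_integrable d)
  have hi: "intl (\<lambda>xi. of_real (gs (d n) xi) * cnj (fourier f xi))"
  proof (rule lintegrable_bound)
   show "intl (\<lambda>xi. gs (d n) xi * B)" by (intro integrable_mult_left gs_integrable d)
   show "(\<lambda>xi. of_real (gs (d n) xi) * cnj (fourier f xi)) \<in> borel_measurable lborel" by measurable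
   show "AE xi in lborel. norm (of_real (gs (d n) xi) * cnj (fourier f xi)) \<le> norm (gs (d n) xi * B)"
   proof (rule AE_I2)
    fix xi
    have "gs (d n) xi * norm (fourier f xi) \<le> gs (d n) xi * B"
     using gs_pos[of "d n" xi] B[of xi] by (intro mult_left_mono) auto
    then show "norm (of_real (gs (d n) xi) * cnj (fourier f xi)) \<le> norm (gs (d n) xi * B)"
     using gs_pos[of "d n" xi] B0 by (simp add: norm_mult)
   qed
  qed
  have "of_real ((L2norm (F n))\<^sup>2) = (LI xi. fourier f xi * (of_real (gs (d n) xi) * cnj (fourier f xi)))"
   unfolding L2norm_square FF[symmetric] by (rule integral_complex_of_real[symmetric])
  also have "... = (LI x. f x * fourier (\<lambda>xi. of_real (gs (d n) xi) * cnj (fourier f xi)) x)"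
   by (rule fourier_pairing[OF f hi])
  also have "... = (LI x. LI y. f x * of_real (gk (d n) (x - y)) * cnj (f y))"
  proof (rule lintegral_cong[OF refl])
   fix x
   have "fourier (\<lambda>xi. of_real (gs (d n) xi) * cnj (fourier f xi)) x
     = (LI xi. e2 (- (xi * x)) * (of_real (gs (d n) xi) * fourier (\<lambda>x. cnj (f x)) (- xi)))"
    by (simp add: fourier_eq[of "\<lambda>xi. of_real (gs (d n) xi) * cnj (fourier f xi)"] fourier_cnj)
   also have "... = (LI xi. fourier (\<lambda>x. cnj (f x)) xi * (e2 (xi * x) * of_real (gs (d n) xi)))"
    by (subst lborel_integral_real_affine[of "-1" _ 0]) (simp_all add: gs_def mult.commute mult.left_commute)
   also have "... = (LI y. cnj (f y) * fourier (\<lambda>xi. e2 (xi * x) * of_real (gs (d n) xi)) y)"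
    by (intro fourier_pairing cf integrable_e2_mult gi) measurable
   also have "... = (LI y. of_real (gk (d n) (x - y)) * cnj (f y))"
    using gk_even[of "d n" "y - x" for y] by (simp add: fourier_modulate fourier_gs d mult.commute)
   finally show "f x * fourier (\<lambda>xi. of_real (gs (d n) xi) * cnj (fourier f xi)) x
    = (LI y. f x * of_real (gk (d n) (x - y)) * cnj (f y))" by (simp add: mult.assoc)
  qed
  finally have "complex_of_real ((L2norm (F n))\<^sup>2) = (LI x. LI y. f x * of_real (gk (d n) (x - y)) * cnj (f y))" .
  from arg_cong[OF this, of norm] have "(L2norm (F n))\<^sup>2 = norm (LI x. LI y. f x * of_real (gk (d n) (x - y)) * cnj (f y))"
   by (simp only: norm_of_real abs_of_nonneg zero_le_power2)
  also have "... \<le> (LI z. \<bar>gk (d n) z\<bar>) * L2norm f * L2norm (\<lambda>x. cnj (f x))"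
   by (rule young_integral_le[OF f2 L2_cnj[OF f2] gk_integrable[OF d]]) (auto simp: norm_mult)
  also have "... = (L2norm f)\<^sup>2"
   using gk_nonneg[OF d] gk_integral[OF d] L2norm_cnj[OF f2] by (simp add: power2_eq_square)
  finally have "L2norm (F n) \<le> L2norm f" by (rule power2_le_imp_le) simp
  with L show ?thesis by blast
 qed
 have lim: "AE xi in lborel. (\<lambda>n. F n xi) ----> fourier f xi"
 proof (rule AE_I2)
  fix xi
  have "(\<lambda>n. of_real (sqrt (exp (- ((2 * pi * d n * xi)\<^sup>2 / 2)))) * fourier f xi)
   ----> of_real (sqrt (exp (- ((2 * pi * 0 * xi)\<^sup>2 / 2)))) * fourier f xi"
   by (intro tendsto_intros d0) auto
  then show "(\<lambda>n. F n xi) ----> fourier f xi" by (simp add: F_def gs_def)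
 qed
 show "L2 (fourier f)" "L2norm (fourier f) \<le> L2norm f"
  using L2_fatou[OF _ _ _ lim, of "L2norm f"] L by auto
qed

section \<open>Schwartz functions\<close>

lemma iter_deriv_0 [simp]: "iter_deriv 0 f = f" by (simp add: iter_deriv_def)

lemma iter_deriv_Suc: "iter_deriv (Suc k) f = (\<lambda>x. vector_derivative (iter_deriv k f) (at x))"
 by (simp add: iter_deriv_def)

lemma iter_deriv_add: "iter_deriv j (iter_deriv k f) = iter_deriv (j + k) f"
 by (simp add: iter_deriv_def funpow_add)

lemma smooth_has_vector_derivative:
 assumes "smooth f"
 shows "(iter_deriv k f has_vector_derivative iter_deriv (Suc k) f x) (at x)"
 using assms by (simp add: smooth_def iter_deriv_Suc vector_derivative_works[symmetric])

lemma smooth_has_vector_derivative_0: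
 "smooth f ==> (f has_vector_derivative iter_deriv 1 f x) (at x)"
 using smooth_has_vector_derivative[of f 0] by simp

lemma smooth_iter_deriv: "smooth f ==> smooth (iter_deriv k f)" by (simp add: smooth_def iter_deriv_add)

lemma smooth_continuous: "smooth f ==> continuous_on A (iter_deriv k f)"
 by (meson continuous_at_imp_continuous_on differentiable_imp_continuous_within smooth_def)

lemma smooth_continuous_0: "smooth f ==> continuous_on A f" using smooth_continuous[of f A 0] by simp

text \<open>Coinduction in place of Leibniz formulas: to control all iterated derivatives it
  suffices to exhibit a set of functions that is closed under differentiation and contains the given
  one. Smoothness, Schwartz decay and polynomial growth are obtained in this way.\<close>

lemma iter_deriv_in_coind:
 assumes "f \<in> S" and step: "\<And>f. f \<in> S ==> \<exists>f'\<in>S. \<forall>x. (f has_vector_derivative f' x) (at x)"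
 shows "iter_deriv k f \<in> S"
proof (induction k)
 case (Suc k)
 then obtain f' where f': "f' \<in> S" "\<And>x. (iter_deriv k f has_vector_derivative f' x) (at x)"
  using step by meson
 have "iter_deriv (Suc k) f = f'" unfolding iter_deriv_Suc by (intro ext vector_derivative_at f'(2))
 with f'(1) show ?case by simp
qed (use assms in simp)

lemma smooth_coind:
 assumes "f \<in> S" and step: "\<And>f. f \<in> S ==> \<exists>f'\<in>S. \<forall>x. (f has_vector_derivative f' x) (at x)"
 shows "smooth f" unfolding smooth_def
proof (intro allI)
 fix k x
 obtain f' where "\<forall>x. (iter_deriv k f has_vector_derivative f' x) (at x)"
  using step[OF iter_deriv_in_coind[OF assms]] by meson
 then show "iter_deriv k f differentiable at x" by (auto intro: differentiableI_vector)
qed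

lemma iter_deriv_eqI:
 assumes "\<And>x. (f has_vector_derivative f' x) (at x)"
 shows "iter_deriv (Suc 0) f = f'"
 unfolding iter_deriv_Suc iter_deriv_0 by (intro ext vector_derivative_at assms)

lemma schwartz_smooth: "f \<in> schwartz ==> smooth f" by (simp add: schwartz_def)

lemma schwartz_bound:
 assumes "f \<in> schwartz"
 obtains C where "0 \<le> C" "\<And>x. \<bar>x\<bar> ^ j * cmod (iter_deriv k f x) \<le> C"
proof -
 from assms have "bdd_above (range (\<lambda>x. \<bar>x\<bar> ^ j * cmod (iter_deriv k f x)))" by (simp add: schwartz_def)
 then obtain C where C: "\<And>x. \<bar>x\<bar> ^ j * cmod (iter_deriv k f x) \<le> C" by (auto simp: bdd_above_def)
 have "0 \<le> \<bar>0::real\<bar> ^ j * cmod (iter_deriv k f 0)" by simp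
 then have "0 \<le> C" using C[of 0] by linarith
 with C show ?thesis using that by blast
qed

lemma schwartz_iter_deriv: "f \<in> schwartz ==> iter_deriv k f \<in> schwartz"
 by (simp add: schwartz_def iter_deriv_add smooth_iter_deriv)

lemma schwartz_coind:
 assumes "f \<in> S" and step: "\<And>f. f \<in> S ==> \<exists>f'\<in>S. \<forall>x. (f has_vector_derivative f' x) (at x)"
  and bd: "\<And>f j. f \<in> S ==> \<exists>C. \<forall>x. \<bar>x\<bar> ^ j * cmod (f x) \<le> C"
 shows "f \<in> schwartz"
proof -
 have "bdd_above (range (\<lambda>x. \<bar>x\<bar> ^ j * cmod (iter_deriv k f x)))" for j k
  using bd[OF iter_deriv_in_coind[OF assms(1) step], of j k] by (auto simp: bdd_above_def)
 then show ?thesis using smooth_coind[OF assms(1) step] by (simp add: schwartz_def)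
qed

text \<open>The multipliers of the Schwartz space: here the weights, characters and affine functions
  by which Schwartz functions get multiplied.\<close>

definition slow :: "(real => complex) => bool" where
 "slow g \<longleftrightarrow> smooth g \<and> (\<forall>k. \<exists>C n. \<forall>x. cmod (iter_deriv k g x) \<le> C * (1 + \<bar>x\<bar>) ^ n)"

lemma slow_smooth: "slow f ==> smooth f" by (simp add: slow_def)

lemma slow_iter_deriv: "slow f ==> slow (iter_deriv k f)"
 by (simp add: slow_def iter_deriv_add smooth_iter_deriv)

lemma slow_coind:
 assumes "f \<in> S" and step: "\<And>f. f \<in> S ==> \<exists>f'\<in>S. \<forall>x. (f has_vector_derivative f' x) (at x)"
  and bd: "\<And>f. f \<in> S ==> \<exists>C n. \<forall>x. cmod (f x) \<le> C * (1 + \<bar>x\<bar>) ^ n"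
 shows "slow f"
 unfolding slow_def using smooth_coind[OF assms(1) step] bd[OF iter_deriv_in_coind[OF assms(1) step]] by auto

lemma schwartz_weighted_bound:
 assumes "f \<in> schwartz"
 obtains C where "0 \<le> C" "\<And>x. (1 + \<bar>x\<bar>) ^ n * cmod (f x) \<le> C"
proof -
 have "\<exists>C\<ge>0. \<forall>x. (1 + \<bar>x\<bar>) ^ n * (\<bar>x\<bar> ^ j * cmod (f x)) \<le> C" for j
 proof (induction n arbitrary: j)
  case 0
  show ?case using schwartz_bound[OF assms, of j 0] by auto
 next
  case (Suc n)
  from Suc.IH[of j] obtain C1 where C1: "C1 \<ge> 0" "\<And>x. (1 + \<bar>x\<bar>) ^ n * (\<bar>x\<bar> ^ j * cmod (f x)) \<le> C1" by blast
  from Suc.IH[of "Suc j"] obtain C2 where C2: "C2 \<ge> 0" "\<And>x. (1 + \<bar>x\<bar>) ^ n * (\<bar>x\<bar> ^ Suc j * cmod (f x)) \<le> C2" by blast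
  have "(1 + \<bar>x\<bar>) ^ Suc n * (\<bar>x\<bar> ^ j * cmod (f x)) \<le> C1 + C2" for x
   using C1(2)[of x] C2(2)[of x] by (simp add: algebra_simps)
  then show ?case using C1(1) C2(1) by (intro exI[of _ "C1 + C2"]) auto
 qed
 from this[of 0] show ?thesis using that by auto
qed

text \<open>Sums are included because the derivative of a product is a sum of two products; the set
  is then closed under differentiation, as the coinduction requires.\<close>

inductive_set slow_products :: "(real => complex) set" where
 prod: "f \<in> schwartz ==> slow g ==> (\<lambda>x. g x * f x) \<in> slow_products"
| add: "a \<in> slow_products ==> b \<in> slow_products ==> (\<lambda>x. a x + b x) \<in> slow_products"

lemma slow_products_schwartz: "f \<in> slow_products ==> f \<in> schwartz"
proof (erule schwartz_coind)
 show "\<exists>f'\<in>slow_products. \<forall>x. (f has_vector_derivative f' x) (at x)" if "f \<in> slow_products" for f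
  using that
 proof induction
  case (prod f g)
  have "(\<lambda>x. g x * iter_deriv 1 f x + iter_deriv 1 g x * f x) \<in> slow_products"
   by (intro slow_products.intros prod schwartz_iter_deriv slow_iter_deriv)
  moreover have "((\<lambda>x. g x * f x) has_vector_derivative (g x * iter_deriv 1 f x + iter_deriv 1 g x * f x)) (at x)" for x
   by (intro has_vector_derivative_mult smooth_has_vector_derivative_0 schwartz_smooth slow_smooth prod)
  ultimately show ?case by (intro bexI[of _ "\<lambda>x. g x * iter_deriv 1 f x + iter_deriv 1 g x * f x"] allI)
 next
  case (add a b)
  then obtain a' b' where ab: "a' \<in> slow_products" "b' \<in> slow_products"
   "\<forall>x. (a has_vector_derivative a' x) (at x)" "\<forall>x. (b has_vector_derivative b' x) (at x)" by blast
  show ?case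
   by (rule bexI[of _ "\<lambda>x. a' x + b' x"]) (use ab in \<open>auto intro: slow_products.add has_vector_derivative_add\<close>)
 qed
 show "\<exists>C. \<forall>x. \<bar>x\<bar> ^ j * cmod (f x) \<le> C" if "f \<in> slow_products" for f j
  using that
 proof induction
  case (prod f g)
  from prod(2) have "\<exists>C n. \<forall>x. cmod (iter_deriv 0 g x) \<le> C * (1 + \<bar>x\<bar>) ^ n"
   unfolding slow_def by blast
  then obtain C n where g: "\<And>x. cmod (g x) \<le> C * (1 + \<bar>x\<bar>) ^ n" by auto
  obtain B where B: "0 \<le> B" "\<And>x. (1 + \<bar>x\<bar>) ^ (n + j) * cmod (f x) \<le> B"
   using schwartz_weighted_bound[OF prod(1)] by blast
  have "0 \<le> C * (1 + \<bar>0\<bar>) ^ n" using g[of 0] norm_ge_zero order_trans by blast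
  then have C: "0 \<le> C" by simp
  have "\<bar>x\<bar> ^ j * cmod (g x * f x) \<le> C * B" for x
  proof -
   have "\<bar>x\<bar> ^ j * cmod (g x * f x) \<le> (1 + \<bar>x\<bar>) ^ j * ((C * (1 + \<bar>x\<bar>) ^ n) * cmod (f x))"
    unfolding norm_mult by (intro mult_mono power_mono g) (auto simp: C)
   also have "... = C * ((1 + \<bar>x\<bar>) ^ (n + j) * cmod (f x))" by (simp add: power_add)
   also have "... \<le> C * B" by (intro mult_left_mono B C)
   finally show ?thesis .
  qed
  then show ?case by blast
 next
  case (add a b)
  then obtain C D where "\<forall>x. \<bar>x\<bar> ^ j * cmod (a x) \<le> C" "\<forall>x. \<bar>x\<bar> ^ j * cmod (b x) \<le> D" by blast
  then have CD: "\<bar>x\<bar> ^ j * cmod (a x) \<le> C" "\<bar>x\<bar> ^ j * cmod (b x) \<le> D" for x by auto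
  have "\<bar>x\<bar> ^ j * cmod (a x + b x) \<le> C + D" for x
  proof -
   have "\<bar>x\<bar> ^ j * cmod (a x + b x) \<le> \<bar>x\<bar> ^ j * (cmod (a x) + cmod (b x))"
    by (intro mult_left_mono norm_triangle_ineq) simp
   also have "... = \<bar>x\<bar> ^ j * cmod (a x) + \<bar>x\<bar> ^ j * cmod (b x)" by (rule distrib_left)
   also have "... \<le> C + D" by (intro add_mono CD)
   finally show ?thesis .
  qed
  then show ?case by blast
 qed
qed

lemma schwartz_mult_slow: "f \<in> schwartz ==> slow g ==> (\<lambda>x. g x * f x) \<in> schwartz"
 by (rule slow_products_schwartz[OF slow_products.prod])

lemma slow_const [simp]: "slow (\<lambda>x. a)"
proof (rule slow_coind)
 show "(\<lambda>x. a) \<in> range (\<lambda>a x. a)" by blast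
 show "\<exists>f'\<in>range (\<lambda>a x. a). \<forall>x. (f has_vector_derivative f' x) (at x)" if "f \<in> range (\<lambda>a x. a)" for f :: cfun
 proof -
  have "\<forall>x. (f has_vector_derivative (\<lambda>x. 0) x) (at x)" using that by auto
  then show ?thesis by (intro bexI[of _ "\<lambda>x. 0"]) (rule allI, simp, blast)
 qed
 show "\<exists>C n. \<forall>x. cmod (f x) \<le> C * (1 + \<bar>x\<bar>) ^ n" if f: "f \<in> range (\<lambda>a x. a)" for f :: cfun
 proof -
  from f obtain a where "f = (\<lambda>x. a)" by (rule rangeE)
  then show ?thesis by (intro exI[of _ "cmod a"] exI[of _ 0]) simp
 qed
qed

lemma schwartz_cmult: "f \<in> schwartz ==> (\<lambda>x. a * f x) \<in> schwartz"
 by (rule schwartz_mult_slow[OF _ slow_const])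

lemma schwartz_add: "f \<in> schwartz ==> g \<in> schwartz ==> (\<lambda>x. f x + g x) \<in> schwartz"
 using slow_products.add[OF slow_products.prod[OF _ slow_const[of 1]] slow_products.prod[OF _ slow_const[of 1]], of f g]
 by (simp add: slow_products_schwartz)

lemma schwartz_zero: "(\<lambda>x. 0) \<in> schwartz"
proof (rule schwartz_coind)
 show "(\<lambda>x. 0) \<in> {\<lambda>x. 0 :: complex}" by blast
qed auto

lemma slow_linear: "slow (\<lambda>x. a * of_real x + b)"
proof (rule slow_coind)
 let ?S = "range (\<lambda>(a, b) x. a * of_real x + b) :: (real => complex) set"
 show "(\<lambda>x. a * of_real x + b) \<in> ?S" by (auto intro: range_eqI[of _ _ "(a, b)"])
 fix f assume "f \<in> ?S"
 then obtain a b where f: "f = (\<lambda>x. a * of_real x + b)" by auto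
 show "\<exists>f'\<in>?S. \<forall>x. (f has_vector_derivative f' x) (at x)"
 proof (intro bexI allI)
  show "(\<lambda>x. 0 * of_real x + a) \<in> ?S" by (auto intro: range_eqI[of _ _ "(0, a)"])
  show "(f has_vector_derivative 0 * complex_of_real x + a) (at x)" for x
   unfolding f by (auto intro!: derivative_eq_intros simp: scaleR_conv_of_real)
 qed
 have "cmod (a * of_real x + b) \<le> (cmod a + cmod b) * (1 + \<bar>x\<bar>) ^ 1" for x
 proof -
  have "cmod (a * of_real x + b) \<le> cmod a * \<bar>x\<bar> + cmod b"
   using norm_triangle_ineq[of "a * of_real x" b] by (simp add: norm_mult)
  moreover have "0 \<le> cmod b * \<bar>x\<bar>" by simp
  ultimately show ?thesis unfolding power_one_right distrib_left distrib_right mult_1_right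
   using norm_ge_zero[of a] by linarith
 qed
 then show "\<exists>C n. \<forall>x. cmod (f x) \<le> C * (1 + \<bar>x\<bar>) ^ n" unfolding f by blast
qed

lemma slow_e2: "slow (\<lambda>x. e2 (a * x))"
proof (rule slow_coind)
 let ?S = "range (\<lambda>c x. c * e2 (a * x)) :: (real => complex) set"
 show "(\<lambda>x. e2 (a * x)) \<in> ?S" by (auto intro: range_eqI[of _ _ 1])
 fix f assume "f \<in> ?S"
 then obtain c where f: "f = (\<lambda>x. c * e2 (a * x))" by auto
 show "\<exists>f'\<in>?S. \<forall>x. (f has_vector_derivative f' x) (at x)"
 proof (intro bexI allI)
  show "(\<lambda>x. (c * (2 * pi * \<i> * a)) * e2 (a * x)) \<in> ?S" by blast
  show "(f has_vector_derivative (c * (2 * pi * \<i> * a)) * e2 (a * x)) (at x)" for x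
   unfolding f mult.assoc[of c] by (intro has_vector_derivative_mult_right e2_has_vector_derivative)
 qed
 show "\<exists>C n. \<forall>x. cmod (f x) \<le> C * (1 + \<bar>x\<bar>) ^ n"
  unfolding f by (intro exI[of _ "cmod c"] exI[of _ 0]) (simp add: norm_mult)
qed

lemma cmod_one_plus_i: "1 \<le> cmod (1 + \<i> * of_real t * of_real x)" "cmod (1 + \<i> * of_real t * of_real x) \<le> 1 + \<bar>t * x\<bar>"
proof -
 have "1 = Re (1 + \<i> * of_real t * of_real x)" by simp
 also have "... \<le> cmod (1 + \<i> * of_real t * of_real x)" by (rule complex_Re_le_cmod)
 finally show "1 \<le> cmod (1 + \<i> * of_real t * of_real x)" .
 show "cmod (1 + \<i> * of_real t * of_real x) \<le> 1 + \<bar>t * x\<bar>"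
  using norm_triangle_ineq[of 1 "\<i> * of_real t * of_real x"] by (simp add: norm_mult abs_mult)
qed

lemma one_plus_i_nonneg: "1 + \<i> * of_real t * of_real x \<notin> \<real>\<^sub>\<le>\<^sub>0"
 by (simp add: complex_nonpos_Reals_iff)

text \<open>Differentiation lowers the exponent by one and changes the constant, so the functions
  \<open>c (1 + i t xi)^s\<close> with all \<open>c\<close> and \<open>s\<close> form a closed set.
  The base has real part 1 and stays off the branch cut of the power.\<close>

lemma slow_weight: "slow (\<lambda>xi. (1 + \<i> * of_real t * of_real xi) powr (of_real s))"
proof (rule slow_coind)
 let ?w = "\<lambda>xi. 1 + \<i> * of_real t * complex_of_real xi"
 let ?S = "range (\<lambda>(c, s) xi. c * ?w xi powr (of_real s)) :: (real => complex) set"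
 show "(\<lambda>xi. ?w xi powr of_real s) \<in> ?S" by (auto intro: range_eqI[of _ _ "(1, s)"])
 fix f assume "f \<in> ?S"
 then obtain c s where f: "f = (\<lambda>xi. c * ?w xi powr (of_real s))" by auto
 show "\<exists>f'\<in>?S. \<forall>x. (f has_vector_derivative f' x) (at x)"
 proof (intro bexI allI)
  show "(\<lambda>x. (c * (\<i> * of_real t * of_real s)) * ?w x powr of_real (s - 1)) \<in> ?S"
   by (auto intro: range_eqI[of _ _ "(c * (\<i> * of_real t * of_real s), s - 1)"])
  show "(f has_vector_derivative (c * (\<i> * of_real t * of_real s)) * ?w x powr of_real (s - 1)) (at x)" for x
  proof -
   have "(?w has_vector_derivative \<i> * of_real t) (at x)"
    by (auto intro!: derivative_eq_intros simp: scaleR_conv_of_real)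
   from field_vector_diff_chain_at[OF this has_field_derivative_powr[OF one_plus_i_nonneg, of "of_real s"]]
   have "((\<lambda>x. ?w x powr of_real s) has_vector_derivative (\<i> * of_real t * of_real s) * ?w x powr of_real (s - 1)) (at x)"
    by (simp add: o_def mult.assoc)
   then show ?thesis unfolding f mult.assoc[of c] by (rule has_vector_derivative_mult_right)
  qed
 qed
 define n where "n = nat \<lceil>\<bar>s\<bar>\<rceil>"
 have n: "\<bar>s\<bar> \<le> real n" by (simp add: n_def)
 have "cmod (c * ?w x powr of_real s) \<le> (cmod c * (1 + \<bar>t\<bar>) ^ n) * (1 + \<bar>x\<bar>) ^ n" for x
 proof -
  have "cmod (?w x powr of_real s) = cmod (?w x) powr s" by (simp add: norm_powr_real_powr')
  also have "... \<le> cmod (?w x) powr real n" using n cmod_one_plus_i(1) by (intro powr_mono) auto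
  also have "... = cmod (?w x) ^ n" using cmod_one_plus_i(1)[of t x] by (intro powr_realpow) linarith
  also have "... \<le> ((1 + \<bar>t\<bar>) * (1 + \<bar>x\<bar>)) ^ n"
  proof (rule power_mono)
   have "1 + \<bar>t * x\<bar> \<le> (1 + \<bar>t\<bar>) * (1 + \<bar>x\<bar>)" by (simp add: abs_mult algebra_simps)
   then show "cmod (?w x) \<le> (1 + \<bar>t\<bar>) * (1 + \<bar>x\<bar>)" using cmod_one_plus_i(2)[of t x] by linarith
  qed simp
  finally have "cmod (?w x powr of_real s) \<le> ((1 + \<bar>t\<bar>) * (1 + \<bar>x\<bar>)) ^ n" .
  from mult_left_mono[OF this, of "cmod c"] show ?thesis
   by (simp add: norm_mult power_mult_distrib mult.assoc)
 qed
 then show "\<exists>C n. \<forall>x. cmod (f x) \<le> C * (1 + \<bar>x\<bar>) ^ n" unfolding f by blast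
qed

lemma schwartz_measurable [measurable_dest]: "f \<in> schwartz ==> f \<in> BM"
 by (intro borel_measurable_continuous_onI smooth_continuous_0 schwartz_smooth)

lemma schwartz_L2: assumes "f \<in> schwartz" shows "L2 f"
proof -
 obtain C where C: "0 \<le> C" "\<And>x. (1 + \<bar>x\<bar>) ^ 1 * cmod (f x) \<le> C"
  using schwartz_weighted_bound[OF assms] by blast
 show ?thesis
 proof (rule L2_bound(1)[OF L2_inverse_weight(2) _ C(1)])
  show "f \<in> BM" using assms by (rule schwartz_measurable)
  show "cmod (f x) \<le> C * norm (1 / (1 + \<bar>x\<bar>))" for x using C(2)[of x] by (simp add: field_simps)
 qed
qed

lemma schwartz_integrable: assumes "f \<in> schwartz" shows "intl f"
proof -
 have 1: "(\<lambda>x. (1 * of_real x + 0) * ((1 * of_real x + 0) * f x)) \<in> schwartz"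
  by (intro schwartz_mult_slow assms slow_linear)
 have "(\<lambda>x. f x + (1 * of_real x + 0) * ((1 * of_real x + 0) * f x)) \<in> schwartz"
  by (rule schwartz_add[OF assms 1])
 then have "(\<lambda>z. of_real (1 + z\<^sup>2) * f z) \<in> schwartz"
  by (simp add: power2_eq_square algebra_simps)
 then have i: "intl (\<lambda>z. of_real (1 + \<bar>z\<bar>) * f z)"
  by (intro integrable_of_weighted_L2 schwartz_L2)
 show ?thesis
 proof (rule lintegrable_bound[OF i])
  show "f \<in> borel_measurable lborel" using schwartz_measurable[OF assms] by simp
  show "AE x in lborel. cmod (f x) \<le> cmod (of_real (1 + \<bar>x\<bar>) * f x)"
   by (rule AE_I2) (simp add: norm_mult mult_right_mono[of 1 "1 + \<bar>_\<bar>" "cmod _", simplified] del: of_real_add)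
 qed
qed

lemma schwartz_bounded:
 assumes "f \<in> schwartz" obtains B where "0 \<le> B" "\<And>x. cmod (f x) \<le> B"
 using schwartz_bound[OF assms, of 0 0] by auto

section \<open>Differentiation and the Fourier transform\<close>

lemma has_vector_derivative_iff_quotient:
 "(f has_vector_derivative D) (at x) \<longleftrightarrow> ((\<lambda>h. (f (x + h) - f x) /\<^sub>R h) \<longlongrightarrow> D) (at 0)"
proof -
 have "(f has_vector_derivative D) (at x) \<longleftrightarrow> ((\<lambda>h. norm (f (x + h) - f x - h *\<^sub>R D) / norm h) \<longlongrightarrow> 0) (at 0)"
  unfolding has_vector_derivative_def has_derivative_at by (simp add: bounded_linear_scaleR_left)
 also have "... \<longleftrightarrow> ((\<lambda>h. norm ((f (x + h) - f x) /\<^sub>R h - D)) \<longlongrightarrow> 0) (at 0)"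
 proof (rule filterlim_cong[OF refl refl])
  show "\<forall>\<^sub>F h in at 0. norm (f (x + h) - f x - h *\<^sub>R D) / norm h = norm ((f (x + h) - f x) /\<^sub>R h - D)"
   unfolding eventually_at_filter
  proof (intro always_eventually allI impI)
   fix h :: real assume "h \<noteq> 0"
   then have "(f (x + h) - f x) /\<^sub>R h - D = (f (x + h) - f x - h *\<^sub>R D) /\<^sub>R h"
    by (simp add: scaleR_diff_right)
   then show "norm (f (x + h) - f x - h *\<^sub>R D) / norm h = norm ((f (x + h) - f x) /\<^sub>R h - D)"
    by (simp add: divide_inverse mult.commute)
  qed
 qed
 also have "... \<longleftrightarrow> ((\<lambda>h. (f (x + h) - f x) /\<^sub>R h) \<longlongrightarrow> D) (at 0)"
  by (simp add: tendsto_norm_zero_iff LIM_zero_iff)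
 finally show ?thesis .
qed

lemma has_vector_derivative_fourier_integral:
 assumes g: "intl g" and xg: "intl (\<lambda>x. of_real x * g x)"
 shows "((\<lambda>xi. LI x. e2 (x * xi) * g x) has_vector_derivative
  (LI x. e2 (x * xi) * (2 * pi * \<i> * x * g x))) (at xi)"
proof -
 have [measurable]: "g \<in> BM" using g by (rule borel_of_integrable)
 define I where "I xi = (LI x. e2 (x * xi) * g x)" for xi
 have ii: "intl (\<lambda>x. e2 (x * xi) * g x)" for xi by (intro integrable_e2_mult g) measurable
 have "((\<lambda>h. (I (xi + h) - I xi) /\<^sub>R h) \<longlongrightarrow> (LI x. e2 (x * xi) * (2 * pi * \<i> * x * g x))) (at 0)"
  unfolding tendsto_at_iff_sequentially o_def
 proof (intro allI impI)
  fix X :: "nat => real" assume X: "\<forall>i. X i \<in> UNIV - {0}" "X ----> 0"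
  have eq: "(I (xi + X n) - I xi) /\<^sub>R X n = (LI x. e2 (x * xi) * ((e2 (x * X n) - 1) /\<^sub>R X n * g x))" for n
  proof -
   have "(LI x. e2 (x * xi) * ((e2 (x * X n) - 1) /\<^sub>R X n * g x))
    = (LI x. (1 / X n) *\<^sub>R (e2 (x * (xi + X n)) * g x - e2 (x * xi) * g x))"
    by (intro lintegral_cong refl) (simp add: ring_distribs e2_add scaleR_conv_of_real field_simps)
   also have "... = (1 / X n) *\<^sub>R (I (xi + X n) - I xi)" unfolding I_def using ii by simp
   finally show ?thesis unfolding inverse_eq_divide by (rule sym)
  qed
  show "(\<lambda>n. (I (xi + X n) - I xi) /\<^sub>R X n) ----> (LI x. e2 (x * xi) * (2 * pi * \<i> * x * g x))"
   unfolding eq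
  proof (rule integral_dominated_convergence[where w="\<lambda>x. 2 * pi * cmod (of_real x * g x)"])
   show "intl (\<lambda>x. 2 * pi * cmod (of_real x * g x))" using xg by auto
   show "AE x in lborel. (\<lambda>n. e2 (x * xi) * ((e2 (x * X n) - 1) /\<^sub>R X n * g x)) ----> e2 (x * xi) * (2 * pi * \<i> * x * g x)"
   proof (rule AE_I2)
    fix x
    have "((\<lambda>h. (e2 (x * (0 + h)) - e2 (x * 0)) /\<^sub>R h) \<longlongrightarrow> 2 * pi * \<i> * x * e2 (x * 0)) (at 0)"
     using e2_has_vector_derivative[of x 0 UNIV] unfolding has_vector_derivative_iff_quotient .
    then have "(\<lambda>n. (e2 (x * X n) - 1) /\<^sub>R X n) ----> 2 * pi * \<i> * x"
     using X unfolding tendsto_at_iff_sequentially o_def by auto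
    then show "(\<lambda>n. e2 (x * xi) * ((e2 (x * X n) - 1) /\<^sub>R X n * g x)) ----> e2 (x * xi) * (2 * pi * \<i> * x * g x)"
     by (intro tendsto_mult tendsto_const)
   qed
   show "AE x in lborel. cmod (e2 (x * xi) * ((e2 (x * X n) - 1) /\<^sub>R X n * g x)) \<le> 2 * pi * cmod (of_real x * g x)" for n
   proof (rule AE_I2)
    fix x
    have "X n \<noteq> 0" using X(1) by auto
    then have "cmod ((e2 (x * X n) - 1) /\<^sub>R X n) \<le> 2 * pi * \<bar>x\<bar>"
     using norm_e2_diff_le[of "x * X n"] by (simp add: divide_simps abs_mult)
    from mult_right_mono[OF this, of "cmod (g x)"]
    show "cmod (e2 (x * xi) * ((e2 (x * X n) - 1) /\<^sub>R X n * g x)) \<le> 2 * pi * cmod (of_real x * g x)"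
     by (simp add: norm_mult mult.assoc)
   qed
  qed auto
 qed
 then show ?thesis unfolding I_def[symmetric] has_vector_derivative_iff_quotient .
qed

lemma fourier_has_vector_derivative:
 assumes g: "intl g" and xg: "intl (\<lambda>x. of_real x * g x)"
 shows "(fourier g has_vector_derivative fourier (\<lambda>x. (- 2 * pi * \<i> * x) * g x) xi) (at xi)"
proof -
 have [measurable]: "g \<in> BM" using g by (rule borel_of_integrable)
 have "((\<lambda>xi. - xi) has_vector_derivative (- 1)) (at xi)" by (auto intro!: derivative_eq_intros)
 from vector_diff_chain_at[OF this has_vector_derivative_fourier_integral[OF g xg, of "- xi"]]
 have "((\<lambda>xi. LI x. e2 (- (x * xi)) * g x) has_vector_derivative
   - (LI x. e2 (- (x * xi)) * (2 * pi * \<i> * x * g x))) (at xi)" by (simp add: o_def)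
 moreover have "(\<lambda>xi. LI x. e2 (- (x * xi)) * g x) = fourier g"
  by (intro ext fourier_eq[symmetric]) measurable
 moreover have "- (LI x. e2 (- (x * xi)) * (2 * pi * \<i> * x * g x)) = fourier (\<lambda>x. (- 2 * pi * \<i> * x) * g x) xi"
  by (simp add: fourier_eq integral_minus[symmetric] mult.assoc del: integral_minus)
 ultimately show ?thesis by simp
qed

lemma integral_derivative_eq_0:
 fixes F :: cfun
 assumes F: "\<And>x. (F has_vector_derivative f x) (at x)" and cont: "continuous_on UNIV f"
  and int: "intl f" and bd: "\<And>x. \<bar>x\<bar> * cmod (F x) \<le> C"
 shows "(LI x. f x) = 0"
proof -
 have C: "0 \<le> C" using bd[of 0] by simp
 have top: "(F \<longlongrightarrow> 0) at_top"
 proof (rule Lim_null_comparison)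
  show "\<forall>\<^sub>F x in at_top. norm (F x) \<le> C / x" using eventually_gt_at_top[of 0]
   by eventually_elim (use bd in \<open>simp add: field_simps, metis abs_of_pos\<close>)
  show "((\<lambda>x. C / x) \<longlongrightarrow> 0) at_top"
   by (intro tendsto_divide_0[OF tendsto_const] filterlim_at_top_imp_at_infinity filterlim_ident)
 qed
 have bot: "(F \<longlongrightarrow> 0) at_bot"
 proof (rule Lim_null_comparison)
  show "\<forall>\<^sub>F x in at_bot. norm (F x) \<le> C / - x" using eventually_gt_at_bot[of 0]
  proof eventually_elim
   case (elim x)
   then show ?case using bd[of x] by (simp add: field_simps)
  qed
  show "((\<lambda>x. C / - x) \<longlongrightarrow> 0) at_bot"
   by (intro tendsto_divide_0[OF tendsto_const] filterlim_at_top_imp_at_infinity filterlim_uminus_at_top_at_bot)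
 qed
 have "(LBINT x=-\<infinity>..\<infinity>. f x) = 0 - 0"
 proof (rule interval_integral_FTC_integrable)
  show "((F \<circ> real_of_ereal) \<longlongrightarrow> 0) (at_right (- \<infinity>))"
   using bot by (simp add: ereal_tendsto_simps)
  show "((F \<circ> real_of_ereal) \<longlongrightarrow> 0) (at_left \<infinity>)"
   using top by (simp add: ereal_tendsto_simps)
 qed (use F cont int in \<open>auto simp: continuous_on_eq_continuous_at set_integrable_def\<close>)
 then show ?thesis by (simp add: interval_lebesgue_integral_def set_lebesgue_integral_def)
qed

lemma fourier_derivative:
 assumes f: "\<And>x. (f has_vector_derivative f' x) (at x)" and cont: "continuous_on UNIV f'"
  and int: "intl f" "intl f'" and bd: "\<And>x. \<bar>x\<bar> * cmod (f x) \<le> C"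
 shows "fourier f' xi = (2 * pi * \<i> * xi) * fourier f xi"
proof -
 have m [measurable]: "f \<in> BM" "f' \<in> BM" using int by (auto intro: borel_of_integrable)
 define F where "F x = e2 ((- xi) * x) * f x" for x
 define G where "G x = e2 ((- xi) * x) * f' x + (2 * pi * \<i> * (- xi)) * (e2 ((- xi) * x) * f x)" for x
 have contf: "continuous_on UNIV f" by (rule differentiable_imp_continuous_on)
   (metis differentiable_at_imp_differentiable_on differentiableI_vector f)
 have i1: "intl (\<lambda>x. e2 ((- xi) * x) * f' x)" "intl (\<lambda>x. e2 ((- xi) * x) * f x)"
  by (intro integrable_e2_mult int; measurable)+
 have "(LI x. G x) = 0"
 proof (rule integral_derivative_eq_0)
  show "(F has_vector_derivative G x) (at x)" for x
  proof -
   have "(F has_vector_derivative e2 ((- xi) * x) * f' x + (2 * pi * \<i> * (- xi)) * e2 ((- xi) * x) * f x) (at x)"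
    unfolding F_def by (rule has_vector_derivative_eq_rhs[OF has_vector_derivative_mult[OF e2_has_vector_derivative f]]) simp
   then show ?thesis by (simp add: G_def mult.assoc)
  qed
  show "continuous_on UNIV G" unfolding G_def by (intro continuous_intros cont contf)
  show "intl G" unfolding G_def by (intro lintegrable_add integrable_mult_right i1)
  show "\<bar>x\<bar> * cmod (F x) \<le> C" for x using bd by (simp add: F_def norm_mult)
 qed
 then have "(LI x. e2 ((- xi) * x) * f' x) + (2 * pi * \<i> * (- xi)) * (LI x. e2 ((- xi) * x) * f x) = 0"
  unfolding G_def using i1 by simp
 then show ?thesis by (simp add: fourier_eq mult.commute[of _ xi] add_eq_0_iff)
qed

lemma schwartz_mult_x: "f \<in> schwartz ==> (\<lambda>x. a * of_real x * f x) \<in> schwartz"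
 using schwartz_mult_slow[OF _ slow_linear[of a 0]] by simp

text \<open>The image of the Schwartz space is closed under differentiation, the derivative being
  the transform of \<open>- 2 pi i x g\<close>; decay of order \<open>j\<close> follows by trading
  each factor \<open>xi\<close> for a derivative of \<open>g\<close>.\<close>

lemma schwartz_fourier:
 assumes "f \<in> schwartz" shows "fourier f \<in> schwartz"
proof (rule schwartz_coind)
 show "fourier f \<in> fourier ` schwartz" using assms by blast
 show "\<exists>f'\<in>fourier ` schwartz. \<forall>x. (f has_vector_derivative f' x) (at x)" if f: "f \<in> fourier ` schwartz" for f
 proof -
  obtain g where g: "g \<in> schwartz" "f = fourier g" using f by blast
  have 1: "(\<lambda>x. 1 * of_real x * g x) \<in> schwartz" by (rule schwartz_mult_x[OF g(1)])
  have "(f has_vector_derivative fourier (\<lambda>x. (- 2 * pi * \<i>) * of_real x * g x) xi) (at xi)" for xi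
   unfolding g(2) using fourier_has_vector_derivative[OF schwartz_integrable[OF g(1)]] schwartz_integrable[OF 1] by simp
  then show ?thesis using schwartz_mult_x[OF g(1), of "- 2 * pi * \<i>"]
   by (intro bexI[of _ "fourier (\<lambda>x. (- 2 * pi * \<i>) * of_real x * g x)"] allI imageI)
 qed
 show "\<exists>C. \<forall>x. \<bar>x\<bar> ^ j * cmod (f x) \<le> C" if f: "f \<in> fourier ` schwartz" for f j
 proof -
  obtain g where g: "g \<in> schwartz" "f = fourier g" using f by blast
  have "\<exists>C. \<forall>xi. \<bar>xi\<bar> ^ j * cmod (fourier g xi) \<le> C" using g(1)
  proof (induction j arbitrary: g)
   case 0
   then show ?case using norm_fourier_le[OF schwartz_integrable] by auto
  next
   case (Suc j)
   have g': "iter_deriv 1 g \<in> schwartz" by (rule schwartz_iter_deriv[OF Suc.prems])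
   obtain C where C: "\<And>xi. \<bar>xi\<bar> ^ j * cmod (fourier (iter_deriv 1 g) xi) \<le> C" using Suc.IH[OF g'] by blast
   obtain B where B: "\<And>x. \<bar>x\<bar> ^ 1 * cmod (iter_deriv 0 g x) \<le> B" using schwartz_bound[OF Suc.prems] by metis
   have "fourier (iter_deriv 1 g) xi = (2 * pi * \<i> * xi) * fourier g xi" for xi
    by (rule fourier_derivative[where C=B])
     (use B smooth_has_vector_derivative_0[OF schwartz_smooth[OF Suc.prems]] smooth_continuous[OF schwartz_smooth[OF Suc.prems]]
      schwartz_integrable[OF Suc.prems] schwartz_integrable[OF g'] in auto)
   then have "cmod (fourier (iter_deriv 1 g) xi) = 2 * pi * \<bar>xi\<bar> * cmod (fourier g xi)" for xi
    by (simp add: norm_mult)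
   then have "2 * pi * (\<bar>xi\<bar> ^ Suc j * cmod (fourier g xi)) \<le> C" for xi
    using C[of xi] by (simp add: mult_ac)
   then have "\<bar>xi\<bar> ^ Suc j * cmod (fourier g xi) \<le> C / (2 * pi)" for xi
    by (simp add: field_simps)
   then show ?case by blast
  qed
  then show ?thesis unfolding g(2) .
 qed
qed

lemma schwartz_fourier_inversion:
 assumes "f \<in> schwartz" shows "fourier (fourier f) x = f (- x)"
proof -
 obtain B where "\<And>x. cmod (f x) \<le> B" using schwartz_bounded[OF assms] by blast
 from fourier_inversion[OF schwartz_integrable[OF assms] schwartz_integrable[OF schwartz_fourier[OF assms]]
  smooth_continuous_0[OF schwartz_smooth[OF assms]] this, of "- x"]
 show ?thesis by simp
qed

lemma schwartz_fourier_inverse: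
 assumes "phi \<in> schwartz"
 obtains psi where "psi \<in> schwartz" "fourier psi = phi" "\<And>x. psi x = fourier phi (- x)"
proof -
 \<comment> \<open>Two transforms reflect, so four give the identity and the third power of the
   transform inverts it.\<close>
 let ?psi = "fourier (fourier (fourier phi))"
 have S: "fourier phi \<in> schwartz" "fourier (fourier phi) \<in> schwartz" "?psi \<in> schwartz"
  by (intro schwartz_fourier assms)+
 have e: "?psi x = fourier phi (- x)" for x by (rule schwartz_fourier_inversion[OF S(1)])
 have "fourier ?psi x = phi x" for x
  using schwartz_fourier_inversion[OF S(2)] schwartz_fourier_inversion[OF assms] by simp
 then have "fourier ?psi = phi" by (rule ext)
 then show ?thesis using that[OF S(3) _ e] by blast
qed

section \<open>Smooth cutoffs\<close>

inductive_set smooth_products :: "(real => 'a::real_normed_algebra) set" where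
 prod: "smooth f ==> smooth g ==> (\<lambda>x. f x * g x) \<in> smooth_products"
| add: "a \<in> smooth_products ==> b \<in> smooth_products ==> (\<lambda>x. a x + b x) \<in> smooth_products"

lemma smooth_products_smooth: "f \<in> smooth_products ==> smooth f"
proof (erule smooth_coind)
 show "\<exists>f'\<in>smooth_products. \<forall>x. (f has_vector_derivative f' x) (at x)" if "f \<in> smooth_products" for f :: "real => 'a"
  using that
 proof induction
  case (prod f g)
  have "(\<lambda>x. f x * iter_deriv 1 g x + iter_deriv 1 f x * g x) \<in> smooth_products"
   by (intro smooth_products.intros prod smooth_iter_deriv)
  moreover have "((\<lambda>x. f x * g x) has_vector_derivative (f x * iter_deriv 1 g x + iter_deriv 1 f x * g x)) (at x)" for x
   by (intro has_vector_derivative_mult smooth_has_vector_derivative_0 prod)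
  ultimately show ?case by (intro bexI[of _ "\<lambda>x. f x * iter_deriv 1 g x + iter_deriv 1 f x * g x"] allI)
 next
  case (add a b)
  then obtain a' b' where ab: "a' \<in> smooth_products" "b' \<in> smooth_products"
   "\<forall>x. (a has_vector_derivative a' x) (at x)" "\<forall>x. (b has_vector_derivative b' x) (at x)" by blast
  show ?case
   by (rule bexI[of _ "\<lambda>x. a' x + b' x"]) (use ab in \<open>auto intro: smooth_products.add has_vector_derivative_add\<close>)
 qed
qed

lemma smooth_mult: "smooth f ==> smooth g ==> smooth (\<lambda>x. f x * g x :: 'a::real_normed_algebra)"
 by (rule smooth_products_smooth[OF smooth_products.prod])

lemma smooth_bounded_linear:
 assumes T: "bounded_linear T" and "smooth f"
 shows "smooth (\<lambda>x. T (f x))" "iter_deriv (Suc 0) (\<lambda>x. T (f x)) = (\<lambda>x. T (iter_deriv (Suc 0) f x))"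
proof -
 have d: "((\<lambda>x. T (g x)) has_vector_derivative T (iter_deriv 1 g x)) (at x)" if "smooth g" for g x
  by (rule bounded_linear.has_vector_derivative[OF T smooth_has_vector_derivative_0[OF that]])
 show "smooth (\<lambda>x. T (f x))"
 proof (rule smooth_coind)
  show "(\<lambda>x. T (f x)) \<in> (\<lambda>g x. T (g x)) ` {g. smooth g}" using assms by blast
  fix h assume "h \<in> (\<lambda>g x. T (g x)) ` {g. smooth g}"
  then obtain g where g: "smooth g" "h = (\<lambda>x. T (g x))" by blast
  have "(\<lambda>x. T (iter_deriv 1 g x)) \<in> (\<lambda>g x. T (g x)) ` {g. smooth g}"
   using smooth_iter_deriv[OF g(1)] by blast
  then show "\<exists>f'\<in>(\<lambda>g x. T (g x)) ` {g. smooth g}. \<forall>x. (h has_vector_derivative f' x) (at x)"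
   using d[OF g(1)] unfolding g(2) by (intro bexI[of _ "\<lambda>x. T (iter_deriv 1 g x)"] allI)
 qed
 show "iter_deriv (Suc 0) (\<lambda>x. T (f x)) = (\<lambda>x. T (iter_deriv (Suc 0) f x))"
  using d[OF assms(2)] by (intro iter_deriv_eqI) simp
qed

lemma smooth_affine:
 fixes f :: "real => 'a::real_normed_vector"
 assumes "smooth f"
 shows "smooth (\<lambda>x. f (a * x + b))"
proof (rule smooth_coind)
 let ?S = "{h :: real => 'a. \<exists>c g. smooth g \<and> h = (\<lambda>x. c *\<^sub>R g (a * x + b))}"
 show "(\<lambda>x. f (a * x + b)) \<in> ?S" using assms by (auto intro!: exI[of _ 1] exI[of _ f])
 fix h assume "h \<in> ?S"
 then obtain c g where g: "smooth g" "h = (\<lambda>x. c *\<^sub>R g (a * x + b))" by blast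
 have "(h has_vector_derivative (c * a) *\<^sub>R iter_deriv 1 g (a * x + b)) (at x)" for x
 proof -
  have "((\<lambda>x. a * x + b) has_vector_derivative a) (at x)" by (auto intro!: derivative_eq_intros)
  from vector_diff_chain_at[OF this smooth_has_vector_derivative_0[OF g(1)]]
  have "((\<lambda>x. g (a * x + b)) has_vector_derivative a *\<^sub>R iter_deriv 1 g (a * x + b)) (at x)"
   by (simp add: o_def)
  then show ?thesis unfolding g(2) scaleR_scaleR[symmetric]
   by (rule bounded_linear.has_vector_derivative[OF bounded_linear_scaleR_right])
 qed
 then show "\<exists>f'\<in>?S. \<forall>x. (h has_vector_derivative f' x) (at x)"
  using smooth_iter_deriv[OF g(1), of 1]
  by (intro bexI[of _ "\<lambda>x. (c * a) *\<^sub>R iter_deriv 1 g (a * x + b)"] allI) auto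
qed

lemma smooth_antiderivative:
 assumes "\<And>x. (F has_vector_derivative f x) (at x)" "smooth f"
 shows "smooth F"
proof (rule smooth_coind)
 show "F \<in> insert F {f. smooth f}" by simp
 fix h assume "h \<in> insert F {f. smooth f}"
 then show "\<exists>f'\<in>insert F {f. smooth f}. \<forall>x. (h has_vector_derivative f' x) (at x)"
 proof
  assume "h = F"
  then show ?thesis using assms by blast
 next
  assume "h \<in> {f. smooth f}"
  then have h: "smooth h" by simp
  then have "iter_deriv 1 h \<in> insert F {f. smooth f}" using smooth_iter_deriv[OF h] by simp
  then show ?thesis using smooth_has_vector_derivative_0[OF h] by blast
 qed
qed

text \<open>The polynomial parameter makes the family closed under differentiation: the derivative
  has the same form with \<open>p(y)\<close> replaced by \<open>y^2 (p(y) - p'(y))\<close>.\<close>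

definition flat :: "real poly => real => real" where
 "flat p x = (if 0 < x then poly p (1 / x) * exp (- (1 / x)) else 0)"

lemma poly_exp_tendsto_0: "((\<lambda>y::real. y ^ k * poly r y * exp (- y)) \<longlongrightarrow> 0) at_top"
proof (induction r arbitrary: k)
 case (pCons a r)
 have "((\<lambda>y. a * (y ^ k / exp y) + y ^ Suc k * poly r y * exp (- y)) \<longlongrightarrow> a * 0 + 0) at_top"
  by (intro tendsto_add tendsto_mult tendsto_const tendsto_power_div_exp_0 pCons.IH)
 then show ?case by (simp add: algebra_simps exp_minus divide_inverse)
qed simp

lemma flat_has_derivative:
 "(flat p has_vector_derivative flat (monom 1 2 * (p - pderiv p)) x) (at x)"
proof -
 let ?q = "monom 1 2 * (p - pderiv p)"
 consider "0 < x" | "x < 0" | "x = 0" by linarith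
 then show ?thesis
 proof cases
  case 1
  have "((\<lambda>x. poly p (1 / x) * exp (- (1 / x))) has_real_derivative
   poly (pderiv p) (1 / x) * (- (1 / x\<^sup>2)) * exp (- (1 / x)) + poly p (1 / x) * (exp (- (1 / x)) * (1 / x\<^sup>2))) (at x)"
   using 1 by (auto intro!: derivative_eq_intros simp: power2_eq_square divide_simps)
  also have "poly (pderiv p) (1 / x) * (- (1 / x\<^sup>2)) * exp (- (1 / x)) + poly p (1 / x) * (exp (- (1 / x)) * (1 / x\<^sup>2)) = flat ?q x"
   using 1 by (simp add: flat_def poly_monom algebra_simps power_divide)
  finally have "(flat p has_real_derivative flat ?q x) (at x)"
  proof (rule DERIV_cong_ev[OF refl _ refl, THEN iffD2, rotated])
   show "\<forall>\<^sub>F y in nhds x. flat p y = poly p (1 / y) * exp (- (1 / y))"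
    using eventually_nhds_in_open[of "{0<..}" x] 1 by (auto simp: flat_def elim: eventually_mono)
  qed
  then show ?thesis by (simp add: has_real_derivative_iff_has_vector_derivative)
 next
  case 2
  have "(flat p has_real_derivative 0) (at x)"
  proof (rule DERIV_cong_ev[OF refl _ refl, THEN iffD2])
   show "\<forall>\<^sub>F y in nhds x. flat p y = 0"
    using eventually_nhds_in_open[of "{..<0}" x] 2 by (auto simp: flat_def elim: eventually_mono)
  qed simp
  then show ?thesis using 2 by (simp add: has_real_derivative_iff_has_vector_derivative flat_def)
 next
  case 3
  have "((\<lambda>h. (flat p (0 + h) - flat p 0) /\<^sub>R h) \<longlongrightarrow> 0) (at 0)"
   unfolding filterlim_at_split
  proof (intro conjI)
   show "((\<lambda>h. (flat p (0 + h) - flat p 0) /\<^sub>R h) \<longlongrightarrow> 0) (at_left 0)"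
    by (rule tendsto_eventually) (auto simp: flat_def eventually_at_filter)
   have "((\<lambda>h. inverse h ^ 1 * poly p (inverse h) * exp (- inverse h)) \<longlongrightarrow> 0) (at_right (0::real))"
    by (rule filterlim_compose[OF poly_exp_tendsto_0 filterlim_inverse_at_top_right])
   then show "((\<lambda>h. (flat p (0 + h) - flat p 0) /\<^sub>R h) \<longlongrightarrow> 0) (at_right 0)"
    by (rule Lim_transform_eventually) (auto simp: flat_def eventually_at_filter inverse_eq_divide)
  qed
  then show ?thesis using 3 by (simp add: has_vector_derivative_iff_quotient flat_def)
 qed
qed

lemma smooth_flat: "smooth (flat p)"
proof (rule smooth_coind)
 show "flat p \<in> range flat" by blast
 show "\<exists>f'\<in>range flat. \<forall>x. (f has_vector_derivative f' x) (at x)" if "f \<in> range flat" for f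
  using that flat_has_derivative by blast
qed

lemma smooth_step_exists:
 obtains F :: "real => real" where "smooth F" "\<And>x. x \<le> 0 ==> F x = 0" "\<And>x. 1 \<le> x ==> F x = 1"
  "\<And>x. 0 \<le> F x" "\<And>x. F x \<le> 1"
proof -
 define b where "b x = flat 1 x * flat 1 ((-1) * x + 1)" for x
 have sb: "smooth b" unfolding b_def[abs_def] by (intro smooth_mult smooth_affine smooth_flat)
 have cb: "continuous_on A b" for A by (rule smooth_continuous_0[OF sb])
 have b0: "0 \<le> b x" for x by (simp add: b_def flat_def)
 have bz: "b x = 0" if "x \<le> 0 \<or> 1 \<le> x" for x using that by (auto simp: b_def flat_def)
 define I where "I = integral {0..1} b"
 have ii: "b integrable_on {u..v}" for u v by (rule integrable_continuous_real[OF cb])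
 have "I \<noteq> 0"
 proof
  assume "I = 0"
  then have "b (1/2) = 0" unfolding I_def by (subst (asm) integral_eq_0_iff[OF cb]) (auto simp: b0)
  then show False by (simp add: b_def flat_def)
 qed
 moreover have "0 \<le> I" unfolding I_def by (rule integral_nonneg[OF ii]) (simp add: b0)
 ultimately have I: "0 < I" by simp
 define F where "F x = integral {0..x} b / I" for x
 have Fd: "(F has_vector_derivative b x / I) (at x)" for x
 proof -
  \<comment> \<open>The interval \<open>{0..x}\<close> is empty for \<open>x < 0\<close>, where its
    integral is 0 by default. Starting from a point \<open>A\<close> below both 0 and
    \<open>x\<close> gives one formula on a neighbourhood of \<open>x\<close>, with the same values,
    since \<open>b\<close> vanishes to the left of 0.\<close>
  define A where "A = min (-1) (x - 1)"
  have FA: "F y = integral {A..y} b / I" if "A < y" for y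
  proof (cases "0 \<le> y")
   case True
   have "integral {A..y} b = integral {A..0} b + integral {0..y} b"
    by (rule Henstock_Kurzweil_Integration.integral_combine[symmetric]) (use True ii in \<open>auto simp: A_def\<close>)
   moreover have "integral {A..0} b = integral {A..0} (\<lambda>_. 0)" by (rule integral_cong) (auto simp: bz)
   ultimately show ?thesis by (simp add: F_def)
  next
   case False
   have "integral {A..y} b = integral {A..y} (\<lambda>_. 0)"
    by (rule integral_cong) (use False in \<open>auto simp: bz\<close>)
   then show ?thesis using False by (simp add: F_def)
  qed
  have "((\<lambda>u. integral {A..u} b) has_vector_derivative b x) (at x within {A..x + 1})"
   by (rule integral_has_vector_derivative[OF cb]) (auto simp: A_def)
  then have "((\<lambda>u. integral {A..u} b) has_vector_derivative b x) (at x)"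
   by (subst (asm) at_within_interior) (auto simp: A_def min_def)
  then have "((\<lambda>u. integral {A..u} b / I) has_vector_derivative b x / I) (at x)"
   by (rule bounded_linear.has_vector_derivative[OF bounded_linear_divide])
  then show ?thesis
  proof (rule has_vector_derivative_transform_within_open)
   show "open {A<..}" "x \<in> {A<..}" by (auto simp: A_def)
   show "integral {A..y} b / I = F y" if "y \<in> {A<..}" for y using FA that by simp
  qed
 qed
 have sF: "smooth F"
  by (rule smooth_antiderivative[OF Fd smooth_bounded_linear(1)[OF bounded_linear_divide sb]])
 have F0: "F x = 0" if "x \<le> 0" for x
 proof (cases "x = 0")
  case False
  then show ?thesis using that by (simp add: F_def)
 qed (simp add: F_def)
 have F1: "F x = 1" if "1 \<le> x" for x
 proof -
  have "integral {0..x} b = integral {0..1} b + integral {1..x} b"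
   by (rule Henstock_Kurzweil_Integration.integral_combine[symmetric]) (use that ii in auto)
  moreover have "integral {1..x} b = integral {1..x} (\<lambda>_. 0)" by (rule integral_cong) (auto simp: bz)
  ultimately show ?thesis using I by (simp add: F_def I_def)
 qed
 have Fpos: "0 \<le> F x" for x unfolding F_def using I
  by (intro divide_nonneg_pos integral_nonneg ii) (auto simp: b0)
 have Fle: "F x \<le> 1" for x
 proof (cases "x \<le> 1")
  case True
  have "integral {0..x} b \<le> integral {0..1} b" by (rule integral_subset_le) (use True ii b0 in auto)
  then show ?thesis using I by (simp add: F_def I_def)
 qed (use F1 in simp)
 show ?thesis by (rule that[OF sF F0 F1 Fpos Fle])
qed

lemma plateau_exists:
 assumes "a < b" "b \<le> c" "c < d"
 obtains P :: "real => real" where "smooth P" "\<And>x. x \<in> {b..c} ==> P x = 1"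
  "\<And>x. x \<notin> {a<..<d} ==> P x = 0" "\<And>x. 0 \<le> P x" "\<And>x. P x \<le> 1"
proof -
 obtain F :: "real => real" where F: "smooth F" "\<And>x. x \<le> 0 ==> F x = 0" "\<And>x. 1 \<le> x ==> F x = 1"
  "\<And>x. 0 \<le> F x" "\<And>x. F x \<le> 1" using smooth_step_exists by blast
 define P where "P x = F ((1 / (b - a)) * x + (- a / (b - a))) * F ((- 1 / (d - c)) * x + d / (d - c))" for x
 have e: "(1 / (b - a)) * x + (- a / (b - a)) = (x - a) / (b - a)" "(- 1 / (d - c)) * x + d / (d - c) = (d - x) / (d - c)" for x
  by (simp_all add: diff_divide_distrib)
 show ?thesis
 proof (rule that[of P])
  show "smooth P" unfolding P_def[abs_def] by (intro smooth_mult smooth_affine F(1))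
  show "P x = 1" if "x \<in> {b..c}" for x using that assms unfolding P_def e by (simp add: F(3))
  show "P x = 0" if "x \<notin> {a<..<d}" for x
   using that assms unfolding P_def e by (auto simp: F(2) divide_nonpos_pos not_less)
  show "0 \<le> P x" for x unfolding P_def by (intro mult_nonneg_nonneg F(4))
  show "P x \<le> 1" for x unfolding P_def by (intro mult_le_one F(4,5))
 qed
qed

lemma schwartz_of_compact_support:
 assumes "smooth f" "\<And>x. R < \<bar>x\<bar> ==> f x = 0"
 shows "f \<in> schwartz"
proof (rule schwartz_coind)
 let ?S = "{f :: real => complex. smooth f \<and> (\<forall>x. R < \<bar>x\<bar> \<longrightarrow> f x = 0)}"
 show "f \<in> ?S" using assms by simp
 fix f assume "f \<in> ?S"
 then have f: "smooth f" "\<And>x. R < \<bar>x\<bar> ==> f x = 0" by auto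
 have "iter_deriv 1 f x = 0" if "R < \<bar>x\<bar>" for x
 proof -
  have "open {x::real. R < \<bar>x\<bar>}" by (intro open_Collect_less continuous_intros)
  then have "(f has_vector_derivative 0) (at x)"
   by (intro has_vector_derivative_transform_within_open[of "\<lambda>_. 0" 0 x "{x. R < \<bar>x\<bar>}" f])
    (use that f(2) in auto)
  then show ?thesis using smooth_has_vector_derivative_0[OF f(1)] vector_derivative_unique_at by blast
 qed
 then have "iter_deriv 1 f \<in> ?S" using smooth_iter_deriv[OF f(1)] by simp
 then show "\<exists>f'\<in>?S. \<forall>x. (f has_vector_derivative f' x) (at x)"
  using smooth_has_vector_derivative_0[OF f(1)] by (intro bexI[of _ "iter_deriv 1 f"] allI)
 fix j
 have "compact ((\<lambda>x. \<bar>x\<bar> ^ j * cmod (f x)) ` {- R..R})"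
  by (intro compact_continuous_image continuous_intros smooth_continuous_0 f(1) compact_Icc)
 then have "bdd_above ((\<lambda>x. \<bar>x\<bar> ^ j * cmod (f x)) ` {- R..R})"
  by (rule bounded_imp_bdd_above[OF compact_imp_bounded])
 then obtain C where "\<forall>y\<in>(\<lambda>x. \<bar>x\<bar> ^ j * cmod (f x)) ` {- R..R}. y \<le> C"
  unfolding bdd_above_def by blast
 then have C: "\<bar>x\<bar> ^ j * cmod (f x) \<le> C" if "x \<in> {- R..R}" for x using that by blast
 have "\<bar>x\<bar> ^ j * cmod (f x) \<le> max C 0" for x
 proof (cases "R < \<bar>x\<bar>")
  case False
  then have "x \<in> {- R..R}" by auto
  then show ?thesis using C[of x] by simp
 qed (simp add: f(2))
 then show "\<exists>C. \<forall>x. \<bar>x\<bar> ^ j * cmod (f x) \<le> C" by blast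
qed

lemma schwartz_slow: "f \<in> schwartz ==> slow f" unfolding slow_def
proof (intro conjI allI)
 assume f: "f \<in> schwartz"
 then show "smooth f" by (rule schwartz_smooth)
 fix k
 obtain C where "\<And>x. \<bar>x\<bar> ^ 0 * cmod (iter_deriv k f x) \<le> C" using schwartz_bound[OF f] by blast
 then show "\<exists>C n. \<forall>x. cmod (iter_deriv k f x) \<le> C * (1 + \<bar>x\<bar>) ^ n"
  by (intro exI[of _ C] exI[of _ 0]) simp
qed

lemma smooth_of_real: "smooth f ==> smooth (\<lambda>x. complex_of_real (f x))"
 by (rule smooth_bounded_linear(1)[OF bounded_linear_of_real])

section \<open>Density and duality\<close>

text \<open>Open intervals form an intersection-stable generator of the Borel sets, so vanishing
  spreads to all Borel sets. The bounded support makes the total integral one of the interval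
  integrals, which the passage to complements requires.\<close>

lemma AE_zero_of_interval_integrals:
 fixes h :: cfun
 assumes int: "intl h" and z: "\<And>a b. (LINT x:{a<..<b}|lborel. h x) = 0"
  and supp: "\<And>x. x \<notin> {-n<..<n} ==> h x = 0"
 shows "AE x in lborel. h x = 0"
proof -
 have si: "set_integrable lborel A h" if "A \<in> sets borel" for A
  unfolding set_integrable_def using integrable_mult_indicator[of A lborel h] that int by simp
 have tot: "(LI x. h x) = 0"
 proof -
  have "indicator {-n<..<n} x *\<^sub>R h x = h x" for x using supp[of x] by (auto simp: indicator_def)
  then show ?thesis using z[of "-n" n] by (simp add: set_lebesgue_integral_def)
 qed
 have "(LINT x:A|lborel. h x) = 0" if "A \<in> sets borel" for A
 proof -
  define G where "G = range (\<lambda>(a, b). {a<..<b::real})"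
  have GB: "sigma_sets UNIV G = sets borel"
   using arg_cong[OF borel_eq_box, of "sets :: real measure => _"] by (simp add: G_def)
  have "Int_stable G"
  proof (rule Int_stableI)
   fix x y assume "x \<in> G" "y \<in> G"
   then obtain a b c d where "x = {a<..<b}" "y = {c<..<d}" unfolding G_def by auto
   then have "x \<inter> y = {max a c<..<min b d}" by auto
   then show "x \<inter> y \<in> G" unfolding G_def by (auto intro: range_eqI[of _ _ "(max a c, min b d)"])
  qed
  moreover have "G \<subseteq> Pow UNIV" by simp
  moreover have "A \<in> sigma_sets UNIV G" using that GB by simp
  ultimately show ?thesis
  proof (induction rule: sigma_sets_induct_disjoint)
   case (basic A)
   then show ?case using z by (auto simp: G_def)
  next
   case empty
   show ?case by (simp add: set_lebesgue_integral_def)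
  next
   case (compl A)
   then have A: "A \<in> sets borel" using GB by simp
   have "(LI x. h x) = (LINT x:A|lborel. h x) + (LINT x:(UNIV - A)|lborel. h x)"
    using set_integral_Un[of A "UNIV - A" lborel h] si A by (auto simp: set_lebesgue_integral_def)
   then show ?case using tot compl by simp
  next
   case (union A)
   then have A: "\<And>i. A i \<in> sets borel" using GB by auto
   have "(LINT x:(\<Union>i. A i)|lborel. h x) = (\<Sum>i. (LINT x:(A i)|lborel. h x))"
   proof (rule lebesgue_integral_countable_add)
    show "set_integrable lborel (\<Union>i. A i) h" using A by (intro si) auto
    show "A i \<inter> A j = {}" if "i \<noteq> j" for i j using union(1) that by (auto simp: disjoint_family_on_def)
   qed (use A in auto)
   then show ?case using union by simp
  qed
 qed
 then show ?thesis
  by (intro sigma_finite_measure.density_zero[OF lborel.sigma_finite_measure_axioms int]) simp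
qed

lemma plateau_schwartz:
 assumes "smooth P" "\<And>x. x \<notin> {a<..<d} ==> P x = 0"
 shows "(\<lambda>x. complex_of_real (P x)) \<in> schwartz"
proof (rule schwartz_of_compact_support[where R="\<bar>a\<bar> + \<bar>d\<bar>"])
 show "smooth (\<lambda>x. complex_of_real (P x))" by (rule smooth_of_real[OF assms(1)])
 fix x assume "\<bar>a\<bar> + \<bar>d\<bar> < \<bar>x\<bar>"
 then have "x \<notin> {a<..<d}" by auto
 then show "complex_of_real (P x) = 0" using assms(2) by simp
qed

text \<open>Plateau functions converging to the indicator of an interval show that interval
  integrals vanish. Testing against a plateau equal to 1 on a compact interval also yields local
  integrability, hence the dominating function for that limit.\<close>

lemma schwartz_orthogonal_AE_zero:
 assumes g [measurable]: "g \<in> BM"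
  and int: "\<And>phi. phi \<in> schwartz ==> intl (\<lambda>x. g x * phi x)"
  and z: "\<And>phi. phi \<in> schwartz ==> (LI x. g x * phi x) = 0"
 shows "AE x in lborel. g x = 0"
proof -
 have loc: "set_integrable lborel {a..b} g" if "a < b" for a b
 proof -
  have h: "a - 1 < a" "a \<le> b" "b < b + 1" using \<open>a < b\<close> by auto
  obtain P :: "real => real" where P: "smooth P" "\<And>x. x \<in> {a..b} ==> P x = 1"
   "\<And>x. x \<notin> {a-1<..<b+1} ==> P x = 0" "\<And>x. 0 \<le> P x" "\<And>x. P x \<le> 1"
   by (rule plateau_exists[OF h]) blast
  have "intl (\<lambda>x. g x * of_real (P x))" by (rule int[OF plateau_schwartz[OF P(1,3)]])
  from integrable_mult_indicator[OF _ this, of "{a..b}"]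
  have "intl (\<lambda>x. indicator {a..b} x *\<^sub>R (g x * of_real (P x)))" by simp
  moreover have "indicator {a..b} x *\<^sub>R (g x * of_real (P x)) = indicator {a..b} x *\<^sub>R g x" for x
   using P(2)[of x] by (auto simp: indicator_def)
  ultimately show ?thesis by (simp add: set_integrable_def)
 qed
 have iv: "(LINT x:{a<..<b}|lborel. g x) = 0" for a b
 proof (cases "a < b")
  case True
  \<comment> \<open>The 3 keeps \<open>a + dl k\<close> to the left of \<open>b - dl k\<close>
    already for \<open>k = 0\<close>, so that a plateau exists for every \<open>k\<close>.\<close>
  define dl where "dl k = (b - a) / (real k + 3)" for k
  have dl: "0 < dl k" "a + dl k \<le> b - dl k" for k
  proof -
   show "0 < dl k" using True by (simp add: dl_def)
   have "dl k \<le> (b - a) / 2" unfolding dl_def using True by (intro divide_left_mono) auto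
   then show "a + dl k \<le> b - dl k" by (simp add: field_simps)
  qed
  have "\<exists>P :: real => real. smooth P \<and> (\<forall>x\<in>{a + dl k..b - dl k}. P x = 1) \<and> (\<forall>x. x \<notin> {a<..<b} \<longrightarrow> P x = 0) \<and> (\<forall>x. 0 \<le> P x \<and> P x \<le> 1)" for k
  proof -
   have h: "a < a + dl k" "a + dl k \<le> b - dl k" "b - dl k < b" using dl[of k] by auto
   obtain P :: "real => real" where "smooth P" "\<And>x. x \<in> {a + dl k..b - dl k} ==> P x = 1"
    "\<And>x. x \<notin> {a<..<b} ==> P x = 0" "\<And>x. 0 \<le> P x" "\<And>x. P x \<le> 1"
    by (rule plateau_exists[OF h]) blast
   then show ?thesis by (intro exI[of _ P] conjI ballI allI impI)
  qed
  then obtain P :: "nat => real => real" where P: "\<And>k. smooth (P k)" "\<And>k x. x \<in> {a + dl k..b - dl k} ==> P k x = 1"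
   "\<And>k x. x \<notin> {a<..<b} ==> P k x = 0" "\<And>k x. 0 \<le> P k x" "\<And>k x. P k x \<le> 1" by metis
  have Pm [measurable]: "P k \<in> BM" for k by (intro borel_measurable_continuous_onI smooth_continuous_0 P)
  have "dl ----> 0"
  proof -
   have "(\<lambda>k. (b - a) / real k) ----> 0" by (rule lim_const_over_n)
   from LIMSEQ_ignore_initial_segment[OF this, of 3] show ?thesis by (simp add: dl_def[abs_def])
  qed
  have "(\<lambda>k. LI x. g x * of_real (P k x)) ----> (LI x. indicator {a<..<b} x *\<^sub>R g x)"
  proof (rule integral_dominated_convergence[where w="\<lambda>x. norm (indicator {a..b} x *\<^sub>R g x)"])
   show "intl (\<lambda>x. norm (indicator {a..b} x *\<^sub>R g x))"
    using loc[OF True] unfolding set_integrable_def by (rule integrable_norm)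
   show "AE x in lborel. (\<lambda>k. g x * of_real (P k x)) ----> indicator {a<..<b} x *\<^sub>R g x"
   proof (rule AE_I2)
    fix x
    show "(\<lambda>k. g x * of_real (P k x)) ----> indicator {a<..<b} x *\<^sub>R g x"
    proof (cases "x \<in> {a<..<b}")
     case True
     have "\<forall>\<^sub>F k in sequentially. dl k < min (x - a) (b - x)"
      using \<open>dl ----> 0\<close> True by (intro order_tendstoD) auto
     then have "\<forall>\<^sub>F k in sequentially. g x * of_real (P k x) = indicator {a<..<b} x *\<^sub>R g x"
      by eventually_elim (use True P(2) in auto)
     then show ?thesis by (rule tendsto_eventually)
    qed (simp add: P(3))
   qed
   show "AE x in lborel. norm (g x * of_real (P k x)) \<le> norm (indicator {a..b} x *\<^sub>R g x)" for k
   proof (rule AE_I2)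
    fix x
    show "norm (g x * of_real (P k x)) \<le> norm (indicator {a..b} x *\<^sub>R g x)"
    proof (cases "x \<in> {a<..<b}")
     case True
     then show ?thesis using P(4,5)[of k x] by (simp add: norm_mult mult_left_le)
    qed (simp add: P(3))
   qed
  qed auto
  moreover have "(LI x. g x * of_real (P k x)) = 0" for k by (intro z plateau_schwartz[OF P(1,3)])
  ultimately show ?thesis by (simp add: set_lebesgue_integral_def LIMSEQ_const_iff)
 qed (simp add: set_lebesgue_integral_def)
 have "AE x in lborel. indicator {- real n<..<real n} x *\<^sub>R g x = 0" for n
 proof (cases "n = 0")
  case False
  show ?thesis
  proof (rule AE_zero_of_interval_integrals[where n="real n"])
   have "intl (\<lambda>x. indicator {- real n<..<real n} x *\<^sub>R (indicator {- real n..real n} x *\<^sub>R g x))"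
    using loc[of "- real n" "real n"] False
    by (intro integrable_mult_indicator[where f="\<lambda>x. indicator {- real n..real n} x *\<^sub>R g x"]) (auto simp: set_integrable_def)
   moreover have "indicator {- real n<..<real n} x *\<^sub>R (indicator {- real n..real n} x *\<^sub>R g x) = indicator {- real n<..<real n} x *\<^sub>R g x" for x
    by (auto simp: indicator_def)
   ultimately show "intl (\<lambda>x. indicator {- real n<..<real n} x *\<^sub>R g x)" by (simp only:)
   show "(LINT x:{a<..<b}|lborel. indicator {- real n<..<real n} x *\<^sub>R g x) = 0" for a b
   proof -
    have "indicator {a<..<b} x *\<^sub>R (indicator {- real n<..<real n} x *\<^sub>R g x)
     = indicator {max a (- real n)<..<min b (real n)} x *\<^sub>R g x" for x by (auto simp: indicator_def)
    then show ?thesis using iv[of "max a (- real n)" "min b (real n)"] unfolding set_lebesgue_integral_def by (simp only:)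
   qed
  qed auto
 qed simp
 then have "AE x in lborel. \<forall>n. indicator {- real n<..<real n} x *\<^sub>R g x = 0"
  by (subst AE_all_countable) (rule allI)
 then show ?thesis
 proof eventually_elim
  case (elim x)
  obtain n where "\<bar>x\<bar> < real n" using reals_Archimedean2 by blast
  then show ?case using elim[rule_format, of n] by (auto simp: indicator_def abs_less_iff)
 qed
qed

lemma L2_schwartz_integrable: "L2 g ==> phi \<in> schwartz ==> intl (\<lambda>x. g x * phi x)"
 by (rule L2_mult_integrable[OF _ schwartz_L2])

lemma L2_eq_AE:
 assumes f: "L2 f" and g: "L2 g" and eq: "\<And>phi. phi \<in> schwartz ==> (LI x. f x * phi x) = (LI x. g x * phi x)"
 shows "AE x in lborel. f x = (g x :: complex)"
proof -
 have "AE x in lborel. f x - g x = 0"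
 proof (rule schwartz_orthogonal_AE_zero)
  show "(\<lambda>x. f x - g x) \<in> BM" using f g by (auto dest: L2_measurable)
  fix phi :: cfun assume phi: "phi \<in> schwartz"
  show "intl (\<lambda>x. (f x - g x) * phi x)" by (rule L2_schwartz_integrable[OF L2_diff[OF f g] phi])
  show "(LI x. (f x - g x) * phi x) = 0"
   using eq[OF phi] L2_schwartz_integrable[OF f phi] L2_schwartz_integrable[OF g phi] by (simp add: left_diff_distrib)
 qed
 then show ?thesis by simp
qed

lemma schwartz_riesz:
 assumes add: "\<And>phi psi. phi \<in> schwartz ==> psi \<in> schwartz ==> \<Lambda> (\<lambda>x. phi x + psi x) = \<Lambda> phi + \<Lambda> psi"
  and mult: "\<And>a phi. phi \<in> schwartz ==> \<Lambda> (\<lambda>x. a * phi x) = a * \<Lambda> phi"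
  and bd: "\<And>phi. phi \<in> schwartz ==> norm (\<Lambda> phi :: complex) \<le> M * L2norm phi" and M: "0 \<le> M"
 obtains u F where "L2 u" "L2norm u \<le> M" "\<And>phi. phi \<in> schwartz ==> \<Lambda> phi = (LI x. u x * phi x)"
  "\<And>n::nat. F n \<in> schwartz" "(\<lambda>n. L2norm (\<lambda>x. F n x - cnj (u x))) ----> 0"
 by (rule riesz_L2[of schwartz \<Lambda> M])
  (rule schwartz_L2 schwartz_zero schwartz_add schwartz_cmult add mult bd M that; assumption)+

text \<open>Density comes from the Riesz lemma: the functional given by the conjugate of
  \<open>w\<close> has a representative whose conjugate is a limit of Schwartz functions, and the
  representative agrees almost everywhere with the conjugate of \<open>w\<close>, because Schwartz
  functions separate.\<close>

lemma schwartz_dense_L2: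
 assumes w: "L2 (w :: real => complex)"
 obtains F where "\<And>n::nat. F n \<in> schwartz" "(\<lambda>n. L2norm (\<lambda>x. F n x - w x)) ----> 0"
proof -
 have cw: "L2 (\<lambda>x. cnj (w x))" by (rule L2_cnj[OF w])
 obtain u F where u: "L2 u" "\<And>phi. phi \<in> schwartz ==> (LI x. cnj (w x) * phi x) = (LI x. u x * phi x)"
  and F: "\<And>n::nat. F n \<in> schwartz" "(\<lambda>n. L2norm (\<lambda>x. F n x - cnj (u x))) ----> 0"
 proof (rule schwartz_riesz[where \<Lambda>="\<lambda>phi. LI x. cnj (w x) * phi x" and M="L2norm w"])
  fix phi psi :: cfun assume p: "phi \<in> schwartz" "psi \<in> schwartz"
  show "(LI x. cnj (w x) * (phi x + psi x)) = (LI x. cnj (w x) * phi x) + (LI x. cnj (w x) * psi x)"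
   using L2_schwartz_integrable[OF cw p(1)] L2_schwartz_integrable[OF cw p(2)] by (simp add: distrib_left)
 next
  fix a and phi :: cfun assume "phi \<in> schwartz"
  have "cnj (w x) * (a * phi x) = a * (cnj (w x) * phi x)" for x by (rule mult.left_commute)
  then show "(LI x. cnj (w x) * (a * phi x)) = a * (LI x. cnj (w x) * phi x)"
   by (simp only: integral_mult_right_zero)
 next
  fix phi :: cfun assume "phi \<in> schwartz"
  then show "norm (LI x. cnj (w x) * phi x) \<le> L2norm w * L2norm phi"
   using L2_mult_integral_le[OF cw schwartz_L2] L2norm_cnj[OF w] by simp
 next
  show "0 \<le> L2norm w" by (rule L2norm_nonneg)
 next
  fix u F
  assume u: "L2 u" "\<And>phi. phi \<in> schwartz ==> (LI x. cnj (w x) * phi x) = (LI x. u x * phi x)"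
   and F: "\<And>n::nat. F n \<in> schwartz" "(\<lambda>n. L2norm (\<lambda>x. F n x - cnj (u x))) ----> 0"
  show thesis by (rule that[OF u F])
 qed
 have ae: "AE x in lborel. cnj (w x) = u x" by (rule L2_eq_AE[OF cw u])
 have "L2norm (\<lambda>x. F n x - w x) = L2norm (\<lambda>x. F n x - cnj (u x))" for n
 proof (rule L2norm_cong_AE)
  have m: "F n \<in> BM" by (rule schwartz_measurable[OF F(1)])
  show "(\<lambda>x. F n x - w x) \<in> BM" "(\<lambda>x. F n x - cnj (u x)) \<in> BM"
   using m L2_measurable[OF w] L2_measurable[OF L2_cnj[OF u(1)]] by auto
  show "AE x in lborel. F n x - w x = F n x - cnj (u x)" using ae by eventually_elim (metis complex_cnj_cnj)
 qed
 with F show ?thesis using that[OF F(1)] by simp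
qed

section \<open>The symbol and its derivatives in the parameter\<close>

text \<open>\<open>l0 g p = ln (1 + g p) / g\<close> is the exponent of the symbol; \<open>l1\<close>, \<open>l2\<close>, \<open>l3\<close> are its
 derivatives in \<open>g\<close>.\<close>

definition l0 :: "real => real => real" where "l0 g p = ln (1 + g * p) * inverse g"
definition l1 :: "real => real => real" where
 "l1 g p = - (ln (1 + g * p) * inverse g ^ 2) + p * inverse g * inverse (1 + g * p)"
definition l2 :: "real => real => real" where
 "l2 g p = 2 * (ln (1 + g * p) * inverse g ^ 3) - 2 * p * inverse g ^ 2 * inverse (1 + g * p)
  - p ^ 2 * inverse g * inverse (1 + g * p) ^ 2"
definition l3 :: "real => real => real" where
 "l3 g p = - (6 * (ln (1 + g * p) * inverse g ^ 4)) + 6 * p * inverse g ^ 3 * inverse (1 + g * p)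
  + 3 * p ^ 2 * inverse g ^ 2 * inverse (1 + g * p) ^ 2 + 2 * p ^ 3 * inverse g * inverse (1 + g * p) ^ 3"

lemma one_plus_pos: "0 < g ==> 0 \<le> p ==> 0 < 1 + g * p" for g p :: real by (simp add: add_pos_nonneg)

lemma l_deriv_g:
 assumes "0 < g" "0 \<le> p"
 shows "((\<lambda>g. l0 g p) has_real_derivative l1 g p) (at g)"
  and "((\<lambda>g. l1 g p) has_real_derivative l2 g p) (at g)"
  and "((\<lambda>g. l2 g p) has_real_derivative l3 g p) (at g)"
proof -
 define G where "G = inverse g"
 define R where "R = inverse (1 + g * p)"
 have X: "0 < 1 + g * p" by (rule one_plus_pos[OF assms])
 have dL: "((\<lambda>g. ln (1 + g * p)) has_real_derivative p * R) (at g)"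
  using X by (auto intro!: derivative_eq_intros simp: R_def divide_inverse)
 have dG: "(inverse has_real_derivative - (G * G)) (at g)"
  using assms DERIV_inverse[of g UNIV] by (simp add: G_def)
 have dR: "((\<lambda>g. inverse (1 + g * p)) has_real_derivative - (p * R * R)) (at g)"
  using X by (auto intro!: derivative_eq_intros simp: R_def)
 have dGn: "((\<lambda>g. inverse g ^ n) has_real_derivative real n * (- (G * G) * G ^ (n - Suc 0))) (at g)" for n
  by (rule DERIV_cong[OF DERIV_power[OF dG]]) (simp add: G_def)
 have dRn: "((\<lambda>g. inverse (1 + g * p) ^ n) has_real_derivative real n * (- (p * R * R) * R ^ (n - Suc 0))) (at g)" for n
  by (rule DERIV_cong[OF DERIV_power[OF dR]]) (simp add: R_def)
 note d = DERIV_add DERIV_diff DERIV_minus DERIV_mult DERIV_const dL dG dR dGn dRn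
 show "((\<lambda>g. l0 g p) has_real_derivative l1 g p) (at g)"
  unfolding l0_def l1_def G_def[symmetric] R_def[symmetric]
  by (rule DERIV_cong, (rule d)+) (simp add: G_def[symmetric] R_def[symmetric] power2_eq_square algebra_simps)
 show "((\<lambda>g. l1 g p) has_real_derivative l2 g p) (at g)"
  unfolding l1_def l2_def G_def[symmetric] R_def[symmetric]
  by (rule DERIV_cong, (rule d)+) (simp add: G_def[symmetric] R_def[symmetric] power2_eq_square power3_eq_cube algebra_simps)
 show "((\<lambda>g. l2 g p) has_real_derivative l3 g p) (at g)"
  unfolding l2_def l3_def G_def[symmetric] R_def[symmetric]
  by (rule DERIV_cong, (rule d)+) (simp add: G_def[symmetric] R_def[symmetric] power2_eq_square power3_eq_cube power4_eq_xxxx algebra_simps)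
qed

text \<open>The logarithms cancel on differentiating in \<open>p\<close>: the \<open>j\<close>-th
  function has derivative a multiple of \<open>p^j (1 + g p)^(-j-1)\<close>, which is dominated by
  the derivative of \<open>ln (1 + g p)\<close>. Differences in \<open>p\<close> are therefore
  measured by the logarithmic distance \<open>logd\<close>.\<close>

lemma l_deriv_p:
 assumes "0 < g" "0 \<le> p"
 shows "((\<lambda>p. l0 g p) has_real_derivative inverse (1 + g * p)) (at p)"
  and "((\<lambda>p. l1 g p) has_real_derivative - (p * inverse (1 + g * p) ^ 2)) (at p)"
  and "((\<lambda>p. l2 g p) has_real_derivative 2 * p ^ 2 * inverse (1 + g * p) ^ 3) (at p)"
  and "((\<lambda>p. l3 g p) has_real_derivative - (6 * p ^ 3 * inverse (1 + g * p) ^ 4)) (at p)"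
proof -
 define G where "G = inverse g"
 define R where "R = inverse (1 + g * p)"
 have gG: "g * G = 1" "G * g = 1" using assms by (simp_all add: G_def)
 have gGx: "g * (G * x) = x" for x using gG(1) by (simp add: mult.assoc[symmetric])
 have X: "0 < 1 + g * p" by (rule one_plus_pos[OF assms])
 have dL: "((\<lambda>p. ln (1 + g * p)) has_real_derivative g * R) (at p)"
  using X by (auto intro!: derivative_eq_intros simp: R_def divide_inverse)
 have dR: "((\<lambda>p. inverse (1 + g * p)) has_real_derivative - (g * R * R)) (at p)"
  using X by (auto intro!: derivative_eq_intros simp: R_def)
 have dRn: "((\<lambda>p. inverse (1 + g * p) ^ n) has_real_derivative real n * (- (g * R * R) * R ^ (n - Suc 0))) (at p)" for n
  by (rule DERIV_cong[OF DERIV_power[OF dR]]) (simp add: R_def)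
 have dpn: "((\<lambda>p. p ^ n) has_real_derivative real n * (1 * p ^ (n - Suc 0))) (at p)" for n
  by (rule DERIV_cong[OF DERIV_power[OF DERIV_ident]]) simp
 note d = DERIV_add DERIV_diff DERIV_minus DERIV_mult DERIV_const DERIV_ident dL dR dRn dpn
 show "((\<lambda>p. l0 g p) has_real_derivative inverse (1 + g * p)) (at p)"
  unfolding l0_def G_def[symmetric] R_def[symmetric]
  by (rule DERIV_cong, (rule d)+) (simp add: G_def[symmetric] R_def[symmetric] gG gGx algebra_simps)
 show "((\<lambda>p. l1 g p) has_real_derivative - (p * inverse (1 + g * p) ^ 2)) (at p)"
  unfolding l1_def G_def[symmetric] R_def[symmetric]
  by (rule DERIV_cong, (rule d)+) (simp add: G_def[symmetric] R_def[symmetric] gG gGx power2_eq_square algebra_simps)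
 show "((\<lambda>p. l2 g p) has_real_derivative 2 * p ^ 2 * inverse (1 + g * p) ^ 3) (at p)"
  unfolding l2_def G_def[symmetric] R_def[symmetric]
  by (rule DERIV_cong, (rule d)+) (simp add: G_def[symmetric] R_def[symmetric] power2_eq_square power3_eq_cube, use gG(1) in algebra)
 show "((\<lambda>p. l3 g p) has_real_derivative - (6 * p ^ 3 * inverse (1 + g * p) ^ 4)) (at p)"
  unfolding l3_def G_def[symmetric] R_def[symmetric]
  by (rule DERIV_cong, (rule d)+) (simp add: G_def[symmetric] R_def[symmetric] power2_eq_square power3_eq_cube power4_eq_xxxx, use gG(1) in algebra)
qed

lemma abs_diff_le_of_deriv:
 fixes f :: "real => real"
 assumes f: "\<And>p. 0 \<le> p ==> (f has_real_derivative f' p) (at p)"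
  and h: "\<And>p. 0 \<le> p ==> (h has_real_derivative h' p) (at p)"
  and le: "\<And>p. 0 \<le> p ==> \<bar>f' p\<bar> \<le> h' p" and "0 \<le> p" "0 \<le> q"
 shows "\<bar>f p - f q\<bar> \<le> \<bar>h p - h q\<bar>"
proof -
 have *: "\<bar>f v - f u\<bar> \<le> h v - h u" if "0 \<le> u" "u \<le> v" for u v
 proof -
  have "h u - f u \<le> h v - f v"
   by (rule DERIV_nonneg_imp_nondecreasing[OF that(2), of "\<lambda>p. h p - f p"])
    (use that le in \<open>auto intro!: exI DERIV_diff[OF h f] dest: order_trans[OF that(1)] simp: abs_le_iff\<close>)
  moreover have "h u + f u \<le> h v + f v"
  proof (rule DERIV_nonneg_imp_nondecreasing[OF that(2), of "\<lambda>p. h p + f p"])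
   fix x assume "u \<le> x" "x \<le> v"
   then have x: "0 \<le> x" using that by linarith
   show "\<exists>y. ((\<lambda>p. h p + f p) has_real_derivative y) (at x) \<and> 0 \<le> y"
    using DERIV_add[OF h[OF x] f[OF x]] le[OF x] by (intro exI[of _ "h' x + f' x"]) auto
  qed
  ultimately show ?thesis by linarith
 qed
 show ?thesis
 proof (cases "q \<le> p")
  case True
  then show ?thesis using *[OF \<open>0 \<le> q\<close> True] by linarith
 next
  case False
  then show ?thesis using *[OF \<open>0 \<le> p\<close>, of q] by linarith
 qed
qed

definition logd :: "real => real => real => real" where
 "logd g p q = \<bar>ln (1 + g * p) - ln (1 + g * q)\<bar>"

text \<open>The \<open>p\<close>-derivatives are compared with that of
  \<open>K ln (1 + g p)\<close>. In \<open>K\<close>, 6 is the largest coefficient, that of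
  \<open>l3\<close>; each of at most three factors \<open>p / (1 + g p)\<close> costs
  \<open>1 + 1/a\<close>, and one more such factor produces the \<open>g\<close> of the logarithm's
  derivative.\<close>

lemma l_diff_le:
 assumes a: "0 < a" "a \<le> g" and "0 \<le> p" "0 \<le> q"
 defines "K \<equiv> 6 * (1 + inverse a) ^ 4"
 shows "\<bar>l0 g p - l0 g q\<bar> \<le> K * logd g p q" "\<bar>l1 g p - l1 g q\<bar> \<le> K * logd g p q"
  "\<bar>l2 g p - l2 g q\<bar> \<le> K * logd g p q" "\<bar>l3 g p - l3 g q\<bar> \<le> K * logd g p q"
proof -
 have g: "0 < g" using a by linarith
 have main: "\<bar>f p - f q\<bar> \<le> K * logd g p q"
  if f: "\<And>p. 0 \<le> p ==> (f has_real_derivative s * (m * p ^ i * inverse (1 + g * p) ^ Suc i)) (at p)"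
   and i: "i \<le> 3" and m: "0 \<le> m" "m \<le> 6" and s: "\<bar>s\<bar> = 1" for f and s m :: real and i
 proof -
  have "\<bar>f p - f q\<bar> \<le> \<bar>K * ln (1 + g * p) - K * ln (1 + g * q)\<bar>"
  proof (rule abs_diff_le_of_deriv[OF f])
   fix p :: real assume p: "0 \<le> p"
   have X: "0 < 1 + g * p" by (rule one_plus_pos[OF g p])
   show "((\<lambda>p. K * ln (1 + g * p)) has_real_derivative K * (g * inverse (1 + g * p))) (at p)"
    using X by (auto intro!: derivative_eq_intros simp: divide_inverse)
   have "p * inverse (1 + g * p) \<le> inverse g" using X g p by (simp add: field_simps)
   then have "(p * inverse (1 + g * p)) ^ i \<le> inverse g ^ i" using X p by (intro power_mono) auto
   also have "... \<le> (1 + inverse a) ^ i"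
   proof (rule power_mono)
    show "inverse g \<le> 1 + inverse a" using le_imp_inverse_le[OF a(2,1)] by linarith
   qed (use g in simp)
   finally have 1: "(p * inverse (1 + g * p)) ^ i \<le> (1 + inverse a) ^ i" .
   have "1 \<le> (1 + inverse a) * g"
   proof -
    have "1 = inverse a * a" using a by simp
    also have "... \<le> (1 + inverse a) * g" using a by (intro mult_mono) auto
    finally show ?thesis .
   qed
   then have "(1 + inverse a) ^ i * 1 \<le> (1 + inverse a) ^ i * ((1 + inverse a) * g)"
    using a by (intro mult_left_mono) auto
   also have "... = (1 + inverse a) ^ Suc i * g" by simp
   also have "... \<le> (1 + inverse a) ^ 4 * g"
    using a g i by (intro mult_right_mono power_increasing) auto
   finally have 2: "(1 + inverse a) ^ i \<le> (1 + inverse a) ^ 4 * g" by simp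
   have "\<bar>s * (m * p ^ i * inverse (1 + g * p) ^ Suc i)\<bar> = m * ((p * inverse (1 + g * p)) ^ i * inverse (1 + g * p))"
    using s m p X by (simp add: abs_mult power_mult_distrib abs_of_nonneg)
   also have "... \<le> 6 * (((1 + inverse a) ^ 4 * g) * inverse (1 + g * p))"
    using m X p a g by (intro mult_mono order_trans[OF 1 2]) auto
   also have "... = K * (g * inverse (1 + g * p))" by (simp add: K_def)
   finally show "\<bar>s * (m * p ^ i * inverse (1 + g * p) ^ Suc i)\<bar> \<le> K * (g * inverse (1 + g * p))" .
  qed (use \<open>0 \<le> p\<close> \<open>0 \<le> q\<close> in auto)
  also have "... = K * logd g p q"
   using a by (simp add: logd_def K_def right_diff_distrib[symmetric] abs_mult)
  finally show ?thesis .
 qed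
 show "\<bar>l0 g p - l0 g q\<bar> \<le> K * logd g p q"
  by (rule main[where i=0 and m=1 and s=1]) (use l_deriv_p(1)[OF g] in auto)
 show "\<bar>l1 g p - l1 g q\<bar> \<le> K * logd g p q"
  by (rule main[where i=1 and m=1 and s="-1"]) (use l_deriv_p(2)[OF g] in \<open>auto simp: numeral_2_eq_2\<close>)
 show "\<bar>l2 g p - l2 g q\<bar> \<le> K * logd g p q"
  by (rule main[where i=2 and m=2 and s=1]) (use l_deriv_p(3)[OF g] in \<open>auto simp: eval_nat_numeral mult.assoc\<close>)
 show "\<bar>l3 g p - l3 g q\<bar> \<le> K * logd g p q"
  by (rule main[where i=3 and m=6 and s="-1"]) (use l_deriv_p(4)[OF g] in \<open>auto simp: eval_nat_numeral mult.assoc\<close>)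
qed

text \<open>\<open>sy j g p q\<close> is the \<open>j\<close>-th derivative in \<open>g\<close> (\<open>j \<le> 3\<close>) of
 \<open>(1 + g p)\<^bsup>1/g\<^esup> (1 + g q)\<^bsup>-1/g\<^esup>\<close>.\<close>

definition sy :: "nat => real => real => real => real" where
 "sy j g p q = exp (l0 g p - l0 g q) *
  (if j = 0 then 1 else if j = 1 then l1 g p - l1 g q
   else if j = 2 then (l1 g p - l1 g q) ^ 2 + (l2 g p - l2 g q)
   else (l1 g p - l1 g q) ^ 3 + 3 * (l1 g p - l1 g q) * (l2 g p - l2 g q) + (l3 g p - l3 g q))"

lemma sy_0_diag [simp]: "sy 0 g p p = 1" by (simp add: sy_def)

lemma sy_pos: "0 < sy 0 g p q" by (simp add: sy_def)

lemma sy_deriv: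
 assumes "0 < g" "0 \<le> p" "0 \<le> q" "j < 3"
 shows "((\<lambda>g. sy j g p q) has_real_derivative sy (Suc j) g p q) (at g)"
proof -
 define e0 e1 e2 e3 where "e0 g = l0 g p - l0 g q" and "e1 g = l1 g p - l1 g q"
  and "e2 g = l2 g p - l2 g q" and "e3 g = l3 g p - l3 g q" for g
 have d0: "(e0 has_real_derivative e1 g) (at g)" and d1: "(e1 has_real_derivative e2 g) (at g)"
  and d2: "(e2 has_real_derivative e3 g) (at g)"
  unfolding e0_def[abs_def] e1_def[abs_def] e2_def[abs_def] e3_def by (intro DERIV_diff l_deriv_g assms)+
 have dE: "((\<lambda>g. exp (e0 g)) has_real_derivative exp (e0 g) * e1 g) (at g)"
  by (rule DERIV_fun_exp[OF d0])
 have d1n: "((\<lambda>g. e1 g ^ 2) has_real_derivative 2 * (e2 g * e1 g)) (at g)"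
  by (rule DERIV_cong[OF DERIV_power[OF d1]]) simp
 have "j = 0 \<or> j = 1 \<or> j = 2" using \<open>j < 3\<close> by auto
 then show ?thesis
 proof (elim disjE)
  assume j: "j = 0"
  show ?thesis unfolding j sy_def e0_def[symmetric] e1_def[symmetric] using dE by simp
 next
  assume j: "j = 1"
  have "((\<lambda>g. exp (e0 g) * e1 g) has_real_derivative exp (e0 g) * (e1 g ^ 2 + e2 g)) (at g)"
   by (rule DERIV_cong[OF DERIV_mult[OF dE d1]]) (simp add: power2_eq_square algebra_simps)
  then show ?thesis unfolding j sy_def e0_def[symmetric] e1_def[symmetric] e2_def[symmetric] by simp
 next
  assume j: "j = 2"
  have "((\<lambda>g. exp (e0 g) * (e1 g ^ 2 + e2 g)) has_real_derivative
    exp (e0 g) * (e1 g ^ 3 + 3 * e1 g * e2 g + e3 g)) (at g)"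
   by (rule DERIV_cong[OF DERIV_mult[OF dE DERIV_add[OF d1n d2]]])
    (simp add: power2_eq_square power3_eq_cube algebra_simps)
  then show ?thesis unfolding j sy_def e0_def[symmetric] e1_def[symmetric] e2_def[symmetric] e3_def[symmetric] by simp
 qed
qed

lemma logd_nonneg [simp]: "0 \<le> logd g p q" by (simp add: logd_def)

text \<open>For \<open>j \<ge> 1\<close> the quotient \<open>sy j / sy 0\<close> is a polynomial
  without constant term in the differences of \<open>l1\<close>, \<open>l2\<close>,
  \<open>l3\<close>, each at most \<open>K D\<close>, and its degrees 1 to 3 are absorbed by
  \<open>D + D^3\<close>. The first bound keeps the factor \<open>D\<close> and so vanishes at
  \<open>p = q\<close>; from it comes the gain \<open>t\<close> when two frequencies are
  compared.\<close>

lemma sy_le: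
 assumes a: "0 < a" "a \<le> g" and p: "0 \<le> p" and q: "0 \<le> q"
 defines "K \<equiv> 6 * (1 + inverse a) ^ 4" and "D \<equiv> logd g p q"
 shows "1 \<le> j ==> \<bar>sy j g p q\<bar> \<le> 4 * K ^ 3 * (D * (1 + D ^ 2)) * sy 0 g p q"
  and "\<bar>sy j g p q\<bar> \<le> 4 * K ^ 3 * ((1 + D) * (1 + D ^ 2)) * sy 0 g p q"
proof -
 have K: "1 \<le> K"
 proof -
  have "1 \<le> (1 + inverse a) ^ 4" using a by (intro one_le_power) simp
  then show ?thesis by (simp add: K_def)
 qed
 have D: "0 \<le> D" by (simp add: D_def)
 define e1 e2 e3 where "e1 = l1 g p - l1 g q" and "e2 = l2 g p - l2 g q" and "e3 = l3 g p - l3 g q"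
 have e: "\<bar>e1\<bar> \<le> K * D" "\<bar>e2\<bar> \<le> K * D" "\<bar>e3\<bar> \<le> K * D"
  unfolding e1_def e2_def e3_def K_def D_def by (intro l_diff_le a p q)+
 have K2: "K \<le> K ^ 3" "K ^ 2 \<le> K ^ 3" using K by (auto intro: power_increasing[of 1, simplified] power_increasing)
 \<comment> \<open>The terms of degree two are absorbed because
   \<open>D (1 - D)^2 \<ge> 0\<close>.\<close>
 have D2: "D ^ 2 \<le> (D + D ^ 3) / 2"
 proof -
  have "0 \<le> D * (1 - D) ^ 2" using D by simp
  then show ?thesis by (simp add: power2_eq_square power3_eq_cube algebra_simps)
 qed
 define B where "B = K ^ 3 * (D + D ^ 3)"
 have b1: "\<bar>e\<bar> \<le> B" if "\<bar>e\<bar> \<le> K * D" for e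
 proof -
  have "K * D \<le> K ^ 3 * (D + D ^ 3)" using K2 K D by (intro mult_mono) auto
  then show ?thesis using that by (simp add: B_def)
 qed
 have b2: "\<bar>e * f\<bar> \<le> B / 2" if "\<bar>e\<bar> \<le> K * D" "\<bar>f\<bar> \<le> K * D" for e f
 proof -
  have "\<bar>e * f\<bar> \<le> (K * D) * (K * D)" unfolding abs_mult using that K D by (intro mult_mono) auto
  also have "... = K ^ 2 * D ^ 2" by (simp add: power2_eq_square)
  also have "... \<le> K ^ 3 * ((D + D ^ 3) / 2)" using K2 D2 K D by (intro mult_mono) auto
  finally show ?thesis by (simp add: B_def)
 qed
 have b3: "\<bar>e1 ^ 3\<bar> \<le> B"
 proof -
  have "\<bar>e1 ^ 3\<bar> \<le> (K * D) ^ 3" unfolding power_abs using e(1) by (intro power_mono) auto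
  also have "... \<le> B" using K D unfolding B_def power_mult_distrib by (intro mult_left_mono) auto
  finally show ?thesis .
 qed
 have B: "0 \<le> B" using K D by (simp add: B_def)
 have fac: "\<bar>sy j g p q\<bar> = \<bar>sy j g p q / sy 0 g p q\<bar> * sy 0 g p q" for j
  using sy_pos[of g p q] by (simp add: abs_mult)
 have f1: "\<bar>sy j g p q / sy 0 g p q\<bar> \<le> 4 * B" if "1 \<le> j"
 proof -
  have r: "sy j g p q / sy 0 g p q = (if j = 1 then e1 else if j = 2 then e1 ^ 2 + e2 else e1 ^ 3 + 3 * e1 * e2 + e3)"
   using that by (simp add: sy_def e1_def e2_def e3_def)
  have "\<bar>e1 ^ 2 + e2\<bar> \<le> 4 * B" using b2[OF e(1) e(1)] b1[OF e(2)] B abs_triangle_ineq[of "e1 * e1" e2]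
   unfolding power2_eq_square by linarith
  moreover have "\<bar>e1 ^ 3 + 3 * e1 * e2 + e3\<bar> \<le> 4 * B"
  proof -
   have "\<bar>3 * e1 * e2\<bar> \<le> 3 * (B / 2)" using b2[OF e(1,2)] by (simp add: abs_mult)
   then show ?thesis using b3 b1[OF e(3)] B abs_triangle_ineq[of "e1 ^ 3 + 3 * e1 * e2" e3]
     abs_triangle_ineq[of "e1 ^ 3" "3 * e1 * e2"] by linarith
  qed
  moreover have "\<bar>e1\<bar> \<le> 4 * B" using b1[OF e(1)] B by simp
  ultimately show ?thesis unfolding r by simp
 qed
 have BD: "4 * B = 4 * K ^ 3 * (D * (1 + D ^ 2))"
  by (simp add: B_def power2_eq_square power3_eq_cube algebra_simps)
 show 1: "\<bar>sy j g p q\<bar> \<le> 4 * K ^ 3 * (D * (1 + D ^ 2)) * sy 0 g p q" if "1 \<le> j"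
  unfolding fac[of j] BD[symmetric] using f1[OF that] sy_pos[of g p q] by (intro mult_right_mono) auto
 show "\<bar>sy j g p q\<bar> \<le> 4 * K ^ 3 * ((1 + D) * (1 + D ^ 2)) * sy 0 g p q"
 proof (cases "1 \<le> j")
  case True
  have "4 * K ^ 3 * (D * (1 + D ^ 2)) \<le> 4 * K ^ 3 * ((1 + D) * (1 + D ^ 2))"
   using K D by (intro mult_left_mono mult_right_mono) auto
  then show ?thesis using 1[OF True] sy_pos[of g p q] by (meson mult_right_mono less_imp_le order_trans)
 next
  case False
  then have "j = 0" by simp
  then have "\<bar>sy j g p q\<bar> = 1 * sy 0 g p q" using sy_pos[of g p q] by simp
  also have "... \<le> 4 * K ^ 3 * ((1 + D) * (1 + D ^ 2)) * sy 0 g p q"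
  proof (intro mult_right_mono)
   have k3: "1 \<le> 4 * K ^ 3" using one_le_power[OF K, of 3] by linarith
   have "1 * (1 * 1) \<le> 4 * K ^ 3 * ((1 + D) * (1 + D ^ 2))" using k3 D K by (intro mult_mono) auto
   then show "1 \<le> 4 * K ^ 3 * ((1 + D) * (1 + D ^ 2))" by simp
  qed (use sy_pos[of g p q] in auto)
  finally show ?thesis .
 qed
qed

text \<open>Converts the polynomial losses in the logarithmic distance, caused by differentiating
  the symbol in \<open>g\<close>, into an arbitrarily small power of the frequency ratio; the rate
  used later is \<open>dl\<close>.\<close>

lemma cubic_le_exp:
 assumes "0 < d"
 obtains C :: real where "0 < C" "\<And>D. 0 \<le> D ==> (1 + D) * (1 + D ^ 2) \<le> C * exp (d * D)"
proof -
 define c where "c = min 1 (d / 3)"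
 have c: "0 < c" "c \<le> 1" "c \<le> d / 3" using assms by (auto simp: c_def)
 have "(1 + D) * (1 + D ^ 2) \<le> (1 / c ^ 3) * exp (d * D)" if "0 \<le> D" for D
 proof -
  have "c * (1 + D) \<le> 1 + (d / 3) * D" using c mult_right_mono[OF c(3) that] by (simp add: distrib_left)
  also have "... \<le> exp ((d / 3) * D)" by (rule exp_ge_add_one_self)
  finally have "(c * (1 + D)) ^ 3 \<le> exp ((d / 3) * D) ^ 3" using c that by (intro power_mono) auto
  also have "... = exp (d * D)" by (simp add: exp_of_nat_mult[symmetric])
  finally have "c ^ 3 * (1 + D) ^ 3 \<le> exp (d * D)" by (simp only: power_mult_distrib)
  then have "(1 + D) ^ 3 \<le> (1 / c ^ 3) * exp (d * D)" using c by (simp add: pos_le_divide_eq mult.commute)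
  moreover have "(1 + D) * (1 + D ^ 2) \<le> (1 + D) ^ 3"
   using that by (simp add: power2_eq_square power3_eq_cube algebra_simps)
  ultimately show ?thesis by linarith
 qed
 then show ?thesis using c by (intro that[of "1 / c ^ 3"]) auto
qed

lemma sy_0_eq: "0 < g ==> sy 0 g p q = exp ((ln (1 + g * p) - ln (1 + g * q)) / g)"
 by (simp add: sy_def l0_def divide_inverse left_diff_distrib)

text \<open>The factor \<open>exp (- ln (1 + g * q))\<close> is one power of decay in
  \<open>q\<close>, which balances the weight of order \<open>m1\<close>. The second bound is the
  simplest but grows exponentially in the distance. The last two avoid this, case by case, and serve
  where the remaining factor has only finite decay in frequency.\<close>

lemma logd_le:
 assumes "0 < g" "0 \<le> p" "0 \<le> q"
 shows "exp (logd g p q) \<le> 1 + g * \<bar>p - q\<bar>"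
  and "logd g p q \<le> g * \<bar>p - q\<bar> * exp (logd g p q) * exp (- ln (1 + g * q))"
  and "ln (1 + g * p) \<ge> ln (1 + g * q) ==> logd g p q \<le> g * \<bar>p - q\<bar> * exp (- ln (1 + g * q))"
  and "ln (1 + g * p) \<le> ln (1 + g * q) ==> logd g p q \<le> g * \<bar>p - q\<bar> * exp (- ln (1 + g * q)) * (1 + logd g p q)"
proof -
 define X Y where "X = 1 + g * p" and "Y = 1 + g * q"
 have X: "1 \<le> X" "1 \<le> Y" using assms by (auto simp: X_def Y_def)
 have XY: "g * \<bar>p - q\<bar> = \<bar>X - Y\<bar>"   proof -
  have "X - Y = g * (p - q)" by (simp add: X_def Y_def right_diff_distrib)
  then show ?thesis using assms(1) by (simp add: abs_mult)
 qed
 have D: "logd g p q = \<bar>ln X - ln Y\<bar>" by (simp add: logd_def X_def Y_def)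
 have eY: "exp (- ln (1 + g * q)) = 1 / Y" using X by (simp add: Y_def[symmetric] exp_minus inverse_eq_divide)
 have le: "ln X \<le> ln Y \<longleftrightarrow> X \<le> Y" "ln Y \<le> ln X \<longleftrightarrow> Y \<le> X" using X by auto
 have r: "ln (u / v) \<le> (u - v) / v" if "0 < u" "0 < v" for u v :: real
  using ln_le_minus_one[of "u / v"] that by (simp add: diff_divide_distrib)
 have c3: "logd g p q \<le> \<bar>X - Y\<bar> * (1 / Y)" if "Y \<le> X"
  using r[of X Y] that X le by (simp add: D ln_div abs_of_nonneg)
 have ed: "exp (logd g p q) = (if Y \<le> X then X / Y else Y / X)"
  using X le by (auto simp: D exp_diff abs_if not_le)
 \<comment> \<open>With \<open>L = ln (Y / X)\<close> the claim is
   \<open>L \<le> (1 + L) (1 - exp (- L))\<close>, that is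
   \<open>(1 + L) exp (- L) \<le> 1\<close>.\<close>
 have c4: "logd g p q \<le> \<bar>X - Y\<bar> * (1 / Y) * (1 + logd g p q)" if "X \<le> Y"
 proof -
  define L where "L = ln Y - ln X"
  have "X / Y = exp (- L)" using X by (simp add: L_def exp_diff)
  moreover have "1 + L \<le> exp L" by (rule exp_ge_add_one_self)
  ultimately have "(1 + L) * (X / Y) \<le> exp L * exp (- L)" by (simp add: mult_right_mono)
  then have "(1 + L) * (X / Y) \<le> 1" by (simp add: exp_minus)
  moreover have "\<bar>X - Y\<bar> * (1 / Y) * (1 + L) = (1 + L) - (1 + L) * (X / Y)"
   using that X by (simp add: field_simps)
  moreover have "logd g p q = L" using that X le by (simp add: D L_def)
  ultimately show ?thesis by simp
 qed
 show "exp (logd g p q) \<le> 1 + g * \<bar>p - q\<bar>"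
 proof (cases "Y \<le> X")
  case True
  have "X / Y = 1 + (X - Y) / Y" using X by (simp add: field_simps)
  also have "(X - Y) / Y \<le> (X - Y) / 1" using True X by (intro divide_left_mono) auto
  finally show ?thesis using True unfolding ed XY by simp
 next
  case False
  have "Y / X = 1 + (Y - X) / X" using X by (simp add: field_simps)
  also have "(Y - X) / X \<le> (Y - X) / 1" using False X by (intro divide_left_mono) auto
  finally show ?thesis using False unfolding ed XY by simp
 qed
 show "ln (1 + g * p) \<ge> ln (1 + g * q) ==> logd g p q \<le> g * \<bar>p - q\<bar> * exp (- ln (1 + g * q))"
  unfolding XY eY using c3 le by (simp add: X_def Y_def)
 show "ln (1 + g * p) \<le> ln (1 + g * q) ==> logd g p q \<le> g * \<bar>p - q\<bar> * exp (- ln (1 + g * q)) * (1 + logd g p q)"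
  unfolding XY eY using c4 le by (simp add: X_def Y_def)
 have pos: "0 \<le> \<bar>X - Y\<bar> * (1 / Y)" using X by simp
 show "logd g p q \<le> g * \<bar>p - q\<bar> * exp (logd g p q) * exp (- ln (1 + g * q))"
 proof (cases "Y \<le> X")
  case True
  have "\<bar>X - Y\<bar> * (1 / Y) * 1 \<le> \<bar>X - Y\<bar> * (1 / Y) * exp (logd g p q)"
   by (rule mult_left_mono[OF _ pos]) simp
  then show ?thesis using c3[OF True] unfolding XY eY by (simp add: mult_ac)
 next
  case False
  then have "logd g p q \<le> \<bar>X - Y\<bar> * (1 / Y) * (1 + logd g p q)" using c4 by simp
  also have "... \<le> \<bar>X - Y\<bar> * (1 / Y) * exp (logd g p q)"
   by (rule mult_left_mono[OF exp_ge_add_one_self pos])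
  finally show ?thesis unfolding XY eY by (simp add: mult_ac)
 qed
qed

section \<open>Symbol estimates\<close>

text \<open>The Japanese bracket; \<open>jp (t * xi)\<close> is the modulus of
  \<open>1 + i t xi\<close>.\<close>

definition jp :: "real => real" where "jp p = sqrt (1 + p\<^sup>2)"

lemma jp_ge_1: "1 \<le> jp p" by (simp add: jp_def)
lemma jp_pos: "0 < jp p" using jp_ge_1[of p] by linarith
lemma jp_nonneg [simp]: "0 \<le> jp p" using jp_ge_1[of p] by linarith
lemma jp_abs [simp]: "jp \<bar>p\<bar> = jp p" by (simp add: jp_def)

lemma jp_measurable [measurable]: "jp \<in> BM" unfolding jp_def[abs_def] by measurable

lemma jp_le: "jp p \<le> 1 + \<bar>p\<bar>"
 unfolding jp_def by (rule real_le_lsqrt) (auto simp: power2_eq_square algebra_simps)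

lemma le_jp: "1 + \<bar>p\<bar> \<le> 2 * jp p"
proof -
 have "\<bar>p\<bar> \<le> jp p" unfolding jp_def by (rule real_le_rsqrt) simp
 then show ?thesis using jp_ge_1[of p] by linarith
qed

lemma powr_compare:
 fixes X W k al :: real
 assumes "0 < X" "0 < W" "1 \<le> k" "X \<le> k * W" "W \<le> k * X"
 shows "X powr al \<le> k powr \<bar>al\<bar> * W powr al"
proof (cases "0 \<le> al")
 case True
 have "X powr al \<le> (k * W) powr al" using True assms by (intro powr_mono2) auto
 then show ?thesis using True assms by (simp add: powr_mult)
next
 case False
 have "(k * X) powr al \<le> W powr al" using False assms by (intro powr_mono2') auto
 then have "k powr al * X powr al \<le> W powr al" using assms by (simp add: powr_mult)
 then have "k powr \<bar>al\<bar> * (k powr al * X powr al) \<le> k powr \<bar>al\<bar> * W powr al" by (intro mult_left_mono) auto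
 moreover have "k powr \<bar>al\<bar> * k powr al = 1" using False assms by (simp add: powr_add[symmetric])
 ultimately show ?thesis by (simp add: mult.assoc[symmetric])
qed

lemma jp_compare:
 assumes "0 < a" "a \<le> g" "g \<le> b" "0 \<le> p"
 defines "k \<equiv> 2 * (1 + inverse a + b)"
 shows "1 \<le> k" "1 + g * p \<le> k * jp p" "jp p \<le> k * (1 + g * p)"
proof -
 have ab: "0 < inverse a" "0 < b" using assms by auto
 show "1 \<le> k" using ab by (simp add: k_def)
 have "1 + g * p \<le> (1 + b) * (1 + p)"
  using mult_right_mono[OF assms(3,4)] assms(4) ab by (simp add: algebra_simps)
 also have "... \<le> (1 + b) * (2 * jp p)" using le_jp[of p] assms(4) ab by (intro mult_left_mono) auto
 also have "... \<le> k * jp p" using ab jp_nonneg[of p] by (simp add: k_def algebra_simps mult_right_mono)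
 finally show "1 + g * p \<le> k * jp p" .
 have "p \<le> inverse a * (g * p)"
 proof -
  have "p = inverse a * (a * p)" using assms(1) by simp
  also have "... \<le> inverse a * (g * p)" using ab assms by (intro mult_left_mono mult_right_mono) auto
  finally show ?thesis .
 qed
 then have "jp p \<le> 1 + inverse a * (g * p)" using jp_le[of p] assms(4) by simp
 also have "... \<le> (1 + inverse a) * (1 + g * p)" using ab assms by (simp add: algebra_simps)
 also have "... \<le> k * (1 + g * p)" using ab assms by (intro mult_right_mono) (auto simp: k_def)
 finally show "jp p \<le> k * (1 + g * p)" .
qed

lemma
 assumes "0 < a" "a \<le> g" "g \<le> b" "0 \<le> p"
 defines "k \<equiv> 2 * (1 + inverse a + b)"
 shows jp_powr_le: "jp p powr al \<le> k powr \<bar>al\<bar> * (1 + g * p) powr al"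
  and powr_le_jp: "(1 + g * p) powr al \<le> k powr \<bar>al\<bar> * jp p powr al"
proof -
 have X: "0 < 1 + g * p" using assms by (intro one_plus_pos) auto
 note c = jp_compare[OF assms(1-4), folded k_def]
 show "jp p powr al \<le> k powr \<bar>al\<bar> * (1 + g * p) powr al"
  by (rule powr_compare[OF jp_pos X c(1,3,2)])
 show "(1 + g * p) powr al \<le> k powr \<bar>al\<bar> * jp p powr al"
  by (rule powr_compare[OF X jp_pos c(1,2,3)])
qed

lemma abs_exp_minus_1_le: "\<bar>exp u - 1\<bar> \<le> \<bar>u\<bar> * exp \<bar>u\<bar>" for u :: real
proof (cases "0 \<le> u")
 case True
 have "1 - u \<le> exp (- u)" using exp_ge_add_one_self[of "- u"] by simp
 then have "(1 - u) * exp u \<le> exp (- u) * exp u" by (intro mult_right_mono) auto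
 then have "exp u - 1 \<le> u * exp u" by (simp add: exp_minus algebra_simps)
 then show ?thesis using True by simp
next
 case False
 have "exp u < 1" using False by simp
 then have "\<bar>exp u - 1\<bar> \<le> \<bar>u\<bar> * 1" using False exp_ge_add_one_self[of u] by linarith
 also have "... \<le> \<bar>u\<bar> * exp \<bar>u\<bar>" by (intro mult_left_mono) auto
 finally show ?thesis .
qed

lemma sy_minus_1_le:
 assumes "0 < g" "0 \<le> p" "0 \<le> q"
 shows "\<bar>sy 0 g p q - 1\<bar> \<le> \<bar>p - q\<bar> * exp ((1 + 1 / g) * logd g p q - ln (1 + g * q))"
  and "\<bar>sy 0 g q p - 1\<bar> \<le> \<bar>p - q\<bar> * exp ((1 + 1 / g) * logd g p q - ln (1 + g * q))"
proof -
 define D where "D = logd g p q"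
 have *: "\<bar>exp u - 1\<bar> \<le> \<bar>p - q\<bar> * exp ((1 + 1 / g) * D - ln (1 + g * q))" if "\<bar>u\<bar> = D / g" for u
 proof -
  have "\<bar>exp u - 1\<bar> \<le> (D / g) * exp (D / g)" using abs_exp_minus_1_le[of u] that by simp
  also have "... \<le> ((g * \<bar>p - q\<bar> * exp D * exp (- ln (1 + g * q))) / g) * exp (D / g)"
   using logd_le(2)[OF assms] assms by (intro mult_right_mono divide_right_mono) (auto simp: D_def)
  also have "... = \<bar>p - q\<bar> * (exp D * exp (- ln (1 + g * q)) * exp (D / g))" using assms by simp
  also have "exp D * exp (- ln (1 + g * q)) * exp (D / g) = exp ((1 + 1 / g) * D - ln (1 + g * q))"
   unfolding exp_add[symmetric] by (simp add: algebra_simps)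
  finally show ?thesis .
 qed
 show "\<bar>sy 0 g p q - 1\<bar> \<le> \<bar>p - q\<bar> * exp ((1 + 1 / g) * logd g p q - ln (1 + g * q))"
  unfolding sy_0_eq[OF assms(1)] D_def[symmetric]
  by (rule *) (use assms in \<open>simp add: D_def logd_def abs_divide\<close>)
 show "\<bar>sy 0 g q p - 1\<bar> \<le> \<bar>p - q\<bar> * exp ((1 + 1 / g) * logd g p q - ln (1 + g * q))"
  unfolding sy_0_eq[OF assms(1)] D_def[symmetric]
  by (rule *) (use assms in \<open>simp add: D_def logd_def abs_divide abs_minus_commute\<close>)
qed

lemma exp_logd_le:
 assumes "0 < g" "g \<le> b" "0 \<le> p" "0 \<le> q" "c \<le> real N"
 shows "exp (c * logd g p q) \<le> (1 + b) ^ N * (1 + \<bar>p - q\<bar>) ^ N"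
proof -
 have "exp (c * logd g p q) \<le> exp (real N * logd g p q)" using assms(5) by (simp add: mult_right_mono)
 also have "... = exp (logd g p q) ^ N" by (rule exp_of_nat_mult)
 also have "... \<le> ((1 + b) * (1 + \<bar>p - q\<bar>)) ^ N"
 proof (rule power_mono)
  have "g * \<bar>p - q\<bar> \<le> b * \<bar>p - q\<bar>" using assms by (intro mult_right_mono) auto
  then have "1 + g * \<bar>p - q\<bar> \<le> (1 + b) * (1 + \<bar>p - q\<bar>)" using assms by (simp add: algebra_simps)
  then show "exp (logd g p q) \<le> (1 + b) * (1 + \<bar>p - q\<bar>)" using logd_le(1)[OF assms(1,3,4)] by linarith
 qed simp
 finally show ?thesis by (simp add: power_mult_distrib)
qed

text \<open>\<open>{a..b}\<close> will hold the values of \<open>V\<close> on the interval,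
  \<open>m\<close> is \<open>- s_minus\<close>, \<open>sp\<close> is \<open>s_plus\<close>, and
  \<open>- m1\<close> is the order of the source space. \<open>dl\<close> is the common slack: it
  separates \<open>1/a\<close> from \<open>m\<close> and \<open>-1/b\<close> from \<open>sp\<close>,
  and in the condition on \<open>m1\<close> it is what remains of \<open>1/c1 - 1/c2 \<le> 1\<close>
  once \<open>b\<close> is strictly less than \<open>c2\<close>.\<close>

locale symbol_bounds =
 fixes a b m m1 sp dl :: real
 assumes a: "0 < a" and ab: "a \<le> b" and dl: "0 < dl" and m: "1 / a + dl \<le> m"
  and m1: "0 \<le> m1" "m1 + dl \<le> 1 + 1 / b" and sp: "dl - 1 / b \<le> sp"
begin

lemma gb:
 assumes "g \<in> {a..b}"
 shows "0 < g" "a \<le> g" "1 / g + dl \<le> m" "m1 + dl \<le> 1 + 1 / g" "dl - 1 / g \<le> sp" "1 / g \<le> 1 / a" "0 \<le> 1 / g"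
proof -
 show g: "0 < g" "a \<le> g" using assms a by auto
 have "1 / g \<le> 1 / a" "1 / b \<le> 1 / g" using assms a g by (auto intro!: divide_left_mono)
 then show "1 / g + dl \<le> m" "m1 + dl \<le> 1 + 1 / g" "dl - 1 / g \<le> sp" "1 / g \<le> 1 / a" using m m1 sp by auto
 show "0 \<le> 1 / g" using g by simp
qed

text \<open>In logarithmic variables \<open>x = ln (1 + g p)\<close>, \<open>y = ln (1 + g q)\<close> all bounds reduce to the
 sign of linear exponents.\<close>

lemma S1:
 "\<exists>C\<ge>0. \<forall>g\<in>{a..b}. \<forall>p\<ge>0. \<forall>q\<ge>0. \<forall>j\<ge>1. \<bar>sy j g p q\<bar> * jp p powr (- m) * jp q powr m1 \<le> C * \<bar>p - q\<bar>"
proof -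
 obtain C0 :: real where C0: "0 < C0" "\<And>D. 0 \<le> D ==> (1 + D) * (1 + D ^ 2) \<le> C0 * exp (dl * D)"
  using cubic_le_exp[OF dl] by blast
 define K where "K = 6 * (1 + inverse a) ^ 4"
 have K: "0 \<le> K" using a by (simp add: K_def)
 define k where "k = 2 * (1 + inverse a + b)"
 have k0: "0 \<le> k" using a ab by (simp add: k_def)
 define C where "C = k powr \<bar>- m\<bar> * k powr \<bar>m1\<bar> * (4 * K ^ 3 * C0 * b)"
 have "\<bar>sy j g p q\<bar> * jp p powr (- m) * jp q powr m1 \<le> C * \<bar>p - q\<bar>"
  if g: "g \<in> {a..b}" and p: "0 \<le> p" and q: "0 \<le> q" and j: "1 \<le> j" for g p q :: real and j
 proof -
  note gg = gb[OF g]
  define x y where "x = ln (1 + g * p)" and "y = ln (1 + g * q)"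
  have X: "1 \<le> 1 + g * p" "1 \<le> 1 + g * q" using gg p q by auto
  have xy: "0 \<le> x" "0 \<le> y" using X by (auto simp: x_def y_def)
  have gb: "g \<le> b" using g by simp
  have jX: "jp p powr (- m) \<le> k powr \<bar>- m\<bar> * (1 + g * p) powr (- m)"
   unfolding k_def by (rule jp_powr_le[OF a gg(2) gb p])
  have jY: "jp q powr m1 \<le> k powr \<bar>m1\<bar> * (1 + g * q) powr m1"
   unfolding k_def by (rule jp_powr_le[OF a gg(2) gb q])
  have pX: "(1 + g * p) powr (- m) = exp (- m * x)" "(1 + g * q) powr m1 = exp (m1 * y)"
   using X by (auto simp: powr_def x_def y_def)
  define D where "D = logd g p q"
  have D: "0 \<le> D" "D = \<bar>x - y\<bar>" by (auto simp: D_def logd_def x_def y_def)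
  have s0: "sy 0 g p q = exp ((x - y) / g)" unfolding x_def y_def by (rule sy_0_eq[OF gg(1)])
  have main: "D * (1 + D ^ 2) * exp ((x - y) / g) * exp (- m * x) * exp (m1 * y) \<le> C0 * (g * \<bar>p - q\<bar>)"
  proof (cases "y \<le> x")
   case True
   have "D * (1 + D ^ 2) \<le> g * \<bar>p - q\<bar> * exp (- y) * (1 + D ^ 2)"
    using logd_le(3)[OF gg(1) p q] True by (intro mult_right_mono) (auto simp: x_def y_def D_def)
   also have "... \<le> g * \<bar>p - q\<bar> * exp (- y) * (C0 * exp (dl * D))"
   proof (rule mult_left_mono)
    have "1 * (1 + D ^ 2) \<le> (1 + D) * (1 + D ^ 2)" using D(1) by (intro mult_right_mono) auto
    from order_trans[OF this C0(2)[OF D(1)]] show "1 + D ^ 2 \<le> C0 * exp (dl * D)" by simp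
   qed (use gg in auto)
   finally have "D * (1 + D ^ 2) * exp ((x - y) / g) * exp (- m * x) * exp (m1 * y)
    \<le> g * \<bar>p - q\<bar> * exp (- y) * (C0 * exp (dl * D)) * exp ((x - y) / g) * exp (- m * x) * exp (m1 * y)"
    by (intro mult_right_mono) auto
   also have "... = C0 * (g * \<bar>p - q\<bar>) * exp (- y + dl * D + (x - y) / g + - m * x + m1 * y)"
    by (simp only: exp_add mult_ac)
   also have "- y + dl * D + (x - y) / g + - m * x + m1 * y = x * (1 / g + dl - m) + y * (m1 - dl - 1 / g - 1)"
   proof -
    have D': "D = x - y" using True D by simp
    show ?thesis unfolding D' by (simp add: algebra_simps diff_divide_distrib)
   qed
   also have "exp ... \<le> 1" using xy gg dl by (simp add: mult_nonneg_nonpos add_nonpos_nonpos)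
   finally show ?thesis using C0 gg by (simp add: mult_left_mono)
  next
   case False
   have "D * (1 + D ^ 2) \<le> g * \<bar>p - q\<bar> * exp (- y) * (1 + D) * (1 + D ^ 2)"
    using logd_le(4)[OF gg(1) p q] False by (intro mult_right_mono) (auto simp: x_def y_def D_def)
   also have "... = g * \<bar>p - q\<bar> * exp (- y) * ((1 + D) * (1 + D ^ 2))" by (simp add: mult.assoc)
   also have "... \<le> g * \<bar>p - q\<bar> * exp (- y) * (C0 * exp (dl * D))"
    by (rule mult_left_mono[OF C0(2)[OF D(1)]]) (use gg in auto)
   finally have "D * (1 + D ^ 2) * exp ((x - y) / g) * exp (- m * x) * exp (m1 * y)
    \<le> g * \<bar>p - q\<bar> * exp (- y) * (C0 * exp (dl * D)) * exp ((x - y) / g) * exp (- m * x) * exp (m1 * y)"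
    by (intro mult_right_mono) auto
   also have "... = C0 * (g * \<bar>p - q\<bar>) * exp (- y + dl * D + (x - y) / g + - m * x + m1 * y)"
    by (simp only: exp_add mult_ac)
   also have "- y + dl * D + (x - y) / g + - m * x + m1 * y = x * (1 / g - dl - m) + y * (m1 + dl - 1 / g - 1)"
   proof -
    have D': "D = y - x" using False D by simp
    show ?thesis unfolding D' by (simp add: algebra_simps diff_divide_distrib)
   qed
   also have "exp ... \<le> 1" using xy gg dl by (simp add: mult_nonneg_nonpos add_nonpos_nonpos)
   finally show ?thesis using C0 gg by (simp add: mult_left_mono)
  qed
  have "\<bar>sy j g p q\<bar> * jp p powr (- m) * jp q powr m1
   \<le> (4 * K ^ 3 * (D * (1 + D ^ 2)) * exp ((x - y) / g)) * (k powr \<bar>- m\<bar> * exp (- m * x)) * (k powr \<bar>m1\<bar> * exp (m1 * y))"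
   using sy_le(1)[OF a gg(2) p q j] jX jY unfolding s0 pX K_def[symmetric] D_def[symmetric]
   by (intro mult_mono) (auto simp: K D)
  also have "... = k powr \<bar>- m\<bar> * k powr \<bar>m1\<bar> * (4 * K ^ 3) * (D * (1 + D ^ 2) * exp ((x - y) / g) * exp (- m * x) * exp (m1 * y))"
   by (simp only: mult_ac)
  also have "... \<le> k powr \<bar>- m\<bar> * k powr \<bar>m1\<bar> * (4 * K ^ 3) * (C0 * (b * \<bar>p - q\<bar>))"
  proof (rule mult_left_mono)
   have "C0 * (g * \<bar>p - q\<bar>) \<le> C0 * (b * \<bar>p - q\<bar>)" using C0 gb by (intro mult_left_mono mult_right_mono) auto
   then show "D * (1 + D ^ 2) * exp ((x - y) / g) * exp (- m * x) * exp (m1 * y) \<le> C0 * (b * \<bar>p - q\<bar>)"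
    using main by linarith
  qed (use K in auto)
  also have "... = C * \<bar>p - q\<bar>" by (simp add: C_def)
  finally show ?thesis .
 qed
 moreover have "0 \<le> C" using C0 K a ab by (simp add: C_def)
 ultimately show ?thesis by blast
qed

definition k where "k = 2 * (1 + inverse a + b)"

text \<open>The undifferentiated ratio may lose powers of \<open>1 + |p - q|\<close>, because in
  \<open>Kf_compare\<close> it multiplies the transform of a Schwartz function. The bound of
  \<open>sy_minus_1_le\<close> is therefore enough, its exponential in the distance being turned
  into a power by \<open>exp_logd_le\<close>.\<close>

lemma S2:
 "\<exists>C\<ge>0. \<exists>N. \<forall>g\<in>{a..b}. \<forall>p\<ge>0. \<forall>q\<ge>0.
  \<bar>sy 0 g p q - 1\<bar> * jp p powr (- m) * jp q powr m1 \<le> C * (\<bar>p - q\<bar> * (1 + \<bar>p - q\<bar>) ^ N)"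
proof -
 \<comment> \<open>\<open>N\<close> bounds the coefficient of the distance in the exponent:
   \<open>1 + 1/g\<close> from the difference and \<open>m\<close> from moving the weight from
   \<open>p\<close> to \<open>q\<close>.\<close>
 define N where "N = nat \<lceil>1 + 1 / a + m\<rceil>"
 have N: "1 + 1 / a + m \<le> real N" unfolding N_def by (rule real_nat_ceiling_ge)
 define C where "C = k powr \<bar>- m\<bar> * k powr \<bar>m1\<bar> * (1 + b) ^ N"
 have "\<bar>sy 0 g p q - 1\<bar> * jp p powr (- m) * jp q powr m1 \<le> C * (\<bar>p - q\<bar> * (1 + \<bar>p - q\<bar>) ^ N)"
  if g: "g \<in> {a..b}" and p: "0 \<le> p" and q: "0 \<le> q" for g p q :: real
 proof -
  note gg = gb[OF g]
  have gb: "g \<le> b" using g by simp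
  define x y D where "x = ln (1 + g * p)" and "y = ln (1 + g * q)" and "D = logd g p q"
  have X: "1 \<le> 1 + g * p" "1 \<le> 1 + g * q" using gg p q by auto
  have xy: "0 \<le> x" "0 \<le> y" using X by (auto simp: x_def y_def)
  have jX: "jp p powr (- m) \<le> k powr \<bar>- m\<bar> * exp (- m * x)"
   using jp_powr_le[OF a gg(2) gb p, of "- m"] X unfolding k_def by (simp add: powr_def x_def)
  have jY: "jp q powr m1 \<le> k powr \<bar>m1\<bar> * exp (m1 * y)"
   using jp_powr_le[OF a gg(2) gb q, of m1] X unfolding k_def by (simp add: powr_def y_def)
  have D: "0 \<le> D" "D = \<bar>x - y\<bar>" by (auto simp: D_def logd_def x_def y_def)
  have m0: "0 \<le> m" using gg dl by linarith
  have "\<bar>sy 0 g p q - 1\<bar> * jp p powr (- m) * jp q powr m1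
   \<le> (\<bar>p - q\<bar> * exp ((1 + 1 / g) * D - y)) * (k powr \<bar>- m\<bar> * exp (- m * x)) * (k powr \<bar>m1\<bar> * exp (m1 * y))"
   using sy_minus_1_le(1)[OF gg(1) p q] jX jY unfolding D_def[symmetric] y_def[symmetric]
   by (intro mult_mono) auto
  also have "... = k powr \<bar>- m\<bar> * k powr \<bar>m1\<bar> * \<bar>p - q\<bar> * (exp ((1 + 1 / g) * D - y) * exp (- m * x) * exp (m1 * y))"
   by (simp only: mult_ac)
  also have "... \<le> k powr \<bar>- m\<bar> * k powr \<bar>m1\<bar> * \<bar>p - q\<bar> * ((1 + b) ^ N * (1 + \<bar>p - q\<bar>) ^ N)"
  proof (rule mult_left_mono)
   have "(1 + 1 / g) * D - y + - m * x + m1 * y \<le> (1 + 1 / g + m) * D"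
   proof -
    have "m * y \<le> m * (x + D)" using D m0 by (intro mult_left_mono) auto
    moreover have "(m1 - 1 - m) * y \<le> 0" using gg dl xy by (intro mult_nonpos_nonneg) auto
    ultimately show ?thesis by (simp add: algebra_simps)
   qed
   then have "exp ((1 + 1 / g) * D - y + - m * x + m1 * y) \<le> exp ((1 + 1 / g + m) * D)" by simp
   also have "... \<le> (1 + b) ^ N * (1 + \<bar>p - q\<bar>) ^ N"
    unfolding D_def by (rule exp_logd_le[OF gg(1) gb p q]) (use gg N in linarith)
   finally show "exp ((1 + 1 / g) * D - y) * exp (- m * x) * exp (m1 * y) \<le> (1 + b) ^ N * (1 + \<bar>p - q\<bar>) ^ N"
    by (simp only: exp_add)
  qed simp
  also have "... = C * (\<bar>p - q\<bar> * (1 + \<bar>p - q\<bar>) ^ N)" by (simp add: C_def)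
  finally show ?thesis .
 qed
 moreover have "0 \<le> C" using a ab by (simp add: C_def)
 ultimately show ?thesis by blast
qed

text \<open>Keeps exponents that depend on \<open>g\<close>: \<open>S4\<close> uses the decay
  \<open>-1/g\<close> itself, while \<open>S3\<close> passes to the uniform orders \<open>sp\<close>
  and \<open>m\<close>.\<close>

lemma S3':
 obtains C where "0 \<le> C"
  "\<And>g p j. g \<in> {a..b} ==> 0 \<le> p ==> \<bar>sy j g 0 p\<bar> \<le> C * exp ((dl - 1 / g) * ln (1 + g * p))"
  "\<And>g p j. g \<in> {a..b} ==> 0 \<le> p ==> \<bar>sy j g p 0\<bar> \<le> C * exp ((dl + 1 / g) * ln (1 + g * p))"
proof -
 obtain C0 :: real where C0: "0 < C0" "\<And>D. 0 \<le> D ==> (1 + D) * (1 + D ^ 2) \<le> C0 * exp (dl * D)"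
  using cubic_le_exp[OF dl] by blast
 define K where "K = 6 * (1 + inverse a) ^ 4"
 have K: "0 \<le> K" using a by (simp add: K_def)
 have "\<bar>sy j g 0 p\<bar> \<le> (4 * K ^ 3 * C0) * exp ((dl - 1 / g) * ln (1 + g * p))"
  "\<bar>sy j g p 0\<bar> \<le> (4 * K ^ 3 * C0) * exp ((dl + 1 / g) * ln (1 + g * p))"
  if g: "g \<in> {a..b}" and p: "0 \<le> p" for g p j
 proof -
  note gg = gb[OF g]
  define x where "x = ln (1 + g * p)"
  have x: "0 \<le> x" using gg p by (simp add: x_def)
  have D: "logd g 0 p = x" "logd g p 0 = x" using x by (auto simp: logd_def x_def)
  have h: "4 * K ^ 3 * ((1 + x) * (1 + x ^ 2)) \<le> 4 * K ^ 3 * (C0 * exp (dl * x))"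
   by (rule mult_left_mono[OF C0(2)[OF x]]) (use K in simp)
  have "\<bar>sy j g 0 p\<bar> \<le> 4 * K ^ 3 * ((1 + x) * (1 + x ^ 2)) * sy 0 g 0 p"
   using sy_le(2)[OF a gg(2) order_refl p, of j] unfolding D K_def .
  also have "... \<le> 4 * K ^ 3 * (C0 * exp (dl * x)) * sy 0 g 0 p"
   by (rule mult_right_mono[OF h less_imp_le[OF sy_pos]])
  also have "sy 0 g 0 p = exp (- (x / g))" by (simp add: sy_0_eq[OF gg(1)] x_def)
  also have "4 * K ^ 3 * (C0 * exp (dl * x)) * exp (- (x / g)) = (4 * K ^ 3 * C0) * exp ((dl - 1 / g) * x)"
   by (simp add: exp_add[symmetric] left_diff_distrib mult.assoc)
  finally show "\<bar>sy j g 0 p\<bar> \<le> (4 * K ^ 3 * C0) * exp ((dl - 1 / g) * ln (1 + g * p))" unfolding x_def .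
  have "\<bar>sy j g p 0\<bar> \<le> 4 * K ^ 3 * ((1 + x) * (1 + x ^ 2)) * sy 0 g p 0"
   using sy_le(2)[OF a gg(2) p order_refl, of j] unfolding D K_def .
  also have "... \<le> 4 * K ^ 3 * (C0 * exp (dl * x)) * sy 0 g p 0"
   by (rule mult_right_mono[OF h less_imp_le[OF sy_pos]])
  also have "sy 0 g p 0 = exp (x / g)" by (simp add: sy_0_eq[OF gg(1)] x_def)
  also have "4 * K ^ 3 * (C0 * exp (dl * x)) * exp (x / g) = (4 * K ^ 3 * C0) * exp ((dl + 1 / g) * x)"
   by (simp add: exp_add[symmetric] distrib_right mult.assoc)
  finally show "\<bar>sy j g p 0\<bar> \<le> (4 * K ^ 3 * C0) * exp ((dl + 1 / g) * ln (1 + g * p))" unfolding x_def .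
 qed
 moreover have "0 \<le> 4 * K ^ 3 * C0" using K C0 by simp
 ultimately show ?thesis using that by blast
qed

lemma S3:
 "\<exists>C\<ge>0. \<forall>g\<in>{a..b}. \<forall>p\<ge>0. \<forall>j. \<bar>sy j g 0 p\<bar> \<le> C * jp p powr sp \<and> \<bar>sy j g p 0\<bar> \<le> C * jp p powr m"
proof -
 obtain C where C: "0 \<le> C"
  "\<And>g p j. g \<in> {a..b} ==> 0 \<le> p ==> \<bar>sy j g 0 p\<bar> \<le> C * exp ((dl - 1 / g) * ln (1 + g * p))"
  "\<And>g p j. g \<in> {a..b} ==> 0 \<le> p ==> \<bar>sy j g p 0\<bar> \<le> C * exp ((dl + 1 / g) * ln (1 + g * p))"
  using S3' by blast
 define C' where "C' = C * (k powr \<bar>sp\<bar> + k powr \<bar>m\<bar>)"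
 have "\<bar>sy j g 0 p\<bar> \<le> C' * jp p powr sp \<and> \<bar>sy j g p 0\<bar> \<le> C' * jp p powr m"
  if g: "g \<in> {a..b}" and p: "0 \<le> p" for g p j
 proof
  note gg = gb[OF g]
  have gb: "g \<le> b" using g by simp
  have X: "1 \<le> 1 + g * p" using gg p by auto
  then have x: "0 \<le> ln (1 + g * p)" by simp
  have e: "exp (al * ln (1 + g * p)) \<le> (k powr \<bar>sp\<bar> + k powr \<bar>m\<bar>) * jp p powr bt"
   if "al \<le> bt" "bt = sp \<or> bt = m" for al bt
  proof -
   have "exp (al * ln (1 + g * p)) \<le> exp (bt * ln (1 + g * p))" using that(1) x by (simp add: mult_right_mono)
   also have "... = (1 + g * p) powr bt" using X by (simp add: powr_def)
   also have "... \<le> k powr \<bar>bt\<bar> * jp p powr bt" unfolding k_def by (rule powr_le_jp[OF a gg(2) gb p])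
   also have "... \<le> (k powr \<bar>sp\<bar> + k powr \<bar>m\<bar>) * jp p powr bt" using that(2) by (intro mult_right_mono) auto
   finally show ?thesis .
  qed
  have "\<bar>sy j g 0 p\<bar> \<le> C * ((k powr \<bar>sp\<bar> + k powr \<bar>m\<bar>) * jp p powr sp)"
   by (rule order_trans[OF C(2)[OF g p] mult_left_mono[OF e C(1)]]) (use gg in auto)
  then show "\<bar>sy j g 0 p\<bar> \<le> C' * jp p powr sp" by (simp add: C'_def mult.assoc)
  have "\<bar>sy j g p 0\<bar> \<le> C * ((k powr \<bar>sp\<bar> + k powr \<bar>m\<bar>) * jp p powr m)"
   by (rule order_trans[OF C(3)[OF g p] mult_left_mono[OF e C(1)]]) (use gg in auto)
  then show "\<bar>sy j g p 0\<bar> \<le> C' * jp p powr m" by (simp add: C'_def mult.assoc)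
 qed
 moreover have "0 \<le> C'" using C by (simp add: C'_def)
 ultimately show ?thesis by blast
qed

text \<open>A difference of symbols factors as the symbol at \<open>q\<close> times one minus a
  ratio. The ratio yields \<open>|p - q| / (1 + g q)\<close>, the symbol the exponent
  \<open>dl - 1/g\<close>, and together they beat the weight \<open>m1\<close>. Derivatives up to
  order one suffice, since this bound enters through Taylor's formula of depth one.\<close>

lemma S4:
 "\<exists>C\<ge>0. \<exists>N. \<forall>g\<in>{a..b}. \<forall>p\<ge>0. \<forall>q\<ge>0. \<forall>j\<le>1.
  \<bar>sy j g 0 q - sy j g 0 p\<bar> * jp q powr m1 \<le> C * (\<bar>p - q\<bar> * (1 + \<bar>p - q\<bar>) ^ N)"
proof -
 obtain C where C: "0 \<le> C"
  "\<And>g p j. g \<in> {a..b} ==> 0 \<le> p ==> \<bar>sy j g 0 p\<bar> \<le> C * exp ((dl - 1 / g) * ln (1 + g * p))"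
  "\<And>g p j. g \<in> {a..b} ==> 0 \<le> p ==> \<bar>sy j g p 0\<bar> \<le> C * exp ((dl + 1 / g) * ln (1 + g * p))"
  using S3' by blast
 define K where "K = 6 * (1 + inverse a) ^ 4"
 have K: "0 \<le> K" using a by (simp add: K_def)
 define N where "N = nat \<lceil>1 + 1 / a\<rceil>"
 have N: "1 + 1 / a \<le> real N" unfolding N_def by (rule real_nat_ceiling_ge)
 define C' where "C' = C * (1 + K * b) * k powr \<bar>m1\<bar> * (1 + b) ^ N"
 have "\<bar>sy j g 0 q - sy j g 0 p\<bar> * jp q powr m1 \<le> C' * (\<bar>p - q\<bar> * (1 + \<bar>p - q\<bar>) ^ N)"
  if g: "g \<in> {a..b}" and p: "0 \<le> p" and q: "0 \<le> q" and j: "j \<le> 1" for g p q :: real and j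
 proof -
  note gg = gb[OF g]
  have gb: "g \<le> b" using g by simp
  define y D where "y = ln (1 + g * q)" and "D = logd g p q"
  have Y: "1 \<le> 1 + g * q" using gg q by auto
  then have y: "0 \<le> y" by (simp add: y_def)
  define E where "E = exp ((1 + 1 / g) * D - y)"
  define F where "F = C * exp ((dl - 1 / g) * y)"
  have D: "0 \<le> D" by (simp add: D_def)
  have F: "0 \<le> F" "\<bar>sy i g 0 q\<bar> \<le> F" for i using C q g by (auto simp: F_def y_def)
  have jY: "jp q powr m1 \<le> k powr \<bar>m1\<bar> * exp (m1 * y)"
   using jp_powr_le[OF a gg(2) gb q, of m1] Y unfolding k_def by (simp add: powr_def y_def)
  have s0: "\<bar>1 - sy 0 g q p\<bar> \<le> \<bar>p - q\<bar> * E"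
   using sy_minus_1_le(2)[OF gg(1) p q] unfolding E_def D_def y_def by (simp add: abs_minus_commute)
  have s1: "\<bar>sy 1 g q p\<bar> \<le> K * b * (\<bar>p - q\<bar> * E)"
  proof -
   have "\<bar>l1 g q - l1 g p\<bar> \<le> K * D"
    using l_diff_le(2)[OF a gg(2) p q] unfolding K_def D_def by (simp add: abs_minus_commute)
   moreover have "sy 0 g q p \<le> exp (D / g)"
    unfolding sy_0_eq[OF gg(1)] D_def logd_def using gg by (auto intro!: divide_right_mono)
   moreover have "\<bar>sy 1 g q p\<bar> = sy 0 g q p * \<bar>l1 g q - l1 g p\<bar>" by (simp add: sy_def abs_mult)
   ultimately have "\<bar>sy 1 g q p\<bar> \<le> exp (D / g) * (K * D)" using sy_pos[of g q p] by (auto intro!: mult_mono)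
   also have "... \<le> exp (D / g) * (K * (g * \<bar>p - q\<bar> * exp D * exp (- y)))"
    using logd_le(2)[OF gg(1) p q] K unfolding D_def[symmetric] y_def[symmetric] by (intro mult_left_mono) auto
   also have "... = K * g * (\<bar>p - q\<bar> * (exp (D / g) * exp D * exp (- y)))" by (simp only: mult_ac)
   also have "exp (D / g) * exp D * exp (- y) = E"
    unfolding exp_add[symmetric] E_def by (simp add: algebra_simps)
   also have "K * g * (\<bar>p - q\<bar> * E) \<le> K * b * (\<bar>p - q\<bar> * E)"
    using K gb by (intro mult_right_mono mult_left_mono) (auto simp: E_def)
   finally show ?thesis .
  qed
  have d0: "sy 0 g 0 q - sy 0 g 0 p = sy 0 g 0 q * (1 - sy 0 g q p)"
   by (simp add: sy_def right_diff_distrib exp_add[symmetric])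
  \<comment> \<open>The product rule in \<open>g\<close> for
    \<open>sy 0 g 0 p = sy 0 g 0 q * sy 0 g q p\<close>.\<close>
  have d1: "sy 1 g 0 q - sy 1 g 0 p = sy 1 g 0 q * (1 - sy 0 g q p) - sy 0 g 0 q * sy 1 g q p"
  proof -
   have e: "exp (l0 g 0 - l0 g q) * exp (l0 g q - l0 g p) = exp (l0 g 0 - l0 g p)"
    by (simp add: exp_add[symmetric])
   show ?thesis unfolding sy_def e[symmetric] by (simp add: algebra_simps)
  qed
  have diff: "\<bar>sy j g 0 q - sy j g 0 p\<bar> \<le> F * (1 + K * b) * (\<bar>p - q\<bar> * E)"
  proof -
   have P: "0 \<le> \<bar>p - q\<bar> * E" by (simp add: E_def)
   have KB: "0 \<le> K * b" using K a ab by simp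
   have t1: "\<bar>sy i g 0 q * (1 - sy 0 g q p)\<bar> \<le> F * (\<bar>p - q\<bar> * E)" for i
    unfolding abs_mult by (intro mult_mono F s0) auto
   have t2: "\<bar>sy 0 g 0 q * sy 1 g q p\<bar> \<le> F * (K * b * (\<bar>p - q\<bar> * E))"
    unfolding abs_mult by (intro mult_mono F s1) auto
   have t3: "0 \<le> F * (K * b * (\<bar>p - q\<bar> * E))" using F(1) KB P by simp
   have "F * (1 + K * b) * (\<bar>p - q\<bar> * E) = F * (\<bar>p - q\<bar> * E) + F * (K * b * (\<bar>p - q\<bar> * E))"
    by (simp add: algebra_simps)
   moreover have "j = 0 \<or> j = 1" using j by auto
   ultimately show ?thesis using t1[of 0] t1[of 1] t2 t3 d0 d1
     abs_triangle_ineq4[of "sy 1 g 0 q * (1 - sy 0 g q p)" "sy 0 g 0 q * sy 1 g q p"] by (elim disjE) simp_all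
  qed
  have "\<bar>sy j g 0 q - sy j g 0 p\<bar> * jp q powr m1 \<le> (F * (1 + K * b) * (\<bar>p - q\<bar> * E)) * (k powr \<bar>m1\<bar> * exp (m1 * y))"
   using diff jY by (intro mult_mono) auto
  also have "... = C * (1 + K * b) * k powr \<bar>m1\<bar> * \<bar>p - q\<bar> * (exp ((dl - 1 / g) * y) * E * exp (m1 * y))"
   by (simp only: F_def mult_ac)
  also have "... \<le> C * (1 + K * b) * k powr \<bar>m1\<bar> * \<bar>p - q\<bar> * ((1 + b) ^ N * (1 + \<bar>p - q\<bar>) ^ N)"
  proof (rule mult_left_mono)
   have "(dl - 1 / g) * y + ((1 + 1 / g) * D - y) + m1 * y \<le> (1 + 1 / g) * D"
   proof -
    have "(dl - 1 / g - 1 + m1) * y \<le> 0" using gg y by (intro mult_nonpos_nonneg) auto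
    then show ?thesis by (simp add: algebra_simps)
   qed
   then have "exp ((dl - 1 / g) * y + ((1 + 1 / g) * D - y) + m1 * y) \<le> exp ((1 + 1 / g) * D)" by simp
   also have "... \<le> (1 + b) ^ N * (1 + \<bar>p - q\<bar>) ^ N"
    unfolding D_def by (rule exp_logd_le[OF gg(1) gb p q]) (use gg N in linarith)
   finally show "exp ((dl - 1 / g) * y) * E * exp (m1 * y) \<le> (1 + b) ^ N * (1 + \<bar>p - q\<bar>) ^ N"
    by (simp only: exp_add E_def)
  qed (use C K a ab in auto)
  also have "... = C' * (\<bar>p - q\<bar> * (1 + \<bar>p - q\<bar>) ^ N)" by (simp add: C'_def)
  finally show ?thesis .
 qed
 moreover have "0 \<le> C'" using C K a ab by (simp add: C'_def)
 ultimately show ?thesis by blast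
qed

end

section \<open>Functions of limited regularity\<close>

text \<open>Peano's kernel of Taylor's formula; for \<open>p = 1\<close> it is the indicator of
  \<open>s \<le> v\<close>.\<close>

definition tk :: "nat => real => real => real" where
 "tk p s v = (if s \<le> v then (v - s) ^ (p - 1) / fact (p - 1) else 0)"

lemma tk_measurable [measurable]: "(\<lambda>(s, v). tk p s v) \<in> BM2" unfolding tk_def by measurable

lemma tk_bound:
 assumes "s \<in> {a..b}" "v \<in> {a..b}"
 shows "0 \<le> tk p s v" "tk p s v \<le> (b - a) ^ (p - 1)"
proof -
 show "0 \<le> tk p s v" by (simp add: tk_def)
 have "(v - s) ^ (p - 1) / fact (p - 1) \<le> (b - a) ^ (p - 1) / 1" if "s \<le> v"
  using that assms by (intro frac_le power_mono) (auto simp: fact_ge_1)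
 then show "tk p s v \<le> (b - a) ^ (p - 1)" using assms by (auto simp: tk_def)
qed

text \<open>Truncating the power extends the remainder integral from \<open>{a..v}\<close> to the
  fixed interval \<open>{a..b}\<close>. The variable \<open>v\<close>, later \<open>V x\<close>,
  then occurs only in the kernel and is separated from the derivative \<open>D p s\<close>.\<close>

lemma taylor_kernel:
 fixes D :: "nat => real => real"
 assumes v: "v \<in> {a..b}" and p: "0 < p"
  and D: "\<And>i g. i < p ==> g \<in> {a..b} ==> (D i has_real_derivative D (Suc i) g) (at g)"
  and cont: "continuous_on {a..b} (D p)"
 shows "D 0 v = (\<Sum>i<p. D i a * ((v - a) ^ i / fact i)) + (LINT s:{a..b}|lborel. D p s * tk p s v)"
proof -
 have av: "a \<le> v" "v \<le> b" using v by auto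
 have "((\<lambda>x. ((v - x) ^ (p - 1) / fact (p - 1)) *\<^sub>R D p x) has_integral D 0 v - (\<Sum>i<p. ((v - a) ^ i / fact i) *\<^sub>R D i a)) {a..v}"
 proof (rule Taylor_has_integral[OF p refl _ av(1)])
  fix i t assume it: "i < p" "a \<le> t" "t \<le> v"
  then have "t \<in> {a..b}" using av by simp
  then have "(D i has_real_derivative D (Suc i) t) (at t)" by (rule D[OF it(1)])
  then show "(D i has_vector_derivative D (Suc i) t) (at t within {a..v})"
   unfolding has_real_derivative_iff_has_vector_derivative by (rule has_vector_derivative_at_within)
 qed
 then have HK: "integral {a..v} (\<lambda>x. ((v - x) ^ (p - 1) / fact (p - 1)) *\<^sub>R D p x) = D 0 v - (\<Sum>i<p. ((v - a) ^ i / fact i) *\<^sub>R D i a)"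
  by (rule integral_unique)
 have "continuous_on {a..v} (\<lambda>x. ((v - x) ^ (p - 1) / fact (p - 1)) *\<^sub>R D p x)"
  using av by (intro continuous_intros continuous_on_subset[OF cont]) auto
 then have si: "set_integrable lborel {a..v} (\<lambda>x. ((v - x) ^ (p - 1) / fact (p - 1)) *\<^sub>R D p x)"
  by (rule borel_integrable_atLeastAtMost')
 have "(LINT s:{a..b}|lborel. D p s * tk p s v) = (LINT s:{a..v}|lborel. ((v - s) ^ (p - 1) / fact (p - 1)) *\<^sub>R D p s)"
  unfolding set_lebesgue_integral_def
  by (rule lintegral_cong[OF refl]) (use av in \<open>auto simp: indicator_def tk_def\<close>)
 also have "... = D 0 v - (\<Sum>i<p. ((v - a) ^ i / fact i) *\<^sub>R D i a)"
  using set_borel_integral_eq_integral(2)[OF si] HK by simp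
 finally show ?thesis by (simp add: mult.commute)
qed

lemma integrable_bounded_mult:
 fixes B :: cfun
 assumes "intl B" and [measurable]: "u \<in> BM"
  and "\<And>x. B x \<noteq> 0 ==> \<bar>u x\<bar> \<le> Q"
 shows "intl (\<lambda>x. B x * of_real (u x))"
proof -
 have [measurable]: "B \<in> BM" using assms(1) by (rule borel_of_integrable)
 show ?thesis
 proof (rule lintegrable_bound)
  show "intl (\<lambda>x. of_real Q * B x)" using assms(1) by simp
  show "AE x in lborel. norm (B x * of_real (u x)) \<le> norm (of_real Q * B x)"
  proof (rule AE_I2)
   fix x
   show "norm (B x * of_real (u x)) \<le> norm (of_real Q * B x)"
   proof (cases "B x = 0")
    case False
    have "norm (B x) * \<bar>u x\<bar> \<le> norm (B x) * \<bar>Q\<bar>" using assms(3)[OF False] by (intro mult_left_mono) auto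
    then show ?thesis by (simp add: norm_mult mult.commute)
   qed simp
  qed
 qed measurable
qed

lemma L2_bounded_mult:
 fixes B :: cfun
 assumes B: "L2 B" and [measurable]: "u \<in> BM"
  and u: "\<And>x. B x \<noteq> 0 ==> \<bar>u x\<bar> \<le> Q" and "0 \<le> Q"
 shows "L2 (\<lambda>x. B x * of_real (u x))" "L2norm (\<lambda>x. B x * of_real (u x)) \<le> Q * L2norm B"
proof -
 have [measurable]: "B \<in> BM" using B by (rule L2_measurable)
 have le: "norm (B x * of_real (u x)) \<le> Q * norm (B x)" for x
 proof (cases "B x = 0")
  case False
  then show ?thesis using mult_right_mono[OF u[OF False], of "norm (B x)"] by (simp add: norm_mult mult.commute)
 qed simp
 show "L2 (\<lambda>x. B x * of_real (u x))" "L2norm (\<lambda>x. B x * of_real (u x)) \<le> Q * L2norm B"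
  by (rule L2_bound[OF B _ \<open>0 \<le> Q\<close> le]; measurable)+
qed

section \<open>Transforms of an amplitude times a function of \<open>V\<close>\<close>

locale composite =
 fixes B :: cfun and V :: "real => real" and a b :: real
 assumes B_int: "intl B" and B_L2: "L2 B" and V_meas [measurable]: "V \<in> BM"
  and ab: "a \<le> b" and VB: "\<And>x. B x \<noteq> 0 ==> V x \<in> {a..b}"
begin

lemma B_meas [measurable]: "B \<in> BM" using B_int by (rule borel_of_integrable)

definition rem :: "nat => real => real => real" where
 "rem p s zeta = norm (fourier (\<lambda>x. B x * of_real (tk p s (V x))) zeta)"

text \<open>What is left of Taylor's remainder once the highest derivative is bounded: it depends on
  the amplitude and on \<open>V\<close>, not on the function composed with \<open>V\<close>.\<close>

definition rem_int :: "nat => real => real" where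
 "rem_int p zeta = (LINT s:{a..b}|lborel. rem p s zeta)"

lemma rem_meas [measurable]: "(\<lambda>(s, zeta). rem p s zeta) \<in> BM2"
proof -
 have "rem p s zeta = norm (LI x. e2 (- (x * zeta)) * (B x * of_real (tk p s (V x))))" for s zeta
  unfolding rem_def by (subst fourier_eq) measurable
 then show ?thesis by simp
qed

lemma tkV_bound:
 assumes "s \<in> {a..b}" "B x \<noteq> 0"
 shows "\<bar>tk p s (V x)\<bar> \<le> (b - a) ^ (p - 1)"
 using tk_bound[OF assms(1) VB[OF assms(2)], of p] by simp

lemma tkV_int:
 assumes "s \<in> {a..b}"
 shows "intl (\<lambda>x. B x * of_real (tk p s (V x)))"
 by (rule integrable_bounded_mult[OF B_int]) (use tkV_bound[OF assms] in auto)

lemma tkV_L2: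
 assumes "s \<in> {a..b}"
 shows "L2 (\<lambda>x. B x * of_real (tk p s (V x)))" "L2norm (\<lambda>x. B x * of_real (tk p s (V x))) \<le> (b - a) ^ (p - 1) * L2norm B"
 by (rule L2_bounded_mult[OF B_L2, where Q="(b - a) ^ (p - 1)"]; use tkV_bound[OF assms] ab in auto)+

lemma rem_nonneg: "0 \<le> rem p s zeta" by (simp add: rem_def)

lemma rem_bound: "s \<in> {a..b} ==> rem p s zeta \<le> (b - a) ^ (p - 1) * (LI x. norm (B x))"
proof -
 assume s: "s \<in> {a..b}"
 have "rem p s zeta \<le> (LI x. norm (B x * of_real (tk p s (V x))))"
  unfolding rem_def by (rule norm_fourier_le[OF tkV_int[OF s]])
 also have "... \<le> (LI x. (b - a) ^ (p - 1) * norm (B x))"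
 proof (rule integral_mono)
  fix x
  show "norm (B x * of_real (tk p s (V x))) \<le> (b - a) ^ (p - 1) * norm (B x)"
  proof (cases "B x = 0")
   case False
   then show ?thesis using mult_right_mono[OF tkV_bound[OF s False], of "norm (B x)" p] by (simp add: norm_mult mult.commute)
  qed simp
 qed (use tkV_int[OF s] B_int in auto)
 finally show ?thesis by simp
qed

lemma rem_int_nonneg: "0 \<le> rem_int p zeta" unfolding rem_int_def set_lebesgue_integral_def
 by (intro integral_nonneg_AE AE_I2) (auto simp: rem_nonneg)

lemma rem_int_meas [measurable]: "rem_int p \<in> BM"
 unfolding rem_int_def[abs_def] set_lebesgue_integral_def by measurable

lemma rem_set_integrable: "set_integrable lborel {a..b} (\<lambda>s. rem p s zeta)"
 unfolding set_integrable_def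
 by (rule integrableI_bounded_set_indicator[where B="(b - a) ^ (p - 1) * (LI x. norm (B x))"])
  (use rem_bound rem_nonneg in \<open>auto simp: emeasure_lborel_Icc_eq\<close>)

text \<open>Fubini in \<open>(x, s)\<close> for the separated remainder. The composed function
  enters only through numbers, namely its derivatives at \<open>a\<close> and a bound for the last
  one; the dependence on \<open>zeta\<close> sits in transforms common to all composed
  functions.\<close>

lemma fourier_taylor:
 assumes p: "0 < p"
  and D: "\<And>i g. i < p ==> g \<in> {a..b} ==> (D i has_real_derivative D (Suc i) g) (at g)"
  and cont: "continuous_on {a..b} (D p)"
  and M: "\<And>g. g \<in> {a..b} ==> \<bar>D p g\<bar> \<le> M"
  and D0: "(\<lambda>x. D 0 (V x)) \<in> BM"
 shows "norm (fourier (\<lambda>x. B x * of_real (D 0 (V x))) zeta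
   - (\<Sum>i<p. of_real (D i a) * fourier (\<lambda>x. B x * of_real ((V x - a) ^ i / fact i)) zeta))
  \<le> M * rem_int p zeta"
proof -
 \<comment> \<open>\<open>D p\<close> is controlled on \<open>{a..b}\<close> only; cut off to that
   interval it is Borel and bounded everywhere.\<close>
 define Dp where "Dp s = indicator {a..b} s * D p s" for s
 have Dpm [measurable]: "Dp \<in> BM"
  using borel_measurable_continuous_on_indicator[OF _ cont] by (simp add: Dp_def[abs_def])
 have M0: "0 \<le> M" using M[of a] ab by (auto intro: order_trans[OF abs_ge_zero])
 have Dpb: "\<bar>Dp s\<bar> \<le> M" for s using M[of s] M0 by (auto simp: Dp_def indicator_def)
 define G where "G x s = e2 (- (x * zeta)) * B x * of_real (indicator {a..b} s * (Dp s * tk p s (V x)))" for x s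
 have Gm: "(\<lambda>(x, s). G x s) \<in> BM2" unfolding G_def by measurable
 have ind: "intl (\<lambda>s. complex_of_real (indicator {a..b} s))"
  by (intro integrable_of_real integrable_real_indicator) (auto simp: emeasure_lborel_Icc_eq)
 have Gint: "integrable (lborel \<Otimes>\<^sub>M lborel) (\<lambda>(x, s). G x s)"
 proof (rule integrable_lborel_prod[OF B_int ind Gm])
  fix x s
  show "norm (G x s) \<le> (M * (b - a) ^ (p - 1)) * norm (B x) * norm (complex_of_real (indicator {a..b} s))"
  proof (cases "B x = 0 \<or> s \<notin> {a..b}")
   case True
   then show ?thesis by (auto simp: G_def)
  next
   case False
   then have "\<bar>Dp s\<bar> * \<bar>tk p s (V x)\<bar> \<le> M * (b - a) ^ (p - 1)"
    using tkV_bound[of s x p] by (intro mult_mono Dpb) (auto simp: M0)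
   from mult_left_mono[OF this, of "norm (B x)"] show ?thesis
    using False by (simp add: G_def norm_mult abs_mult mult_ac)
  qed
 qed
 define R where "R x = (LINT s:{a..b}|lborel. D p s * tk p s (V x))" for x
 have R_eq: "R x = (LI s. indicator {a..b} s * (Dp s * tk p s (V x)))" for x
  unfolding R_def set_lebesgue_integral_def by (intro lintegral_cong refl) (auto simp: Dp_def indicator_def)
 have Rm [measurable]: "R \<in> BM" unfolding R_eq[abs_def] by measurable
 have split: "B x * of_real (D 0 (V x)) = (\<Sum>i<p. of_real (D i a) * (B x * of_real ((V x - a) ^ i / fact i))) + B x * of_real (R x)" for x
 proof (cases "B x = 0")
  case False
  have "D 0 (V x) = (\<Sum>i<p. D i a * ((V x - a) ^ i / fact i)) + R x"
   unfolding R_def by (rule taylor_kernel[OF VB[OF False] p D cont])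
  then show ?thesis by (simp add: distrib_left sum_distrib_left mult_ac)
 qed simp
 have Ti: "intl (\<lambda>x. B x * of_real ((V x - a) ^ i / fact i))" for i
 proof (rule integrable_bounded_mult[OF B_int])
  fix x assume "B x \<noteq> 0"
  then have v: "0 \<le> V x - a" "V x - a \<le> b - a" using VB[of x] by auto
  then have "(V x - a) ^ i / fact i \<le> (b - a) ^ i / 1" by (intro frac_le power_mono) (auto simp: fact_ge_1)
  then show "\<bar>(V x - a) ^ i / fact i\<bar> \<le> (b - a) ^ i" using v by simp
 qed measurable
 have Rint: "intl (\<lambda>x. B x * of_real (R x))"
 proof -
  have "intl (\<lambda>x. B x * of_real (D 0 (V x)) - (\<Sum>i<p. of_real (D i a) * (B x * of_real ((V x - a) ^ i / fact i))))"
  proof (intro lintegrable_diff lintegrable_sum integrable_mult_right Ti)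
   have "continuous_on {a..b} (D 0)"
    using D[OF p] by (intro continuous_at_imp_continuous_on ballI) (auto intro: DERIV_isCont)
   then have "compact (D 0 ` {a..b})" by (intro compact_continuous_image compact_Icc)
   then obtain Q where Q: "\<And>y. y \<in> D 0 ` {a..b} ==> norm y \<le> Q"
    using compact_imp_bounded bounded_iff by metis
   show "intl (\<lambda>x. B x * of_real (D 0 (V x)))"
    by (rule integrable_bounded_mult[OF B_int D0, of Q]) (use Q VB in force)
  qed
  then show ?thesis by (simp add: split)
 qed
 have FR: "fourier (\<lambda>x. B x * of_real (R x)) zeta = (LI s. LI x. G x s)"
 proof -
  have "fourier (\<lambda>x. B x * of_real (R x)) zeta = (LI x. e2 (- (x * zeta)) * (B x * of_real (R x)))"
   by (rule fourier_eq) measurable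
  also have "... = (LI x. LI s. G x s)"
  proof (rule lintegral_cong[OF refl])
   fix x
   have "(LI s. G x s) = e2 (- (x * zeta)) * B x * (LI s. complex_of_real (indicator {a..b} s * (Dp s * tk p s (V x))))"
    unfolding G_def by (rule integral_mult_right_zero)
   then show "e2 (- (x * zeta)) * (B x * of_real (R x)) = (LI s. G x s)"
    unfolding R_eq integral_complex_of_real by (simp only: mult.assoc)
  qed
  also have "... = (LI s. LI x. G x s)" using lborel_pair.Fubini_integral[of G] Gint by simp
  finally show ?thesis .
 qed
 have "norm (fourier (\<lambda>x. B x * of_real (R x)) zeta) \<le> M * rem_int p zeta"
 proof -
  have inner: "(LI x. G x s) = of_real (indicator {a..b} s * Dp s) * fourier (\<lambda>x. B x * of_real (tk p s (V x))) zeta" for s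
  proof -
   have "G x s = of_real (indicator {a..b} s * Dp s) * (e2 (- (x * zeta)) * (B x * of_real (tk p s (V x))))" for x
    by (simp add: G_def mult_ac)
   then have "(LI x. G x s) = of_real (indicator {a..b} s * Dp s) * (LI x. e2 (- (x * zeta)) * (B x * of_real (tk p s (V x))))"
    by (simp only: integral_mult_right_zero)
   then show ?thesis by (subst fourier_eq) measurable
  qed
  have "norm (LI s. LI x. G x s) \<le> (LI s. norm (LI x. G x s))" by (rule integral_norm_bound)
  also have "... \<le> (LI s. M * (indicator {a..b} s *\<^sub>R rem p s zeta))"
  proof (rule integral_mono)
   show "intl (\<lambda>s. norm (LI x. G x s))" using lborel_pair.integrable_snd[of G] Gint by simp
   show "intl (\<lambda>s. M * (indicator {a..b} s *\<^sub>R rem p s zeta))"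
    using rem_set_integrable unfolding set_integrable_def by (rule integrable_mult_right)
   show "norm (LI x. G x s) \<le> M * (indicator {a..b} s *\<^sub>R rem p s zeta)" for s
    unfolding inner norm_mult rem_def[symmetric] using mult_right_mono[OF Dpb rem_nonneg, of s p s zeta]
    by (auto simp: indicator_def)
  qed
  also have "... = M * rem_int p zeta" by (simp add: rem_int_def set_lebesgue_integral_def)
  finally show ?thesis unfolding FR .
 qed
 moreover have "fourier (\<lambda>x. B x * of_real (D 0 (V x))) zeta
  = (\<Sum>i<p. of_real (D i a) * fourier (\<lambda>x. B x * of_real ((V x - a) ^ i / fact i)) zeta) + fourier (\<lambda>x. B x * of_real (R x)) zeta"
 proof -
  have s: "intl (\<lambda>x. \<Sum>i\<in>I. of_real (D i a) * (B x * of_real ((V x - a) ^ i / fact i)))" for I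
   by (intro lintegrable_sum integrable_mult_right Ti)
  have "fourier (\<lambda>x. \<Sum>i\<in>I. of_real (D i a) * (B x * of_real ((V x - a) ^ i / fact i))) zeta
   = (\<Sum>i\<in>I. of_real (D i a) * fourier (\<lambda>x. B x * of_real ((V x - a) ^ i / fact i)) zeta)" if "finite I" for I
   using that
  proof induction
   case empty
   show ?case by (simp add: fourier_eq)
  next
   case (insert i I)
   have "fourier (\<lambda>x. of_real (D i a) * (B x * of_real ((V x - a) ^ i / fact i)) + (\<Sum>i\<in>I. of_real (D i a) * (B x * of_real ((V x - a) ^ i / fact i)))) zeta
    = of_real (D i a) * fourier (\<lambda>x. B x * of_real ((V x - a) ^ i / fact i)) zeta + (\<Sum>i\<in>I. of_real (D i a) * fourier (\<lambda>x. B x * of_real ((V x - a) ^ i / fact i)) zeta)"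
    by (subst fourier_add[OF integrable_mult_right[OF Ti] s], subst fourier_cmult) (use insert.IH in \<open>auto intro: borel_of_integrable[OF Ti]\<close>)
   then show ?case using insert by simp
  qed
  then show ?thesis unfolding split by (subst fourier_add[OF s Rint]) simp
 qed
 ultimately show ?thesis by simp
qed

text \<open>Bessel for each \<open>s\<close>, then Minkowski over \<open>{a..b}\<close>; the
  resulting bound involves only the \<open>L2\<close> norm of the amplitude.\<close>

lemma rem_int_L2:
 "L2 (rem_int p)" "L2norm (rem_int p) \<le> (b - a) * ((b - a) ^ (p - 1) * L2norm B)"
proof -
 have r: "L2 (rem p s) \<and> L2norm (rem p s) \<le> (b - a) ^ (p - 1) * L2norm B" if s: "s \<in> {a..b}" for s
 proof -
  have 1: "L2 (fourier (\<lambda>x. B x * of_real (tk p s (V x))))"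
   "L2norm (fourier (\<lambda>x. B x * of_real (tk p s (V x)))) \<le> L2norm (\<lambda>x. B x * of_real (tk p s (V x)))"
   by (rule bessel_fourier[OF tkV_int[OF s] tkV_L2(1)[OF s]])+
  show ?thesis using L2_norm[OF 1(1)] L2norm_norm[OF 1(1)] 1(2) tkV_L2(2)[OF s, of p]
   unfolding rem_def[abs_def] by linarith
 qed
 have bnd: "\<exists>Q. \<forall>s\<in>{a..b}. rem p s zeta \<le> Q" for zeta
  by (rule exI[of _ "(b - a) ^ (p - 1) * (LI x. norm (B x))"]) (intro ballI rem_bound)
 have c0: "0 \<le> (b - a) ^ (p - 1) * L2norm B" using ab by simp
 note X = L2_set_integral[OF rem_meas rem_nonneg bnd conjunct1[OF r] conjunct2[OF r] ab c0]
 show "L2 (rem_int p)" "L2norm (rem_int p) \<le> (b - a) * ((b - a) ^ (p - 1) * L2norm B)"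
  unfolding rem_int_def[abs_def] by (rule X; assumption)+
qed

end

lemma e2_quotient: "((\<lambda>h. (e2 (x * h) - 1) /\<^sub>R h) \<longlongrightarrow> 2 * pi * \<i> * x) (at 0)"
 using e2_has_vector_derivative[of x 0 UNIV] unfolding has_vector_derivative_iff_quotient by simp

text \<open>As \<open>f\<close> is itself a transform, its translation is a modulation of
  \<open>psi\<close>, which changes \<open>psi y\<close> by at most \<open>2 pi |k| |y|\<close>
  times its modulus; Bessel does the rest.\<close>

lemma schwartz_L2_lipschitz:
 assumes "f \<in> schwartz"
 obtains C where "0 \<le> C" "\<And>k. L2norm (\<lambda>x. f (x + k) - f x) \<le> C * \<bar>k\<bar>"
proof -
 obtain psi where psi: "psi \<in> schwartz" "fourier psi = f" using schwartz_fourier_inverse[OF assms] by blast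
 have [measurable]: "psi \<in> BM" by (rule schwartz_measurable[OF psi(1)])
 have xS: "(\<lambda>x. 1 * of_real x * psi x) \<in> schwartz" by (rule schwartz_mult_x[OF psi(1)])
 define C where "C = 2 * pi * L2norm (\<lambda>x. 1 * of_real x * psi x)"
 have "L2norm (\<lambda>x. f (x + k) - f x) \<le> C * \<bar>k\<bar>" for k
 proof -
  define d where "d y = e2 (y * (- k)) * psi y - psi y" for y
  have i1: "intl (\<lambda>y. e2 (y * (- k)) * psi y)"
   by (intro integrable_e2_mult schwartz_integrable psi) measurable
  have di: "intl d" unfolding d_def[abs_def] by (intro lintegrable_diff i1 schwartz_integrable psi)
  have Fd: "fourier d x = f (x + k) - f x" for x
   unfolding d_def[abs_def] by (subst fourier_diff[OF i1 schwartz_integrable[OF psi(1)]], subst fourier_modulate)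
    (simp_all add: psi(2))
  have le: "norm (d y) \<le> (2 * pi * \<bar>k\<bar>) * norm (1 * of_real y * psi y)" for y
  proof -
   have "d y = (e2 (y * (- k)) - 1) * psi y" by (simp add: d_def left_diff_distrib)
   then have "norm (d y) = norm (e2 (y * (- k)) - 1) * norm (psi y)" by (simp only: norm_mult)
   also have "... \<le> (2 * pi * \<bar>y * (- k)\<bar>) * norm (psi y)"
    by (rule mult_right_mono[OF norm_e2_diff_le norm_ge_zero])
   finally show ?thesis by (simp add: norm_mult abs_mult mult_ac)
  qed
  have dL: "L2 d" "L2norm d \<le> (2 * pi * \<bar>k\<bar>) * L2norm (\<lambda>x. 1 * of_real x * psi x)"
   by (rule L2_bound[OF schwartz_L2[OF xS] borel_of_integrable[OF di] _ le]; simp)+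
  have "L2norm (fourier d) \<le> L2norm d" by (rule bessel_fourier(2)[OF di dL(1)])
  moreover have "fourier d = (\<lambda>x. f (x + k) - f x)" by (intro ext Fd)
  ultimately show ?thesis using dL(2) by (simp add: C_def mult_ac)
 qed
 moreover have "0 \<le> C" by (simp add: C_def)
 ultimately show ?thesis using that by blast
qed

section \<open>Composition with a map whose derivative is Lipschitz in the mean\<close>

lemma abs_diff_le_of_deriv_bound:
 fixes f :: "real => real"
 assumes "\<And>x. (f has_real_derivative f' x) (at x)" "\<And>x. x \<in> {min u v..max u v} ==> \<bar>f' x\<bar> \<le> M"
 shows "\<bar>f u - f v\<bar> \<le> M * \<bar>u - v\<bar>"
proof -
 have "norm (f u - f v) \<le> M * norm (u - v)"
  by (rule field_differentiable_bound[of "{min u v..max u v}" f f'])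
   (use assms in \<open>auto intro: DERIV_subset[where s=UNIV]\<close>)
 then show ?thesis by simp
qed

text \<open>Bounds are asked on \<open>[-M, M]\<close> only, which contains the values of
  \<open>V\<close>: the truncated powers and polynomials composed with \<open>V\<close> are
  unbounded on the line. \<open>P'\<close> is Lipschitz rather than differentiable, because the
  truncated square has no second derivative at its knot.\<close>

definition C1_bound :: "real => real => (real => real) => (real => real) => bool" where
 "C1_bound M Q P P' \<longleftrightarrow> 0 \<le> Q \<and> (\<forall>v. (P has_real_derivative P' v) (at v)) \<and> continuous_on UNIV P' \<and>
  (\<forall>v. \<bar>v\<bar> \<le> M \<longrightarrow> \<bar>P v\<bar> \<le> Q \<and> \<bar>P' v\<bar> \<le> Q) \<and>
  (\<forall>u v. \<bar>u\<bar> \<le> M \<longrightarrow> \<bar>v\<bar> \<le> M \<longrightarrow> \<bar>P' u - P' v\<bar> \<le> Q * \<bar>u - v\<bar>)"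

locale regular =
 fixes V V' :: "real => real" and M :: real
 assumes dV: "\<And>x. (V has_real_derivative V' x) (at x)" and cV': "continuous_on UNIV V'"
  and V'_le: "\<And>x. \<bar>V' x\<bar> \<le> M" and V_le: "\<And>x. \<bar>V x\<bar> \<le> M"
  and V'_L2: "\<And>k. L2 (\<lambda>x. V' (x + k) - V' x)" "\<And>k. L2norm (\<lambda>x. V' (x + k) - V' x) \<le> M * \<bar>k\<bar>"
begin

lemma M_nonneg: "0 \<le> M" using V_le[of 0] by linarith

lemma cV: "continuous_on UNIV V"
 using dV by (intro continuous_at_imp_continuous_on ballI) (auto intro: DERIV_isCont)

lemma V_lip: "\<bar>V u - V v\<bar> \<le> M * \<bar>u - v\<bar>"
 by (rule abs_diff_le_of_deriv_bound[OF dV V'_le])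

lemma V_borel [measurable]: "V \<in> BM" "V' \<in> BM" by (intro borel_measurable_continuous_onI cV cV')+

text \<open>The derivative of \<open>B P(V)\<close> is Lipschitz in the mean with a constant
  proportional to \<open>Q\<close>. On the Fourier side its difference quotients are multiplication
  by \<open>(e2 (zeta h) - 1) / h\<close>, which tends to \<open>2 pi i zeta\<close>; Bessel and
  Fatou give the second power of \<open>zeta\<close> without a second derivative of \<open>P\<close>
  or \<open>V\<close>.\<close>

lemma fourier_composite_decay:
 assumes B: "B \<in> schwartz"
 shows "\<exists>C\<ge>0. \<forall>P P' Q. C1_bound M Q P P' \<longrightarrow>
   L2 (\<lambda>zeta. of_real (1 + zeta\<^sup>2) * fourier (\<lambda>x. B x * of_real (P (V x))) zeta) \<and>
   L2norm (\<lambda>zeta. of_real (1 + zeta\<^sup>2) * fourier (\<lambda>x. B x * of_real (P (V x))) zeta) \<le> C * Q"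
proof -
 define B' where "B' = iter_deriv 1 B"
 have B'S: "B' \<in> schwartz" unfolding B'_def by (rule schwartz_iter_deriv[OF B])
 have dB: "(B has_vector_derivative B' x) (at x)" for x
  unfolding B'_def by (rule smooth_has_vector_derivative_0[OF schwartz_smooth[OF B]])
 have [measurable]: "B \<in> BM" "B' \<in> BM"
  by (rule schwartz_measurable[OF B], rule schwartz_measurable[OF B'S])
 have BL: "L2 B" "L2 B'" by (rule schwartz_L2[OF B], rule schwartz_L2[OF B'S])
 have Bi: "intl B" "intl B'" by (rule schwartz_integrable[OF B], rule schwartz_integrable[OF B'S])
 obtain C1 where C1: "0 \<le> C1" "\<And>k. L2norm (\<lambda>x. B' (x + k) - B' x) \<le> C1 * \<bar>k\<bar>"
  using schwartz_L2_lipschitz[OF B'S] by blast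
 obtain C2 where C2: "0 \<le> C2" "\<And>k. L2norm (\<lambda>x. B (x + k) - B x) \<le> C2 * \<bar>k\<bar>"
  using schwartz_L2_lipschitz[OF B] by blast
 obtain SB where SB: "0 \<le> SB" "\<And>x. cmod (B x) \<le> SB" using schwartz_bounded[OF B] by blast
 obtain XB where XB: "0 \<le> XB" "\<And>x. \<bar>x\<bar> ^ 1 * cmod (iter_deriv 0 B x) \<le> XB" using schwartz_bound[OF B] by blast
 note M0 = M_nonneg
 define C0 where "C0 = C1 + M * L2norm B' + M * C2 + M * M * L2norm B + SB * M"
 have C0: "0 \<le> C0" using C1 C2 M0 SB by (simp add: C0_def)
 have main: "L2 (\<lambda>zeta. of_real (1 + zeta\<^sup>2) * fourier (\<lambda>x. B x * of_real (P (V x))) zeta) \<and>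
   L2norm (\<lambda>zeta. of_real (1 + zeta\<^sup>2) * fourier (\<lambda>x. B x * of_real (P (V x))) zeta) \<le> (L2norm B + C0) * Q"
  if c: "C1_bound M Q P P'" for P P' Q
 proof -
  have Q: "0 \<le> Q" and dP: "\<And>v. (P has_real_derivative P' v) (at v)" and cP': "continuous_on UNIV P'"
   and P_le: "\<And>v. \<bar>v\<bar> \<le> M ==> \<bar>P v\<bar> \<le> Q" and P'_le: "\<And>v. \<bar>v\<bar> \<le> M ==> \<bar>P' v\<bar> \<le> Q"
   and P'_lip: "\<And>u v. \<bar>u\<bar> \<le> M ==> \<bar>v\<bar> \<le> M ==> \<bar>P' u - P' v\<bar> \<le> Q * \<bar>u - v\<bar>"
   using c unfolding C1_bound_def by simp_all
  have cP: "continuous_on UNIV P"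
   using dP by (intro continuous_at_imp_continuous_on ballI) (auto intro: DERIV_isCont)
  have [measurable]: "P \<in> BM" "P' \<in> BM" by (intro borel_measurable_continuous_onI cP cP')+
  have PV: "\<bar>P (V x)\<bar> \<le> Q" "\<bar>P' (V x)\<bar> \<le> Q" for x using P_le[OF V_le] P'_le[OF V_le] by auto
  have PVlip: "\<bar>P (V u) - P (V v)\<bar> \<le> Q * (M * \<bar>u - v\<bar>)" for u v
  proof -
   have "\<bar>P (V u) - P (V v)\<bar> \<le> Q * \<bar>V u - V v\<bar>"
    by (rule abs_diff_le_of_deriv_bound[OF dP P'_le]) (use V_le[of u] V_le[of v] in \<open>auto simp: abs_le_iff\<close>)
   also have "... \<le> Q * (M * \<bar>u - v\<bar>)" by (rule mult_left_mono[OF V_lip Q])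
   finally show ?thesis .
  qed
  have P'Vlip: "\<bar>P' (V u) - P' (V v)\<bar> \<le> Q * (M * \<bar>u - v\<bar>)" for u v
   using P'_lip[OF V_le V_le, of u v] mult_left_mono[OF V_lip Q, of u v] by linarith
  define bt where "bt x = B x * of_real (P (V x))" for x
  define bt' where "bt' x = B x * of_real (P' (V x) * V' x) + B' x * of_real (P (V x))" for x
  have dbt: "(bt has_vector_derivative bt' x) (at x)" for x
  proof -
   have "((\<lambda>x. P (V x)) has_real_derivative P' (V x) * V' x) (at x)" by (rule DERIV_chain2[OF dP dV])
   then have "((\<lambda>x. complex_of_real (P (V x))) has_vector_derivative of_real (P' (V x) * V' x)) (at x)"
    by (intro bounded_linear.has_vector_derivative[OF bounded_linear_of_real]) (simp add: has_real_derivative_iff_has_vector_derivative)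
   then show ?thesis unfolding bt_def bt'_def by (rule has_vector_derivative_mult[OF dB])
  qed
  have cPV1: "continuous_on UNIV (\<lambda>x. P (V x))" by (rule continuous_on_compose2[OF cP cV]) simp
  have cPV2: "continuous_on UNIV (\<lambda>x. P' (V x))" by (rule continuous_on_compose2[OF cP' cV]) simp
  have cbt': "continuous_on UNIV bt'" unfolding bt'_def
   by (intro continuous_intros cPV1 cPV2 cV' smooth_continuous_0 schwartz_smooth B B'S)
  have P'V': "\<bar>P' (V x) * V' x\<bar> \<le> Q * M" for x
   unfolding abs_mult using PV(2) V'_le Q by (intro mult_mono) auto
  have ibt: "intl bt" unfolding bt_def[abs_def] by (rule integrable_bounded_mult[OF Bi(1)]) (use PV in auto)
  have Lbt: "L2 bt" "L2norm bt \<le> Q * L2norm B" unfolding bt_def[abs_def]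
   by (rule L2_bounded_mult[OF BL(1), where Q=Q]; use PV Q in auto)+
  have ibt': "intl bt'" unfolding bt'_def[abs_def]
   by (intro lintegrable_add integrable_bounded_mult[OF Bi(1), where Q="Q * M"] integrable_bounded_mult[OF Bi(2), where Q=Q])
    (use PV P'V' in auto)
  have Lbt': "L2 bt'" unfolding bt'_def[abs_def]
   by (intro L2_add L2_bounded_mult(1)[OF BL(1), where Q="Q * M"] L2_bounded_mult(1)[OF BL(2), where Q=Q])
    (use PV P'V' Q M0 in auto)
  have Fbt': "fourier bt' zeta = (2 * pi * \<i> * zeta) * fourier bt zeta" for zeta
  proof (rule fourier_derivative[OF dbt cbt' ibt ibt'])
   fix x
   have "\<bar>x\<bar> * cmod (B x) * \<bar>P (V x)\<bar> \<le> XB * Q" using XB PV Q by (intro mult_mono) auto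
   then show "\<bar>x\<bar> * cmod (bt x) \<le> XB * Q" by (simp add: bt_def norm_mult mult.assoc)
  qed
  have lip: "L2norm (\<lambda>x. bt' (x + k) - bt' x) \<le> C0 * Q * \<bar>k\<bar>" for k
  proof -
   \<comment> \<open>Telescoping: each of the five terms differences one factor of
     \<open>bt'\<close> and evaluates the others at \<open>x\<close> or \<open>x + k\<close>. The
     first four rest on pointwise bounds and on the Schwartz functions; \<open>t5\<close> alone uses
     the hypothesis on \<open>V'\<close> in the mean.\<close>
   define t1 where "t1 x = (B' (x + k) - B' x) * of_real (P (V (x + k)))" for x
   define t2 where "t2 x = B' x * of_real (P (V (x + k)) - P (V x))" for x
   define t3 where "t3 x = (B (x + k) - B x) * of_real (P' (V (x + k)) * V' (x + k))" for x
   define t4 where "t4 x = B x * of_real ((P' (V (x + k)) - P' (V x)) * V' (x + k))" for x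
   define t5 where "t5 x = B x * of_real (P' (V x) * (V' (x + k) - V' x))" for x
   have dec: "bt' (x + k) - bt' x = t1 x + (t2 x + (t3 x + (t4 x + t5 x)))" for x
    by (simp add: bt'_def t1_def t2_def t3_def t4_def t5_def algebra_simps)
   have s: "L2 (\<lambda>x. B' (x + k) - B' x)" "L2 (\<lambda>x. B (x + k) - B x)"
    by (intro L2_diff L2_shift BL)+
   have 1: "L2 t1" "L2norm t1 \<le> Q * (C1 * \<bar>k\<bar>)"
   proof -
    note * = L2_bounded_mult[OF s(1), of "\<lambda>x. P (V (x + k))" Q]
    show "L2 t1" unfolding t1_def[abs_def] by (rule *(1)) (use PV Q in auto)
    have "L2norm t1 \<le> Q * L2norm (\<lambda>x. B' (x + k) - B' x)" unfolding t1_def[abs_def] by (rule *(2)) (use PV Q in auto)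
    also have "... \<le> Q * (C1 * \<bar>k\<bar>)" by (rule mult_left_mono[OF C1(2) Q])
    finally show "L2norm t1 \<le> Q * (C1 * \<bar>k\<bar>)" .
   qed
   have 2: "L2 t2" "L2norm t2 \<le> (Q * (M * \<bar>k\<bar>)) * L2norm B'" unfolding t2_def[abs_def]
    by (rule L2_bounded_mult[OF BL(2), where Q="Q * (M * \<bar>k\<bar>)"]; use PVlip[of "x + k" x for x] Q M0 in auto)+
   have 3: "L2 t3" "L2norm t3 \<le> (Q * M) * (C2 * \<bar>k\<bar>)"
   proof -
    note * = L2_bounded_mult[OF s(2), of "\<lambda>x. P' (V (x + k)) * V' (x + k)" "Q * M"]
    show "L2 t3" unfolding t3_def[abs_def] by (rule *(1)) (use P'V' Q M0 in auto)
    have "L2norm t3 \<le> (Q * M) * L2norm (\<lambda>x. B (x + k) - B x)" unfolding t3_def[abs_def] by (rule *(2)) (use P'V' Q M0 in auto)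
    also have "... \<le> (Q * M) * (C2 * \<bar>k\<bar>)" using Q M0 by (intro mult_left_mono C2(2)) auto
    finally show "L2norm t3 \<le> (Q * M) * (C2 * \<bar>k\<bar>)" .
   qed
   have p4: "\<bar>(P' (V (x + k)) - P' (V x)) * V' (x + k)\<bar> \<le> Q * (M * \<bar>k\<bar>) * M" for x
    unfolding abs_mult using P'Vlip[of "x + k" x] V'_le Q M0 by (intro mult_mono) auto
   have 4: "L2 t4" "L2norm t4 \<le> (Q * (M * \<bar>k\<bar>) * M) * L2norm B" unfolding t4_def[abs_def]
    by (rule L2_bounded_mult[OF BL(1), where Q="Q * (M * \<bar>k\<bar>) * M"]; use p4 Q M0 in auto)+
   have 5: "L2 t5" "L2norm t5 \<le> (SB * Q) * (M * \<bar>k\<bar>)"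
   proof -
    have le: "norm (t5 x) \<le> (SB * Q) * norm (V' (x + k) - V' x)" for x
    proof -
     have "norm (t5 x) = cmod (B x) * \<bar>P' (V x)\<bar> * \<bar>V' (x + k) - V' x\<bar>" by (simp only: t5_def norm_mult norm_of_real abs_mult mult.assoc)
     also have "... \<le> SB * Q * \<bar>V' (x + k) - V' x\<bar>" using SB PV Q by (intro mult_right_mono mult_mono) auto
     finally show ?thesis by simp
    qed
    have t5m: "t5 \<in> BM" unfolding t5_def[abs_def] by measurable
    have SQ: "0 \<le> SB * Q" using SB Q by simp
    show "L2 t5" by (rule L2_bound(1)[OF V'_L2(1) t5m SQ le])
    have "L2norm t5 \<le> (SB * Q) * L2norm (\<lambda>x. V' (x + k) - V' x)" by (rule L2_bound(2)[OF V'_L2(1) t5m SQ le])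
    also have "... \<le> (SB * Q) * (M * \<bar>k\<bar>)" by (rule mult_left_mono[OF V'_L2(2) SQ])
    finally show "L2norm t5 \<le> (SB * Q) * (M * \<bar>k\<bar>)" .
   qed
   have 45: "L2 (\<lambda>x. t4 x + t5 x)" by (rule L2_add[OF 4(1) 5(1)])
   have 345: "L2 (\<lambda>x. t3 x + (t4 x + t5 x))" by (rule L2_add[OF 3(1) 45])
   have 2345: "L2 (\<lambda>x. t2 x + (t3 x + (t4 x + t5 x)))" by (rule L2_add[OF 2(1) 345])
   have "L2norm (\<lambda>x. bt' (x + k) - bt' x) \<le> L2norm t1 + (L2norm t2 + (L2norm t3 + (L2norm t4 + L2norm t5)))"
    unfolding dec
    using L2norm_triangle[OF 1(1) 2345] L2norm_triangle[OF 2(1) 345] L2norm_triangle[OF 3(1) 45] L2norm_triangle[OF 4(1) 5(1)]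
    by linarith
   also have "... \<le> Q * (C1 * \<bar>k\<bar>) + ((Q * (M * \<bar>k\<bar>)) * L2norm B' + ((Q * M) * (C2 * \<bar>k\<bar>) + ((Q * (M * \<bar>k\<bar>) * M) * L2norm B + (SB * Q) * (M * \<bar>k\<bar>))))"
    using 1(2) 2(2) 3(2) 4(2) 5(2) by linarith
   also have "... = C0 * Q * \<bar>k\<bar>" by (simp add: C0_def algebra_simps)
   finally show ?thesis .
  qed
  define d where "d n = 1 / real (Suc n)" for n
  have d: "0 < d n" for n by (simp add: d_def)
  have d0: "d ----> 0" unfolding d_def[abs_def] using LIMSEQ_Suc[OF lim_1_over_n] by simp
  define F where "F n zeta = ((e2 (zeta * d n) - 1) /\<^sub>R d n) * fourier bt' zeta" for n zeta
  have Fn: "L2 (F n)" "L2norm (F n) \<le> C0 * Q" for n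
  proof -
   have i1: "intl (\<lambda>x. bt' (x + d n))"
    using lborel_integrable_real_affine[OF ibt', of 1 "d n"] by (simp add: add.commute)
   have "fourier (\<lambda>x. bt' (x + d n) - bt' x) zeta = (e2 (zeta * d n) - 1) * fourier bt' zeta" for zeta
    by (subst fourier_diff[OF i1 ibt'], subst fourier_shift)
     (auto simp: borel_of_integrable[OF ibt'] algebra_simps)
   then have e: "fourier (\<lambda>x. bt' (x + d n) - bt' x) = (\<lambda>zeta. (e2 (zeta * d n) - 1) * fourier bt' zeta)" by (rule ext)
   have L: "L2 (\<lambda>x. bt' (x + d n) - bt' x)" by (intro L2_diff L2_shift Lbt')
   have b: "L2 (\<lambda>zeta. (e2 (zeta * d n) - 1) * fourier bt' zeta)"
    "L2norm (\<lambda>zeta. (e2 (zeta * d n) - 1) * fourier bt' zeta) \<le> L2norm (\<lambda>x. bt' (x + d n) - bt' x)"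
    using bessel_fourier[OF lintegrable_diff[OF i1 ibt'] L] unfolding e by auto
   have Fe: "F n = (\<lambda>zeta. of_real (1 / d n) * ((e2 (zeta * d n) - 1) * fourier bt' zeta))"
    by (rule ext) (simp add: F_def scaleR_conv_of_real divide_inverse mult.assoc)
   show "L2 (F n)" unfolding Fe by (rule L2_cmult[OF b(1)])
   have "L2norm (F n) = (1 / d n) * L2norm (\<lambda>zeta. (e2 (zeta * d n) - 1) * fourier bt' zeta)"
    unfolding Fe L2norm_cmult[OF b(1)] using d[of n] by (simp add: norm_divide)
   also have "... \<le> (1 / d n) * (C0 * Q * \<bar>d n\<bar>)"
    using b(2) lip[of "d n"] d[of n] by (intro mult_left_mono) auto
   also have "... = C0 * Q" using d[of n] by simp
   finally show "L2norm (F n) \<le> C0 * Q" .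
  qed
  have lim: "AE zeta in lborel. (\<lambda>n. F n zeta) ----> (2 * pi * \<i> * zeta) * fourier bt' zeta"
  proof (rule AE_I2)
   fix zeta
   have "(\<lambda>n. (e2 (zeta * d n) - 1) /\<^sub>R d n) ----> 2 * pi * \<i> * zeta"
    using e2_quotient[of zeta] d0 d unfolding tendsto_at_iff_sequentially o_def by (auto simp: less_imp_neq[symmetric])
   then show "(\<lambda>n. F n zeta) ----> (2 * pi * \<i> * zeta) * fourier bt' zeta"
    unfolding F_def by (intro tendsto_mult tendsto_const)
  qed
  have Fm: "(\<lambda>zeta. (2 * pi * \<i> * zeta) * fourier bt' zeta) \<in> BM"
   using fourier_measurable[OF borel_of_integrable[OF ibt']] by measurable
  note G = L2_fatou[OF Fn Fm lim]
  note H = bessel_fourier[OF ibt Lbt(1)]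
  \<comment> \<open>\<open>zeta^2\<close> is \<open>-1 / (4 pi^2)\<close> times the square of
    \<open>2 pi i zeta\<close>, one factor coming from \<open>Fbt'\<close> and one from the limit of
    \<open>F n\<close>.\<close>
  have eq: "of_real (1 + zeta\<^sup>2) * fourier bt zeta = fourier bt zeta + of_real (- 1 / (4 * pi\<^sup>2)) * ((2 * pi * \<i> * zeta) * fourier bt' zeta)" for zeta
   unfolding Fbt' by (simp add: power2_eq_square field_simps)
  note G' = L2_cmult[OF G(1), of "of_real (- 1 / (4 * pi\<^sup>2))"]
  have "L2norm (\<lambda>zeta. fourier bt zeta + of_real (- 1 / (4 * pi\<^sup>2)) * ((2 * pi * \<i> * zeta) * fourier bt' zeta))
   \<le> L2norm (fourier bt) + L2norm (\<lambda>zeta. of_real (- 1 / (4 * pi\<^sup>2)) * ((2 * pi * \<i> * zeta) * fourier bt' zeta))"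
   by (rule L2norm_triangle[OF H(1) G'])
  also have "L2norm (\<lambda>zeta. of_real (- 1 / (4 * pi\<^sup>2)) * ((2 * pi * \<i> * zeta) * fourier bt' zeta)) \<le> 1 * (C0 * Q)"
   unfolding L2norm_cmult[OF G(1)]
  proof (rule mult_mono)
   have "1 \<le> 4 * pi\<^sup>2" using pi_gt3 one_le_power[of pi 2] by linarith
   then show "cmod (of_real (- 1 / (4 * pi\<^sup>2))) \<le> 1" unfolding norm_of_real by (simp add: divide_le_eq_1)
  qed (use G(2) in auto)
  also have "L2norm (fourier bt) \<le> Q * L2norm B" using H(2) Lbt(2) by linarith
  finally have "L2norm (\<lambda>zeta. of_real (1 + zeta\<^sup>2) * fourier bt zeta) \<le> (L2norm B + C0) * Q"
   unfolding eq by (simp add: algebra_simps)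
  moreover have "L2 (\<lambda>zeta. of_real (1 + zeta\<^sup>2) * fourier bt zeta)" unfolding eq by (rule L2_add[OF H(1) G'])
  ultimately show ?thesis unfolding bt_def[abs_def] by blast
 qed
 show ?thesis by (rule exI[of _ "L2norm B + C0"], intro conjI allI impI) (use C0 main in auto)
qed

end

text \<open>Depth three is the least for which the truncated power is differentiable with Lipschitz
  derivative, as \<open>C1_bound\<close> demands.\<close>

lemma tk_3_has_derivative: "(tk 3 s has_real_derivative max 0 (v - s)) (at v)"
proof -
 have tk3: "tk 3 s = (\<lambda>v. (max 0 (v - s))\<^sup>2 / 2)" by (rule ext) (simp add: tk_def fact_numeral)
 consider "s < v" | "v < s" | "v = s" by linarith
 then show ?thesis
 proof cases
  case 1
  have "((\<lambda>v. (v - s)\<^sup>2 / 2) has_real_derivative max 0 (v - s)) (at v)"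
   using 1 by (auto intro!: derivative_eq_intros)
  then show ?thesis
   by (rule has_field_derivative_transform_within_open[of _ _ _ "{s<..}"]) (use 1 in \<open>auto simp: tk3\<close>)
 next
  case 2
  have "((\<lambda>v. 0) has_real_derivative max 0 (v - s)) (at v)" using 2 by simp
  then show ?thesis
   by (rule has_field_derivative_transform_within_open[of _ _ _ "{..<s}"]) (use 2 in \<open>auto simp: tk3\<close>)
 next
  case 3
  have "((\<lambda>h. (tk 3 s (s + h) - tk 3 s s) / h) \<longlongrightarrow> 0) (at 0)"
  proof (rule Lim_null_comparison)
   show "\<forall>\<^sub>F h in at 0. norm ((tk 3 s (s + h) - tk 3 s s) / h) \<le> \<bar>h\<bar>"
   proof (intro always_eventually allI)
    fix h :: real
    show "norm ((tk 3 s (s + h) - tk 3 s s) / h) \<le> \<bar>h\<bar>"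
     by (cases "0 \<le> h") (auto simp: tk3 power2_eq_square)
   qed
   have "((\<lambda>h::real. \<bar>h\<bar>) \<longlongrightarrow> \<bar>0\<bar>) (at 0)" by (intro tendsto_intros)
   then show "((\<lambda>h::real. \<bar>h\<bar>) \<longlongrightarrow> 0) (at 0)" by simp
  qed
  then show ?thesis unfolding DERIV_def using 3 by simp
 qed
qed

context regular
begin

text \<open>The term of order zero is split off, so that the bound involves only derivatives of
  orders 1 to 3. For a ratio of symbols these vanish at equal frequencies, whereas the ratio itself
  is then 1. \<open>om\<close> collects the two other Taylor terms and the remainder, all of which
  decay by \<open>fourier_composite_decay\<close>.\<close>

lemma fourier_composite_majorant:
 assumes B: "B \<in> schwartz" and ab: "a \<le> b" and VB: "\<And>x. B x \<noteq> 0 ==> V x \<in> {a..b}"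
 obtains om :: "real => real" where "\<And>zeta. 0 \<le> om zeta" "om \<in> BM"
  "L2 (\<lambda>zeta. (1 + zeta\<^sup>2) * om zeta)"
  "\<And>D Q zeta. (\<And>i g. i < 3 ==> g \<in> {a..b} ==> (D i has_real_derivative D (Suc i) g) (at g)) ==>
   continuous_on {a..b} (D 3) ==> (\<lambda>x. D 0 (V x)) \<in> BM ==>
   (\<And>i g. 1 \<le> i ==> i \<le> 3 ==> g \<in> {a..b} ==> \<bar>D i g\<bar> \<le> Q) ==>
   norm (fourier (\<lambda>x. B x * of_real (D 0 (V x))) zeta - of_real (D 0 a) * fourier B zeta) \<le> Q * om zeta"
proof -
 interpret composite B V a b
  by unfold_locales (use B ab VB in \<open>auto intro: schwartz_integrable schwartz_L2\<close>)
 obtain C where C: "0 \<le> C" "\<And>P P' Q. C1_bound M Q P P' ==>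
   L2 (\<lambda>zeta. of_real (1 + zeta\<^sup>2) * fourier (\<lambda>x. B x * of_real (P (V x))) zeta) \<and>
   L2norm (\<lambda>zeta. of_real (1 + zeta\<^sup>2) * fourier (\<lambda>x. B x * of_real (P (V x))) zeta) \<le> C * Q"
  using fourier_composite_decay[OF B] by blast
 define q where "q = M + \<bar>a\<bar> + \<bar>b\<bar>"
 define Q where "Q = 1 + q + q\<^sup>2"
 have q: "0 \<le> q" using M_nonneg by (simp add: q_def)
 have Q: "0 \<le> Q" "1 \<le> Q" "q \<le> Q" "q\<^sup>2 \<le> Q" using q by (auto simp: Q_def)
 have vs: "\<bar>v - s\<bar> \<le> q" if "\<bar>v\<bar> \<le> M" "s \<in> {a..b}" for v s
  using that by (auto simp: q_def)
 have sq: "(v - s)\<^sup>2 / 2 \<le> Q" if "\<bar>v\<bar> \<le> M" "s \<in> {a..b}" for v s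
 proof -
  have "\<bar>v - s\<bar>\<^sup>2 \<le> q\<^sup>2" by (intro power_mono vs that) simp
  then show ?thesis using Q by simp
 qed
 have aI: "a \<in> {a..b}" using ab by simp
 have T1: "L2 (\<lambda>zeta. of_real (1 + zeta\<^sup>2) * fourier (\<lambda>x. B x * of_real (V x - a)) zeta)"
 proof (rule conjunct1[OF C(2)[of Q "\<lambda>v. v - a" "\<lambda>_. 1"]], unfold C1_bound_def, intro conjI allI impI)
  show "((\<lambda>v. v - a) has_real_derivative 1) (at v)" for v by (auto intro!: derivative_eq_intros)
  show "\<bar>v - a\<bar> \<le> Q" if "\<bar>v\<bar> \<le> M" for v using vs[OF that aI] Q by linarith
 qed (use Q in auto)
 have T2: "L2 (\<lambda>zeta. of_real (1 + zeta\<^sup>2) * fourier (\<lambda>x. B x * of_real ((V x - a)\<^sup>2 / 2)) zeta)"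
 proof (rule conjunct1[OF C(2)[of Q "\<lambda>v. (v - a)\<^sup>2 / 2" "\<lambda>v. v - a"]], unfold C1_bound_def, intro conjI allI impI)
  show "((\<lambda>v. (v - a)\<^sup>2 / 2) has_real_derivative v - a) (at v)" for v by (auto intro!: derivative_eq_intros)
  show "\<bar>v - a\<bar> \<le> Q" if "\<bar>v\<bar> \<le> M" for v using vs[OF that aI] Q by linarith
  show "\<bar>(v - a)\<^sup>2 / 2\<bar> \<le> Q" if "\<bar>v\<bar> \<le> M" for v using sq[OF that aI] by simp
  show "\<bar>u - a - (v - a)\<bar> \<le> Q * \<bar>u - v\<bar>" for u v using mult_right_mono[OF Q(2), of "\<bar>u - v\<bar>"] by simp
 qed (use Q in \<open>auto intro!: continuous_intros\<close>)
 have T3: "L2 (\<lambda>zeta. of_real (1 + zeta\<^sup>2) * fourier (\<lambda>x. B x * of_real (tk 3 s (V x))) zeta) \<and>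
   L2norm (\<lambda>zeta. of_real (1 + zeta\<^sup>2) * fourier (\<lambda>x. B x * of_real (tk 3 s (V x))) zeta) \<le> C * Q" if s: "s \<in> {a..b}" for s
 proof (rule C(2)[of Q "tk 3 s" "\<lambda>v. max 0 (v - s)"], unfold C1_bound_def, intro conjI allI impI)
  show "continuous_on UNIV (\<lambda>v. max 0 (v - s))" by (intro continuous_intros)
  show "\<bar>max 0 (v - s)\<bar> \<le> Q" if "\<bar>v\<bar> \<le> M" for v using vs[OF that s] Q by linarith
  show "\<bar>tk 3 s v\<bar> \<le> Q" if "\<bar>v\<bar> \<le> M" for v using sq[OF that s] Q by (simp add: tk_def fact_numeral)
  show "\<bar>max 0 (u - s) - max 0 (v - s)\<bar> \<le> Q * \<bar>u - v\<bar>" for u v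
  proof -
   have "\<bar>max 0 (u - s) - max 0 (v - s)\<bar> \<le> \<bar>u - v\<bar>" by linarith
   then show ?thesis using mult_right_mono[OF Q(2), of "\<bar>u - v\<bar>"] by simp
  qed
 qed (use Q tk_3_has_derivative in auto)
 have R3: "L2 (\<lambda>zeta. (1 + zeta\<^sup>2) * rem 3 s zeta) \<and> L2norm (\<lambda>zeta. (1 + zeta\<^sup>2) * rem 3 s zeta) \<le> C * Q" if s: "s \<in> {a..b}" for s
 proof -
  have e: "norm (of_real (1 + zeta\<^sup>2) * fourier (\<lambda>x. B x * of_real (tk 3 s (V x))) zeta) = (1 + zeta\<^sup>2) * rem 3 s zeta" for zeta
   unfolding norm_mult norm_of_real rem_def by simp
  show ?thesis using L2_norm[OF conjunct1[OF T3[OF s]]] L2norm_norm[OF conjunct1[OF T3[OF s]]] conjunct2[OF T3[OF s]]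
   unfolding e by simp
 qed
 have T3': "L2 (\<lambda>zeta. (1 + zeta\<^sup>2) * rem_int 3 zeta)"
 proof -
  have m: "(\<lambda>(s, zeta). (1 + zeta\<^sup>2) * rem 3 s zeta) \<in> BM2" by measurable
  have n: "0 \<le> (1 + zeta\<^sup>2) * rem 3 s zeta" for s zeta by (simp add: rem_nonneg)
  have bnd: "\<exists>K. \<forall>s\<in>{a..b}. (1 + zeta\<^sup>2) * rem 3 s zeta \<le> K" for zeta
   by (rule exI[of _ "(1 + zeta\<^sup>2) * ((b - a) ^ (3 - 1) * (LI x. norm (B x)))"])
    (intro ballI mult_left_mono rem_bound, auto)
  have c0: "0 \<le> C * Q" using C(1) Q(1) by simp
  have "L2 (\<lambda>zeta. LINT s:{a..b}|lborel. (1 + zeta\<^sup>2) * rem 3 s zeta)"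
   by (rule L2_set_integral(1)[OF m n bnd conjunct1[OF R3] conjunct2[OF R3] ab c0]) assumption+
  then show ?thesis by (simp add: rem_int_def)
 qed
 define om where "om zeta = norm (fourier (\<lambda>x. B x * of_real (V x - a)) zeta) + norm (fourier (\<lambda>x. B x * of_real ((V x - a)\<^sup>2 / 2)) zeta) + rem_int 3 zeta" for zeta
 have m1: "fourier (\<lambda>x. B x * of_real (V x - a)) \<in> BM"
  and m2: "fourier (\<lambda>x. B x * of_real ((V x - a)\<^sup>2 / 2)) \<in> BM"
  by (rule fourier_measurable, measurable)+
 show ?thesis
 proof (rule that[of om])
  show "0 \<le> om zeta" for zeta by (simp add: om_def rem_int_nonneg)
  show "om \<in> BM" unfolding om_def[abs_def] using m1 m2 by measurable
  have "L2 (\<lambda>zeta. norm (of_real (1 + zeta\<^sup>2) * fourier (\<lambda>x. B x * of_real (V x - a)) zeta)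
   + norm (of_real (1 + zeta\<^sup>2) * fourier (\<lambda>x. B x * of_real ((V x - a)\<^sup>2 / 2)) zeta) + (1 + zeta\<^sup>2) * rem_int 3 zeta)"
   by (intro L2_add L2_norm T1 T2 T3')
  moreover have "norm (of_real (1 + zeta\<^sup>2) * z) = (1 + zeta\<^sup>2) * norm z" for zeta and z :: complex
   unfolding norm_mult norm_of_real by simp
  ultimately show "L2 (\<lambda>zeta. (1 + zeta\<^sup>2) * om zeta)" by (simp only: om_def distrib_left)
  fix D Q' zeta
  assume D: "\<And>i g. i < 3 ==> g \<in> {a..b} ==> (D i has_real_derivative D (Suc i) g) (at g)"
   and cD: "continuous_on {a..b} (D 3)" and mD: "(\<lambda>x. D 0 (V x)) \<in> BM"
   and bD: "\<And>i g. 1 \<le> i ==> i \<le> 3 ==> g \<in> {a..b} ==> \<bar>D i g\<bar> \<le> Q'"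
  let ?f1 = "fourier (\<lambda>x. B x * of_real (V x - a)) zeta" and ?f2 = "fourier (\<lambda>x. B x * of_real ((V x - a)\<^sup>2 / 2)) zeta"
  have "norm (fourier (\<lambda>x. B x * of_real (D 0 (V x))) zeta
   - (\<Sum>i<3. of_real (D i a) * fourier (\<lambda>x. B x * of_real ((V x - a) ^ i / fact i)) zeta)) \<le> Q' * rem_int 3 zeta"
   by (rule fourier_taylor) (use D cD mD bD in simp_all)
  also have "(\<Sum>i<3. of_real (D i a) * fourier (\<lambda>x. B x * of_real ((V x - a) ^ i / fact i)) zeta)
   = of_real (D 0 a) * fourier B zeta + (of_real (D 1 a) * ?f1 + of_real (D 2 a) * ?f2)"
   by (simp add: eval_nat_numeral)
  finally have 1: "norm ((fourier (\<lambda>x. B x * of_real (D 0 (V x))) zeta - of_real (D 0 a) * fourier B zeta)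
   - (of_real (D 1 a) * ?f1 + of_real (D 2 a) * ?f2)) \<le> Q' * rem_int 3 zeta" by (simp only: diff_diff_eq)
  have 2: "norm (of_real (D 1 a) * ?f1 + of_real (D 2 a) * ?f2) \<le> Q' * norm ?f1 + Q' * norm ?f2"
  proof (rule order_trans[OF norm_triangle_ineq add_mono])
   show "norm (of_real (D 1 a) * ?f1) \<le> Q' * norm ?f1"
    unfolding norm_mult norm_of_real by (rule mult_right_mono[OF bD[OF _ _ aI] norm_ge_zero]) simp_all
   show "norm (of_real (D 2 a) * ?f2) \<le> Q' * norm ?f2"
    unfolding norm_mult norm_of_real by (rule mult_right_mono[OF bD[OF _ _ aI] norm_ge_zero]) simp_all
  qed
  have "norm (fourier (\<lambda>x. B x * of_real (D 0 (V x))) zeta - of_real (D 0 a) * fourier B zeta)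
   \<le> norm (of_real (D 1 a) * ?f1 + of_real (D 2 a) * ?f2)
    + norm ((fourier (\<lambda>x. B x * of_real (D 0 (V x))) zeta - of_real (D 0 a) * fourier B zeta)
    - (of_real (D 1 a) * ?f1 + of_real (D 2 a) * ?f2))" by (rule norm_triangle_sub)
  also have "... \<le> Q' * om zeta" using 1 2 unfolding om_def distrib_left by linarith
  finally show "norm (fourier (\<lambda>x. B x * of_real (D 0 (V x))) zeta - of_real (D 0 a) * fourier B zeta) \<le> Q' * om zeta" .
 qed
qed

end

context composite
begin

text \<open>The majorant of depth one. Its kernel \<open>tk 1\<close> has a jump, which gives up
  decay in \<open>zeta\<close>, but is at most 1, so that the \<open>L2\<close> norm is controlled
  by that of \<open>B\<close> whatever the regularity of \<open>B\<close>; amplitudes containing a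
  test function require exactly this.\<close>

definition maj :: "real => real" where
 "maj zeta = norm (fourier B zeta) + rem_int 1 zeta"

lemma maj_nonneg: "0 \<le> maj zeta" by (simp add: maj_def rem_int_nonneg)

lemma maj_L2: "L2 maj" "L2norm maj \<le> (1 + (b - a)) * L2norm B"
proof -
 note bf = bessel_fourier[OF B_int B_L2]
 have 1: "L2 (\<lambda>zeta. norm (fourier B zeta))" "L2norm (\<lambda>zeta. norm (fourier B zeta)) \<le> L2norm B"
  using L2_norm[OF bf(1)] L2norm_norm[OF bf(1)] bf(2) by auto
 show "L2 maj" unfolding maj_def[abs_def] by (rule L2_add[OF 1(1) rem_int_L2(1)])
 have "L2norm maj \<le> L2norm (\<lambda>zeta. norm (fourier B zeta)) + L2norm (rem_int 1)"
  unfolding maj_def[abs_def] by (rule L2norm_triangle[OF 1(1) rem_int_L2(1)])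
 then show "L2norm maj \<le> (1 + (b - a)) * L2norm B"
  using 1(2) rem_int_L2(2)[of 1] by (simp add: algebra_simps)
qed

lemma fourier_le_maj:
 assumes D: "\<And>g. g \<in> {a..b} ==> (D (0::nat) has_real_derivative D 1 g) (at g)"
  and cont: "continuous_on {a..b} (D 1)" and D0: "(\<lambda>x. D 0 (V x)) \<in> BM"
  and Q: "\<And>i g. i \<le> 1 ==> g \<in> {a..b} ==> \<bar>D i g\<bar> \<le> Q"
 shows "norm (fourier (\<lambda>x. B x * of_real (D 0 (V x))) zeta) \<le> Q * maj zeta"
proof -
 have "norm (fourier (\<lambda>x. B x * of_real (D 0 (V x))) zeta
   - (\<Sum>i<1. of_real (D i a) * fourier (\<lambda>x. B x * of_real ((V x - a) ^ i / fact i)) zeta)) \<le> Q * rem_int 1 zeta"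
  by (rule fourier_taylor) (use D cont D0 Q in simp_all)
 then have 1: "norm (fourier (\<lambda>x. B x * of_real (D 0 (V x))) zeta - of_real (D 0 a) * fourier B zeta) \<le> Q * rem_int 1 zeta"
  by simp
 have 2: "norm (of_real (D 0 a) * fourier B zeta) \<le> Q * norm (fourier B zeta)"
  unfolding norm_mult norm_of_real by (rule mult_right_mono[OF Q norm_ge_zero]) (use ab in auto)
 show ?thesis
  using norm_triangle_sub[of "fourier (\<lambda>x. B x * of_real (D 0 (V x))) zeta" "of_real (D 0 a) * fourier B zeta"] 1 2
  unfolding maj_def distrib_left by linarith
qed

end

section \<open>Distributions and Sobolev norms\<close>

lemma lebesgue_borel_version:
 fixes f :: cfun
 assumes "f \<in> borel_measurable lebesgue"
 obtains g where "g \<in> BM" "AE x in lebesgue. f x = g x"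
proof -
 have r: "\<exists>g\<in>borel_measurable lborel. AE x in lborel. u x = g x" if "u \<in> borel_measurable lebesgue" for u :: "real => real"
  using completion_ex_borel_measurable_real[OF that] by blast
 obtain g1 g2 where g: "g1 \<in> borel_measurable lborel" "AE x in lborel. Re (f x) = g1 x"
  "g2 \<in> borel_measurable lborel" "AE x in lborel. Im (f x) = g2 x"
  using r[of "\<lambda>x. Re (f x)"] r[of "\<lambda>x. Im (f x)"] assms by auto
 have [measurable]: "g1 \<in> BM" "g2 \<in> BM" using g by auto
 show ?thesis
 proof (rule that[of "\<lambda>x. Complex (g1 x) (g2 x)"])
  show "(\<lambda>x. Complex (g1 x) (g2 x)) \<in> BM" unfolding Complex_eq by measurable
  have "AE x in lborel. f x = Complex (g1 x) (g2 x)"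
   using g(2,4) by eventually_elim (simp add: complex_eq_iff)
  then show "AE x in lebesgue. f x = Complex (g1 x) (g2 x)" by (rule AE_completion)
 qed
qed

lemma lebesgue_integral_eq_lborel:
 fixes f g :: "real => 'a::{banach, second_countable_topology}"
 assumes "AE x in lebesgue. f x = g x" "f \<in> borel_measurable lebesgue" "g \<in> BM"
 shows "(LINT x|lebesgue. f x) = (LI x. g x)"
proof -
 have "(LINT x|lebesgue. f x) = (LINT x|lebesgue. g x)"
  by (rule integral_cong_AE[OF assms(2) _ assms(1)]) (use assms(3) in \<open>simp add: measurable_completion\<close>)
 also have "... = (LI x. g x)" by (rule integral_completion) (use assms(3) in simp)
 finally show ?thesis .
qed

lemma lebesgue_mult_measurable:
 fixes f g :: cfun
 assumes "f \<in> borel_measurable lebesgue" "g \<in> BM"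
 shows "(\<lambda>x. f x * g x) \<in> borel_measurable lebesgue"
proof -
 have "g \<in> borel_measurable lebesgue" using assms(2) by (simp add: measurable_completion)
 then show ?thesis using assms(1) by (rule borel_measurable_times[rotated])
qed

lemma square_integrable_borel_version:
 assumes "square_integrable g"
 obtains h where "L2 h" "L2norm h = sqrt (LINT x|lebesgue. (cmod (g x))\<^sup>2)"
  "\<And>phi. phi \<in> schwartz ==> distr_of_fun g phi = (LI x. h x * phi x)"
proof -
 have gm: "g \<in> borel_measurable lebesgue" and gi: "integrable lebesgue (\<lambda>x. (cmod (g x))\<^sup>2)"
  using assms by (auto simp: square_integrable_def)
 obtain h where h: "h \<in> BM" "AE x in lebesgue. g x = h x" using lebesgue_borel_version[OF gm] by blast
 have m2: "(\<lambda>x. (cmod (h x))\<^sup>2) \<in> borel_measurable lborel" using h(1) by simp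
 have ae: "AE x in lebesgue. (cmod (g x))\<^sup>2 = (cmod (h x))\<^sup>2" using h(2) by eventually_elim simp
 have "integrable lebesgue (\<lambda>x. (cmod (h x))\<^sup>2)"
  by (rule integrable_cong_AE_imp[OF gi]) (use ae m2 in \<open>auto simp: measurable_completion elim: eventually_mono\<close>)
 then have "intl (\<lambda>x. (cmod (h x))\<^sup>2)" using integrable_completion[OF m2] by simp
 then have L: "L2 h" using h(1) by (simp add: L2_def)
 have n: "L2norm h = sqrt (LINT x|lebesgue. (cmod (g x))\<^sup>2)" unfolding L2norm_def
  by (subst lebesgue_integral_eq_lborel[OF ae]) (use gi h(1) in \<open>auto dest: borel_measurable_integrable\<close>)
 have "distr_of_fun g phi = (LI x. h x * phi x)" if phi: "phi \<in> schwartz" for phi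
  unfolding distr_of_fun_def
 proof (rule lebesgue_integral_eq_lborel)
  show "AE x in lebesgue. g x * phi x = h x * phi x" using h(2) by eventually_elim simp
  show "(\<lambda>x. g x * phi x) \<in> borel_measurable lebesgue"
   by (rule lebesgue_mult_measurable[OF gm schwartz_measurable[OF phi]])
  show "(\<lambda>x. h x * phi x) \<in> BM" using h(1) schwartz_measurable[OF phi] by simp
 qed
 with L n show ?thesis using that by blast
qed

lemma L2_square_integrable:
 assumes "L2 h"
 shows "square_integrable h" "(LINT x|lebesgue. (cmod (h x))\<^sup>2) = (L2norm h)\<^sup>2"
  "\<And>phi. phi \<in> schwartz ==> distr_of_fun h phi = (LI x. h x * phi x)"
proof -
 have m [measurable]: "h \<in> BM" using assms by (rule L2_measurable)
 have m2: "(\<lambda>x. (cmod (h x))\<^sup>2) \<in> borel_measurable lborel" by simp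
 have i: "intl (\<lambda>x. (cmod (h x))\<^sup>2)" using assms by (simp add: L2_def)
 show "square_integrable h" unfolding square_integrable_def
  using integrable_completion[OF m2] i m by (simp add: measurable_completion)
 show "(LINT x|lebesgue. (cmod (h x))\<^sup>2) = (L2norm h)\<^sup>2"
  unfolding L2norm_square by (rule integral_completion[OF m2])
 show "distr_of_fun h phi = (LI x. h x * phi x)" if "phi \<in> schwartz" for phi unfolding distr_of_fun_def
  by (rule integral_completion) (use schwartz_measurable[OF that] in simp)
qed

lemma l2_norm_le:
 assumes "L2 h" "\<And>phi. phi \<in> schwartz ==> u phi = (LI x. h x * phi x)"
 shows "l2_norm u \<le> ereal (L2norm h)" unfolding l2_norm_def
 by (rule INF_lower2[of h]) (use assms L2_square_integrable[OF assms(1)] in auto)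

lemma l2_norm_eq:
 assumes h: "L2 h" and u: "\<And>phi. phi \<in> schwartz ==> u phi = (LI x. h x * phi x)"
 shows "l2_norm u = ereal (L2norm h)"
proof (rule antisym[OF l2_norm_le[OF assms]])
 show "ereal (L2norm h) \<le> l2_norm u" unfolding l2_norm_def
 proof (rule INF_greatest)
  fix g assume "g \<in> {g. square_integrable g \<and> (\<forall>phi\<in>schwartz. u phi = distr_of_fun g phi)}"
  then have g: "square_integrable g" "\<And>phi. phi \<in> schwartz ==> u phi = distr_of_fun g phi" by auto
  obtain k where k: "L2 k" "L2norm k = sqrt (LINT x|lebesgue. (cmod (g x))\<^sup>2)"
   "\<And>phi. phi \<in> schwartz ==> distr_of_fun g phi = (LI x. k x * phi x)"
   using square_integrable_borel_version[OF g(1)] by blast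
  have "AE x in lborel. h x = k x" by (rule L2_eq_AE[OF h k(1)]) (use u g k in simp)
  then have "L2norm h = L2norm k" by (intro L2norm_cong_AE L2_measurable h k(1))
  then show "ereal (L2norm h) \<le> ereal (sqrt (LINT x|lebesgue. (cmod (g x))\<^sup>2))" using k(2) by simp
 qed
qed

lemma l2_norm_less_top:
 assumes "l2_norm u < \<infinity>"
 obtains h where "L2 h" "\<And>phi. phi \<in> schwartz ==> u phi = (LI x. h x * phi x)" "l2_norm u = ereal (L2norm h)"
proof -
 obtain g where g: "square_integrable g" "\<forall>phi\<in>schwartz. u phi = distr_of_fun g phi"
  using assms[unfolded l2_norm_def INF_less_iff] by blast
 obtain k where k: "L2 k" "L2norm k = sqrt (LINT x|lebesgue. (cmod (g x))\<^sup>2)"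
  "\<And>phi. phi \<in> schwartz ==> distr_of_fun g phi = (LI x. k x * phi x)"
  using square_integrable_borel_version[OF g(1)] by blast
 have u: "u phi = (LI x. k x * phi x)" if "phi \<in> schwartz" for phi using g(2) k(3) that by simp
 show ?thesis by (rule that[OF k(1) u l2_norm_eq[OF k(1) u]])
qed

definition wt :: "real => real => real => complex" where
 "wt t s xi = (1 + \<i> * of_real t * of_real xi) powr (of_real s)"

lemma cmod_wt: "cmod (wt t s xi) = jp (t * xi) powr s"
proof -
 have "cmod (1 + \<i> * of_real t * of_real xi) = jp (t * xi)" by (simp add: cmod_def jp_def)
 then show ?thesis by (simp add: wt_def norm_powr_real_powr')
qed

lemma wt_inverse: "wt t s xi * wt t (- s) xi = 1"
proof -
 have "1 + \<i> * complex_of_real t * of_real xi \<noteq> 0" using one_plus_i_nonneg[of t xi] by auto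
 then show ?thesis unfolding wt_def powr_add[symmetric] by simp
qed

lemma slow_wt: "slow (wt t s)" unfolding wt_def[abs_def] by (rule slow_weight)

lemma wt_measurable [measurable]: "wt t s \<in> BM"
 by (intro borel_measurable_continuous_onI smooth_continuous_0 slow_smooth slow_wt)

lemma schwartz_wt: "phi \<in> schwartz ==> (\<lambda>xi. wt t s xi * phi xi) \<in> schwartz"
 by (rule schwartz_mult_slow[OF _ slow_wt])

text \<open>A relation rather than a function: \<open>w\<close> matters up to null sets and may be
  neither bounded nor integrable; its pairing with Schwartz functions is meaningful as soon as some
  weight \<open>wt t s\<close> makes it square integrable.\<close>

definition has_FT :: "distribution => (real => complex) => bool" where
 "has_FT f w \<longleftrightarrow> (\<forall>phi\<in>schwartz. f (fourier phi) = (LI xi. w xi * phi xi))"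

lemma sobolev_norm_eq: "sobolev_norm t s f = l2_norm (\<lambda>phi. f (fourier (\<lambda>xi. wt t s xi * phi xi)))"
 by (simp add: sobolev_norm_def distr_mult_def distr_fourier_def wt_def)

lemma sobolev_norm_has_FT:
 assumes "has_FT f w" "L2 (\<lambda>xi. wt t s xi * w xi)"
 shows "sobolev_norm t s f = ereal (L2norm (\<lambda>xi. wt t s xi * w xi))" unfolding sobolev_norm_eq
proof (rule l2_norm_eq[OF assms(2)])
 fix phi :: cfun assume "phi \<in> schwartz"
 then have "f (fourier (\<lambda>xi. wt t s xi * phi xi)) = (LI xi. w xi * (wt t s xi * phi xi))"
  using assms(1) schwartz_wt unfolding has_FT_def by blast
 then show "f (fourier (\<lambda>xi. wt t s xi * phi xi)) = (LI x. wt t s x * w x * phi x)"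
  by (simp only: mult_ac)
qed

text \<open>The \<open>L2\<close> representative of the weighted transform is divided by the weight,
  which vanishes nowhere and whose inverse again maps the Schwartz space to itself.\<close>

lemma sobolev_norm_finite:
 assumes "sobolev_norm t s f < \<infinity>"
 obtains w where "w \<in> BM" "has_FT f w" "L2 (\<lambda>xi. wt t s xi * w xi)"
  "sobolev_norm t s f = ereal (L2norm (\<lambda>xi. wt t s xi * w xi))"
proof -
 obtain h where h: "L2 h" "\<And>phi. phi \<in> schwartz ==> f (fourier (\<lambda>xi. wt t s xi * phi xi)) = (LI x. h x * phi x)"
  using l2_norm_less_top[OF assms[unfolded sobolev_norm_eq]] by blast
 define w where "w xi = wt t (- s) xi * h xi" for xi
 have [measurable]: "h \<in> BM" using h(1) by (rule L2_measurable)
 have wm: "w \<in> BM" unfolding w_def[abs_def] by measurable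
 have e: "(\<lambda>xi. wt t s xi * w xi) = h"
  by (rule ext) (simp only: w_def mult.assoc[symmetric] wt_inverse mult_1)
 have FT: "has_FT f w" unfolding has_FT_def
 proof
  fix phi :: cfun assume phi: "phi \<in> schwartz"
  have "f (fourier (\<lambda>xi. wt t s xi * (wt t (- s) xi * phi xi))) = (LI x. h x * (wt t (- s) x * phi x))"
   by (rule h(2)[OF schwartz_wt[OF phi]])
  then show "f (fourier phi) = (LI xi. w xi * phi xi)"
   by (simp only: mult.assoc[symmetric] wt_inverse mult_1 w_def mult.commute[of "h _"])
 qed
 show ?thesis by (rule that[OF wm FT _ sobolev_norm_has_FT[OF FT]]) (use h e in simp_all)
qed

section \<open>Regularity of admissible functions\<close>

lemma L2_reflect:
 assumes "L2 f"
 shows "L2 (\<lambda>x. f (- x))" "L2norm (\<lambda>x. f (- x)) = L2norm f"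
proof -
 have [measurable]: "f \<in> BM" using assms by (rule L2_measurable)
 have 1: "intl (\<lambda>x. (norm (f (0 + (-1) * x)))\<^sup>2)"
  by (rule lborel_integrable_real_affine) (use assms in \<open>auto simp: L2_def\<close>)
 then show "L2 (\<lambda>x. f (- x))" by (simp add: L2_def)
 have "(LI x. (norm (f x))\<^sup>2) = \<bar>-1\<bar> *\<^sub>R (LI x. (norm (f (0 + (-1) * x)))\<^sup>2)"
  by (rule lborel_integral_real_affine) simp
 then show "L2norm (\<lambda>x. f (- x)) = L2norm f" by (simp add: L2norm_def)
qed

lemma one_plus_square_pos: "0 < 1 + zeta\<^sup>2" for zeta :: real by (rule add_pos_nonneg) auto

text \<open>Translating the derivative by \<open>k\<close> multiplies \<open>2 pi i xi h\<close> by
  a factor that differs from 1 by at most \<open>2 pi |xi k|\<close>. The change is dominated by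
  \<open>4 pi^2 |k|\<close> times the weighted \<open>h\<close>, so Bessel gives the Lipschitz bound
  in the mean.\<close>

lemma regular_fourier_integral:
 fixes h :: cfun and c0 :: real
 assumes h: "L2 (\<lambda>xi. of_real (1 + xi\<^sup>2) * h xi)" and [measurable]: "h \<in> BM"
 obtains V' M where "regular (\<lambda>x. c0 + Re (LI xi. e2 (x * xi) * h xi)) V' M"
proof -
 have i1: "intl (\<lambda>xi. of_real (1 + \<bar>xi\<bar>) * h xi)" by (rule integrable_of_weighted_L2[OF h])
 have ih: "intl h" by (rule lintegrable_bound[OF i1])
   (auto simp: norm_mult simp del: of_real_add intro!: AE_I2 mult_right_mono[of 1 "\<bar>1 + \<bar>_\<bar>\<bar>" "cmod _", simplified])
 have ixh: "intl (\<lambda>xi. of_real xi * h xi)" by (rule lintegrable_bound[OF i1])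
   (auto simp: norm_mult simp del: of_real_add intro!: AE_I2 mult_right_mono)
 define I where "I x = (LI xi. e2 (xi * x) * h xi)" for x
 define I' where "I' x = (LI xi. e2 (xi * x) * (2 * pi * \<i> * xi * h xi))" for x
 have dI: "(I has_vector_derivative I' x) (at x)" for x
  unfolding I_def[abs_def] I'_def by (rule has_vector_derivative_fourier_integral[OF ih ixh])
 have im: "intl (\<lambda>xi. 2 * pi * \<i> * xi * h xi)"
  using integrable_mult_right[OF ixh, of "2 * pi * \<i>"] by (simp only: mult.assoc)
 define A where "A = (LI xi. norm (h xi))"
 define A' where "A' = (LI xi. norm (2 * pi * \<i> * xi * h xi))"
 have Ib: "norm (I x) \<le> A" for x
  using integral_norm_bound[of lborel "\<lambda>xi. e2 (xi * x) * h xi"] by (simp add: I_def A_def norm_mult)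
 have I'b: "norm (I' x) \<le> A'" for x
  using integral_norm_bound[of lborel "\<lambda>xi. e2 (xi * x) * (2 * pi * \<i> * xi * h xi)"] by (simp add: I'_def A'_def norm_mult)
 have cI': "continuous_on UNIV I'" unfolding continuous_on_sequentially
 proof (intro allI ballI impI, elim conjE)
  fix X and x :: real assume X: "X ----> x"
  have "(\<lambda>n. LI xi. e2 (xi * X n) * (2 * pi * \<i> * xi * h xi)) ----> (LI xi. e2 (xi * x) * (2 * pi * \<i> * xi * h xi))"
  proof (rule integral_dominated_convergence[where w="\<lambda>xi. norm (2 * pi * \<i> * xi * h xi)"])
   show "AE xi in lborel. (\<lambda>n. e2 (xi * X n) * (2 * pi * \<i> * xi * h xi)) ----> e2 (xi * x) * (2 * pi * \<i> * xi * h xi)"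
   proof (intro AE_I2 tendsto_mult tendsto_const)
    fix xi
    have "isCont e2 (xi * x)" using continuous_on_e2[of UNIV "\<lambda>x. x"] by (simp add: continuous_on_eq_continuous_at)
    moreover have "(\<lambda>n. xi * X n) ----> xi * x" by (intro tendsto_mult tendsto_const X)
    ultimately show "(\<lambda>n. e2 (xi * X n)) ----> e2 (xi * x)" by (rule isCont_tendsto_compose)
   qed
   show "intl (\<lambda>xi. norm (2 * pi * \<i> * xi * h xi))" by (rule integrable_norm[OF im])
  qed (auto simp: norm_mult)
  then show "(I' \<circ> X) ----> I' x" by (simp add: I'_def o_def)
 qed
 define U where "U = L2norm (\<lambda>xi. of_real (1 + xi\<^sup>2) * h xi)"
 have U0: "0 \<le> U" by (simp add: U_def)
 have lip: "L2 (\<lambda>x. I' (x + k) - I' x) \<and> L2norm (\<lambda>x. I' (x + k) - I' x) \<le> (4 * pi\<^sup>2 * \<bar>k\<bar>) * U" for k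
 proof -
  define u where "u xi = e2 (xi * k) * (2 * pi * \<i> * xi * h xi) - 2 * pi * \<i> * xi * h xi" for xi
  have ie: "intl (\<lambda>xi. e2 (xi * x) * (2 * pi * \<i> * xi * h xi))" for x
   by (rule integrable_e2_mult[OF im]) measurable
  have iu: "intl u" unfolding u_def[abs_def] by (intro lintegrable_diff ie im)
  have [measurable]: "u \<in> BM" using iu by (rule borel_of_integrable)
  have le: "norm (u xi) \<le> (4 * pi\<^sup>2 * \<bar>k\<bar>) * norm (of_real (1 + xi\<^sup>2) * h xi)" for xi
  proof -
   have "u xi = (e2 (xi * k) - 1) * (2 * pi * \<i> * xi * h xi)" by (simp add: u_def left_diff_distrib)
   then have "norm (u xi) = norm (e2 (xi * k) - 1) * (2 * pi * \<bar>xi\<bar> * norm (h xi))" by (simp add: norm_mult)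
   also have "... \<le> (2 * pi * \<bar>xi * k\<bar>) * (2 * pi * \<bar>xi\<bar> * norm (h xi))"
    by (intro mult_right_mono norm_e2_diff_le) auto
   also have "... = (4 * pi\<^sup>2 * \<bar>k\<bar>) * (xi\<^sup>2 * norm (h xi))" by (simp add: abs_mult power2_eq_square)
   also have "... \<le> (4 * pi\<^sup>2 * \<bar>k\<bar>) * ((1 + xi\<^sup>2) * norm (h xi))"
    by (intro mult_left_mono mult_right_mono) auto
   also have "(1 + xi\<^sup>2) * norm (h xi) = norm (of_real (1 + xi\<^sup>2) * h xi)"
    unfolding norm_mult norm_of_real by simp
   finally show ?thesis .
  qed
  have c: "0 \<le> 4 * pi\<^sup>2 * \<bar>k\<bar>" by simp
  have Lu: "L2 u" "L2norm u \<le> (4 * pi\<^sup>2 * \<bar>k\<bar>) * U"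
   unfolding U_def by (rule L2_bound[OF h _ c le]; measurable)+
  have F: "fourier u (- x) = I' (x + k) - I' x" for x
  proof -
   have "fourier u (- x) = (LI xi. e2 (xi * (x + k)) * (2 * pi * \<i> * xi * h xi) - e2 (xi * x) * (2 * pi * \<i> * xi * h xi))"
    unfolding fourier_eq[OF borel_of_integrable[OF iu]]
    by (intro lintegral_cong refl) (simp add: u_def distrib_left e2_add right_diff_distrib)
   also have "... = I' (x + k) - I' x" unfolding I'_def by (rule lintegral_diff[OF ie ie])
   finally show ?thesis .
  qed
  note b = bessel_fourier[OF iu Lu(1)]
  show ?thesis using L2_reflect[OF b(1)] b(2) Lu(2) unfolding F by auto
 qed
 define M where "M = \<bar>c0\<bar> + A + A' + 4 * pi\<^sup>2 * U"
 have A0: "0 \<le> A" "0 \<le> A'" by (auto simp: A_def A'_def)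
 have "regular (\<lambda>x. c0 + Re (I x)) (\<lambda>x. Re (I' x)) M"
 proof
  fix x
  have "((\<lambda>x. Re (I x)) has_vector_derivative Re (I' x)) (at x)"
   by (rule bounded_linear.has_vector_derivative[OF bounded_linear_Re dI])
  then have "((\<lambda>x. Re (I x)) has_real_derivative Re (I' x)) (at x)"
   unfolding has_real_derivative_iff_has_vector_derivative .
  from DERIV_add[OF DERIV_const this] show "((\<lambda>x. c0 + Re (I x)) has_real_derivative Re (I' x)) (at x)"
   by simp
  have p: "0 \<le> 4 * pi\<^sup>2 * U" using U0 by simp
  show "\<bar>Re (I' x)\<bar> \<le> M" using abs_Re_le_cmod[of "I' x"] I'b[of x] A0 p unfolding M_def by linarith
  show "\<bar>c0 + Re (I x)\<bar> \<le> M" using abs_Re_le_cmod[of "I x"] Ib[of x] A0 p unfolding M_def by linarith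
 next
  show "continuous_on UNIV (\<lambda>x. Re (I' x))" by (intro continuous_intros cI')
  fix k
  have m: "(\<lambda>x. Re (I' (x + k)) - Re (I' x)) \<in> BM"
   using L2_measurable[OF conjunct1[OF lip[of k]]] by (simp add: minus_complex.sel(1)[symmetric] del: minus_complex.sel)
  have le: "norm (Re (I' (x + k)) - Re (I' x)) \<le> 1 * norm (I' (x + k) - I' x)" for x
   using abs_Re_le_cmod[of "I' (x + k) - I' x"] by simp
  have o: "(0::real) \<le> 1" by simp
  note b = L2_bound[OF conjunct1[OF lip[of k]] m o le]
  show "L2 (\<lambda>x. Re (I' (x + k)) - Re (I' x))" by (rule b(1))
  have "4 * pi\<^sup>2 * \<bar>k\<bar> * U \<le> M * \<bar>k\<bar>" using A0 by (simp add: M_def algebra_simps)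
  then show "L2norm (\<lambda>x. Re (I' (x + k)) - Re (I' x)) \<le> M * \<bar>k\<bar>" using b(2) lip[of k] by linarith
 qed
 then show ?thesis using that unfolding I_def by (simp add: mult.commute)
qed

text \<open>Every Schwartz function is the transform of another, so equal pairings with transforms
  identify \<open>v\<close>; the pairing with \<open>h\<close> is rewritten by inversion as one with
  the inverse Fourier integral of \<open>h\<close>.\<close>

lemma fourier_integral_AE_eq:
 fixes h v :: cfun
 assumes h: "intl h" and [measurable]: "v \<in> BM"
  and vi: "\<And>phi. phi \<in> schwartz ==> intl (\<lambda>x. v x * phi x)"
  and eq: "\<And>phi. phi \<in> schwartz ==> (LI x. v x * fourier phi x) = (LI xi. h xi * phi xi)"
 shows "AE x in lborel. v x = (LI xi. e2 (x * xi) * h xi)"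
proof -
 have [measurable]: "h \<in> BM" using h by (rule borel_of_integrable)
 have I: "(LI xi. e2 (x * xi) * h xi) = fourier h (- x)" for x by (simp add: fourier_eq mult.commute)
 have Fm [measurable]: "fourier h \<in> BM" by (rule fourier_measurable) measurable
 have Fi: "intl (\<lambda>x. fourier h (- x) * phi x)" if phi: "phi \<in> schwartz" for phi
 proof (rule lintegrable_bound)
  show "intl (\<lambda>x. of_real (LI x. norm (h x)) * phi x)" using schwartz_integrable[OF phi] by simp
  show "(\<lambda>x. fourier h (- x) * phi x) \<in> borel_measurable lborel" using schwartz_measurable[OF phi] by simp
  show "AE x in lborel. norm (fourier h (- x) * phi x) \<le> norm (of_real (LI x. norm (h x)) * phi x)"
   unfolding norm_mult norm_of_real
   by (intro AE_I2 mult_right_mono order_trans[OF norm_fourier_le[OF h] abs_ge_self] norm_ge_zero)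
 qed
 have "AE x in lborel. v x - fourier h (- x) = 0"
 proof (rule schwartz_orthogonal_AE_zero)
  show "(\<lambda>x. v x - fourier h (- x)) \<in> BM" by measurable
  fix phi :: cfun assume phi: "phi \<in> schwartz"
  show "intl (\<lambda>x. (v x - fourier h (- x)) * phi x)"
   unfolding left_diff_distrib by (intro lintegrable_diff vi Fi phi)
  obtain psi where psi: "psi \<in> schwartz" "fourier psi = phi" "\<And>x. psi x = fourier phi (- x)"
   using schwartz_fourier_inverse[OF phi] by blast
  have pm [measurable]: "phi \<in> BM" by (rule schwartz_measurable[OF phi])
  have ir: "intl (\<lambda>x. phi (- x))"
   using lborel_integrable_real_affine[OF schwartz_integrable[OF phi], of "-1" 0] by simp
  have "(LI x. fourier h (- x) * phi x) = (LI x. fourier h x * phi (- x))"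
   using lborel_integral_real_affine[of "-1" "\<lambda>x. fourier h (- x) * phi x" 0] by simp
  also have "... = (LI x. h x * fourier (\<lambda>x. phi (- x)) x)" by (rule fourier_pairing[OF h ir])
  also have "... = (LI x. h x * psi x)" unfolding fourier_reflect[OF pm] psi(3) ..
  finally show "(LI x. (v x - fourier h (- x)) * phi x) = 0"
   unfolding left_diff_distrib using eq[OF psi(1)] vi[OF phi] Fi[OF phi] psi(2) by simp
 qed
 then show ?thesis by (simp add: I)
qed

lemma weighted_L2_integrable:
 fixes h :: cfun
 assumes h: "L2 (\<lambda>xi. of_real (1 + xi\<^sup>2) * h xi)" and hm: "h \<in> BM"
 shows "intl h"
proof (rule lintegrable_bound[OF integrable_of_weighted_L2[OF h]])
 show "h \<in> borel_measurable lborel" using hm by simp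
 show "AE x in lborel. cmod (h x) \<le> cmod (of_real (1 + \<bar>x\<bar>) * h x)"
 proof (rule AE_I2)
  fix x
  have "1 * cmod (h x) \<le> \<bar>1 + \<bar>x\<bar>\<bar> * cmod (h x)" by (intro mult_right_mono) auto
  then show "cmod (h x) \<le> cmod (of_real (1 + \<bar>x\<bar>) * h x)" unfolding norm_mult norm_of_real by simp
 qed
qed

text \<open>For \<open>s \<ge> 2\<close> the Sobolev weight dominates \<open>1 + xi^2\<close>, which
  is what \<open>regular_fourier_integral\<close> asks. The agreement holds on the whole line here,
  with the constant \<open>c0\<close> added back.\<close>

lemma sobolev_H_regular:
 fixes c :: "real => real"
 assumes s: "2 \<le> s" and c: "(\<lambda>x. c x - c0) \<in> sobolev_H s"
 obtains V V' M where "regular V V' M" "AE x in lebesgue. c x = V x" "c \<in> borel_measurable lebesgue"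
proof -
 define v where "v x = complex_of_real (c x - c0)" for x
 have vm: "(\<lambda>x. c x - c0) \<in> borel_measurable lebesgue"
  and vi: "\<And>phi. phi \<in> schwartz ==> integrable lebesgue (\<lambda>x. v x * phi x)"
  and sp: "distr_of_fun v \<in> sobolev_space 1 s" using c unfolding sobolev_H_def v_def[abs_def] by auto
 have cm: "c \<in> borel_measurable lebesgue"
  using borel_measurable_add[OF vm borel_measurable_const[of c0]] by simp
 have vcm: "v \<in> borel_measurable lebesgue" unfolding v_def[abs_def] by (rule measurable_compose[OF vm borel_measurable_of_real])
 obtain vb where vb [measurable]: "vb \<in> BM" and ae: "AE x in lebesgue. v x = vb x"
  using lebesgue_borel_version[OF vcm] by blast
 obtain w where w: "w \<in> BM" "has_FT (distr_of_fun v) w" "L2 (\<lambda>xi. wt 1 s xi * w xi)"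
  using sobolev_norm_finite sp unfolding sobolev_space_def by blast
 have eqi: "(LINT x|lebesgue. v x * phi x) = (LI x. vb x * phi x)" if phi: "phi \<in> schwartz" for phi
  by (rule lebesgue_integral_eq_lborel)
   (use ae lebesgue_mult_measurable[OF vcm schwartz_measurable[OF phi]] schwartz_measurable[OF phi] vb in \<open>auto elim: eventually_mono\<close>)
 have vbi: "intl (\<lambda>x. vb x * phi x)" if phi: "phi \<in> schwartz" for phi
 proof -
  have m: "(\<lambda>x. vb x * phi x) \<in> borel_measurable lborel" using vb schwartz_measurable[OF phi] by simp
  have "integrable lebesgue (\<lambda>x. vb x * phi x)"
   by (rule integrable_cong_AE_imp[OF vi[OF phi] measurable_completion[OF m]]) (use ae in \<open>auto elim: eventually_mono\<close>)
  then show ?thesis using integrable_completion[OF m] by simp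
 qed
 have hL: "L2 (\<lambda>xi. of_real (1 + xi\<^sup>2) * w xi)"
 proof (rule L2_bound(1)[OF w(3), where C=1])
  show "(\<lambda>xi. of_real (1 + xi\<^sup>2) * w xi) \<in> BM" using w(1) by measurable
  fix xi
  have "1 + xi\<^sup>2 = jp xi powr 2" using jp_pos[of xi] one_plus_square_pos[of xi] by (simp add: powr_numeral jp_def)
  also have "... \<le> jp (1 * xi) powr s" unfolding mult_1 by (rule powr_mono[OF s jp_ge_1])
  finally have "\<bar>1 + xi\<^sup>2\<bar> * cmod (w xi) \<le> jp (1 * xi) powr s * cmod (w xi)"
   using one_plus_square_pos[of xi] by (intro mult_right_mono) auto
  then show "norm (of_real (1 + xi\<^sup>2) * w xi) \<le> 1 * norm (wt 1 s xi * w xi)"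
   unfolding norm_mult norm_of_real cmod_wt by simp
 qed simp
 obtain V' M where reg: "regular (\<lambda>x. c0 + Re (LI xi. e2 (x * xi) * w xi)) V' M"
  using regular_fourier_integral[OF hL w(1)] by blast
 have "AE x in lborel. vb x = (LI xi. e2 (x * xi) * w xi)"
 proof (rule fourier_integral_AE_eq[OF weighted_L2_integrable[OF hL w(1)] vb vbi])
  fix phi :: cfun assume phi: "phi \<in> schwartz"
  have "distr_of_fun v (fourier phi) = (LI xi. w xi * phi xi)" using w(2) phi unfolding has_FT_def by blast
  then show "(LI x. vb x * fourier phi x) = (LI xi. w xi * phi xi)"
   using eqi[OF schwartz_fourier[OF phi]] by (simp add: distr_of_fun_def)
 qed
 then have "AE x in lebesgue. vb x = (LI xi. e2 (x * xi) * w xi)" by (rule AE_completion)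
 with ae have "AE x in lebesgue. c x = c0 + Re (LI xi. e2 (x * xi) * w xi)"
 proof eventually_elim
  case (elim x)
  then have "Re (v x) = Re (LI xi. e2 (x * xi) * w xi)" by simp
  then show ?case by (simp add: v_def)
 qed
 with reg cm show ?thesis using that by blast
qed

lemma ess_bounded_borel_version:
 assumes "ess_bounded f"
 obtains g B where "g \<in> BM" "AE x in lebesgue. f x = g x" "\<And>x. \<bar>g x\<bar> \<le> B" "0 \<le> B"
proof -
 obtain B where f: "f \<in> borel_measurable lebesgue" "AE x in lebesgue. \<bar>f x\<bar> \<le> B"
  using assms by (auto simp: ess_bounded_def)
 obtain g where g: "g \<in> borel_measurable lborel" "AE x in lborel. f x = g x"
  using completion_ex_borel_measurable_real[OF f(1)] by blast
 have gm [measurable]: "g \<in> BM" using g(1) by simp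
 define k where "k x = max (- \<bar>B\<bar>) (min \<bar>B\<bar> (g x))" for x
 show ?thesis
 proof (rule that[of k "\<bar>B\<bar>"])
  show "k \<in> BM" unfolding k_def[abs_def] by measurable
  have "AE x in lebesgue. f x = g x" using g(2) by (rule AE_completion)
  with f(2) show "AE x in lebesgue. f x = k x" by eventually_elim (auto simp: k_def)
  show "\<bar>k x\<bar> \<le> \<bar>B\<bar>" for x by (auto simp: k_def)
 qed simp
qed

lemma lborel_integral_complex_Re_Im:
 fixes u :: "real => real" and F G :: cfun
 assumes "intl F" "intl G"
  and "(LI x. Re (F x)) = s * (LI x. Re (G x))"
  and "(LI x. Im (F x)) = s * (LI x. Im (G x))"
 shows "(LI x. F x) = of_real s * (LI x. G x)" using assms by (intro complex_eqI) simp_all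

text \<open>Weak derivatives are tested by real bump functions, whereas a Fourier transform calls
  for complex exponentials times a cutoff; real and imaginary parts are tested separately. Both
  functions are replaced by Borel versions on the way.\<close>

lemma weak_deriv_complex:
 fixes Phi :: cfun
 assumes wd: "weak_deriv k f g" and k: "k \<le> 2"
  and f: "f \<in> borel_measurable lebesgue" "AE x in lebesgue. f x = fb x" "fb \<in> BM" "\<And>x. \<bar>fb x\<bar> \<le> Bf"
  and g: "g \<in> borel_measurable lebesgue" "AE x in lebesgue. g x = gb x" "gb \<in> BM" "\<And>x. \<bar>gb x\<bar> \<le> Bg"
  and Phi: "smooth Phi" "\<And>x. R < \<bar>x\<bar> ==> Phi x = 0"
 shows "(LI x. iter_deriv k Phi x * of_real (fb x)) = (-1) ^ k * (LI x. Phi x * of_real (gb x))"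
proof -
 have S: "Phi \<in> schwartz" by (rule schwartz_of_compact_support[OF Phi])
 have Sk: "iter_deriv k Phi \<in> schwartz" by (rule schwartz_iter_deriv[OF S])
 have i1: "intl (\<lambda>x. iter_deriv k Phi x * of_real (fb x))"
  by (rule integrable_bounded_mult[OF schwartz_integrable[OF Sk] f(3,4)])
 have i2: "intl (\<lambda>x. Phi x * of_real (gb x))"
  by (rule integrable_bounded_mult[OF schwartz_integrable[OF S] g(3,4)])
 have part: "(LI x. fb x * T (iter_deriv k Phi x)) = (-1) ^ k * (LI x. gb x * T (Phi x))"
  if T: "bounded_linear T" and Tm: "T \<in> BM" for T :: "complex => real"
 proof -
  have sT: "smooth (\<lambda>x. T (Phi x))" by (rule smooth_bounded_linear(1)[OF T Phi(1)])
  have T0: "T 0 = 0" by (rule linear_0[OF bounded_linear.linear[OF T]])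
  have itT: "iter_deriv k (\<lambda>x. T (Phi x)) = (\<lambda>x. T (iter_deriv k Phi x))"
  proof -
   have 1: "iter_deriv 1 (\<lambda>x. T (h x)) = (\<lambda>x. T (iter_deriv 1 h x))" if "smooth h" for h
    using smooth_bounded_linear(2)[OF T that] by simp
   have 2: "iter_deriv 2 h = iter_deriv 1 (iter_deriv 1 h)" for h :: "real => 'b::real_normed_vector"
    by (simp add: iter_deriv_add numeral_2_eq_2)
   have "iter_deriv 2 (\<lambda>x. T (Phi x)) = (\<lambda>x. T (iter_deriv 2 Phi x))"
    unfolding 2 1[OF Phi(1)] by (rule 1[OF smooth_iter_deriv[OF Phi(1)]])
   moreover have "k = 0 \<or> k = 1 \<or> k = 2" using k by auto
   ultimately show ?thesis using 1[OF Phi(1)] by auto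
  qed
  have "bounded {x. T (Phi x) \<noteq> 0}"
   unfolding bounded_iff using Phi(2) T0 by (intro exI[of _ R]) (auto simp: not_less[symmetric])
  then have "bump_function_on UNIV (\<lambda>x. T (Phi x))"
   using sT by (simp add: bump_function_on_def compact_closure)
  from wd[unfolded weak_deriv_def, rule_format, OF this]
  have "(LINT x|lebesgue. f x * T (iter_deriv k Phi x)) = (-1) ^ k * (LINT x|lebesgue. g x * T (Phi x))"
   unfolding itT .
  moreover have lb: "(LINT x|lebesgue. u x * T (psi x)) = (LI x. ub x * T (psi x))"
   if u: "u \<in> borel_measurable lebesgue" "AE x in lebesgue. u x = ub x" "ub \<in> BM" and psi: "psi \<in> schwartz"
   for u ub :: "real => real" and psi
  proof (rule lebesgue_integral_eq_lborel)
   have m: "(\<lambda>x. T (psi x)) \<in> BM" by (rule measurable_compose[OF schwartz_measurable[OF psi] Tm])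
   then have m': "(\<lambda>x. T (psi x)) \<in> borel_measurable lebesgue" by (simp add: measurable_completion)
   show "AE x in lebesgue. u x * T (psi x) = ub x * T (psi x)" using u(2) by eventually_elim simp
   show "(\<lambda>x. u x * T (psi x)) \<in> borel_measurable lebesgue" by (rule borel_measurable_times[OF u(1) m'])
   show "(\<lambda>x. ub x * T (psi x)) \<in> BM" by (rule borel_measurable_times[OF u(3) m])
  qed
  ultimately show ?thesis using lb[OF f(1,2,3) Sk] lb[OF g(1,2,3) S] by simp
 qed
 have "(LI x. iter_deriv k Phi x * of_real (fb x)) = of_real ((-1) ^ k) * (LI x. Phi x * of_real (gb x))"
 proof (rule lborel_integral_complex_Re_Im[OF i1 i2])
  have "Re \<in> BM" "Im \<in> BM" by measurable
  from part[OF bounded_linear_Re this(1)] part[OF bounded_linear_Im this(2)]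
  show "(LI x. Re (iter_deriv k Phi x * of_real (fb x))) = (-1) ^ k * (LI x. Re (Phi x * of_real (gb x)))"
   "(LI x. Im (iter_deriv k Phi x * of_real (fb x))) = (-1) ^ k * (LI x. Im (Phi x * of_real (gb x)))"
   by (simp_all add: mult.commute)
 qed
 then show ?thesis by simp
qed

text \<open>A merely bounded \<open>c\<close> need not have a square integrable transform, so it is
  cut off by a plateau equal to 1 near \<open>x0\<close>, and the agreement with \<open>V\<close> is
  accordingly local. Testing the two weak derivatives against exponentials times the plateau shows
  that \<open>zeta^2\<close> times the transform of the localized function is again the transform of
  an \<open>L2\<close> function.\<close>

lemma sobolev_W_regular:
 fixes c :: "real => real"
 assumes N: "2 \<le> N" and c: "c \<in> sobolev_W_inf N"
 obtains V V' M where "regular V V' M" "AE x in lebesgue. x \<in> {x0 - 1<..<x0 + 1} \<longrightarrow> c x = V x" "c \<in> borel_measurable lebesgue"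
proof -
 have ce: "ess_bounded c" using c by (simp add: sobolev_W_inf_def)
 obtain g1 g2 where g: "ess_bounded g1" "weak_deriv 1 c g1" "ess_bounded g2" "weak_deriv 2 c g2"
 proof -
  have w: "\<exists>g. ess_bounded g \<and> weak_deriv k c g" if "k \<le> N" for k
   using c that unfolding sobolev_W_inf_def by blast
  have "1 \<le> N" using N by simp
  from w[OF this] w[OF N] show ?thesis using that by blast
 qed
 have meas: "c \<in> borel_measurable lebesgue" "g1 \<in> borel_measurable lebesgue" "g2 \<in> borel_measurable lebesgue"
  using ce g by (auto simp: ess_bounded_def)
 obtain cb Bc where cb: "cb \<in> BM" "AE x in lebesgue. c x = cb x" "\<And>x. \<bar>cb x\<bar> \<le> Bc" "0 \<le> Bc"
  using ess_bounded_borel_version[OF ce] by blast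
 obtain h1 B1 where h1: "h1 \<in> BM" "AE x in lebesgue. g1 x = h1 x" "\<And>x. \<bar>h1 x\<bar> \<le> B1" "0 \<le> B1"
  using ess_bounded_borel_version[OF g(1)] by blast
 obtain h2 B2 where h2: "h2 \<in> BM" "AE x in lebesgue. g2 x = h2 x" "\<And>x. \<bar>h2 x\<bar> \<le> B2" "0 \<le> B2"
  using ess_bounded_borel_version[OF g(3)] by blast
 have pl: "x0 - 2 < x0 - 1" "x0 - 1 \<le> x0 + 1" "x0 + 1 < x0 + 2" by auto
 obtain P :: "real => real" where P: "smooth P" "\<And>x. x \<in> {x0 - 1..x0 + 1} ==> P x = 1"
  "\<And>x. x \<notin> {x0 - 2<..<x0 + 2} ==> P x = 0" "\<And>x. 0 \<le> P x" "\<And>x. P x \<le> 1"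
  by (rule plateau_exists[OF pl]) blast
 define psi where "psi x = complex_of_real (P x)" for x
 have psiS: "psi \<in> schwartz" unfolding psi_def[abs_def] by (rule plateau_schwartz[OF P(1,3)])
 define psi1 where "psi1 = iter_deriv 1 psi"
 define psi2 where "psi2 = iter_deriv 1 psi1"
 have S1: "psi1 \<in> schwartz" unfolding psi1_def by (rule schwartz_iter_deriv[OF psiS])
 have S2: "psi2 \<in> schwartz" unfolding psi2_def by (rule schwartz_iter_deriv[OF S1])
 have d0: "(psi has_vector_derivative psi1 x) (at x)" for x
  unfolding psi1_def by (rule smooth_has_vector_derivative_0[OF schwartz_smooth[OF psiS]])
 have d1: "(psi1 has_vector_derivative psi2 x) (at x)" for x
  unfolding psi2_def by (rule smooth_has_vector_derivative_0[OF schwartz_smooth[OF S1]])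
 define R where "R = \<bar>x0\<bar> + 2"
 have psi0: "psi x = 0" if "R < \<bar>x\<bar>" for x
 proof -
  have "x \<notin> {x0 - 2<..<x0 + 2}" using that by (auto simp: R_def)
  then show ?thesis using P(3) by (simp add: psi_def)
 qed
 have psi10: "psi1 x = 0" if "R < \<bar>x\<bar>" for x
 proof -
  have "open {x::real. R < \<bar>x\<bar>}" by (intro open_Collect_less continuous_intros)
  then have "(psi has_vector_derivative 0) (at x)"
   by (intro has_vector_derivative_transform_within_open[of "\<lambda>_. 0" 0 x "{x. R < \<bar>x\<bar>}" psi])
    (use that psi0 in auto)
  then show ?thesis using d0 vector_derivative_unique_at by blast
 qed
 have int: "intl (\<lambda>x. phi x * of_real (u x))" and L: "L2 (\<lambda>x. phi x * of_real (u x))"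
  if "phi \<in> schwartz" "u \<in> BM" "\<And>x. \<bar>u x\<bar> \<le> B" "0 \<le> B" for phi u B
  using integrable_bounded_mult[OF schwartz_integrable[OF that(1)] that(2,3)]
   L2_bounded_mult(1)[OF schwartz_L2[OF that(1)] that(2,3,4)] by auto
 define v where "v x = psi x * of_real (cb x)" for x
 have vi: "intl v" and vL: "L2 v" unfolding v_def[abs_def]
  by (rule int[OF psiS cb(1,3,4)], rule L[OF psiS cb(1,3,4)])
 have vm [measurable]: "v \<in> BM" using vi by (rule borel_of_integrable)
 \<comment> \<open>The Leibniz expansion of the second derivative of \<open>psi c\<close>, with the
   weak derivatives \<open>h1\<close>, \<open>h2\<close> of \<open>c\<close>.\<close>
 define u where "u x = psi2 x * of_real (cb x) + (2 * (psi1 x * of_real (h1 x)) + psi x * of_real (h2 x))" for x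
 have ui: "intl u" unfolding u_def[abs_def]
  by (intro lintegrable_add integrable_mult_right int[OF S2 cb(1,3,4)] int[OF S1 h1(1,3,4)] int[OF psiS h2(1,3,4)])
 have uL: "L2 u" unfolding u_def[abs_def]
  by (intro L2_add L2_cmult L[OF S2 cb(1,3,4)] L[OF S1 h1(1,3,4)] L[OF psiS h2(1,3,4)])
 have key: "of_real ((2 * pi * zeta)\<^sup>2) * fourier v zeta = - fourier u zeta" for zeta
 proof -
  define E where "E x = e2 ((- zeta) * x)" for x
  define om where "om = 2 * pi * \<i> * complex_of_real (- zeta)"
  have dE: "(E has_vector_derivative om * E x) (at x)" for x
   unfolding E_def[abs_def] om_def by (rule e2_has_vector_derivative)
  have sE: "slow E" unfolding E_def[abs_def] by (rule slow_e2)
  define Phi where "Phi x = E x * psi x" for x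
  define Phi1 where "Phi1 x = E x * psi1 x" for x
  have SPhi: "smooth Phi" unfolding Phi_def[abs_def] by (rule schwartz_smooth[OF schwartz_mult_slow[OF psiS sE]])
  have SPhi1: "smooth Phi1" unfolding Phi1_def[abs_def] by (rule schwartz_smooth[OF schwartz_mult_slow[OF S1 sE]])
  have iPhi: "iter_deriv 1 Phi = (\<lambda>x. E x * psi1 x + (om * E x) * psi x)"
   unfolding Phi_def[abs_def] One_nat_def by (rule iter_deriv_eqI[OF has_vector_derivative_mult[OF dE d0]])
  have iPhi1: "iter_deriv 1 Phi1 = (\<lambda>x. E x * psi2 x + (om * E x) * psi1 x)"
   unfolding Phi1_def[abs_def] One_nat_def by (rule iter_deriv_eqI[OF has_vector_derivative_mult[OF dE d1]])
  have iPhi2: "iter_deriv 2 Phi = (\<lambda>x. E x * psi2 x + (om * E x) * psi1 x + om * (E x * psi1 x + (om * E x) * psi x))"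
  proof -
   have "iter_deriv 2 Phi = iter_deriv 1 (iter_deriv 1 Phi)" by (simp add: iter_deriv_add numeral_2_eq_2)
   also have "... = iter_deriv 1 (\<lambda>x. Phi1 x + om * Phi x)" unfolding iPhi by (simp add: Phi_def Phi1_def mult.assoc)
   also have "... = (\<lambda>x. iter_deriv 1 Phi1 x + om * iter_deriv 1 Phi x)" unfolding One_nat_def
    by (rule iter_deriv_eqI, intro has_vector_derivative_add has_vector_derivative_mult_right
      smooth_has_vector_derivative_0[unfolded One_nat_def] SPhi SPhi1)
   finally show ?thesis unfolding iPhi iPhi1 .
  qed
  \<comment> \<open>The first weak derivative is tested against the exponential times
    \<open>psi1\<close>, the second against the exponential times \<open>psi\<close>; eliminating
    the mixed integral of \<open>psi1\<close> with \<open>cb\<close> leaves the transform of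
    \<open>u\<close>.\<close>
  have w1: "(LI x. iter_deriv 1 Phi1 x * of_real (cb x)) = (-1) ^ 1 * (LI x. Phi1 x * of_real (h1 x))"
   by (rule weak_deriv_complex[OF g(2) _ meas(1) cb(2,1,3) meas(2) h1(2,1,3) SPhi1, where R=R])
    (use psi10 in \<open>auto simp: Phi1_def\<close>)
  have w2: "(LI x. iter_deriv 2 Phi x * of_real (cb x)) = (-1) ^ 2 * (LI x. Phi x * of_real (h2 x))"
   by (rule weak_deriv_complex[OF g(4) _ meas(1) cb(2,1,3) meas(3) h2(2,1,3) SPhi, where R=R])
    (use psi0 in \<open>auto simp: Phi_def\<close>)
  define J where "J phi k = (LI x. E x * (phi x * of_real (k x)))" for phi :: cfun and k :: "real => real"
  have Ji: "intl (\<lambda>x. E x * (phi x * of_real (k x)))"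
   if "phi \<in> schwartz" "k \<in> BM" "\<And>x. \<bar>k x\<bar> \<le> B" "0 \<le> B" for phi k B
   unfolding E_def by (rule integrable_e2_mult[OF int[OF that]]) measurable
  note J1 = Ji[OF psiS cb(1,3,4)] Ji[OF S1 cb(1,3,4)] Ji[OF S2 cb(1,3,4)]
  have e1: "J psi2 cb + om * J psi1 cb = - J psi1 h1"
  proof -
   have "(LI x. iter_deriv 1 Phi1 x * of_real (cb x)) = (LI x. E x * (psi2 x * of_real (cb x)) + om * (E x * (psi1 x * of_real (cb x))))"
    unfolding iPhi1 by (intro lintegral_cong refl) (simp add: algebra_simps)
   also have "... = J psi2 cb + om * J psi1 cb" unfolding J_def using J1 by simp
   finally show ?thesis using w1 by (simp add: J_def Phi1_def mult.assoc)
  qed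
  have e2': "J psi2 cb + 2 * om * J psi1 cb + om * om * J psi cb = J psi h2"
  proof -
   have "(LI x. iter_deriv 2 Phi x * of_real (cb x)) = (LI x. E x * (psi2 x * of_real (cb x)) + (2 * om) * (E x * (psi1 x * of_real (cb x))) + (om * om) * (E x * (psi x * of_real (cb x))))"
    unfolding iPhi2 by (intro lintegral_cong refl) (simp add: algebra_simps)
   also have "... = J psi2 cb + 2 * om * J psi1 cb + om * om * J psi cb" unfolding J_def using J1 by simp
   finally show ?thesis using w2 by (simp add: J_def Phi_def mult.assoc)
  qed
  have fv: "fourier v zeta = J psi cb" unfolding fourier_eq[OF vm] J_def by (simp add: v_def E_def mult.commute[of zeta])
  have fu: "fourier u zeta = J psi2 cb + (2 * J psi1 h1 + J psi h2)"
  proof -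
   have "fourier u zeta = (LI x. E x * (psi2 x * of_real (cb x)) + (2 * (E x * (psi1 x * of_real (h1 x))) + E x * (psi x * of_real (h2 x))))"
    unfolding fourier_eq[OF borel_of_integrable[OF ui]]
    by (intro lintegral_cong refl) (simp add: u_def E_def mult.commute[of zeta] algebra_simps)
   also have "... = J psi2 cb + (2 * J psi1 h1 + J psi h2)"
    unfolding J_def using J1(3) Ji[OF S1 h1(1,3,4)] Ji[OF psiS h2(1,3,4)] by simp
   finally show ?thesis .
  qed
  have ww: "om * om = - of_real ((2 * pi * zeta)\<^sup>2)" by (simp add: om_def power2_eq_square)
  have "om * om * J psi cb = J psi h2 + J psi2 cb - 2 * (J psi2 cb + om * J psi1 cb)"
   using e2' by (simp add: algebra_simps)
  then have "om * om * J psi cb = fourier u zeta" unfolding e1 fu by simp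
  then show ?thesis unfolding ww fv by (simp add: neg_eq_iff_add_eq_0 add_eq_0_iff)
 qed
 note bv = bessel_fourier[OF vi vL] and bu = bessel_fourier[OF ui uL]
 have hL: "L2 (\<lambda>xi. of_real (1 + xi\<^sup>2) * fourier v xi)"
 proof -
  have "of_real (1 + xi\<^sup>2) * fourier v xi = fourier v xi + of_real (- 1 / (2 * pi)\<^sup>2) * fourier u xi" for xi
  proof -
   have "of_real (1 + xi\<^sup>2) * fourier v xi = fourier v xi + of_real (1 / (2 * pi)\<^sup>2) * (of_real ((2 * pi * xi)\<^sup>2) * fourier v xi)"
    unfolding mult.assoc[symmetric] of_real_mult[symmetric] by (simp add: power_mult_distrib distrib_right)
   then show ?thesis unfolding key by simp
  qed
  then show ?thesis by (simp only:) (intro L2_add L2_cmult bv(1) bu(1))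
 qed
 have hm: "fourier v \<in> BM" by (rule fourier_measurable[OF vm])
 obtain V' M where reg: "regular (\<lambda>x. 0 + Re (LI xi. e2 (x * xi) * fourier v xi)) V' M"
  using regular_fourier_integral[OF hL hm] by blast
 have "AE x in lborel. v x = (LI xi. e2 (x * xi) * fourier v xi)"
 proof (rule fourier_integral_AE_eq[OF weighted_L2_integrable[OF hL hm] vm])
  fix phi :: cfun assume phi: "phi \<in> schwartz"
  show "intl (\<lambda>x. v x * phi x)" by (rule L2_schwartz_integrable[OF vL phi])
  show "(LI x. v x * fourier phi x) = (LI xi. fourier v xi * phi xi)"
   by (rule fourier_pairing[OF vi schwartz_integrable[OF phi], symmetric])
 qed
 then have "AE x in lebesgue. v x = (LI xi. e2 (x * xi) * fourier v xi)" by (rule AE_completion)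
 with cb(2) have "AE x in lebesgue. x \<in> {x0 - 1<..<x0 + 1} \<longrightarrow> c x = 0 + Re (LI xi. e2 (x * xi) * fourier v xi)"
 proof eventually_elim
  case (elim x)
  show ?case
  proof
   assume "x \<in> {x0 - 1<..<x0 + 1}"
   then have "P x = 1" using P(2) by auto
   then have "v x = of_real (c x)" using elim(1) by (simp add: v_def psi_def)
   then show "c x = 0 + Re (LI xi. e2 (x * xi) * fourier v xi)" using elim(2) by simp
  qed
 qed
 with reg meas(1) show ?thesis using that by blast
qed

text \<open>Since \<open>c1 < 2\<close>, the number \<open>1/c1\<close> exceeds \<open>1/2\<close>,
  and either alternative provides at least two derivatives.\<close>

lemma admissible_regular:
 assumes "0 < c1" "c1 < c2" "c2 \<le> 2" and adm: "admissible c1 c2 c"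
 obtains V V' M where "regular V V' M" "AE x in lebesgue. x \<in> {x0 - 1<..<x0 + 1} \<longrightarrow> c x = V x" "c \<in> borel_measurable lebesgue"
proof -
 have "1 / 2 \<le> 1 / c2" using assms by (intro divide_left_mono) auto
 also have "1 / c2 < 1 / c1" using assms by (intro divide_strict_left_mono) auto
 finally have c1: "1 / 2 < 1 / c1" .
 from adm consider (W) N :: nat where "real N > 3/2 + 1 / c1" "c \<in> sobolev_W_inf N"
  | (H) c0 s where "s > 3/2 + 1 / c1" "(\<lambda>x. c x - c0) \<in> sobolev_H s"
  unfolding admissible_def by blast
 then show ?thesis
 proof cases
  case W
  then have "2 \<le> N" using c1 by linarith
  then show ?thesis using sobolev_W_regular[OF _ W(2)] that by blast
 next
  case H
  then have "2 \<le> s" using c1 by linarith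
  then obtain V V' M where r: "regular V V' M" and ae: "AE x in lebesgue. c x = V x" and m: "c \<in> borel_measurable lebesgue"
   using sobolev_H_regular[OF _ H(2)] by blast
  have "AE x in lebesgue. x \<in> {x0 - 1<..<x0 + 1} \<longrightarrow> c x = V x" using ae by eventually_elim simp
  with r m show ?thesis using that by blast
 qed
qed

section \<open>Kernels\<close>

lemma peetre: "jp p \<le> jp q * (1 + \<bar>p - q\<bar>)"
proof -
 have "jp p = norm (Complex 1 p)" "jp q = norm (Complex 1 q)" by (simp_all add: jp_def cmod_def)
 moreover have "norm (Complex 1 p) \<le> norm (Complex 1 q) + norm (Complex 0 (p - q))"
  using norm_triangle_ineq[of "Complex 1 q" "Complex 0 (p - q)"] by (simp add: complex_eq_iff plus_complex.code)
 moreover have "norm (Complex 0 (p - q)) = \<bar>p - q\<bar>" by (simp add: cmod_def)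
 ultimately have "jp p \<le> jp q + 1 * \<bar>p - q\<bar>" by simp
 also have "... \<le> jp q + jp q * \<bar>p - q\<bar>" by (intro add_left_mono mult_right_mono jp_ge_1) simp
 finally show ?thesis by (simp add: distrib_left)
qed

lemma jp_powr_mono: "s \<le> s' ==> jp p powr s \<le> jp p powr s'"
 by (rule powr_mono) (use jp_ge_1[of p] in auto)

lemma jp_powr_peetre:
 assumes "0 \<le> s" "s \<le> real N" "0 \<le> t" "t \<le> 1"
 shows "jp (t * eta) powr s \<le> jp (t * xi) powr s * (1 + \<bar>xi - eta\<bar>) ^ N"
proof -
 have "\<bar>t * eta - t * xi\<bar> = t * \<bar>xi - eta\<bar>"
  using assms(3) by (simp add: right_diff_distrib[symmetric] abs_mult abs_minus_commute)
 also have "... \<le> 1 * \<bar>xi - eta\<bar>" by (intro mult_right_mono) (use assms in auto)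
 finally have "jp (t * eta) \<le> jp (t * xi) * (1 + \<bar>xi - eta\<bar>)"
  by (intro order_trans[OF peetre[of _ "t * xi"]] mult_left_mono) auto
 then have "jp (t * eta) powr s \<le> (jp (t * xi) * (1 + \<bar>xi - eta\<bar>)) powr s"
  by (intro powr_mono2 assms) auto
 also have "... = jp (t * xi) powr s * (1 + \<bar>xi - eta\<bar>) powr s" by (rule powr_mult)
 also have "(1 + \<bar>xi - eta\<bar>) powr s \<le> (1 + \<bar>xi - eta\<bar>) powr real N" by (intro powr_mono assms) auto
 also have "... = (1 + \<bar>xi - eta\<bar>) ^ N" by (rule powr_realpow) auto
 finally show ?thesis by (simp add: mult_left_mono)
qed

lemma jp_mult_le: "0 \<le> t ==> t \<le> 1 ==> jp (t * xi) \<le> 1 + \<bar>xi\<bar>"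
 by (rule order_trans[OF jp_le]) (auto simp: abs_mult intro: mult_left_le_one_le)

lemma schwartz_weighted_integrable:
 assumes "phi \<in> schwartz"
 shows "intl (\<lambda>zeta. (1 + \<bar>zeta\<bar>) ^ N * norm (phi zeta))"
proof -
 obtain C where C: "0 \<le> C" "\<And>x. (1 + \<bar>x\<bar>) ^ (N + 2) * cmod (phi x) \<le> C"
  using schwartz_weighted_bound[OF assms, of "N + 2"] by blast
 have [measurable]: "phi \<in> BM" by (rule schwartz_measurable[OF assms])
 have "intl (\<lambda>x::real. C * (1 / (1 + x\<^sup>2)))"
  by (intro integrable_mult_right integrable_inverse_1_plus_square')
 then show ?thesis
 proof (rule lintegrable_bound, goal_cases)
  case 2
  show ?case
  proof (rule AE_I2)
   fix x :: real
   have p: "0 < 1 + x\<^sup>2" by (rule one_plus_square_pos)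
   have "(1 + x\<^sup>2) \<le> (1 + \<bar>x\<bar>)\<^sup>2" by (simp add: power2_sum)
   then have "((1 + \<bar>x\<bar>) ^ N * norm (phi x)) * (1 + x\<^sup>2) \<le> ((1 + \<bar>x\<bar>) ^ N * norm (phi x)) * (1 + \<bar>x\<bar>)\<^sup>2"
    by (intro mult_left_mono) auto
   also have "... \<le> C" using C(2)[of x] by (simp add: power_add power2_eq_square mult_ac)
   finally have "(1 + \<bar>x\<bar>) ^ N * norm (phi x) \<le> C * (1 / (1 + x\<^sup>2))"
    using p by (simp add: pos_le_divide_eq)
   moreover have "0 \<le> C * (1 / (1 + x\<^sup>2))" using C(1) p by simp
   ultimately show "norm ((1 + \<bar>x\<bar>) ^ N * norm (phi x)) \<le> norm (C * (1 / (1 + x\<^sup>2)))"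
    by (simp only: real_norm_def abs_of_nonneg abs_mult abs_norm_cancel power_abs) (simp add: abs_of_nonneg C(1))
  qed
 qed simp
qed

lemma schwartz_weighted_L2:
 assumes "phi \<in> schwartz"
 shows "L2 (\<lambda>zeta. (1 + \<bar>zeta\<bar>) ^ N * norm (phi zeta))"
proof -
 obtain C where C: "0 \<le> C" "\<And>x. (1 + \<bar>x\<bar>) ^ (Suc N) * cmod (phi x) \<le> C"
  using schwartz_weighted_bound[OF assms, of "Suc N"] by blast
 have [measurable]: "phi \<in> BM" by (rule schwartz_measurable[OF assms])
 show ?thesis
 proof (rule L2_bound(1)[OF L2_inverse_weight(2) _ C(1)])
  fix x :: real
  have p: "0 < 1 + \<bar>x\<bar>" by simp
  have "((1 + \<bar>x\<bar>) ^ N * norm (phi x)) * (1 + \<bar>x\<bar>) \<le> C"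
   using C(2)[of x] by (simp add: mult_ac)
  then have "(1 + \<bar>x\<bar>) ^ N * norm (phi x) \<le> C / (1 + \<bar>x\<bar>)" using p by (simp only: pos_le_divide_eq)
  then show "norm ((1 + \<bar>x\<bar>) ^ N * norm (phi x)) \<le> C * norm (1 / (1 + \<bar>x\<bar>))" using p by simp
 qed simp
qed

lemma abs_scaled_diff:
 fixes t xi eta :: real
 assumes "0 \<le> t" "t \<le> 1"
 shows "\<bar>\<bar>t * xi\<bar> - \<bar>t * eta\<bar>\<bar> \<le> t * \<bar>xi - eta\<bar>" "\<bar>\<bar>t * xi\<bar> - \<bar>t * eta\<bar>\<bar> \<le> \<bar>xi - eta\<bar>"
proof -
 have "\<bar>\<bar>t * xi\<bar> - \<bar>t * eta\<bar>\<bar> \<le> \<bar>t * xi - t * eta\<bar>" by (rule abs_triangle_ineq3)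
 then show 1: "\<bar>\<bar>t * xi\<bar> - \<bar>t * eta\<bar>\<bar> \<le> t * \<bar>xi - eta\<bar>"
  using assms by (simp add: right_diff_distrib[symmetric] abs_mult)
 also have "... \<le> \<bar>xi - eta\<bar>" using mult_right_mono[OF assms(2), of "\<bar>xi - eta\<bar>"] by simp
 finally show "\<bar>\<bar>t * xi\<bar> - \<bar>t * eta\<bar>\<bar> \<le> \<bar>xi - eta\<bar>" .
qed

text \<open>Writing the integrand as \<open>sqrt f\<close> times \<open>sqrt f |g|\<close> in
  Cauchy-Schwarz costs one integral of \<open>f\<close>, and Fubini the other. Everything is done
  with nonnegative integrals.\<close>

lemma L2_convolution:
 fixes f g :: "real => real" and v :: cfun
 assumes f: "intl f" "\<And>x. 0 \<le> f x" and g: "L2 g" and [measurable]: "v \<in> BM"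
  and le: "\<And>y. ennreal (norm (v y)) \<le> (NI x. ennreal (f x * \<bar>g (x - y)\<bar>))"
 shows "L2 v"
proof (rule L2I_nn)
 have [measurable]: "f \<in> BM" "g \<in> BM" using borel_of_integrable[OF f(1)] L2_measurable[OF g] by auto
 define If where "If = (LI x. f x)"
 have If0: "0 \<le> If" unfolding If_def by (intro lintegral_nonneg f)
 have If: "(NI x. ennreal (f x)) = ennreal If"
  unfolding If_def by (rule nn_integral_eq_integral) (use f in auto)
 have "(ennreal (norm (v y)))\<^sup>2 \<le> ennreal If * (NI x. ennreal (f x) * (ennreal \<bar>g (x - y)\<bar>)\<^sup>2)" for y
 proof -
  have "(NI x. ennreal (f x * \<bar>g (x - y)\<bar>)) = (NI x. ennreal (sqrt (f x)) * ennreal (sqrt (f x) * \<bar>g (x - y)\<bar>))"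
   by (intro nn_integral_cong) (simp add: ennreal_mult[symmetric] f(2) mult.assoc[symmetric])
  then have "(ennreal (norm (v y)))\<^sup>2 \<le> (NI x. ennreal (sqrt (f x)) * ennreal (sqrt (f x) * \<bar>g (x - y)\<bar>))\<^sup>2"
   using le[of y] by (intro power_mono) auto
  also have "... \<le> (NI x. (ennreal (sqrt (f x)))\<^sup>2) * (NI x. (ennreal (sqrt (f x) * \<bar>g (x - y)\<bar>))\<^sup>2)"
   by (rule Cauchy_Schwarz_nn_integral) measurable
  also have "(NI x. (ennreal (sqrt (f x)))\<^sup>2) = ennreal If"
   unfolding If[symmetric] by (intro nn_integral_cong) (simp add: ennreal_power f(2))
  also have "(NI x. (ennreal (sqrt (f x) * \<bar>g (x - y)\<bar>))\<^sup>2) = (NI x. ennreal (f x) * (ennreal \<bar>g (x - y)\<bar>)\<^sup>2)"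
   by (intro nn_integral_cong) (simp add: ennreal_power ennreal_mult[symmetric] f(2) power_mult_distrib)
  finally show ?thesis .
 qed
 then have "(NI y. (ennreal (norm (v y)))\<^sup>2)
  \<le> (NI y. ennreal If * (NI x. ennreal (f x) * (ennreal \<bar>g (x - y)\<bar>)\<^sup>2))"
  by (rule nn_integral_mono)
 also have "... = ennreal If * (NI y. (NI x. ennreal (f x) * (ennreal \<bar>g (x - y)\<bar>)\<^sup>2))"
  by (rule nn_integral_cmult) measurable
 also have "(NI y. (NI x. ennreal (f x) * (ennreal \<bar>g (x - y)\<bar>)\<^sup>2))
  = (NI x. (NI y. ennreal (f x) * (ennreal \<bar>g (x - y)\<bar>)\<^sup>2))"
  by (rule lborel_pair.Fubini') measurable
 also have "... = (NI x. ennreal (f x) * ennreal ((L2norm g)\<^sup>2))"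
 proof (rule nn_integral_cong)
  fix x
  have "(NI z. (ennreal \<bar>g z\<bar>)\<^sup>2) = ennreal \<bar>- 1\<bar> * (NI y. (ennreal \<bar>g (x + - 1 * y)\<bar>)\<^sup>2)"
   by (rule nn_integral_real_affine) auto
  then have "(NI y. (ennreal \<bar>g (x - y)\<bar>)\<^sup>2) = ennreal ((L2norm g)\<^sup>2)"
   using nn_integral_L2[OF g] by simp
  then show "(NI y. ennreal (f x) * (ennreal \<bar>g (x - y)\<bar>)\<^sup>2) = ennreal (f x) * ennreal ((L2norm g)\<^sup>2)"
   by (subst nn_integral_cmult) auto
 qed
 also have "... = ennreal If * ennreal ((L2norm g)\<^sup>2)" by (subst nn_integral_multc) (auto simp: If)
 finally show "(NI y. (ennreal (norm (v y)))\<^sup>2) \<le> ennreal ((If * L2norm g)\<^sup>2)"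
  using If0 by (simp add: ennreal_mult[symmetric] power2_eq_square mult_ac)
 show "0 \<le> If * L2norm g" using If0 by simp
qed simp

text \<open>\<open>B1\<close> is written as the inverse integral of its transform, and Fubini does
  the rest. The hypotheses are those of inversion because \<open>B1\<close> will be a cutoff times
  the symbol, which is not a Schwartz function.\<close>

lemma fourier_mult_eq_convolution:
 assumes B1: "intl B1" "intl (fourier B1)" "continuous_on UNIV B1" "\<And>x. norm (B1 x) \<le> K"
  and B2: "intl B2"
 shows "fourier (\<lambda>x. B1 x * B2 x) zeta = (LI s. fourier B1 s * fourier B2 (zeta - s))"
  and "fourier (\<lambda>x. B1 x * B2 x) (xi - eta) = (LI s. fourier B1 (s - eta) * fourier B2 (xi - s))"
proof -
 have [measurable]: "B1 \<in> BM" "B2 \<in> BM"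
  using borel_of_integrable[OF B1(1)] borel_of_integrable[OF B2] by auto
 have inv: "B1 x = (LI s. e2 (x * s) * fourier B1 s)" for x
 proof -
  have "B1 x = fourier (fourier B1) (- x)" using fourier_inversion[OF B1] by simp
  also have "... = (LI s. e2 (x * s) * fourier B1 s)" by (subst fourier_eq) (simp_all add: mult.commute)
  finally show ?thesis .
 qed
 show 1: "fourier (\<lambda>x. B1 x * B2 x) zeta = (LI s. fourier B1 s * fourier B2 (zeta - s))" for zeta
 proof -
  have int: "integrable (lborel \<Otimes>\<^sub>M lborel) (\<lambda>(x, s). e2 (- (x * zeta)) * e2 (x * s) * fourier B1 s * B2 x)"
   by (rule integrable_lborel_prod[OF B2 B1(2), where C = 1]) (simp_all add: norm_mult mult_ac)
  have "fourier (\<lambda>x. B1 x * B2 x) zeta = (LI x. e2 (- (x * zeta)) * ((LI s. e2 (x * s) * fourier B1 s) * B2 x))"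
   by (subst fourier_eq) (simp_all add: inv[symmetric])
  also have "... = (LI x. LI s. e2 (- (x * zeta)) * e2 (x * s) * fourier B1 s * B2 x)"
  proof (rule lintegral_cong[OF refl])
   fix x
   have "(LI s. e2 (- (x * zeta)) * e2 (x * s) * fourier B1 s * B2 x)
    = (LI s. (e2 (- (x * zeta)) * B2 x) * (e2 (x * s) * fourier B1 s))" by (simp only: mult_ac)
   also have "... = (e2 (- (x * zeta)) * B2 x) * (LI s. e2 (x * s) * fourier B1 s)"
    by (simp only: integral_mult_right_zero)
   finally show "e2 (- (x * zeta)) * ((LI s. e2 (x * s) * fourier B1 s) * B2 x)
    = (LI s. e2 (- (x * zeta)) * e2 (x * s) * fourier B1 s * B2 x)" by (simp only: mult_ac)
  qed
  also have "... = (LI s. LI x. e2 (- (x * zeta)) * e2 (x * s) * fourier B1 s * B2 x)"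
   using lborel_pair.Fubini_integral[OF int] by simp
  also have "... = (LI s. fourier B1 s * fourier B2 (zeta - s))"
  proof (rule lintegral_cong[OF refl])
   fix s
   have e: "e2 (- (x * zeta)) * e2 (x * s) = e2 (- (x * (zeta - s)))" for x
    unfolding e2_add[symmetric] by (simp add: algebra_simps)
   have "(LI x. e2 (- (x * zeta)) * e2 (x * s) * fourier B1 s * B2 x)
    = (LI x. fourier B1 s * (e2 (- (x * (zeta - s))) * B2 x))" unfolding e by (simp only: mult_ac)
   also have "... = fourier B1 s * (LI x. e2 (- (x * (zeta - s))) * B2 x)"
    by (simp only: integral_mult_right_zero)
   also have "(LI x. e2 (- (x * (zeta - s))) * B2 x) = fourier B2 (zeta - s)" by (subst fourier_eq) simp_all
   finally show "(LI x. e2 (- (x * zeta)) * e2 (x * s) * fourier B1 s * B2 x) = fourier B1 s * fourier B2 (zeta - s)" .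
  qed
  finally show ?thesis .
 qed
 have "(LI s. fourier B1 s * fourier B2 (xi - eta - s)) = (LI s. fourier B1 (s - eta) * fourier B2 (xi - s))"
  by (subst lborel_integral_real_affine[of 1 _ "- eta"]) (simp_all add: algebra_simps)
 then show "fourier (\<lambda>x. B1 x * B2 x) (xi - eta) = (LI s. fourier B1 (s - eta) * fourier B2 (xi - s))"
  unfolding 1 .
qed

section \<open>Kernels of the localized symbol\<close>

lemma l_measurable [measurable]:
 "(\<lambda>(g, p). l0 g p) \<in> BM2" "(\<lambda>(g, p). l1 g p) \<in> BM2"
 "(\<lambda>(g, p). l2 g p) \<in> BM2" "(\<lambda>(g, p). l3 g p) \<in> BM2"
 unfolding l0_def l1_def l2_def l3_def by measurable

lemma sy_measurable [measurable (raw)]: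
 assumes [measurable]: "g \<in> borel_measurable N" "p \<in> borel_measurable N" "q \<in> borel_measurable N"
 shows "(\<lambda>x. sy j (g x) (p x) (q x)) \<in> borel_measurable N"
 unfolding sy_def by (cases "j = 0"; cases "j = 1"; cases "j = 2") simp_all

lemma l_continuous_on:
 assumes "0 < a" "0 \<le> p"
 shows "continuous_on {a..b} (\<lambda>g. l0 g p)" "continuous_on {a..b} (\<lambda>g. l1 g p)"
  "continuous_on {a..b} (\<lambda>g. l2 g p)" "continuous_on {a..b} (\<lambda>g. l3 g p)"
proof -
 have pos: "0 < g" "1 + g * p \<noteq> 0" if "g \<in> {a..b}" for g
  using that assms one_plus_pos[of g p] by auto
 show "continuous_on {a..b} (\<lambda>g. l0 g p)" "continuous_on {a..b} (\<lambda>g. l1 g p)"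
  "continuous_on {a..b} (\<lambda>g. l2 g p)"
  using l_deriv_g[OF pos(1) assms(2)] by (intro continuous_at_imp_continuous_on ballI; blast dest: DERIV_isCont)+
 have g0: "\<forall>g\<in>{a..b}. g \<noteq> 0" "\<forall>g\<in>{a..b}. 1 + g * p \<noteq> 0" "\<forall>g\<in>{a..b}. 0 < 1 + g * p"
  using pos one_plus_pos[OF pos(1) assms(2)] assms(1) by auto
 have c: "continuous_on {a..b} (\<lambda>g. inverse g)" "continuous_on {a..b} (\<lambda>g. inverse (1 + g * p))"
  by (rule continuous_on_inverse[OF _ g0(1)], rule continuous_on_id)
   (rule continuous_on_inverse[OF _ g0(2)], intro continuous_intros)
 have ln: "continuous_on {a..b} (\<lambda>g. ln (1 + g * p))"
  by (rule continuous_on_ln) (use g0(2) in \<open>auto intro!: continuous_intros\<close>)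
 show "continuous_on {a..b} (\<lambda>g. l3 g p)" unfolding l3_def
  by (intro continuous_on_add continuous_on_minus continuous_on_mult continuous_on_const continuous_on_power c ln)
qed

lemma sy_continuous_on:
 assumes "0 < a" "0 \<le> p" "0 \<le> q"
 shows "continuous_on {a..b} (\<lambda>g. sy j g p q)"
 unfolding sy_def using l_continuous_on[OF assms(1,2)] l_continuous_on[OF assms(1,3)]
 by (cases "j = 0"; cases "j = 1"; cases "j = 2") (auto intro!: continuous_intros)

lemma sy_split: "sy 0 g 0 q * sy 0 g p 0 = sy 0 g p q" by (simp add: sy_def exp_add[symmetric] l0_def)

lemma sy_0_le_1: "0 < g ==> 0 \<le> q ==> sy 0 g 0 q \<le> 1" by (simp add: sy_0_eq divide_nonneg_nonneg)

lemma p_inv_eq: "0 < c x ==> p_inv c x xi = of_real (sy 0 (c x) 0 \<bar>xi\<bar>)"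
 using one_plus_pos[of "c x" "\<bar>xi\<bar>"] by (simp add: p_inv_def sy_0_eq powr_def)

text \<open>\<open>chi\<close> is the cutoff of the theorem and \<open>chi2\<close> a second one,
  equal to 1 wherever \<open>chi\<close> does not vanish. Through \<open>chi = chi chi2\<close> a
  product of two functions of \<open>V\<close> is divided into two factors, each confined to points
  where \<open>V\<close> lies in \<open>{a..b}\<close>. By \<open>m1 + sp \<le> 1\<close> the source
  weight times the size of the symbol grows at most linearly in frequency.\<close>

locale localized_symbol = regular V V' M + symbol_bounds a b m m1 sp dl
 for V V' :: "real => real" and M a b m m1 sp dl :: real +
 fixes chi chi2 :: cfun
 assumes chi: "chi \<in> schwartz" and chi2: "chi2 \<in> schwartz" and chi2_le: "\<And>x. norm (chi2 x) \<le> 1"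
  and chi_chi2: "\<And>x. chi x * chi2 x = chi x" and Vchi2: "\<And>x. chi2 x \<noteq> 0 ==> V x \<in> {a..b}"
  and m1_sp: "m1 + sp \<le> 1"
begin

lemma Vchi: "chi x \<noteq> 0 ==> V x \<in> {a..b}" using Vchi2[of x] chi_chi2[of x] by auto

text \<open>With \<open>p = 0\<close> this is the transform of \<open>B\<close> times the symbol at
  \<open>q\<close>, with \<open>q = 0\<close> that of \<open>B\<close> divided by the symbol at
  \<open>p\<close>.\<close>

definition Kf :: "(real => complex) => real => real => real => complex" where
 "Kf B p q = fourier (\<lambda>x. B x * of_real (sy 0 (V x) p q))"

lemma Kf_eq:
 assumes [measurable]: "B \<in> BM"
 shows "Kf B p q zeta = (LI x. e2 (- (x * zeta)) * (B x * of_real (sy 0 (V x) p q)))"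
 unfolding Kf_def by (subst fourier_eq) simp_all

lemma Kf_measurable [measurable (raw)]:
 assumes [measurable]: "B \<in> BM" "p \<in> borel_measurable N" "q \<in> borel_measurable N" "zeta \<in> borel_measurable N"
 shows "(\<lambda>y. Kf B (p y) (q y) (zeta y)) \<in> borel_measurable N"
 unfolding Kf_eq[OF assms(1)] by measurable

lemma chi_measurable [measurable]: "chi \<in> BM" "chi2 \<in> BM" using schwartz_measurable chi chi2 by auto

lemma sy_derivs:
 assumes "0 \<le> p" "0 \<le> q" "j < 3" "g \<in> {a..b}"
 shows "((\<lambda>g. sy j g p q) has_real_derivative sy (Suc j) g p q) (at g)"
 by (rule sy_deriv) (use assms gb(1) in auto)

lemma Kf_taylor:
 assumes B: "B \<in> schwartz" and VB: "\<And>x. B x \<noteq> 0 ==> V x \<in> {a..b}"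
 obtains om :: "real => real" where "\<And>zeta. 0 \<le> om zeta" "om \<in> BM" "L2 (\<lambda>zeta. (1 + zeta\<^sup>2) * om zeta)"
  "\<And>p q Q zeta. 0 \<le> p ==> 0 \<le> q ==> (\<And>i g. 1 \<le> i ==> i \<le> 3 ==> g \<in> {a..b} ==> \<bar>sy i g p q\<bar> \<le> Q) ==>
   norm (Kf B p q zeta - of_real (sy 0 a p q) * fourier B zeta) \<le> Q * om zeta"
proof (rule fourier_composite_majorant[OF B ab VB], assumption, goal_cases)
 case (1 om)
 show thesis
 proof (rule that[OF 1(2-4)])
  fix p q Q zeta assume pq: "0 \<le> p" "0 \<le> q" and Q: "\<And>i g. 1 \<le> i ==> i \<le> 3 ==> g \<in> {a..b} ==> \<bar>sy i g p q\<bar> \<le> Q"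
  show "norm (Kf B p q zeta - of_real (sy 0 a p q) * fourier B zeta) \<le> Q * om zeta" unfolding Kf_def
  proof (rule 1(5)[of "\<lambda>j g. sy j g p q"])
   show "\<And>i g. i < 3 ==> g \<in> {a..b} ==> ((\<lambda>g. sy i g p q) has_real_derivative sy (Suc i) g p q) (at g)"
    by (rule sy_derivs[OF pq])
   show "continuous_on {a..b} (\<lambda>g. sy 3 g p q)" by (rule sy_continuous_on[OF a pq])
   show "(\<lambda>x. sy 0 (V x) p q) \<in> BM" by measurable
  qed (rule Q)
 qed
qed

text \<open>For a fixed Schwartz amplitude, from depth three: the leading term decays rapidly and
  \<open>om\<close> admits two weighted powers. Nothing is said about how \<open>Om\<close> depends
  on the amplitude; it serves to justify convergence and exchanges of integrals, not the final
  constants.\<close>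

lemma Kf_majorant:
 assumes B: "B \<in> schwartz" and VB: "\<And>x. B x \<noteq> 0 ==> V x \<in> {a..b}"
 obtains Om :: "real => real" where "\<And>zeta. 0 \<le> Om zeta" "Om \<in> BM" "L2 (\<lambda>zeta. (1 + zeta\<^sup>2) * Om zeta)"
  "\<And>q zeta. 0 \<le> q ==> norm (Kf B 0 q zeta) \<le> jp q powr sp * Om zeta"
  "\<And>p zeta. 0 \<le> p ==> norm (Kf B p 0 zeta) \<le> jp p powr m * Om zeta"
proof -
 obtain om where om: "\<And>zeta. 0 \<le> om zeta" "om \<in> BM" "L2 (\<lambda>zeta. (1 + zeta\<^sup>2) * om zeta)"
  "\<And>p q Q zeta. 0 \<le> p ==> 0 \<le> q ==> (\<And>i g. 1 \<le> i ==> i \<le> 3 ==> g \<in> {a..b} ==> \<bar>sy i g p q\<bar> \<le> Q) ==>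
   norm (Kf B p q zeta - of_real (sy 0 a p q) * fourier B zeta) \<le> Q * om zeta"
  by (rule Kf_taylor[OF B VB]) blast+
 have fB: "fourier B \<in> schwartz" by (rule schwartz_fourier[OF B])
 have [measurable]: "B \<in> BM" "fourier B \<in> BM" using schwartz_measurable B fB by auto
 obtain C where C: "0 \<le> C" "\<forall>g\<in>{a..b}. \<forall>p\<ge>0. \<forall>j. \<bar>sy j g 0 p\<bar> \<le> C * jp p powr sp \<and> \<bar>sy j g p 0\<bar> \<le> C * jp p powr m"
  using S3 by blast
 have main: "norm (Kf B p q zeta) \<le> Q * (om zeta + norm (fourier B zeta))"
  if pq: "0 \<le> p" "0 \<le> q" and Q: "\<And>j g. g \<in> {a..b} ==> \<bar>sy j g p q\<bar> \<le> Q" for p q Q zeta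
 proof -
  have "norm (Kf B p q zeta - of_real (sy 0 a p q) * fourier B zeta) \<le> Q * om zeta" by (rule om(4)[OF pq Q])
  moreover have "norm (of_real (sy 0 a p q) * fourier B zeta) \<le> Q * norm (fourier B zeta)"
   unfolding norm_mult norm_of_real by (rule mult_right_mono[OF Q]) (use ab in auto)
  ultimately show ?thesis using norm_triangle_sub[of "Kf B p q zeta" "of_real (sy 0 a p q) * fourier B zeta"]
   unfolding distrib_left by linarith
 qed
 have fw: "L2 (\<lambda>zeta. (1 + zeta\<^sup>2) * norm (fourier B zeta))"
 proof (rule L2_bound(1)[OF schwartz_weighted_L2[OF fB, of 2] _ zero_le_one])
  show "norm ((1 + zeta\<^sup>2) * norm (fourier B zeta)) \<le> 1 * norm ((1 + \<bar>zeta\<bar>)\<^sup>2 * norm (fourier B zeta))" for zeta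
   using mult_right_mono[OF one_plus_abs_square_le(3) norm_ge_zero[of "fourier B zeta"]] by (simp add: abs_mult)
 qed measurable
 show ?thesis
 proof (rule that[of "\<lambda>zeta. C * (om zeta + norm (fourier B zeta))"])
  show "0 \<le> C * (om zeta + norm (fourier B zeta))" for zeta using C(1) om(1)[of zeta] by simp
  show "(\<lambda>zeta. C * (om zeta + norm (fourier B zeta))) \<in> BM" using om(2) by measurable
  have "L2 (\<lambda>zeta. C * ((1 + zeta\<^sup>2) * om zeta + (1 + zeta\<^sup>2) * norm (fourier B zeta)))" by (rule L2_cmult[OF L2_add[OF om(3) fw]])
  then show "L2 (\<lambda>zeta. (1 + zeta\<^sup>2) * (C * (om zeta + norm (fourier B zeta))))" by (simp add: distrib_left mult_ac)
  show "norm (Kf B 0 q zeta) \<le> jp q powr sp * (C * (om zeta + norm (fourier B zeta)))" if "0 \<le> q" for q zeta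
   using main[of 0 q "C * jp q powr sp" zeta] that C(2) by (simp add: mult_ac)
  show "norm (Kf B p 0 zeta) \<le> jp p powr m * (C * (om zeta + norm (fourier B zeta)))" if "0 \<le> p" for p zeta
   using main[of p 0 "C * jp p powr m" zeta] that C(2) by (simp add: mult_ac)
 qed
qed

text \<open>\<open>C\<close> and \<open>N\<close> are to be fixed before \<open>B\<close>: the norm
  of \<open>mu\<close> is controlled by the \<open>L2\<close> norm of the amplitude alone, and one
  \<open>mu\<close> serves all frequencies \<open>p\<close>, \<open>q\<close>.\<close>

definition majorant :: "real => nat => (real => complex) => (real => real) => bool" where
 "majorant C N B mu \<longleftrightarrow> L2 mu \<and> L2norm mu \<le> C * L2norm B \<and> (\<forall>zeta. 0 \<le> mu zeta) \<and>
  (\<forall>q\<ge>0. \<forall>zeta. norm (Kf B 0 q zeta) \<le> jp q powr sp * mu zeta) \<and>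
  (\<forall>p\<ge>0. \<forall>zeta. norm (Kf B p 0 zeta) \<le> jp p powr m * mu zeta) \<and>
  (\<forall>p\<ge>0. \<forall>q\<ge>0. \<forall>zeta. norm (Kf B 0 q zeta - Kf B 0 p zeta) * jp q powr m1 \<le> \<bar>p - q\<bar> * (1 + \<bar>p - q\<bar>) ^ N * mu zeta)"

text \<open>Depth one combined with \<open>S3\<close> and \<open>S4\<close>: at most one derivative
  in \<open>g\<close> is involved, and the majorant is \<open>maj\<close> times a constant
  independent of \<open>B\<close>.\<close>

lemma Kf_maj:
 obtains C N where "0 \<le> C"
  "\<And>B. intl B ==> L2 B ==> (\<And>x. B x \<noteq> 0 ==> V x \<in> {a..b}) ==>
   \<exists>mu. majorant C N B mu"
proof -
 obtain C where C: "0 \<le> C" "\<forall>g\<in>{a..b}. \<forall>p\<ge>0. \<forall>j. \<bar>sy j g 0 p\<bar> \<le> C * jp p powr sp \<and> \<bar>sy j g p 0\<bar> \<le> C * jp p powr m"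
  using S3 by blast
 obtain C' N where C': "0 \<le> C'" "\<forall>g\<in>{a..b}. \<forall>p\<ge>0. \<forall>q\<ge>0. \<forall>j\<le>1.
  \<bar>sy j g 0 q - sy j g 0 p\<bar> * jp q powr m1 \<le> C' * (\<bar>p - q\<bar> * (1 + \<bar>p - q\<bar>) ^ N)"
  using S4 by blast
 define K where "K = C + C'"
 have K: "0 \<le> K" "C \<le> K" "C' \<le> K" using C(1) C'(1) by (auto simp: K_def)
 show ?thesis
 proof (rule that[of "K * (1 + (b - a))" N], goal_cases)
  case 1
  show ?case using K ab by simp
 next
  case (2 B)
  interpret composite B V a b by unfold_locales (use 2 ab in auto)
  note [measurable] = borel_of_integrable[OF 2(1)]
  let ?mu = "\<lambda>zeta. K * maj zeta"
  have le: "Q * maj zeta \<le> R * ?mu zeta" if "Q \<le> R * K" for Q R zeta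
   using mult_right_mono[OF that maj_nonneg[of zeta]] by (simp only: mult.assoc)
  have i1: "i \<le> 1 ==> i < 3" for i :: nat by simp
  show ?case unfolding majorant_def
  proof (rule exI[of _ ?mu], intro conjI allI impI)
   show "L2 ?mu" by (rule L2_cmult[OF maj_L2(1)])
   show "L2norm ?mu \<le> K * (1 + (b - a)) * L2norm B"
    unfolding L2norm_cmult[OF maj_L2(1)] using mult_left_mono[OF maj_L2(2) K(1)] K(1) by (simp add: mult.assoc)
   show "0 \<le> ?mu zeta" for zeta using K(1) maj_nonneg[of zeta] by simp
   show "norm (Kf B 0 q zeta) \<le> jp q powr sp * ?mu zeta" if q: "0 \<le> q" for q zeta
   proof (rule order_trans[OF _ le[of "C * jp q powr sp"]])
    show "norm (Kf B 0 q zeta) \<le> C * jp q powr sp * maj zeta" unfolding Kf_def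
    proof (rule fourier_le_maj[of "\<lambda>j g. sy j g 0 q"])
     show "((\<lambda>g. sy 0 g 0 q) has_real_derivative sy 1 g 0 q) (at g)" if "g \<in> {a..b}" for g
      using sy_derivs[of 0 q 0 g] that q by simp
     show "continuous_on {a..b} (\<lambda>g. sy 1 g 0 q)" by (rule sy_continuous_on[OF a]) (use q in auto)
    qed (use C q in auto)
    show "C * jp q powr sp \<le> jp q powr sp * K" using mult_right_mono[OF K(2), of "jp q powr sp"] by (simp add: mult.commute)
   qed
   show "norm (Kf B p 0 zeta) \<le> jp p powr m * ?mu zeta" if p: "0 \<le> p" for p zeta
   proof (rule order_trans[OF _ le[of "C * jp p powr m"]])
    show "norm (Kf B p 0 zeta) \<le> C * jp p powr m * maj zeta" unfolding Kf_def
    proof (rule fourier_le_maj[of "\<lambda>j g. sy j g p 0"])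
     show "((\<lambda>g. sy 0 g p 0) has_real_derivative sy 1 g p 0) (at g)" if "g \<in> {a..b}" for g
      using sy_derivs[of p 0 0 g] that p by simp
     show "continuous_on {a..b} (\<lambda>g. sy 1 g p 0)" by (rule sy_continuous_on[OF a]) (use p in auto)
    qed (use C p in auto)
    show "C * jp p powr m \<le> jp p powr m * K" using mult_right_mono[OF K(2), of "jp p powr m"] by (simp add: mult.commute)
   qed
   show "norm (Kf B 0 q zeta - Kf B 0 p zeta) * jp q powr m1 \<le> \<bar>p - q\<bar> * (1 + \<bar>p - q\<bar>) ^ N * ?mu zeta"
    if p: "0 \<le> p" and q: "0 \<le> q" for p q zeta
   proof -
    let ?r = "\<bar>p - q\<bar> * (1 + \<bar>p - q\<bar>) ^ N"
    have jq: "0 < jp q powr m1" using jp_pos[of q] by simp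
    have bd: "\<bar>sy 0 (V x) 0 r\<bar> \<le> C * jp r powr sp" if "B x \<noteq> 0" "0 \<le> r" for x r
     using C(2) VB[OF that(1)] that(2) by blast
    have i: "intl (\<lambda>x. B x * of_real (sy 0 (V x) 0 r))" if "0 \<le> r" for r
     by (rule integrable_bounded_mult[OF B_int _ bd[OF _ that]]) simp_all
    have "Kf B 0 q zeta - Kf B 0 p zeta = fourier (\<lambda>x. B x * of_real (sy 0 (V x) 0 q) - B x * of_real (sy 0 (V x) 0 p)) zeta"
     unfolding Kf_def by (rule fourier_diff[symmetric, OF i[OF q] i[OF p]])
    also have "... = fourier (\<lambda>x. B x * of_real (sy 0 (V x) 0 q - sy 0 (V x) 0 p)) zeta"
     by (simp add: right_diff_distrib)
    finally have e: "Kf B 0 q zeta - Kf B 0 p zeta = ..." .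
    have "norm (Kf B 0 q zeta - Kf B 0 p zeta) \<le> (C' * ?r / jp q powr m1) * maj zeta" unfolding e
    proof (rule fourier_le_maj[of "\<lambda>j g. sy j g 0 q - sy j g 0 p"])
     show "((\<lambda>g. sy 0 g 0 q - sy 0 g 0 p) has_real_derivative sy 1 g 0 q - sy 1 g 0 p) (at g)" if "g \<in> {a..b}" for g
      using sy_derivs[of 0 q 0 g] sy_derivs[of 0 p 0 g] that p q by (intro DERIV_diff) auto
     show "continuous_on {a..b} (\<lambda>g. sy 1 g 0 q - sy 1 g 0 p)"
      by (intro continuous_on_diff sy_continuous_on[OF a]) (use p q in auto)
     show "\<bar>sy i g 0 q - sy i g 0 p\<bar> \<le> C' * ?r / jp q powr m1" if "i \<le> 1" "g \<in> {a..b}" for i g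
      using C'(2) that p q jq by (simp add: pos_le_divide_eq)
    qed simp
    then have "norm (Kf B 0 q zeta - Kf B 0 p zeta) * jp q powr m1 \<le> (C' * ?r / jp q powr m1) * maj zeta * jp q powr m1"
     using jq by (intro mult_right_mono) auto
    also have "... = C' * ?r * maj zeta" using jq by simp
    also have "... \<le> ?r * ?mu zeta"
    proof (rule le)
     have "C' * ?r \<le> K * ?r" using K(3) by (intro mult_right_mono) auto
     then show "C' * ?r \<le> ?r * K" by (simp only: mult.commute)
    qed
    finally show ?thesis .
   qed
  qed
 qed
qed

lemma Om_integrable:
 fixes Om :: "real => real"
 assumes "L2 (\<lambda>zeta. (1 + zeta\<^sup>2) * Om zeta)"
 shows "intl (\<lambda>zeta. (1 + \<bar>zeta\<bar>) * Om zeta)"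
proof -
 have "L2 (\<lambda>zeta. of_real (1 + zeta\<^sup>2) * complex_of_real (Om zeta))"
  using L2_of_real[OF assms] by (simp only: of_real_mult)
 from integrable_Re[OF integrable_of_weighted_L2[OF this]] show ?thesis by simp
qed

text \<open>Taylor's formula at \<open>a\<close> divides the difference in two. The derivatives of
  the ratio are bounded by \<open>S1\<close> without loss and multiply \<open>om\<close>, which has
  one integrable power to spare for the factor \<open>|xi - eta|\<close>. The ratio at
  \<open>a\<close> minus one is bounded by \<open>S2\<close> with a polynomial loss and multiplies
  the rapidly decaying transform of \<open>chi\<close>. The factor \<open>t\<close> comes from the
  difference of \<open>|t xi|\<close> and \<open>|t eta|\<close>.\<close>

lemma Kf_compare:
 obtains k :: "real => real" where "intl k" "\<And>zeta. 0 \<le> k zeta"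
  "\<And>t xi eta. 0 < t ==> t \<le> 1 ==>
   norm (Kf chi \<bar>t * xi\<bar> \<bar>t * eta\<bar> (xi - eta) - fourier chi (xi - eta)) * jp (t * xi) powr (- m) * jp (t * eta) powr m1 \<le> t * k (xi - eta)"
proof -
 obtain om where om: "\<And>zeta. 0 \<le> om zeta" "om \<in> BM" "L2 (\<lambda>zeta. (1 + zeta\<^sup>2) * om zeta)"
  "\<And>p q Q zeta. 0 \<le> p ==> 0 \<le> q ==> (\<And>i g. 1 \<le> i ==> i \<le> 3 ==> g \<in> {a..b} ==> \<bar>sy i g p q\<bar> \<le> Q) ==>
   norm (Kf chi p q zeta - of_real (sy 0 a p q) * fourier chi zeta) \<le> Q * om zeta"
  by (rule Kf_taylor[OF chi Vchi]) blast+
 obtain C where C: "0 \<le> C" "\<forall>g\<in>{a..b}. \<forall>p\<ge>0. \<forall>q\<ge>0. \<forall>j\<ge>1. \<bar>sy j g p q\<bar> * jp p powr (- m) * jp q powr m1 \<le> C * \<bar>p - q\<bar>"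
  using S1 by blast
 obtain C' N where C': "0 \<le> C'" "\<forall>g\<in>{a..b}. \<forall>p\<ge>0. \<forall>q\<ge>0.
  \<bar>sy 0 g p q - 1\<bar> * jp p powr (- m) * jp q powr m1 \<le> C' * (\<bar>p - q\<bar> * (1 + \<bar>p - q\<bar>) ^ N)"
  using S2 by blast
 have fchi: "fourier chi \<in> schwartz" by (rule schwartz_fourier[OF chi])
 define k where "k zeta = C * ((1 + \<bar>zeta\<bar>) * om zeta) + C' * ((1 + \<bar>zeta\<bar>) ^ (Suc N) * norm (fourier chi zeta))" for zeta
 show ?thesis
 proof (rule that[of k])
  show "intl k" unfolding k_def[abs_def]
   by (intro lintegrable_add integrable_mult_right schwartz_weighted_integrable[OF fchi] Om_integrable[OF om(3)])
  show "0 \<le> k zeta" for zeta unfolding k_def using C(1) C'(1) om(1)[of zeta] by simp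
  fix t xi eta :: real assume t: "0 < t" "t \<le> 1"
  let ?p = "\<bar>t * xi\<bar>" and ?q = "\<bar>t * eta\<bar>" and ?zeta = "xi - eta"
  define W where "W = jp (t * xi) powr (- m) * jp (t * eta) powr m1"
  have W: "0 < W" unfolding W_def using jp_pos[of "t * xi"] jp_pos[of "t * eta"] by simp
  note pq = abs_scaled_diff(1)[OF less_imp_le[OF t(1)] t(2), of xi eta] and pq' = abs_scaled_diff(2)[OF less_imp_le[OF t(1)] t(2), of xi eta]
  have "norm (Kf chi ?p ?q ?zeta - of_real (sy 0 a ?p ?q) * fourier chi ?zeta) \<le> (C * \<bar>?p - ?q\<bar> / W) * om ?zeta"
  proof (rule om(4))
   show "\<bar>sy i g ?p ?q\<bar> \<le> C * \<bar>?p - ?q\<bar> / W" if "1 \<le> i" "i \<le> 3" "g \<in> {a..b}" for i g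
   proof -
    have "\<bar>sy i g ?p ?q\<bar> * jp ?p powr (- m) * jp ?q powr m1 \<le> C * \<bar>?p - ?q\<bar>"
     by (rule C(2)[rule_format]) (use that in auto)
    then show ?thesis unfolding pos_le_divide_eq[OF W] unfolding W_def jp_abs by (simp only: mult.assoc)
   qed
  qed simp_all
  then have "norm (Kf chi ?p ?q ?zeta - of_real (sy 0 a ?p ?q) * fourier chi ?zeta) * W \<le> C * \<bar>?p - ?q\<bar> * om ?zeta"
   using mult_right_mono[of _ _ W] W by fastforce
  also have "... \<le> C * (t * \<bar>?zeta\<bar>) * om ?zeta" by (intro mult_right_mono mult_left_mono pq C(1) om(1))
  finally have 1: "norm (Kf chi ?p ?q ?zeta - of_real (sy 0 a ?p ?q) * fourier chi ?zeta) * W \<le> t * (C * (\<bar>?zeta\<bar> * om ?zeta))"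
   by (simp only: mult_ac)
  have "a \<in> {a..b}" using ab by simp
  then have "\<bar>sy 0 a ?p ?q - 1\<bar> * jp ?p powr (- m) * jp ?q powr m1 \<le> C' * (\<bar>?p - ?q\<bar> * (1 + \<bar>?p - ?q\<bar>) ^ N)"
   by (intro C'(2)[rule_format]) auto
  then have "\<bar>sy 0 a ?p ?q - 1\<bar> * W \<le> C' * (\<bar>?p - ?q\<bar> * (1 + \<bar>?p - ?q\<bar>) ^ N)"
   unfolding W_def jp_abs by (simp only: mult.assoc)
  also have "... \<le> C' * ((t * \<bar>?zeta\<bar>) * (1 + \<bar>?zeta\<bar>) ^ N)"
   by (intro mult_left_mono mult_mono power_mono pq C'(1)) (use pq' t in auto)
  finally have 2: "\<bar>sy 0 a ?p ?q - 1\<bar> * W \<le> t * (C' * (\<bar>?zeta\<bar> * (1 + \<bar>?zeta\<bar>) ^ N))"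
   by (simp only: mult_ac)
  have n: "norm (of_real (sy 0 a ?p ?q) * fourier chi ?zeta - fourier chi ?zeta) = \<bar>sy 0 a ?p ?q - 1\<bar> * norm (fourier chi ?zeta)"
  proof -
   have "of_real (sy 0 a ?p ?q) * fourier chi ?zeta - fourier chi ?zeta = of_real (sy 0 a ?p ?q - 1) * fourier chi ?zeta"
    by (simp add: left_diff_distrib)
   then show ?thesis by (simp only: norm_mult norm_of_real)
  qed
  have 3: "norm (of_real (sy 0 a ?p ?q) * fourier chi ?zeta - fourier chi ?zeta) * W \<le> t * (C' * (\<bar>?zeta\<bar> * (1 + \<bar>?zeta\<bar>) ^ N * norm (fourier chi ?zeta)))"
   using mult_right_mono[OF 2 norm_ge_zero[of "fourier chi ?zeta"]] unfolding n by (simp only: mult_ac)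
  have "norm (Kf chi ?p ?q ?zeta - fourier chi ?zeta) * W \<le> (norm (Kf chi ?p ?q ?zeta - of_real (sy 0 a ?p ?q) * fourier chi ?zeta)
   + norm (of_real (sy 0 a ?p ?q) * fourier chi ?zeta - fourier chi ?zeta)) * W"
   by (intro mult_right_mono norm_diff_triangle_le[OF order_refl order_refl]) (use W in auto)
  also have "... \<le> t * (C * (\<bar>?zeta\<bar> * om ?zeta)) + t * (C' * (\<bar>?zeta\<bar> * (1 + \<bar>?zeta\<bar>) ^ N * norm (fourier chi ?zeta)))"
   unfolding distrib_right using 1 3 by (rule add_mono)
  also have "... \<le> t * k ?zeta" unfolding k_def distrib_left[of t] power_Suc using t C(1) C'(1) om(1)
   by (intro add_mono mult_left_mono mult_right_mono) auto
  finally show "norm (Kf chi ?p ?q ?zeta - fourier chi ?zeta) * jp (t * xi) powr (- m) * jp (t * eta) powr m1 \<le> t * k ?zeta"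
   unfolding W_def by (simp only: mult.assoc)
 qed
qed

end

lemma schwartz_convolution:
 assumes B1: "B1 \<in> schwartz" and B2: "intl B2"
 shows "fourier (\<lambda>x. B1 x * B2 x) zeta = (LI s. fourier B1 s * fourier B2 (zeta - s))"
  and "fourier (\<lambda>x. B1 x * B2 x) (xi - eta) = (LI s. fourier B1 (s - eta) * fourier B2 (xi - s))"
proof -
 obtain K where K: "\<And>x. norm (B1 x) \<le> K" by (rule schwartz_bounded[OF B1]) blast
 note p = schwartz_integrable[OF B1] schwartz_integrable[OF schwartz_fourier[OF B1]]
  smooth_continuous_0[OF schwartz_smooth[OF B1], of UNIV] K B2
 show "fourier (\<lambda>x. B1 x * B2 x) zeta = (LI s. fourier B1 s * fourier B2 (zeta - s))"
  by (rule fourier_mult_eq_convolution(1)[OF p])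
 show "fourier (\<lambda>x. B1 x * B2 x) (xi - eta) = (LI s. fourier B1 (s - eta) * fourier B2 (xi - s))"
  by (rule fourier_mult_eq_convolution(2)[OF p])
qed

lemma schwartz_mult: "f \<in> schwartz ==> g \<in> schwartz ==> (\<lambda>x. f x * g x) \<in> schwartz"
 by (rule schwartz_mult_slow[OF _ schwartz_slow])

definition weighted :: "real => real => (real => complex) => real => complex" where
 "weighted t s w eta = wt t s eta * w eta"

lemma norm_weighted: "norm (weighted t s w eta) = jp (t * eta) powr s * norm (w eta)"
 by (simp add: weighted_def norm_mult cmod_wt)

lemma norm_eq_weighted: "norm (w eta) = jp (t * eta) powr s * norm (weighted t (- s) w eta)"
proof -
 have "jp (t * eta) powr s * jp (t * eta) powr (- s) = 1"
  using jp_pos[of "t * eta"] by (simp add: powr_add[symmetric])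
 then show ?thesis unfolding norm_weighted by (simp add: mult.assoc[symmetric])
qed

context localized_symbol
begin

lemma sy_bound:
 assumes "0 \<le> p" "0 \<le> q"
 obtains Q where "0 \<le> Q" "\<And>g. g \<in> {a..b} ==> \<bar>sy 0 g p q\<bar> \<le> Q"
proof -
 have "compact ((\<lambda>g. sy 0 g p q) ` {a..b})"
  by (intro compact_continuous_image sy_continuous_on[OF a assms]) simp
 then have "bounded ((\<lambda>g. sy 0 g p q) ` {a..b})" by (rule compact_imp_bounded)
 then obtain Q where "\<forall>x\<in>(\<lambda>g. sy 0 g p q) ` {a..b}. norm x \<le> Q" unfolding bounded_iff by blast
 then have Q: "\<bar>sy 0 g p q\<bar> \<le> Q" if "g \<in> {a..b}" for g using that by simp
 show ?thesis by (rule that[of "max 0 Q"]) (use Q in force)+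
qed

lemma Kf_integrand_integrable:
 fixes B :: cfun
 assumes "intl B" "\<And>x. B x \<noteq> 0 ==> V x \<in> {a..b}" "0 \<le> p" "0 \<le> q"
 shows "intl (\<lambda>x. B x * of_real (sy 0 (V x) p q))"
proof -
 obtain Q where Q: "0 \<le> Q" "\<And>g. g \<in> {a..b} ==> \<bar>sy 0 g p q\<bar> \<le> Q" using sy_bound[OF assms(3,4)] by blast
 show ?thesis by (rule integrable_bounded_mult[OF assms(1) _ Q(2)[OF assms(2)]]) simp_all
qed

lemma Kf_mult_schwartz:
 assumes B: "B \<in> schwartz" and phi: "phi \<in> schwartz" and VB: "\<And>x. B x \<noteq> 0 ==> V x \<in> {a..b}"
  and pq: "0 \<le> p" "0 \<le> q"
 shows "Kf (\<lambda>x. B x * phi x) p q (xi - eta) = (LI s. fourier phi (s - eta) * Kf B p q (xi - s))"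
proof -
 have "Kf (\<lambda>x. B x * phi x) p q (xi - eta) = fourier (\<lambda>x. phi x * (B x * of_real (sy 0 (V x) p q))) (xi - eta)"
  by (simp add: Kf_def mult_ac)
 also have "... = (LI s. fourier phi (s - eta) * Kf B p q (xi - s))"
  unfolding Kf_def by (rule schwartz_convolution(2)[OF phi Kf_integrand_integrable[OF schwartz_integrable[OF B] VB pq]])
 finally show ?thesis .
qed

text \<open>Collects the hypotheses of Fourier inversion for \<open>chi\<close> times the symbol,
  which is not a Schwartz function; integrability of its transform rests on the majorant of depth
  three.\<close>

lemma chi_sy_regular:
 assumes "0 \<le> q"
 shows "intl (\<lambda>x. chi x * of_real (sy 0 (V x) 0 q))"
  and "intl (Kf chi 0 q)"
  and "continuous_on UNIV (\<lambda>x. chi x * complex_of_real (sy 0 (V x) 0 q))"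
  and "\<exists>K. \<forall>x. norm (chi x * complex_of_real (sy 0 (V x) 0 q)) \<le> K"
proof -
 show "intl (\<lambda>x. chi x * of_real (sy 0 (V x) 0 q))"
  by (rule Kf_integrand_integrable[OF schwartz_integrable[OF chi] Vchi]) (use assms in auto)
 obtain Om :: "real => real" where Om: "\<And>zeta. 0 \<le> Om zeta" "Om \<in> BM" "L2 (\<lambda>zeta. (1 + zeta\<^sup>2) * Om zeta)"
  "\<And>q zeta. 0 \<le> q ==> norm (Kf chi 0 q zeta) \<le> jp q powr sp * Om zeta"
  by (rule Kf_majorant[OF chi Vchi]) blast+
 have i: "intl (\<lambda>zeta. jp q powr sp * ((1 + \<bar>zeta\<bar>) * Om zeta))"
  by (rule integrable_mult_right[OF Om_integrable[OF Om(3)]])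
 show "intl (Kf chi 0 q)"
 proof (rule lintegrable_bound[OF i])
  show "AE x in lborel. norm (Kf chi 0 q x) \<le> norm (jp q powr sp * ((1 + \<bar>x\<bar>) * Om x))"
  proof (rule AE_I2)
   fix x :: real
   have "1 * Om x \<le> (1 + \<bar>x\<bar>) * Om x" by (intro mult_right_mono Om(1)) simp
   then have "jp q powr sp * Om x \<le> jp q powr sp * ((1 + \<bar>x\<bar>) * Om x)" by (intro mult_left_mono) auto
   with Om(4)[OF assms, of x] show "norm (Kf chi 0 q x) \<le> norm (jp q powr sp * ((1 + \<bar>x\<bar>) * Om x))"
    using abs_ge_self[of "jp q powr sp * ((1 + \<bar>x\<bar>) * Om x)"] unfolding real_norm_def by linarith
  qed
 qed measurable
 \<comment> \<open>Where \<open>chi\<close> vanishes, \<open>V x\<close> may leave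
   \<open>{a..b}\<close>, the range on which the symbol is known to be continuous in
   \<open>g\<close> and at most 1. Clamping \<open>V\<close> to this range changes nothing after
   multiplication by \<open>chi\<close>.\<close>
 have cl: "max a (min b (V x)) \<in> {a..b}" for x using ab by auto
 have e: "chi x * complex_of_real (sy 0 (V x) 0 q) = chi x * complex_of_real (sy 0 (max a (min b (V x))) 0 q)" for x
  using Vchi[of x] by (cases "chi x = 0") (simp_all add: min_absorb2 max_absorb2)
 have "continuous_on UNIV (\<lambda>x. sy 0 (max a (min b (V x))) 0 q)"
 proof (rule continuous_on_compose2[OF sy_continuous_on[OF a, of 0 q b]])
  show "continuous_on UNIV (\<lambda>x. max a (min b (V x)))" by (intro continuous_intros cV)
 qed (use cl assms in auto)
 then show "continuous_on UNIV (\<lambda>x. chi x * complex_of_real (sy 0 (V x) 0 q))"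
  unfolding e by (intro continuous_intros smooth_continuous_0[OF schwartz_smooth[OF chi]])
 obtain K where K: "0 \<le> K" "\<And>x. norm (chi x) \<le> K" by (rule schwartz_bounded[OF chi]) blast
 have "norm (chi x * complex_of_real (sy 0 (V x) 0 q)) \<le> K" for x
 proof -
  have "0 < sy 0 (max a (min b (V x))) 0 q" "sy 0 (max a (min b (V x))) 0 q \<le> 1"
   using sy_pos sy_0_le_1[OF gb(1)[OF cl] assms] by auto
  then have "norm (chi x * complex_of_real (sy 0 (V x) 0 q)) \<le> norm (chi x) * 1"
   unfolding e norm_mult norm_of_real by (intro mult_left_mono) auto
  then show ?thesis using K(2)[of x] by simp
 qed
 then show "\<exists>K. \<forall>x. norm (chi x * complex_of_real (sy 0 (V x) 0 q)) \<le> K" by blast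
qed

lemma Kf_chi_convolution:
 assumes q: "0 \<le> q" and B: "intl B"
 shows "Kf (\<lambda>x. chi x * B x) 0 q (xi - eta) = (LI s. Kf chi 0 q (s - eta) * fourier B (xi - s))"
proof -
 obtain K where K: "\<And>x. norm (chi x * complex_of_real (sy 0 (V x) 0 q)) \<le> K" using chi_sy_regular(4)[OF q] by blast
 have "Kf (\<lambda>x. chi x * B x) 0 q (xi - eta) = fourier (\<lambda>x. (chi x * complex_of_real (sy 0 (V x) 0 q)) * B x) (xi - eta)"
  unfolding Kf_def by (simp only: mult_ac)
 also have "... = (LI s. Kf chi 0 q (s - eta) * fourier B (xi - s))" unfolding Kf_def
  by (rule fourier_mult_eq_convolution(2)[OF chi_sy_regular(1)[OF q] _ chi_sy_regular(3)[OF q] K B])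
   (use chi_sy_regular(2)[OF q] in \<open>simp add: Kf_def\<close>)
 finally show ?thesis .
qed

text \<open>The exact composition: the ratio splits into the symbol at \<open>q\<close> and the
  reciprocal symbol at \<open>p\<close>, \<open>chi\<close> into \<open>chi chi2\<close>, and the
  transform of the product is a convolution. This takes the place of an asymptotic expansion for the
  composed operators.\<close>

lemma Kf_factor:
 assumes "0 \<le> p" "0 \<le> q"
 shows "Kf chi p q (xi - eta) = (LI s. Kf chi 0 q (s - eta) * Kf chi2 p 0 (xi - s))"
proof -
 have "chi x * of_real (sy 0 (V x) p q) = chi x * (chi2 x * of_real (sy 0 (V x) p 0)) * complex_of_real (sy 0 (V x) 0 q)" for x
 proof -
  have "chi x * (chi2 x * of_real (sy 0 (V x) p 0)) * complex_of_real (sy 0 (V x) 0 q)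
   = (chi x * chi2 x) * of_real (sy 0 (V x) 0 q * sy 0 (V x) p 0)" by (simp add: mult_ac)
  then show ?thesis by (simp only: chi_chi2 sy_split)
 qed
 then have "Kf chi p q (xi - eta) = Kf (\<lambda>x. chi x * (chi2 x * of_real (sy 0 (V x) p 0))) 0 q (xi - eta)"
  by (simp only: Kf_def)
 also have "... = (LI s. Kf chi 0 q (s - eta) * fourier (\<lambda>x. chi2 x * of_real (sy 0 (V x) p 0)) (xi - s))"
  by (rule Kf_chi_convolution[OF assms(2) Kf_integrand_integrable[OF schwartz_integrable[OF chi2] Vchi2 assms(1)]]) simp_all
 finally show ?thesis by (simp add: Kf_def)
qed

section \<open>The localized transform\<close>

abbreviation wm :: "real => cfun => cfun" where "wm t w \<equiv> weighted t (- m1) w"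

definition wdata :: "real => (real => complex) => bool" where
 "wdata t w \<longleftrightarrow> 0 < t \<and> t \<le> 1 \<and> w \<in> BM \<and> L2 (wm t w)"

definition z :: "(real => complex) => real => complex" where
 "z w xi = (LI eta. fourier chi (xi - eta) * w eta)"

text \<open>The 1 is added so that \<open>N1\<close> is at least 1 even for \<open>m1 = 0\<close>;
  see \<open>one_le_N1\<close>.\<close>

definition N1 :: nat where "N1 = nat \<lceil>m1\<rceil> + 1"

lemma N1: "m1 \<le> real N1" unfolding N1_def by linarith

lemma fchi: "fourier chi \<in> schwartz" by (rule schwartz_fourier[OF chi])

lemma fchi_measurable [measurable]: "fourier chi \<in> BM" by (rule schwartz_measurable[OF fchi])

lemma z_measurable [measurable (raw)]:
 assumes "w \<in> BM" and [measurable]: "f \<in> borel_measurable N"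
 shows "(\<lambda>x. z w (f x)) \<in> borel_measurable N"
proof -
 note [measurable] = assms(1)
 show ?thesis unfolding z_def by measurable
qed

lemma norm_w_le:
 assumes "0 \<le> t" "t \<le> 1"
 shows "norm (w eta) \<le> jp (t * xi) powr m1 * (1 + \<bar>xi - eta\<bar>) ^ N1 * norm (wm t w eta)"
 unfolding norm_eq_weighted[of w eta t m1]
 by (rule mult_right_mono[OF jp_powr_peetre[OF m1(1) N1 assms] norm_ge_zero])

lemma z_bound:
 assumes "wdata t w"
 obtains C where "0 \<le> C" "\<And>xi. norm (z w xi) \<le> C * jp (t * xi) powr m1"
  "\<And>xi. intl (\<lambda>eta. fourier chi (xi - eta) * w eta)"
proof -
 have t: "0 \<le> t" "t \<le> 1" and [measurable]: "w \<in> BM" and b: "L2 (wm t w)"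
  using assms by (auto simp: wdata_def)
 let ?g = "\<lambda>zeta. (1 + \<bar>zeta\<bar>) ^ N1 * norm (fourier chi zeta)"
 have g: "L2 ?g" by (rule schwartz_weighted_L2[OF fchi])
 have g': "L2 (\<lambda>eta. ?g (xi - eta))" "L2norm (\<lambda>eta. ?g (xi - eta)) = L2norm ?g" for xi
  using L2_shift[OF L2_reflect(1)[OF g], of "- xi"] L2norm_shift[OF L2_reflect(1)[OF g], of "- xi"] L2_reflect(2)[OF g]
  by simp_all
 have le: "norm (fourier chi (xi - eta) * w eta) \<le> jp (t * xi) powr m1 * (norm (?g (xi - eta)) * norm (wm t w eta))" for xi eta
  using mult_left_mono[OF norm_w_le[OF t, of w eta xi] norm_ge_zero[of "fourier chi (xi - eta)"]]
  by (simp add: norm_mult mult_ac)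
 have i: "intl (\<lambda>eta. jp (t * xi) powr m1 * (norm (?g (xi - eta)) * norm (wm t w eta)))" for xi
  by (rule integrable_mult_right[OF L2_norm_mult_integral_le(1)[OF g'(1) b]])
 have int: "intl (\<lambda>eta. fourier chi (xi - eta) * w eta)" for xi
  by (rule lintegrable_bound[OF i[of xi]]) (use le in \<open>auto intro!: AE_I2 order_trans[OF le]\<close>)
 show ?thesis
 proof (rule that[of "L2norm ?g * L2norm (wm t w)", OF _ _ int])
  fix xi
  have "norm (z w xi) \<le> (LI eta. norm (fourier chi (xi - eta) * w eta))"
   unfolding z_def by (rule integral_norm_bound)
  also have "... \<le> (LI eta. jp (t * xi) powr m1 * (norm (?g (xi - eta)) * norm (wm t w eta)))"
   by (rule integral_mono[OF integrable_norm[OF int] i le])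
  also have "... = jp (t * xi) powr m1 * (LI eta. norm (?g (xi - eta)) * norm (wm t w eta))"
   by (simp only: integral_mult_right_zero)
  also have "... \<le> jp (t * xi) powr m1 * (L2norm ?g * L2norm (wm t w))"
   using L2_norm_mult_integral_le(2)[OF g'(1)[of xi] b] unfolding g'(2) by (rule mult_left_mono) simp
  finally show "norm (z w xi) \<le> L2norm ?g * L2norm (wm t w) * jp (t * xi) powr m1" by (simp only: mult_ac)
 qed simp
qed

text \<open>The test function for \<open>f\<close> is the inverse transform of \<open>chi\<close>
  times \<open>fourier phi\<close>, a convolution of \<open>phi\<close> with the transform of
  \<open>chi\<close>. Young's inequality justifies the exchange, after Peetre's inequality has moved
  the source weight from \<open>eta\<close> to \<open>xi\<close>.\<close>

lemma has_FT_z: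
 assumes w: "wdata t w" and f: "has_FT f w"
 shows "has_FT (distr_mult chi f) (z w)" unfolding has_FT_def distr_mult_def
proof
 fix phi :: cfun assume phi: "phi \<in> schwartz"
 have t: "0 \<le> t" "t \<le> 1" and [measurable]: "w \<in> BM" and b: "L2 (wm t w)"
  using w by (auto simp: wdata_def)
 note [measurable] = schwartz_measurable[OF phi]
 have fphi: "fourier phi \<in> schwartz" by (rule schwartz_fourier[OF phi])
 obtain psi where psi: "psi \<in> schwartz" "fourier psi = (\<lambda>x. chi x * fourier phi x)"
   "\<And>x. psi x = fourier (\<lambda>x. chi x * fourier phi x) (- x)"
  by (rule schwartz_fourier_inverse[OF schwartz_mult[OF chi fphi]]) blast
 have psi_eq: "psi eta = (LI xi. fourier chi (xi - eta) * phi xi)" for eta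
  using schwartz_convolution(2)[OF chi schwartz_integrable[OF fphi], of 0 eta] psi(3)[of eta]
  by (simp add: schwartz_fourier_inversion[OF phi])
 have a: "L2 (weighted t m1 phi)" unfolding weighted_def[abs_def] by (rule schwartz_L2[OF schwartz_wt[OF phi]])
 have le: "norm (fourier chi (xi - eta) * w eta * phi xi)
  \<le> norm (weighted t m1 phi xi) * \<bar>(1 + \<bar>xi - eta\<bar>) ^ N1 * norm (fourier chi (xi - eta))\<bar> * norm (wm t w eta)" for xi eta
 proof -
  have "norm (fourier chi (xi - eta) * w eta * phi xi) = norm (fourier chi (xi - eta)) * norm (phi xi) * norm (w eta)"
   by (simp add: norm_mult mult_ac)
  also have "... \<le> norm (fourier chi (xi - eta)) * norm (phi xi)
   * (jp (t * xi) powr m1 * (1 + \<bar>xi - eta\<bar>) ^ N1 * norm (wm t w eta))"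
   by (intro mult_left_mono norm_w_le t) simp
  finally show ?thesis unfolding norm_weighted[of t m1 phi] abs_mult power_abs by (simp add: mult_ac)
 qed
 have "(LI xi. z w xi * phi xi) = (LI xi. LI eta. fourier chi (xi - eta) * w eta * phi xi)"
  unfolding z_def by (simp only: integral_mult_left_zero)
 also have "... = (LI eta. LI xi. fourier chi (xi - eta) * w eta * phi xi)"
  by (rule young_Fubini[OF a b schwartz_weighted_integrable[OF fchi] _ le]) measurable
 also have "... = (LI eta. w eta * psi eta)"
 proof (rule lintegral_cong[OF refl])
  fix eta
  have "(LI xi. fourier chi (xi - eta) * w eta * phi xi) = (LI xi. w eta * (fourier chi (xi - eta) * phi xi))"
   by (simp only: mult_ac)
  then show "(LI xi. fourier chi (xi - eta) * w eta * phi xi) = w eta * psi eta"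
   unfolding psi_eq by (simp only: integral_mult_right_zero)
 qed
 also have "... = f (\<lambda>x. chi x * fourier phi x)"
  using f psi(1) unfolding has_FT_def psi(2)[symmetric] by simp
 finally show "f (\<lambda>x. chi x * fourier phi x) = (LI xi. z w xi * phi xi)" by simp
qed

text \<open>A finite Sobolev norm provides some representative \<open>w'\<close>. It coincides with
  \<open>z\<close> almost everywhere, because both are transforms of the same distribution and
  integrable against Schwartz functions, \<open>z\<close> by its polynomial bound.\<close>

lemma z_unique:
 assumes w: "wdata t w" and f: "has_FT f w" and fin: "sobolev_norm t s (distr_mult chi f) < \<infinity>"
 shows "L2 (weighted t s (z w))" "sobolev_norm t s (distr_mult chi f) = ereal (L2norm (weighted t s (z w)))"
proof -
 note [measurable] = w[unfolded wdata_def, THEN conjunct2, THEN conjunct2, THEN conjunct1]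
 obtain w' where w': "w' \<in> BM" "has_FT (distr_mult chi f) w'" "L2 (\<lambda>xi. wt t s xi * w' xi)"
  by (rule sobolev_norm_finite[OF fin]) blast
 note [measurable] = w'(1)
 obtain C where C: "0 \<le> C" "\<And>xi. norm (z w xi) \<le> C * jp (t * xi) powr m1" by (rule z_bound[OF w]) blast
 have i1: "intl (\<lambda>xi. z w xi * phi xi)" if phi: "phi \<in> schwartz" for phi
 proof (rule lintegrable_bound[OF integrable_mult_right[OF integrable_norm[OF schwartz_integrable[OF schwartz_wt[OF phi]]]]])
  note [measurable] = schwartz_measurable[OF phi]
  show "(\<lambda>xi. z w xi * phi xi) \<in> borel_measurable lborel" by measurable
  show "AE xi in lborel. norm (z w xi * phi xi) \<le> norm (C * norm (wt t m1 xi * phi xi))"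
  proof (rule AE_I2)
   fix xi
   show "norm (z w xi * phi xi) \<le> norm (C * norm (wt t m1 xi * phi xi))"
    using mult_right_mono[OF C(2)[of xi] norm_ge_zero[of "phi xi"]] C(1) by (simp add: norm_mult cmod_wt mult.assoc)
  qed
 qed
 have i2: "intl (\<lambda>xi. w' xi * phi xi)" if phi: "phi \<in> schwartz" for phi
 proof -
  have "intl (\<lambda>xi. (wt t s xi * w' xi) * (wt t (- s) xi * phi xi))"
   by (rule L2_schwartz_integrable[OF w'(3) schwartz_wt[OF phi]])
  moreover have "(wt t s xi * w' xi) * (wt t (- s) xi * phi xi) = w' xi * phi xi" for xi
  proof -
   have "(wt t s xi * w' xi) * (wt t (- s) xi * phi xi) = (wt t s xi * wt t (- s) xi) * (w' xi * phi xi)" by (simp only: mult_ac)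
   then show ?thesis by (simp only: wt_inverse mult_1_left)
  qed
  ultimately show ?thesis by simp
 qed
 have "AE xi in lborel. z w xi - w' xi = 0"
 proof (rule schwartz_orthogonal_AE_zero)
  show "(\<lambda>xi. z w xi - w' xi) \<in> BM" by measurable
  fix phi :: cfun assume phi: "phi \<in> schwartz"
  show "intl (\<lambda>xi. (z w xi - w' xi) * phi xi)"
   unfolding left_diff_distrib by (rule lintegrable_diff[OF i1[OF phi] i2[OF phi]])
  have "(LI xi. z w xi * phi xi) = (LI xi. w' xi * phi xi)"
   using has_FT_z[OF w f] w'(2) phi unfolding has_FT_def by metis
  then show "(LI xi. (z w xi - w' xi) * phi xi) = 0"
   unfolding left_diff_distrib by (subst lintegral_diff[OF i1[OF phi] i2[OF phi]]) simp
 qed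
 then have ae: "AE xi in lborel. w' xi = z w xi" by eventually_elim simp
 have m: "weighted t s (z w) \<in> BM" unfolding weighted_def[abs_def] by measurable
 have "intl (\<lambda>xi. (norm (weighted t s (z w) xi))\<^sup>2) \<longleftrightarrow> intl (\<lambda>xi. (norm (wt t s xi * w' xi))\<^sup>2)"
  by (rule integrable_cong_AE) (use m ae in \<open>auto simp: weighted_def\<close>)
 then show L: "L2 (weighted t s (z w))" using w'(3) m by (simp add: L2_def)
 show "sobolev_norm t s (distr_mult chi f) = ereal (L2norm (weighted t s (z w)))"
  using sobolev_norm_has_FT[OF has_FT_z[OF w f], of t s] L unfolding weighted_def[abs_def] by simp
qed

end

section \<open>The functional \<open>Lam\<close> and the upper bound\<close>

context localized_symbol
begin

definition Lam :: "real => (real => complex) => (real => complex) => complex" where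
 "Lam t w psi = (LI eta. w eta * Kf (\<lambda>x. chi x * psi x) 0 \<bar>t * eta\<bar> (- eta))"

text \<open>\<open>u\<close> is, in the weak sense, the localized operator applied to the
  distribution with transform \<open>w\<close>.\<close>

definition Lrep :: "real => (real => complex) => (real => complex) => bool" where
 "Lrep t w u \<longleftrightarrow> wdata t w \<and> L2 u \<and> (\<forall>psi\<in>schwartz. Lam t w psi = (LI x. u x * psi x))"

lemma jp_powr_m1_sp_le:
 assumes "0 \<le> t" "t \<le> 1"
 shows "jp (t * eta) powr (m1 + sp) \<le> 1 + \<bar>eta\<bar>" "jp (t * eta) powr (m1 + sp) \<le> 2 * (1 + eta\<^sup>2)"
proof -
 have "jp (t * eta) powr (m1 + sp) \<le> jp (t * eta) powr 1" by (rule jp_powr_mono[OF m1_sp])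
 also have "... \<le> 1 + \<bar>eta\<bar>" using jp_mult_le[OF assms, of eta] jp_pos[of "t * eta"] by simp
 finally show "jp (t * eta) powr (m1 + sp) \<le> 1 + \<bar>eta\<bar>" .
 also have "1 + \<bar>eta\<bar> \<le> 2 * (1 + eta\<^sup>2)" by (rule one_plus_abs_square_le)
 finally show "jp (t * eta) powr (m1 + sp) \<le> 2 * (1 + eta\<^sup>2)" .
qed

text \<open>The weight \<open>m1\<close> and the symbol of order \<open>sp\<close> together grow at
  most linearly, which stays within the two weighted powers of \<open>Om\<close>.\<close>

lemma Kf_L2:
 assumes t: "0 < t" "t \<le> 1" and B: "B \<in> schwartz" "\<And>x. B x \<noteq> 0 ==> V x \<in> {a..b}"
 shows "L2 (weighted t m1 (\<lambda>eta. Kf B 0 \<bar>t * eta\<bar> (- eta)))"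
proof -
 note [measurable] = schwartz_measurable[OF B(1)]
 obtain Om :: "real => real" where Om: "\<And>zeta. 0 \<le> Om zeta" "L2 (\<lambda>zeta. (1 + zeta\<^sup>2) * Om zeta)"
  "\<And>q zeta. 0 \<le> q ==> norm (Kf B 0 q zeta) \<le> jp q powr sp * Om zeta"
  by (rule Kf_majorant[OF B]) blast+
 show ?thesis
 proof (rule L2_bound(1)[OF L2_reflect(1)[OF Om(2)]])
  show "weighted t m1 (\<lambda>eta. Kf B 0 \<bar>t * eta\<bar> (- eta)) \<in> BM"
   unfolding weighted_def[abs_def] by measurable
  fix eta :: real
  have "norm (weighted t m1 (\<lambda>eta. Kf B 0 \<bar>t * eta\<bar> (- eta)) eta) \<le> jp (t * eta) powr m1 * (jp \<bar>t * eta\<bar> powr sp * Om (- eta))"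
   unfolding norm_weighted by (intro mult_left_mono Om(3)) auto
  also have "... = jp (t * eta) powr (m1 + sp) * Om (- eta)" by (simp add: powr_add)
  also have "... \<le> (2 * (1 + eta\<^sup>2)) * Om (- eta)"
   by (rule mult_right_mono[OF jp_powr_m1_sp_le(2) Om(1)]) (use t in auto)
  also have "... = 2 * norm ((1 + (- eta)\<^sup>2) * Om (- eta))" using Om(1)[of "- eta"] by (simp add: abs_mult)
  finally show "norm (weighted t m1 (\<lambda>eta. Kf B 0 \<bar>t * eta\<bar> (- eta)) eta) \<le> 2 * norm ((1 + (- eta)\<^sup>2) * Om (- eta))" .
 qed simp
qed

lemma chi_mult: 
 assumes "psi \<in> schwartz"
 shows "(\<lambda>x. chi x * psi x) \<in> schwartz" "(\<lambda>x. chi2 x * psi x) \<in> schwartz"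
  and "\<And>x. chi x * psi x \<noteq> 0 ==> V x \<in> {a..b}" "\<And>x. chi2 x * psi x \<noteq> 0 ==> V x \<in> {a..b}"
 using schwartz_mult[OF chi assms] schwartz_mult[OF chi2 assms] Vchi Vchi2 by auto

lemma weighted_mult: "weighted t (- s) w eta * weighted t s v eta = w eta * v eta"
proof -
 have "weighted t (- s) w eta * weighted t s v eta = (wt t s eta * wt t (- s) eta) * (w eta * v eta)"
  unfolding weighted_def by (simp only: mult_ac)
 then show ?thesis by (simp only: wt_inverse mult_1_left)
qed

lemma weighted_diff: "weighted t s (\<lambda>xi. f xi - g xi) = (\<lambda>xi. weighted t s f xi - weighted t s g xi)"
 by (simp add: weighted_def fun_eq_iff right_diff_distrib)

lemma Lam_integrable:
 assumes w: "wdata t w" and psi: "psi \<in> schwartz"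
 shows "intl (\<lambda>eta. w eta * Kf (\<lambda>x. chi x * psi x) 0 \<bar>t * eta\<bar> (- eta))"
proof -
 have "L2 (weighted t m1 (\<lambda>eta. Kf (\<lambda>x. chi x * psi x) 0 \<bar>t * eta\<bar> (- eta)))"
  by (rule Kf_L2) (use w psi chi_mult in \<open>auto simp: wdata_def\<close>)
 from L2_mult_integrable[OF _ this, of "wm t w"] w
 show ?thesis unfolding weighted_mult by (simp add: wdata_def)
qed

text \<open>For Schwartz \<open>g\<close> the double integral converges absolutely, since the symbol
  is at most 1 where the amplitude lives. \<open>c\<close> may be replaced by \<open>V\<close>, as
  the two agree for almost every \<open>x\<close> with \<open>chi x \<noteq> 0\<close>;
  measurability of the localized output is inherited through this equality.\<close>

lemma quant_schwartz_pairing: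
 assumes c: "AE x in lebesgue. chi x \<noteq> 0 \<longrightarrow> c x = V x" and psi: "psi \<in> schwartz" and g: "g \<in> schwartz"
 shows "distr_of_fun (quant_schwartz (p_inv c) t g) (\<lambda>x. chi x * psi x)
  = (LI eta. fourier g eta * Kf (\<lambda>x. chi x * psi x) 0 \<bar>t * eta\<bar> (- eta))"
proof -
 define B where "B = (\<lambda>x. chi x * psi x)"
 have B: "B \<in> schwartz" and VB: "\<And>x. B x \<noteq> 0 ==> V x \<in> {a..b}" using chi_mult[OF psi] by (auto simp: B_def)
 have fg: "fourier g \<in> schwartz" by (rule schwartz_fourier[OF g])
 note [measurable] = schwartz_measurable[OF B] schwartz_measurable[OF fg]
 define G where "G x = (LI xi. e2 (x * xi) * of_real (sy 0 (V x) 0 \<bar>t * xi\<bar>) * fourier g xi)" for x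
 have [measurable]: "G \<in> BM" unfolding G_def[abs_def] by measurable
 have ae: "AE x in lebesgue. quant_schwartz (p_inv c) t g x * B x = G x * B x" using c
 proof eventually_elim
  fix x assume cx: "chi x \<noteq> 0 \<longrightarrow> c x = V x"
  show "quant_schwartz (p_inv c) t g x * B x = G x * B x"
  proof (cases "B x = 0")
   case False
   then have "chi x \<noteq> 0" by (auto simp: B_def)
   then have "c x = V x" "0 < c x" using cx gb(1)[OF VB[OF False]] by auto
   then have "p_inv c x xi = of_real (sy 0 (V x) 0 \<bar>xi\<bar>)" for xi using p_inv_eq[of c x xi] by simp
   moreover have "exp (2 * complex_of_real pi * \<i> * complex_of_real x * complex_of_real xi) = e2 (x * xi)" for xi
    by (simp add: e2_def cis_conv_exp mult_ac)
   ultimately have "quant_schwartz (p_inv c) t g x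
    = (LINT xi|lebesgue. e2 (x * xi) * of_real (sy 0 (V x) 0 \<bar>t * xi\<bar>) * fourier g xi)"
    unfolding quant_schwartz_def by simp
   also have "... = G x" unfolding G_def by (rule integral_completion) measurable
   finally show ?thesis by simp
  qed simp
 qed
 have Bm: "(\<lambda>x. G x * B x) \<in> BM" by measurable
 have "(\<lambda>x. G x * B x) \<in> borel_measurable lebesgue" using Bm by (simp add: measurable_completion)
 moreover have "AE x in lebesgue. G x * B x = quant_schwartz (p_inv c) t g x * B x"
  using ae by eventually_elim (rule sym)
 ultimately have m: "(\<lambda>x. quant_schwartz (p_inv c) t g x * B x) \<in> borel_measurable lebesgue"
  by (rule borel_measurable_AE)
 have int: "integrable (lborel \<Otimes>\<^sub>M lborel) (\<lambda>(x, xi). e2 (x * xi) * of_real (sy 0 (V x) 0 \<bar>t * xi\<bar>) * fourier g xi * B x)"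
 proof (rule integrable_lborel_prod[OF schwartz_integrable[OF B] schwartz_integrable[OF fg], where C = 1])
  fix x xi
  show "norm (e2 (x * xi) * of_real (sy 0 (V x) 0 \<bar>t * xi\<bar>) * fourier g xi * B x) \<le> 1 * norm (B x) * norm (fourier g xi)"
  proof (cases "B x = 0")
   case False
   have pos: "0 < sy 0 (V x) 0 \<bar>t * xi\<bar>" "sy 0 (V x) 0 \<bar>t * xi\<bar> \<le> 1"
    using sy_pos sy_0_le_1[OF gb(1)[OF VB[OF False]]] by auto
   have "sy 0 (V x) 0 \<bar>t * xi\<bar> * (norm (fourier g xi) * norm (B x)) \<le> 1 * (norm (fourier g xi) * norm (B x))"
    by (rule mult_right_mono[OF pos(2)]) simp
   moreover have "norm (complex_of_real (sy 0 (V x) 0 \<bar>t * xi\<bar>)) = sy 0 (V x) 0 \<bar>t * xi\<bar>"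
    using pos(1) by simp
   ultimately show ?thesis unfolding norm_mult norm_e2 by (simp add: mult_ac)
  qed simp
 qed measurable
 have "distr_of_fun (quant_schwartz (p_inv c) t g) B = (LI x. G x * B x)"
  unfolding distr_of_fun_def by (rule lebesgue_integral_eq_lborel[OF ae m Bm])
 also have "... = (LI x. LI xi. e2 (x * xi) * of_real (sy 0 (V x) 0 \<bar>t * xi\<bar>) * fourier g xi * B x)"
  unfolding G_def by (simp only: integral_mult_left_zero)
 also have "... = (LI xi. LI x. e2 (x * xi) * of_real (sy 0 (V x) 0 \<bar>t * xi\<bar>) * fourier g xi * B x)"
  using lborel_pair.Fubini_integral[OF int] by simp
 also have "... = (LI xi. fourier g xi * Kf B 0 \<bar>t * xi\<bar> (- xi))"
 proof (rule lintegral_cong[OF refl])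
  fix xi
  have "(LI x. e2 (x * xi) * of_real (sy 0 (V x) 0 \<bar>t * xi\<bar>) * fourier g xi * B x)
   = (LI x. fourier g xi * (e2 (- (x * - xi)) * (B x * of_real (sy 0 (V x) 0 \<bar>t * xi\<bar>))))"
   by (simp add: mult_ac)
  also have "... = fourier g xi * Kf B 0 \<bar>t * xi\<bar> (- xi)"
   by (subst Kf_eq) (simp_all only: integral_mult_right_zero schwartz_measurable[OF B])
  finally show "(LI x. e2 (x * xi) * of_real (sy 0 (V x) 0 \<bar>t * xi\<bar>) * fourier g xi * B x)
   = fourier g xi * Kf B 0 \<bar>t * xi\<bar> (- xi)" .
 qed
 finally show ?thesis unfolding B_def .
qed

lemma has_FT_diff:
 assumes w: "wdata t w" and f: "has_FT f w" and g: "g \<in> schwartz"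
 shows "L2 (weighted t (- m1) (\<lambda>xi. fourier g xi - w xi))"
  "sobolev_norm t (- m1) (distr_diff (distr_of_fun g) f) = ereal (L2norm (weighted t (- m1) (\<lambda>xi. fourier g xi - w xi)))"
proof -
 have b: "L2 (wm t w)" using w by (simp add: wdata_def)
 have fg: "fourier g \<in> schwartz" by (rule schwartz_fourier[OF g])
 show L: "L2 (weighted t (- m1) (\<lambda>xi. fourier g xi - w xi))"
  unfolding weighted_diff using schwartz_L2[OF schwartz_wt[OF fg]]
  by (intro L2_diff b) (simp add: weighted_def[abs_def])
 have FT: "has_FT (distr_diff (distr_of_fun g) f) (\<lambda>xi. fourier g xi - w xi)" unfolding has_FT_def
 proof
  fix phi :: cfun assume phi: "phi \<in> schwartz"
  have i1: "intl (\<lambda>xi. fourier g xi * phi xi)"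
   by (rule L2_schwartz_integrable[OF schwartz_L2[OF fg] phi])
  have "intl (\<lambda>xi. wm t w xi * weighted t m1 phi xi)"
   using L2_schwartz_integrable[OF b schwartz_wt[OF phi]] by (simp add: weighted_def[of t m1 phi])
  then have i2: "intl (\<lambda>xi. w xi * phi xi)" unfolding weighted_mult .
  have "distr_of_fun g (fourier phi) = (LI x. g x * fourier phi x)"
   by (rule L2_square_integrable(3)[OF schwartz_L2[OF g] schwartz_fourier[OF phi]])
  also have "... = (LI xi. fourier g xi * phi xi)"
   by (rule fourier_pairing[symmetric, OF schwartz_integrable[OF g] schwartz_integrable[OF phi]])
  finally show "distr_diff (distr_of_fun g) f (fourier phi) = (LI xi. (fourier g xi - w xi) * phi xi)"
   using f phi unfolding distr_diff_def has_FT_def left_diff_distrib lintegral_diff[OF i1 i2] by simp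
 qed
 show "sobolev_norm t (- m1) (distr_diff (distr_of_fun g) f) = ereal (L2norm (weighted t (- m1) (\<lambda>xi. fourier g xi - w xi)))"
  using sobolev_norm_has_FT[OF FT] L by (simp add: weighted_def[abs_def])
qed

text \<open>The pairing with a fixed test function is continuous in the source norm, so its limit
  along Schwartz approximants of \<open>f\<close> is given by the same formula with \<open>w\<close>
  in place of \<open>fourier g\<close>.\<close>

lemma quant_eq_Lam:
 assumes c: "AE x in lebesgue. chi x \<noteq> 0 \<longrightarrow> c x = V x" and w: "wdata t w" and f: "has_FT f w" and psi: "psi \<in> schwartz"
 shows "distr_mult chi (quant (p_inv c) t (- m1) f) psi = Lam t w psi"
proof -
 define X where "X g = sobolev_norm t (- m1) (distr_diff (distr_of_fun g) f)" for g
 define Fil where "Fil = schwartz_approx t (- m1) f"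
 have Fil: "eventually P Fil \<longleftrightarrow> (\<exists>R. eventually R (nhds 0) \<and> (\<forall>g\<in>schwartz. R (X g) \<longrightarrow> P g))" for P
  unfolding Fil_def schwartz_approx_def X_def[abs_def] inf_commute[of "principal schwartz"]
   eventually_inf_principal eventually_filtercomap by blast
 have b: "L2 (wm t w)" using w by (simp add: wdata_def)
 let ?Psi = "\<lambda>eta. Kf (\<lambda>x. chi x * psi x) 0 \<bar>t * eta\<bar> (- eta)"
 have Psi: "L2 (weighted t m1 ?Psi)" by (rule Kf_L2) (use w chi_mult[OF psi] in \<open>auto simp: wdata_def\<close>)
 let ?d = "\<lambda>g. L2norm (weighted t (- m1) (\<lambda>xi. fourier g xi - w xi))"
 \<comment> \<open>A limit along the trivial filter would say nothing, so approximants must exist: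
   the weighted \<open>w\<close> is approximated by Schwartz functions, the weight removed and the
   transform inverted.\<close>
 have nt: "Fil \<noteq> bot"
 proof
  assume "Fil = bot"
  then have "eventually (\<lambda>_. False) Fil" by simp
  then obtain R where R: "eventually R (nhds (0::ereal))" "\<And>g. g \<in> schwartz ==> \<not> R (X g)"
   unfolding Fil by blast
  obtain F where F: "\<And>n::nat. F n \<in> schwartz" "(\<lambda>n. L2norm (\<lambda>x. F n x - wm t w x)) ----> 0"
   by (rule schwartz_dense_L2[OF b]) blast
  have "\<exists>g. g \<in> schwartz \<and> fourier g = (\<lambda>xi. wt t m1 xi * F n xi)" for n
   by (rule schwartz_fourier_inverse[OF schwartz_wt[OF F(1)]]) blast
  then obtain g where g: "\<And>n. g n \<in> schwartz" "\<And>n. fourier (g n) = (\<lambda>xi. wt t m1 xi * F n xi)" by metis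
  have e: "weighted t (- m1) (\<lambda>xi. fourier (g n) xi - w xi) = (\<lambda>x. F n x - wm t w x)" for n
  proof -
   have "weighted t (- m1) (fourier (g n)) xi = (wt t m1 xi * wt t (- m1) xi) * F n xi" for xi
    unfolding weighted_def g(2) by (simp only: mult_ac)
   then have "weighted t (- m1) (fourier (g n)) xi = F n xi" for xi by (simp only: wt_inverse mult_1_left)
   then show ?thesis unfolding weighted_diff by simp
  qed
  have "(\<lambda>n. ereal (L2norm (\<lambda>x. F n x - wm t w x))) ----> ereal 0"
   using F(2) by (simp only: tendsto_ereal)
  then have "(\<lambda>n. X (g n)) ----> 0" unfolding X_def has_FT_diff(2)[OF w f g(1)] e by (simp add: zero_ereal_def)
  from eventually_compose_filterlim[OF R(1) this] have "eventually (\<lambda>n. R (X (g n))) sequentially" .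
  then show False using R(2)[OF g(1)] by simp
 qed
 have lim: "((\<lambda>g. distr_of_fun (quant_schwartz (p_inv c) t g) (\<lambda>x. chi x * psi x)) \<longlongrightarrow> Lam t w psi) Fil"
 proof (rule tendstoI)
  fix e :: real assume e: "0 < e"
  define K where "K = L2norm (weighted t m1 ?Psi)"
  have K: "0 \<le> K" by (simp add: K_def)
  have pos: "0 < e / (K + 1)" using e K by simp
  show "\<forall>\<^sub>F g in Fil. dist (distr_of_fun (quant_schwartz (p_inv c) t g) (\<lambda>x. chi x * psi x)) (Lam t w psi) < e"
   unfolding Fil
  proof (intro exI conjI ballI impI)
   show "eventually (\<lambda>y. y < ereal (e / (K + 1))) (nhds 0)"
    by (rule eventually_nhds_in_open[of "{..<ereal (e / (K + 1))}", simplified]) (use pos in simp)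
   fix g assume g: "g \<in> schwartz" and "X g < ereal (e / (K + 1))"
   then have d: "?d g < e / (K + 1)" unfolding X_def has_FT_diff(2)[OF w f g] by simp
   have i1: "intl (\<lambda>eta. fourier g eta * ?Psi eta)"
   proof -
    have "L2 (weighted t (- m1) (fourier g))"
     unfolding weighted_def[abs_def] by (rule schwartz_L2[OF schwartz_wt[OF schwartz_fourier[OF g]]])
    from L2_mult_integrable[OF this Psi] show ?thesis unfolding weighted_mult .
   qed
   have "(LI eta. fourier g eta * ?Psi eta) - Lam t w psi = (LI eta. (fourier g eta - w eta) * ?Psi eta)"
    unfolding Lam_def left_diff_distrib by (rule lintegral_diff[symmetric, OF i1 Lam_integrable[OF w psi]])
   also have "... = (LI eta. weighted t (- m1) (\<lambda>xi. fourier g xi - w xi) eta * weighted t m1 ?Psi eta)"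
    by (simp only: weighted_mult)
   finally have "norm ((LI eta. fourier g eta * ?Psi eta) - Lam t w psi) \<le> ?d g * K"
    unfolding K_def using L2_mult_integral_le[OF has_FT_diff(1)[OF w f g] Psi] by simp
   also have "... \<le> ?d g * (K + 1)" by (intro mult_left_mono) auto
   also have "... < e" using d K by (simp add: pos_less_divide_eq)
   finally show "dist (distr_of_fun (quant_schwartz (p_inv c) t g) (\<lambda>x. chi x * psi x)) (Lam t w psi) < e"
    unfolding quant_schwartz_pairing[OF c psi g] dist_norm .
  qed
 qed
 show ?thesis
  unfolding distr_mult_def quant_def Fil_def[symmetric] by (rule tendsto_Lim[OF _ lim]) (use nt in \<open>simp add: trivial_limit_def\<close>)
qed

lemma Lam_linear:
 fixes phi psi :: cfun and k :: complex
 assumes w: "wdata t w"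
 shows "phi \<in> schwartz ==> psi \<in> schwartz ==> Lam t w (\<lambda>x. phi x + psi x) = Lam t w phi + Lam t w psi"
  and "psi \<in> schwartz ==> Lam t w (\<lambda>x. k * psi x) = k * Lam t w psi"
proof -
 show "Lam t w (\<lambda>x. phi x + psi x) = Lam t w phi + Lam t w psi" if phi: "phi \<in> schwartz" and psi: "psi \<in> schwartz"
 proof -
  have i: "intl (\<lambda>x. chi x * u x * of_real (sy 0 (V x) 0 \<bar>t * eta\<bar>))" if "u \<in> schwartz" for u eta
   by (rule Kf_integrand_integrable[OF schwartz_integrable[OF chi_mult(1)[OF that]] chi_mult(3)[OF that]]) auto
  have "Kf (\<lambda>x. chi x * (phi x + psi x)) 0 \<bar>t * eta\<bar> (- eta) = Kf (\<lambda>x. chi x * phi x) 0 \<bar>t * eta\<bar> (- eta) + Kf (\<lambda>x. chi x * psi x) 0 \<bar>t * eta\<bar> (- eta)" for eta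
   unfolding Kf_def distrib_left distrib_right by (rule fourier_add[OF i[OF phi] i[OF psi]])
  then show ?thesis
   unfolding Lam_def using lintegral_add[OF Lam_integrable[OF w phi] Lam_integrable[OF w psi]]
   by (simp add: distrib_left)
 qed
 show "Lam t w (\<lambda>x. k * psi x) = k * Lam t w psi" if psi: "psi \<in> schwartz"
 proof -
  note [measurable] = schwartz_measurable[OF psi]
  have "Kf (\<lambda>x. chi x * (k * psi x)) 0 \<bar>t * eta\<bar> (- eta) = k * Kf (\<lambda>x. chi x * psi x) 0 \<bar>t * eta\<bar> (- eta)" for eta
  proof -
   have "Kf (\<lambda>x. chi x * (k * psi x)) 0 \<bar>t * eta\<bar> (- eta) = fourier (\<lambda>x. k * (chi x * psi x * of_real (sy 0 (V x) 0 \<bar>t * eta\<bar>))) (- eta)"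
    unfolding Kf_def by (simp only: mult_ac)
   also have "... = k * Kf (\<lambda>x. chi x * psi x) 0 \<bar>t * eta\<bar> (- eta)"
    unfolding Kf_def by (rule fourier_cmult) measurable
   finally show ?thesis .
  qed
  then have "Lam t w (\<lambda>x. k * psi x) = (LI eta. k * (w eta * Kf (\<lambda>x. chi x * psi x) 0 \<bar>t * eta\<bar> (- eta)))"
   unfolding Lam_def by (simp only: mult_ac)
  then show ?thesis unfolding Lam_def by (simp only: integral_mult_right_zero)
 qed
qed

end

lemma iterated_integral_diff:
 fixes F G :: "real => real => complex"
 assumes F: "integrable (lborel \<Otimes>\<^sub>M lborel) (\<lambda>(xi, eta). F xi eta)" and G: "integrable (lborel \<Otimes>\<^sub>M lborel) (\<lambda>(xi, eta). G xi eta)"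
 shows "(LI xi. LI eta. F xi eta - G xi eta)
  = (LI xi. LI eta. F xi eta) - (LI xi. LI eta. G xi eta)"
proof -
 have e: "(\<lambda>(xi, eta). F xi eta - G xi eta) = (\<lambda>x. (case x of (xi, eta) => F xi eta) - (case x of (xi, eta) => G xi eta))"
  by auto
 have "integrable (lborel \<Otimes>\<^sub>M lborel) (\<lambda>(xi, eta). F xi eta - G xi eta)"
  unfolding e by (rule lintegrable_diff[OF F G])
 from lborel_pair.integral_fst[OF this] lborel_pair.integral_fst[OF F] lborel_pair.integral_fst[OF G]
 show ?thesis unfolding e using lintegral_diff[OF F G] by simp
qed

context localized_symbol
begin

lemma chi2_L2norm:
 assumes "psi \<in> schwartz"
 shows "L2norm (\<lambda>x. chi2 x * psi x) \<le> L2norm psi"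
proof -
 note [measurable] = schwartz_measurable[OF assms]
 have "L2norm (\<lambda>x. chi2 x * psi x) \<le> 1 * L2norm psi"
  by (rule L2_bound(2)[OF schwartz_L2[OF assms]]) (auto simp: norm_mult intro: mult_left_le_one_le chi2_le)
 then show ?thesis by simp
qed

lemma one_le_N1: "1 \<le> real N1" using m1(1) unfolding N1_def by linarith

text \<open>Since \<open>chi psi = (chi2 psi) chi\<close>, the kernel of \<open>Lam\<close> is a
  convolution of the transform of \<open>chi\<close> with that of \<open>chi2 psi\<close> times the
  symbol. Once the symbol is taken at \<open>t xi\<close>, the integral in \<open>eta\<close> is
  \<open>z w xi\<close>. As the test function is arbitrary, main term and error are bounded through
  the depth one \<open>majorant\<close>, whose norm is at most \<open>C\<close> times that of
  \<open>psi\<close>.\<close>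

lemma Lam_upper:
 obtains C0 C2 where "0 \<le> C0" "0 \<le> C2"
  "\<And>t w psi. wdata t w ==> psi \<in> schwartz ==> L2 (weighted t sp (z w)) ==>
   norm (Lam t w psi) \<le> (C2 * L2norm (weighted t sp (z w)) + t * C0 * L2norm (wm t w)) * L2norm psi"
proof -
 obtain C N where C: "0 \<le> C"
  "\<And>B. intl B ==> L2 B ==> (\<And>x. B x \<noteq> 0 ==> V x \<in> {a..b}) ==>
   \<exists>mu. majorant C N B mu"
  by (rule Kf_maj) blast
 define k0 where "k0 zeta = (1 + \<bar>zeta\<bar>) ^ Suc N * norm (fourier chi zeta)" for zeta
 have k0: "intl k0" "\<And>zeta. 0 \<le> k0 zeta"
  unfolding k0_def[abs_def] by (rule schwartz_weighted_integrable[OF fchi]) simp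
 define I where "I = (LI zeta. \<bar>k0 zeta\<bar>)"
 have I0: "0 \<le> I" unfolding I_def by simp
 show ?thesis
 proof (rule that[of "I * C" C])
  fix t w psi assume w: "wdata t w" and psi: "psi \<in> schwartz" and zs: "L2 (weighted t sp (z w))"
  have t: "0 < t" "0 \<le> t" "t \<le> 1" and [measurable]: "w \<in> BM" and b: "L2 (wm t w)"
   using w by (auto simp: wdata_def)
  define B where "B = (\<lambda>x. chi2 x * psi x)"
  have B: "B \<in> schwartz" and VB: "\<And>x. B x \<noteq> 0 ==> V x \<in> {a..b}" unfolding B_def using chi_mult[OF psi] by auto
  note [measurable] = schwartz_measurable[OF psi] schwartz_measurable[OF B]
  obtain Om :: "real => real" where Om: "\<And>zeta. 0 \<le> Om zeta" "L2 (\<lambda>zeta. (1 + zeta\<^sup>2) * Om zeta)"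
   "\<And>q zeta. 0 \<le> q ==> norm (Kf B 0 q zeta) \<le> jp q powr sp * Om zeta"
   by (rule Kf_majorant[OF B VB]) blast+
  obtain mu where mu: "L2 mu" "L2norm mu \<le> C * L2norm B" "\<forall>zeta. 0 \<le> mu zeta"
   "\<forall>q\<ge>0. \<forall>zeta. norm (Kf B 0 q zeta) \<le> jp q powr sp * mu zeta"
   "\<forall>p\<ge>0. \<forall>q\<ge>0. \<forall>zeta. norm (Kf B 0 q zeta - Kf B 0 p zeta) * jp q powr m1 \<le> \<bar>p - q\<bar> * (1 + \<bar>p - q\<bar>) ^ N * mu zeta"
   using C(2)[OF schwartz_integrable[OF B] schwartz_L2[OF B] VB] unfolding majorant_def by blast
  define G1 where "G1 xi eta = w eta * (fourier chi (xi - eta) * Kf B 0 \<bar>t * eta\<bar> (- xi))" for xi eta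
  define G2 where "G2 xi eta = w eta * (fourier chi (xi - eta) * Kf B 0 \<bar>t * xi\<bar> (- xi))" for xi eta
  have m: "(\<lambda>(xi, eta). G1 xi eta) \<in> BM2" "(\<lambda>(xi, eta). G2 xi eta) \<in> BM2"
   unfolding G1_def G2_def by measurable
  let ?a = "\<lambda>xi. 2 * ((1 + (- xi)\<^sup>2) * Om (- xi))"
  let ?k = "\<lambda>zeta. (1 + \<bar>zeta\<bar>) ^ N1 * norm (fourier chi zeta)"
  have a: "L2 ?a" by (rule L2_cmult[OF L2_reflect(1)[OF Om(2)]])
  have k: "intl ?k" by (rule schwartz_weighted_integrable[OF fchi])
  \<comment> \<open>A qualitative domination for the absolute convergence of both double integrals;
    \<open>Om\<close> depends on \<open>psi\<close> and does not enter the constants.\<close>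
  have le: "norm (w eta * (fourier chi (xi - eta) * Kf B 0 \<bar>t * rho\<bar> (- xi)))
   \<le> norm (?a xi) * \<bar>?k (xi - eta)\<bar> * norm (wm t w eta)" if rho: "rho = xi \<or> rho = eta" for xi eta rho
  proof -
   let ?b = "norm (wm t w eta)" and ?P = "(1 + \<bar>xi - eta\<bar>) ^ N1"
   have "norm (w eta) * jp (t * rho) powr sp \<le> jp (t * xi) powr (m1 + sp) * ?P * ?b \<or>
    norm (w eta) * jp (t * rho) powr sp \<le> jp (t * xi) * ?P * ?b" using rho
   proof
    assume "rho = xi"
    then show ?thesis
     using mult_right_mono[OF norm_w_le[OF t(2,3), of w eta xi], of "jp (t * xi) powr sp"] by (simp add: powr_add mult_ac)
   next
    assume "rho = eta"
    have "norm (w eta) * jp (t * eta) powr sp = jp (t * eta) powr (m1 + sp) * ?b"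
     unfolding norm_eq_weighted[of w eta t m1] by (simp add: powr_add)
    also have "... \<le> (jp (t * xi) * ?P) * ?b"
    proof (rule mult_right_mono)
     have "jp (t * eta) powr (m1 + sp) \<le> jp (t * eta) powr 1" by (rule jp_powr_mono[OF m1_sp])
     also have "... \<le> jp (t * xi) powr 1 * ?P" by (rule jp_powr_peetre) (use one_le_N1 t in auto)
     finally show "jp (t * eta) powr (m1 + sp) \<le> jp (t * xi) * ?P" using jp_pos[of "t * xi"] by simp
    qed simp
    finally show ?thesis using \<open>rho = eta\<close> by simp
   qed
   moreover have "jp (t * xi) powr (m1 + sp) * ?P * ?b \<le> (2 * (1 + xi\<^sup>2)) * ?P * ?b"
    by (intro mult_right_mono jp_powr_m1_sp_le(2) t) auto
   moreover have "jp (t * xi) * ?P * ?b \<le> (2 * (1 + xi\<^sup>2)) * ?P * ?b"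
    by (intro mult_right_mono order_trans[OF jp_mult_le[OF t(2,3)] one_plus_abs_square_le(2)]) auto
   ultimately have 1: "norm (w eta) * jp (t * rho) powr sp \<le> (2 * (1 + xi\<^sup>2)) * ?P * ?b" by linarith
   have "norm (w eta * (fourier chi (xi - eta) * Kf B 0 \<bar>t * rho\<bar> (- xi)))
    \<le> norm (w eta) * (norm (fourier chi (xi - eta)) * (jp \<bar>t * rho\<bar> powr sp * Om (- xi)))"
    unfolding norm_mult by (intro mult_left_mono Om(3)) auto
   also have "... = (norm (w eta) * jp (t * rho) powr sp) * (norm (fourier chi (xi - eta)) * Om (- xi))" by simp
   also have "... \<le> ((2 * (1 + xi\<^sup>2)) * ?P * ?b) * (norm (fourier chi (xi - eta)) * Om (- xi))"
    by (rule mult_right_mono[OF 1]) (use Om(1)[of "- xi"] in simp)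
   also have "... = norm (?a xi) * \<bar>?k (xi - eta)\<bar> * ?b" using Om(1)[of "- xi"] by (simp add: abs_mult mult_ac)
   finally show ?thesis .
  qed
  have le1: "norm (G1 xi eta) \<le> norm (?a xi) * \<bar>?k (xi - eta)\<bar> * norm (wm t w eta)" for xi eta
   unfolding G1_def by (rule le) simp
  have le2: "norm (G2 xi eta) \<le> norm (?a xi) * \<bar>?k (xi - eta)\<bar> * norm (wm t w eta)" for xi eta
   unfolding G2_def by (rule le) simp
  have L1: "Lam t w psi = (LI xi. LI eta. G1 xi eta)"
  proof -
   have e: "(\<lambda>x. chi x * psi x) = (\<lambda>x. B x * chi x)"
   proof
    fix x
    have "B x * chi x = (chi x * chi2 x) * psi x" unfolding B_def by (simp only: mult_ac)
    then show "chi x * psi x = B x * chi x" by (simp only: chi_chi2)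
   qed
   have "Kf (\<lambda>x. chi x * psi x) 0 \<bar>t * eta\<bar> (- eta) = (LI s. fourier chi (s - eta) * Kf B 0 \<bar>t * eta\<bar> (- s))" for eta
    unfolding e using Kf_mult_schwartz[OF B chi VB, of 0 "\<bar>t * eta\<bar>" 0 eta] by simp
   then have "Lam t w psi = (LI eta. LI xi. G1 xi eta)"
    unfolding Lam_def G1_def by (simp only: integral_mult_right_zero)
   also have "... = (LI xi. LI eta. G1 xi eta)" by (rule young_Fubini[symmetric, OF a b k m(1) le1])
   finally show ?thesis .
  qed
  have L2': "(LI xi. LI eta. G2 xi eta) = (LI xi. z w xi * Kf B 0 \<bar>t * xi\<bar> (- xi))"
  proof (rule lintegral_cong[OF refl])
   fix xi
   have "(LI eta. G2 xi eta) = (LI eta. (fourier chi (xi - eta) * w eta) * Kf B 0 \<bar>t * xi\<bar> (- xi))"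
    unfolding G2_def by (simp only: mult_ac)
   then show "(LI eta. G2 xi eta) = z w xi * Kf B 0 \<bar>t * xi\<bar> (- xi)"
    unfolding z_def by (simp only: integral_mult_left_zero)
  qed
  have nB: "L2norm mu \<le> C * L2norm psi"
   using mu(2) mult_left_mono[OF chi2_L2norm[OF psi] C(1)] unfolding B_def by linarith
  have rmu: "L2 (\<lambda>xi. mu (- xi))" "L2norm (\<lambda>xi. mu (- xi)) = L2norm mu" using L2_reflect[OF mu(1)] by auto
  \<comment> \<open>The quantitative error: \<open>|t eta|\<close> and \<open>|t xi|\<close> differ
    by at most \<open>t |xi - eta|\<close>, and the last bound in \<open>majorant\<close> pays for
    the source weight of order \<open>m1\<close>.\<close>
  have D: "norm (LI xi. LI eta. G1 xi eta - G2 xi eta)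
   \<le> (LI zeta. \<bar>t * k0 zeta\<bar>) * L2norm (\<lambda>xi. mu (- xi)) * L2norm (wm t w)"
  proof (rule young_integral_le[OF rmu(1) b integrable_mult_right[OF k0(1)]])
   show "(\<lambda>(xi, eta). G1 xi eta - G2 xi eta) \<in> BM2" unfolding G1_def G2_def by measurable
   fix xi eta
   let ?b = "norm (wm t w eta)" and ?p = "\<bar>t * xi\<bar>" and ?q = "\<bar>t * eta\<bar>" and ?zeta = "xi - eta"
   note pq = abs_scaled_diff(1)[OF t(2,3), of xi eta] and pq' = abs_scaled_diff(2)[OF t(2,3), of xi eta]
   have "G1 xi eta - G2 xi eta = w eta * (fourier chi ?zeta * (Kf B 0 ?q (- xi) - Kf B 0 ?p (- xi)))"
    unfolding G1_def G2_def by (simp only: right_diff_distrib)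
   then have "norm (G1 xi eta - G2 xi eta) = (norm (Kf B 0 ?q (- xi) - Kf B 0 ?p (- xi)) * jp ?q powr m1) * (norm (fourier chi ?zeta) * ?b)"
    by (simp only: norm_mult norm_eq_weighted[of w eta t m1] jp_abs mult_ac)
   also have "... \<le> (\<bar>?p - ?q\<bar> * (1 + \<bar>?p - ?q\<bar>) ^ N * mu (- xi)) * (norm (fourier chi ?zeta) * ?b)"
    by (rule mult_right_mono[OF mu(5)[rule_format]]) auto
   also have "... \<le> ((t * (1 + \<bar>?zeta\<bar>)) * (1 + \<bar>?zeta\<bar>) ^ N * mu (- xi)) * (norm (fourier chi ?zeta) * ?b)"
   proof (intro mult_right_mono mult_mono power_mono)
    show "\<bar>?p - ?q\<bar> \<le> t * (1 + \<bar>?zeta\<bar>)" using pq t(2) by (simp add: distrib_left)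
   qed (use pq' t mu(3) in auto)
   also have "... = norm (mu (- xi)) * \<bar>t * k0 ?zeta\<bar> * ?b"
    using mu(3) t k0(2)[of ?zeta] unfolding abs_mult by (simp add: k0_def mult_ac)
   finally show "norm (G1 xi eta - G2 xi eta) \<le> norm (mu (- xi)) * \<bar>t * k0 ?zeta\<bar> * ?b" .
  qed
  have It: "(LI zeta. \<bar>t * k0 zeta\<bar>) = t * I"
   unfolding I_def abs_mult using t by (simp add: abs_of_pos)
  have main: "norm (LI xi. z w xi * Kf B 0 \<bar>t * xi\<bar> (- xi)) \<le> L2norm (weighted t sp (z w)) * L2norm mu"
  proof -
   have mm: "weighted t (- sp) (\<lambda>xi. Kf B 0 \<bar>t * xi\<bar> (- xi)) \<in> BM"
    unfolding weighted_def[abs_def] by measurable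
   have bd: "norm (weighted t (- sp) (\<lambda>xi. Kf B 0 \<bar>t * xi\<bar> (- xi)) xi) \<le> 1 * norm (mu (- xi))" for xi
   proof -
    have "norm (weighted t (- sp) (\<lambda>xi. Kf B 0 \<bar>t * xi\<bar> (- xi)) xi) \<le> jp (t * xi) powr (- sp) * (jp \<bar>t * xi\<bar> powr sp * mu (- xi))"
     unfolding norm_weighted by (intro mult_left_mono mu(4)[rule_format]) auto
    also have "... = (jp (t * xi) powr (- sp) * jp (t * xi) powr sp) * mu (- xi)" by simp
    also have "jp (t * xi) powr (- sp) * jp (t * xi) powr sp = 1"
     using jp_pos[of "t * xi"] by (simp add: powr_add[symmetric])
    finally show ?thesis using mu(3) by simp
   qed
   have L: "L2 (weighted t (- sp) (\<lambda>xi. Kf B 0 \<bar>t * xi\<bar> (- xi)))"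
    "L2norm (weighted t (- sp) (\<lambda>xi. Kf B 0 \<bar>t * xi\<bar> (- xi))) \<le> 1 * L2norm (\<lambda>xi. mu (- xi))"
    using L2_bound[OF rmu(1) mm zero_le_one bd] .
   have e: "z w xi * Kf B 0 \<bar>t * xi\<bar> (- xi) = weighted t sp (z w) xi * weighted t (- sp) (\<lambda>xi. Kf B 0 \<bar>t * xi\<bar> (- xi)) xi" for xi
    by (rule weighted_mult[of t "- sp" "z w" xi "\<lambda>xi. Kf B 0 \<bar>t * xi\<bar> (- xi)", unfolded minus_minus, symmetric])
   have "norm (LI xi. z w xi * Kf B 0 \<bar>t * xi\<bar> (- xi))
    \<le> L2norm (weighted t sp (z w)) * L2norm (weighted t (- sp) (\<lambda>xi. Kf B 0 \<bar>t * xi\<bar> (- xi)))"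
    unfolding e by (rule L2_mult_integral_le[OF zs L(1)])
   also have "... \<le> L2norm (weighted t sp (z w)) * L2norm mu"
    using L(2) rmu(2) by (intro mult_left_mono) simp_all
   finally show ?thesis .
  qed
  have "Lam t w psi = (LI xi. z w xi * Kf B 0 \<bar>t * xi\<bar> (- xi)) + (LI xi. LI eta. G1 xi eta - G2 xi eta)"
   unfolding L1 L2'[symmetric]
    iterated_integral_diff[OF young_integrable[OF a b k m(1) le1] young_integrable[OF a b k m(2) le2]] by simp
  then have "norm (Lam t w psi) \<le> norm (LI xi. z w xi * Kf B 0 \<bar>t * xi\<bar> (- xi)) + norm (LI xi. LI eta. G1 xi eta - G2 xi eta)"
   by (simp only: norm_triangle_ineq)
  also have "... \<le> L2norm (weighted t sp (z w)) * L2norm mu + t * I * L2norm mu * L2norm (wm t w)"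
   using main D unfolding It rmu(2) by (rule add_mono)
  also have "... = (L2norm (weighted t sp (z w)) + t * I * L2norm (wm t w)) * L2norm mu"
   by (simp add: algebra_simps)
  also have "... \<le> (L2norm (weighted t sp (z w)) + t * I * L2norm (wm t w)) * (C * L2norm psi)"
   by (rule mult_left_mono[OF nB]) (use t I0 in simp)
  also have "... = (C * L2norm (weighted t sp (z w)) + t * (I * C) * L2norm (wm t w)) * L2norm psi"
   by (simp add: algebra_simps)
  finally show "norm (Lam t w psi) \<le> (C * L2norm (weighted t sp (z w)) + t * (I * C) * L2norm (wm t w)) * L2norm psi" .
 qed (use I0 C(1) in auto)
qed

end

lemma compact_support_L2_integrable:
 fixes f :: cfun
 assumes [measurable]: "f \<in> BM" and K: "\<And>x. norm (f x) \<le> K" and R: "\<And>x. R < \<bar>x\<bar> ==> f x = 0"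
 shows "L2 f" "intl f"
proof -
 have K0: "0 \<le> K" using K[of 0] by (rule order_trans[OF norm_ge_zero])
 have le: "norm (f x) * (1 + \<bar>x\<bar>) \<le> K * (1 + \<bar>R\<bar>)" "norm (f x) * (1 + x\<^sup>2) \<le> K * (1 + R\<^sup>2)" for x
 proof -
  consider "\<bar>x\<bar> \<le> R" | "R < \<bar>x\<bar>" by linarith
  then show "norm (f x) * (1 + \<bar>x\<bar>) \<le> K * (1 + \<bar>R\<bar>)"
   by cases (use K R K0 in \<open>auto intro!: mult_mono\<close>)
  consider "\<bar>x\<bar> \<le> R" | "R < \<bar>x\<bar>" by linarith
  then show "norm (f x) * (1 + x\<^sup>2) \<le> K * (1 + R\<^sup>2)"
  proof cases
   case 1
   then have "x\<^sup>2 \<le> R\<^sup>2" by (intro abs_le_square_iff[THEN iffD1]) simp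
   then show ?thesis by (intro mult_mono K K0) auto
  qed (use R K0 in simp)
 qed
 show "L2 f"
 proof (rule L2_bound(1)[OF L2_inverse_weight(2)])
  show "norm (f x) \<le> K * (1 + \<bar>R\<bar>) * norm (1 / (1 + \<bar>x\<bar>))" for x
   using le(1)[of x] by (simp add: pos_le_divide_eq)
 qed (use K0 in simp_all)
 show "intl f"
 proof (rule lintegrable_bound[OF integrable_mult_right[OF integrable_inverse_1_plus_square']])
  show "AE x in lborel. norm (f x) \<le> norm ((K * (1 + R\<^sup>2)) * (1 / (1 + x\<^sup>2)))"
  proof (rule AE_I2)
   fix x :: real
   have "norm (f x) \<le> (K * (1 + R\<^sup>2)) / (1 + x\<^sup>2)"
    using le(2)[of x] one_plus_square_pos[of x] by (simp only: pos_le_divide_eq)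
   also have "... \<le> norm ((K * (1 + R\<^sup>2)) * (1 / (1 + x\<^sup>2)))" using K0 by (simp add: abs_mult)
   finally show "norm (f x) \<le> norm ((K * (1 + R\<^sup>2)) * (1 / (1 + x\<^sup>2)))" .
  qed
 qed simp
qed

lemma L2norm_le_duality:
 assumes g: "L2 g" and M: "0 \<le> M" and le: "\<And>phi. phi \<in> schwartz ==> norm (LI x. g x * phi x) \<le> M * L2norm phi"
 shows "L2norm g \<le> M"
proof -
 have c: "L2 (\<lambda>x. cnj (g x))" by (rule L2_cnj[OF g])
 obtain F where F: "\<And>n::nat. F n \<in> schwartz" "(\<lambda>n. L2norm (\<lambda>x. F n x - cnj (g x))) ----> 0"
  by (rule schwartz_dense_L2[OF c]) blast
 have L: "L2 (F n)" for n by (rule schwartz_L2[OF F(1)])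
 have 1: "(\<lambda>n. norm (LI x. g x * F n x)) ----> norm (LI x. g x * cnj (g x))"
  by (rule tendsto_norm[OF L2_tendsto_integral[OF L c g F(2)]])
 have 2: "(\<lambda>n. M * L2norm (F n)) ----> M * L2norm (\<lambda>x. cnj (g x))"
  by (rule tendsto_mult_left[OF L2norm_tendsto[OF L c F(2)]])
 have "(LI x. g x * cnj (g x)) = of_real ((L2norm g)\<^sup>2)"
  unfolding L2norm_square complex_norm_square[symmetric] integral_complex_of_real by simp
 then have n: "norm (LI x. g x * cnj (g x)) = (L2norm g)\<^sup>2" by (simp only: norm_of_real abs_power2)
 have "(L2norm g)\<^sup>2 \<le> M * L2norm g"
  using LIMSEQ_le[OF 1 2] le[OF F(1)] unfolding n L2norm_cnj[OF g] by blast
 then show ?thesis using M L2norm_nonneg[of g] by (cases "L2norm g = 0") (auto simp: power2_eq_square)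
qed

lemma weighted_one:
 fixes v :: cfun
 assumes v: "L2 (weighted 1 1 v)" and [measurable]: "v \<in> BM"
 shows "intl v" "L2 v" "L2norm v \<le> L2norm (weighted 1 1 v)"
proof -
 have le: "norm (v x) \<le> 1 * norm (weighted 1 1 v x)" for x
  using mult_right_mono[OF jp_ge_1[of x] norm_ge_zero[of "v x"]] jp_pos[of x] unfolding norm_weighted by simp
 show "L2 v" "L2norm v \<le> L2norm (weighted 1 1 v)" using L2_bound[OF v _ zero_le_one le] by simp_all
 have le2: "norm (v x) \<le> norm (2 * (norm (1 / (1 + \<bar>x\<bar>)) * norm (weighted 1 1 v x)))" for x
 proof -
  have p: "0 < 1 + \<bar>x\<bar>" by simp
  have "norm (v x) * (1 + \<bar>x\<bar>) \<le> norm (v x) * (2 * jp x)" by (intro mult_left_mono le_jp) simp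
  also have "... = 2 * norm (weighted 1 1 v x)" using jp_pos[of x] unfolding norm_weighted by simp
  finally have "norm (v x) \<le> (2 * norm (weighted 1 1 v x)) / (1 + \<bar>x\<bar>)" using p by (simp only: pos_le_divide_eq)
  then show ?thesis using p by simp
 qed
 show "intl v"
  by (rule lintegrable_bound[OF integrable_mult_right[OF L2_norm_mult_integral_le(1)[OF L2_inverse_weight(2) v], of 2]])
   (use le2 in auto)
qed

context localized_symbol
begin

section \<open>The lower bound\<close>

text \<open>\<open>Lam\<close> at the transform of \<open>v\<close>, written so that it makes sense
  when \<open>v\<close> is not a Schwartz function.\<close>

definition Lamt :: "real => (real => complex) => (real => complex) => complex" where
 "Lamt t w v = (LI eta. LI s. w eta * (v s * Kf chi 0 \<bar>t * eta\<bar> (s - eta)))"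

lemma jp_le_jp: "0 \<le> t ==> t \<le> 1 ==> jp (t * s) \<le> jp s"
 unfolding jp_def power_mult_distrib by (simp add: mult_left_le_one_le power_le_one)

text \<open>Because \<open>m1 + sp \<le> 1\<close>, one power of the frequency \<open>s\<close> on
  \<open>v\<close> absorbs the source weight together with the symbol.\<close>

lemma Lamt_young:
 obtains k :: "real => real" where "intl k"
  "\<And>t w v s eta. wdata t w ==> norm (w eta * (v s * Kf chi 0 \<bar>t * eta\<bar> (s - eta)))
   \<le> norm (weighted 1 1 v s) * \<bar>k (s - eta)\<bar> * norm (wm t w eta)"
proof -
 obtain Om :: "real => real" where Om: "\<And>zeta. 0 \<le> Om zeta" "L2 (\<lambda>zeta. (1 + zeta\<^sup>2) * Om zeta)"
  "\<And>q zeta. 0 \<le> q ==> norm (Kf chi 0 q zeta) \<le> jp q powr sp * Om zeta"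
  by (rule Kf_majorant[OF chi Vchi]) blast+
 show ?thesis
 proof (rule that[OF Om_integrable[OF Om(2)]])
  fix t s eta :: real and w v :: cfun assume w: "wdata t w"
  then have t: "0 \<le> t" "t \<le> 1" by (auto simp: wdata_def)
  let ?b = "norm (wm t w eta)"
  have "norm (w eta) * jp (t * eta) powr sp = jp (t * eta) powr (m1 + sp) * ?b"
   unfolding norm_eq_weighted[of w eta t m1] by (simp add: powr_add)
  also have "... \<le> (jp s * (1 + \<bar>s - eta\<bar>)) * ?b"
  proof (rule mult_right_mono)
   have "jp (t * eta) powr (m1 + sp) \<le> jp (t * eta) powr 1" by (rule jp_powr_mono[OF m1_sp])
   also have "... \<le> jp (t * s) powr 1 * (1 + \<bar>s - eta\<bar>) ^ 1" by (rule jp_powr_peetre) (use t in auto)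
   also have "... \<le> jp s * (1 + \<bar>s - eta\<bar>)"
    using jp_pos[of "t * s"] jp_le_jp[OF t, of s] by (simp add: mult_right_mono)
   finally show "jp (t * eta) powr (m1 + sp) \<le> jp s * (1 + \<bar>s - eta\<bar>)" .
  qed simp
  finally have 1: "norm (w eta) * jp (t * eta) powr sp \<le> (jp s * (1 + \<bar>s - eta\<bar>)) * ?b" .
  have "norm (w eta * (v s * Kf chi 0 \<bar>t * eta\<bar> (s - eta))) \<le> norm (w eta) * (norm (v s) * (jp \<bar>t * eta\<bar> powr sp * Om (s - eta)))"
   unfolding norm_mult by (intro mult_left_mono Om(3)) auto
  also have "... = (norm (w eta) * jp (t * eta) powr sp) * (norm (v s) * Om (s - eta))" by simp
  also have "... \<le> ((jp s * (1 + \<bar>s - eta\<bar>)) * ?b) * (norm (v s) * Om (s - eta))"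
   by (rule mult_right_mono[OF 1]) (use Om(1)[of "s - eta"] in simp)
  also have "... = norm (weighted 1 1 v s) * \<bar>(1 + \<bar>s - eta\<bar>) * Om (s - eta)\<bar> * ?b"
   using Om(1)[of "s - eta"] jp_pos[of s] unfolding norm_weighted by (simp add: abs_mult mult_ac)
  finally show "norm (w eta * (v s * Kf chi 0 \<bar>t * eta\<bar> (s - eta)))
   \<le> norm (weighted 1 1 v s) * \<bar>(1 + \<bar>s - eta\<bar>) * Om (s - eta)\<bar> * ?b" .
 qed
qed

lemma Lamt_schwartz:
 assumes v: "v \<in> schwartz"
 shows "Lamt t w v = Lam t w (fourier v)"
proof -
 have fv: "fourier v \<in> schwartz" by (rule schwartz_fourier[OF v])
 have "Kf (\<lambda>x. chi x * fourier v x) 0 \<bar>t * eta\<bar> (- eta) = (LI s. v s * Kf chi 0 \<bar>t * eta\<bar> (s - eta))" for eta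
  using Kf_chi_convolution[OF _ schwartz_integrable[OF fv], of "\<bar>t * eta\<bar>" 0 eta]
  by (simp add: schwartz_fourier_inversion[OF v] mult.commute)
 then show ?thesis unfolding Lamt_def Lam_def by (simp only: integral_mult_right_zero)
qed

text \<open>The representation by \<open>u\<close> is given for Schwartz test functions, while the
  test function of the lower bound is the transform of some \<open>v\<close> of which only a
  weighted norm is known to be finite. Both sides are continuous in that norm, in which Schwartz
  functions are dense.\<close>

lemma Lamt_eq:
 assumes r: "Lrep t w u" and v: "L2 (weighted 1 1 v)" and [measurable]: "v \<in> BM"
 shows "Lamt t w v = (LI x. u x * fourier v x)"
proof -
 have w: "wdata t w" and u: "L2 u" "\<And>psi. psi \<in> schwartz ==> Lam t w psi = (LI x. u x * psi x)"
  using r by (auto simp: Lrep_def)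
 have [measurable]: "w \<in> BM" and b: "L2 (wm t w)" using w by (auto simp: wdata_def)
 obtain k where k: "intl k" "\<And>t w v s eta. wdata t w ==> norm (w eta * (v s * Kf chi 0 \<bar>t * eta\<bar> (s - eta)))
   \<le> norm (weighted 1 1 v s) * \<bar>k (s - eta)\<bar> * norm (wm t w eta)"
  by (rule Lamt_young) blast
 have m: "(\<lambda>(s, eta). w eta * (v s * Kf chi 0 \<bar>t * eta\<bar> (s - eta))) \<in> BM2"
  if [measurable]: "v \<in> BM" for v by measurable
 define I where "I = (LI zeta. \<bar>k zeta\<bar>)"
 have diff: "norm (Lamt t w f - Lamt t w v) \<le> I * L2norm (\<lambda>x. weighted 1 1 f x - weighted 1 1 v x) * L2norm (wm t w)"
  if f: "L2 (weighted 1 1 f)" and [measurable]: "f \<in> BM" for f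
 proof -
  have d: "L2 (weighted 1 1 (\<lambda>x. f x - v x))" unfolding weighted_diff by (rule L2_diff[OF f v])
  have s: "Lamt t w g = (LI s. LI eta. w eta * (g s * Kf chi 0 \<bar>t * eta\<bar> (s - eta)))"
   if "L2 (weighted 1 1 g)" "g \<in> BM" for g
   unfolding Lamt_def by (rule young_Fubini[symmetric, OF that(1) b k(1) m[OF that(2)] k(2)[OF w]])
  have "Lamt t w f - Lamt t w v = (LI s. LI eta. w eta * (f s * Kf chi 0 \<bar>t * eta\<bar> (s - eta)) - w eta * (v s * Kf chi 0 \<bar>t * eta\<bar> (s - eta)))"
   unfolding s[OF f that(2)] s[OF v assms(3)]
   by (rule iterated_integral_diff[symmetric, OF young_integrable[OF f b k(1) m[OF that(2)] k(2)[OF w]] young_integrable[OF v b k(1) m[OF assms(3)] k(2)[OF w]]])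
  also have "... = (LI s. LI eta. w eta * ((f s - v s) * Kf chi 0 \<bar>t * eta\<bar> (s - eta)))"
   by (simp only: left_diff_distrib right_diff_distrib)
  also have "norm ... \<le> I * L2norm (weighted 1 1 (\<lambda>x. f x - v x)) * L2norm (wm t w)"
   unfolding I_def by (rule young_integral_le[OF d b k(1) m k(2)[OF w]]) measurable
  finally show ?thesis unfolding weighted_diff .
 qed
 obtain F where F: "\<And>n::nat. F n \<in> schwartz" "(\<lambda>n. L2norm (\<lambda>x. F n x - weighted 1 1 v x)) ----> 0"
  by (rule schwartz_dense_L2[OF v]) blast
 define G where "G n = weighted 1 (- 1) (F n)" for n
 have G: "G n \<in> schwartz" for n unfolding G_def weighted_def[abs_def] by (rule schwartz_wt[OF F(1)])
 have wG: "weighted 1 1 (G n) = F n" for n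
 proof
  fix x
  have "weighted 1 1 (G n) x = (wt 1 1 x * wt 1 (- 1) x) * F n x" unfolding G_def weighted_def by (simp only: mult.assoc)
  then show "weighted 1 1 (G n) x = F n x" by (simp only: wt_inverse mult_1_left)
 qed
 have GL: "L2 (weighted 1 1 (G n))" for n unfolding wG by (rule schwartz_L2[OF F(1)])
 note vi = weighted_one[OF v assms(3)]
 have fv: "L2 (fourier v)" by (rule bessel_fourier(1)[OF vi(1,2)])
 have fG: "L2 (fourier (G n))" for n by (rule schwartz_L2[OF schwartz_fourier[OF G]])
 have lim1: "(\<lambda>n. Lamt t w (G n)) ----> Lamt t w v"
 proof (rule LIM_zero_cancel, rule Lim_null_comparison)
  show "\<forall>\<^sub>F n in sequentially. norm (Lamt t w (G n) - Lamt t w v) \<le> I * L2norm (\<lambda>x. F n x - weighted 1 1 v x) * L2norm (wm t w)"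
   using diff[OF GL schwartz_measurable[OF G]] unfolding wG by (intro always_eventually allI)
  show "(\<lambda>n. I * L2norm (\<lambda>x. F n x - weighted 1 1 v x) * L2norm (wm t w)) ----> 0"
   using tendsto_mult_left_zero[OF tendsto_mult_right_zero[OF F(2), of I], of "L2norm (wm t w)"] .
 qed
 have lim2: "(\<lambda>n. LI x. u x * fourier (G n) x) ----> (LI x. u x * fourier v x)"
 proof (rule L2_tendsto_integral[OF fG fv u(1)], rule Lim_null_comparison)
  show "\<forall>\<^sub>F n in sequentially. norm (L2norm (\<lambda>x. fourier (G n) x - fourier v x)) \<le> L2norm (\<lambda>x. F n x - weighted 1 1 v x)"
  proof (intro always_eventually allI)
   fix n
   have d: "L2 (weighted 1 1 (\<lambda>x. G n x - v x))" unfolding weighted_diff by (rule L2_diff[OF GL v])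
   have dm: "(\<lambda>x. G n x - v x) \<in> BM" using schwartz_measurable[OF G] by measurable
   have "(\<lambda>x. fourier (G n) x - fourier v x) = fourier (\<lambda>x. G n x - v x)"
    by (rule ext, rule fourier_diff[symmetric, OF schwartz_integrable[OF G] vi(1)])
   then have "L2norm (\<lambda>x. fourier (G n) x - fourier v x) \<le> L2norm (weighted 1 1 (\<lambda>x. G n x - v x))"
    using bessel_fourier(2)[OF weighted_one(1,2)[OF d dm]] weighted_one(3)[OF d dm] by simp
   then show "norm (L2norm (\<lambda>x. fourier (G n) x - fourier v x)) \<le> L2norm (\<lambda>x. F n x - weighted 1 1 v x)"
    unfolding weighted_diff wG by simp
  qed
 qed (rule F(2))
 have "Lamt t w (G n) = (LI x. u x * fourier (G n) x)" for n
  using Lamt_schwartz[OF G] u(2)[OF schwartz_fourier[OF G]] by simp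
 then show ?thesis using LIMSEQ_unique[OF lim1] lim2 by simp
qed

end

lemma L2_of_weighted:
 fixes Om :: "real => real"
 assumes "L2 (\<lambda>zeta. (1 + zeta\<^sup>2) * Om zeta)" and [measurable]: "Om \<in> BM"
 shows "L2 (\<lambda>zeta. (1 + \<bar>zeta\<bar>) * Om zeta)" "L2 Om"
proof -
 have a: "\<bar>1 + zeta\<^sup>2\<bar> = 1 + zeta\<^sup>2" for zeta :: real by simp
 show "L2 (\<lambda>zeta. (1 + \<bar>zeta\<bar>) * Om zeta)"
 proof (rule L2_bound(1)[OF assms(1)])
  show "norm ((1 + \<bar>zeta\<bar>) * Om zeta) \<le> 2 * norm ((1 + zeta\<^sup>2) * Om zeta)" for zeta
  proof -
   have "(1 + \<bar>zeta\<bar>) * \<bar>Om zeta\<bar> \<le> (2 * (1 + zeta\<^sup>2)) * \<bar>Om zeta\<bar>" by (rule mult_right_mono[OF one_plus_abs_square_le(2) abs_ge_zero])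
   moreover have "\<bar>1 + \<bar>zeta\<bar>\<bar> = 1 + \<bar>zeta\<bar>" by simp
   ultimately show ?thesis unfolding real_norm_def abs_mult a by (simp only: mult.assoc)
  qed
 qed simp_all
 show "L2 Om"
 proof (rule L2_bound(1)[OF assms(1)])
  fix zeta :: real
  have "1 * \<bar>Om zeta\<bar> \<le> (1 + zeta\<^sup>2) * \<bar>Om zeta\<bar>" by (rule mult_right_mono) auto
  then show "norm (Om zeta) \<le> 1 * norm ((1 + zeta\<^sup>2) * Om zeta)" by (simp add: abs_mult a)
 qed simp_all
qed

text \<open>For a function that is not integrable the left side is 0 by default, so square
  integrability of an integral can be shown before its convergence is discussed.\<close>

lemma norm_integral_le_nn: "ennreal (norm (LINT x|M. f x)) \<le> (\<integral>\<^sup>+x. ennreal (norm (f x)) \<partial>M)"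
 for f :: "'b => 'a::{banach, second_countable_topology}"
 by (cases "integrable M f") (simp_all add: integral_norm_bound_ennreal not_integrable_integral_eq)

lemma m_nonneg: "symbol_bounds a b m m1 sp dl ==> 0 \<le> m"
proof -
 assume "symbol_bounds a b m m1 sp dl"
 then interpret symbol_bounds a b m m1 sp dl .
 have "0 < 1 / a" using a by simp
 then show "0 \<le> m" using m dl by linarith
qed

context localized_symbol
begin

lemma jp_neg_m_le: "jp p powr (- m) \<le> 1"
 using jp_powr_mono[of "- m" 0 p] m_nonneg[OF symbol_bounds_axioms] jp_pos[of p] by simp

lemma jp_m_cancel: "jp p powr (- m) * jp p powr m = 1" using jp_pos[of p] by (simp add: powr_add[symmetric])

text \<open>The image of a test amplitude \<open>h\<close> on the Fourier side: the composition with the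
 quantization of the reciprocal symbol turns it back into \<open>h\<close> up to \<open>O(t)\<close>.\<close>

definition tst :: "real => (real => complex) => real => complex" where
 "tst t h s = (LI xi. of_real (jp (t * xi) powr (- m)) * h xi * Kf chi2 \<bar>t * xi\<bar> 0 (xi - s))"

lemma jp_powr_m1_le:
 assumes "0 \<le> t" "t \<le> 1" "\<bar>x\<bar> \<le> R"
 shows "jp (t * x) powr m1 \<le> (1 + R) ^ N1"
proof -
 have "jp (t * x) powr m1 \<le> (1 + \<bar>x\<bar>) ^ N1"
  using jp_powr_peetre[OF m1(1) N1 assms(1,2), of x 0] by (simp add: jp_def)
 also have "... \<le> (1 + R) ^ N1" using assms(3) by (intro power_mono) auto
 finally show ?thesis .
qed

text \<open>\<open>Lamt\<close> at \<open>tst t h\<close> is computed in two ways. Through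
  \<open>u\<close> it is at most \<open>C\<close> times the norms of \<open>u\<close> and
  \<open>h\<close>, the weight \<open>jp^(-m)\<close> cancelling the growth of the reciprocal
  symbol. Through the kernels it is, by \<open>Kf_factor\<close>, a double integral with the ratio
  of symbols, which \<open>Kf_compare\<close> replaces by the transform of \<open>chi\<close> up to
  \<open>O(t)\<close>; what is left is the pairing of \<open>h\<close> with the weighted
  \<open>z\<close>.\<close>

lemma Lam_lower_test:
 obtains C0 C1 where "0 \<le> C0" "0 \<le> C1"
  "\<And>t w u h K R. Lrep t w u ==>
   h \<in> BM ==> (\<And>x. norm (h x) \<le> K) ==> (\<And>x. R < \<bar>x\<bar> ==> h x = 0) ==>
   norm (LI xi. of_real (jp (t * xi) powr (- m)) * h xi * z w xi)
    \<le> (C1 * L2norm u + t * C0 * L2norm (wm t w)) * L2norm h"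
proof -
 obtain C N where C: "0 \<le> C"
  "\<And>B. intl B ==> L2 B ==> (\<And>x. B x \<noteq> 0 ==> V x \<in> {a..b}) ==>
   \<exists>mu. majorant C N B mu"
  by (rule Kf_maj) blast
 obtain k where k: "intl k" "\<And>zeta. 0 \<le> k zeta"
  "\<And>t xi eta. 0 < t ==> t \<le> 1 ==>
   norm (Kf chi \<bar>t * xi\<bar> \<bar>t * eta\<bar> (xi - eta) - fourier chi (xi - eta)) * jp (t * xi) powr (- m) * jp (t * eta) powr m1 \<le> t * k (xi - eta)"
  by (rule Kf_compare) blast
 obtain Om :: "real => real" where Om: "\<And>zeta. 0 \<le> Om zeta" "Om \<in> BM" "L2 (\<lambda>zeta. (1 + zeta\<^sup>2) * Om zeta)"
  "\<And>p zeta. 0 \<le> p ==> norm (Kf chi2 p 0 zeta) \<le> jp p powr m * Om zeta"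
  by (rule Kf_majorant[OF chi2 Vchi2]) blast+
 obtain Om1 :: "real => real" where Om1: "\<And>zeta. 0 \<le> Om1 zeta" "Om1 \<in> BM" "L2 (\<lambda>zeta. (1 + zeta\<^sup>2) * Om1 zeta)"
  "\<And>q zeta. 0 \<le> q ==> norm (Kf chi 0 q zeta) \<le> jp q powr sp * Om1 zeta"
  by (rule Kf_majorant[OF chi Vchi]) blast+
 define I where "I = (LI zeta. \<bar>k zeta\<bar>)"
 have I0: "0 \<le> I" unfolding I_def by simp
 show ?thesis
 proof (rule that[of I C])
  fix t w u h K R
  assume r: "Lrep t w u"
   and h: "h \<in> BM" "\<And>x. norm (h x) \<le> (K::real)" "\<And>x. (R::real) < \<bar>x\<bar> ==> h x = (0::complex)"
  have w: "wdata t w" and u: "L2 u" using r by (auto simp: Lrep_def)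
  have t: "0 < t" "0 \<le> t" "t \<le> 1" and [measurable]: "w \<in> BM" and b: "L2 (wm t w)"
   using w by (auto simp: wdata_def)
  have K0: "0 \<le> K" using h(2)[of 0] by (rule order_trans[OF norm_ge_zero])
  note [measurable] = h(1) Om(2) Om1(2)
  define sg where "sg xi = of_real (jp (t * xi) powr (- m)) * h xi" for xi
  have [measurable]: "sg \<in> BM" unfolding sg_def[abs_def] by measurable
  have nsg: "norm (sg xi) = jp (t * xi) powr (- m) * norm (h xi)" for xi by (simp add: sg_def norm_mult)
  define v where "v = tst t h"
  have v_eq: "v s = (LI xi. sg xi * Kf chi2 \<bar>t * xi\<bar> 0 (xi - s))" for s unfolding v_def tst_def sg_def ..
  have vm [measurable]: "v \<in> BM" unfolding v_eq[abs_def] by measurable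
  have hL: "L2 h" by (rule compact_support_L2_integrable(1)[OF h])
  have HK: "norm (sg xi * Kf chi2 \<bar>t * xi\<bar> 0 zeta) \<le> norm (h xi) * Om zeta" for xi zeta
  proof -
   have "norm (sg xi * Kf chi2 \<bar>t * xi\<bar> 0 zeta) \<le> norm (sg xi) * (jp \<bar>t * xi\<bar> powr m * Om zeta)"
    unfolding norm_mult by (intro mult_left_mono Om(4)) auto
   also have "... = (jp (t * xi) powr (- m) * jp (t * xi) powr m) * (norm (h xi) * Om zeta)" unfolding nsg by simp
   finally show ?thesis unfolding jp_m_cancel by simp
  qed
  \<comment> \<open>The bound \<open>K\<close> and the radius \<open>R\<close> of \<open>h\<close>
    serve convergence; the final estimate sees only the \<open>L2\<close> norm of
    \<open>h\<close>.\<close>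
  have vw: "L2 (weighted 1 1 v)"
  proof (rule L2_convolution)
   have "intl (\<lambda>xi. (1 + \<bar>xi\<bar>) *\<^sub>R h xi)"
   proof (rule compact_support_L2_integrable(2))
    show "norm ((1 + \<bar>x\<bar>) *\<^sub>R h x) \<le> (1 + \<bar>R\<bar>) * K" for x
     by (cases "R < \<bar>x\<bar>") (use h K0 in \<open>auto intro!: mult_mono\<close>)
    show "R < \<bar>x\<bar> ==> (1 + \<bar>x\<bar>) *\<^sub>R h x = 0" for x using h(3) by simp
   qed measurable
   from integrable_norm[OF this] show "intl (\<lambda>xi. (1 + \<bar>xi\<bar>) * norm (h xi))" by simp
   show "L2 (\<lambda>zeta. (1 + \<bar>zeta\<bar>) * Om zeta)" by (rule L2_of_weighted(1)[OF Om(3,2)])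
   show "weighted 1 1 v \<in> BM" unfolding weighted_def[abs_def] by measurable
   fix s
   have "ennreal (norm (weighted 1 1 v s)) = ennreal (jp s) * ennreal (norm (v s))"
    using jp_pos[of s] unfolding norm_weighted by (simp add: ennreal_mult)
   also have "... \<le> ennreal (jp s) * (NI xi. ennreal (norm (sg xi * Kf chi2 \<bar>t * xi\<bar> 0 (xi - s))))"
    unfolding v_eq by (intro mult_left_mono norm_integral_le_nn) simp
   also have "... = (NI xi. ennreal (jp s) * ennreal (norm (sg xi * Kf chi2 \<bar>t * xi\<bar> 0 (xi - s))))"
    by (rule nn_integral_cmult[symmetric]) measurable
   also have "... \<le> (NI xi. ennreal ((1 + \<bar>xi\<bar>) * norm (h xi) * \<bar>(1 + \<bar>xi - s\<bar>) * Om (xi - s)\<bar>))"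
   proof (rule nn_integral_mono)
    fix xi
    have "jp s \<le> (1 + \<bar>xi\<bar>) * (1 + \<bar>xi - s\<bar>)"
     by (rule order_trans[OF peetre[of s xi]]) (auto intro!: mult_mono jp_le simp: abs_minus_commute)
    then have "jp s * norm (sg xi * Kf chi2 \<bar>t * xi\<bar> 0 (xi - s)) \<le> ((1 + \<bar>xi\<bar>) * (1 + \<bar>xi - s\<bar>)) * (norm (h xi) * Om (xi - s))"
     by (intro mult_mono HK) auto
    also have "... = (1 + \<bar>xi\<bar>) * norm (h xi) * \<bar>(1 + \<bar>xi - s\<bar>) * Om (xi - s)\<bar>"
     using Om(1)[of "xi - s"] by (simp add: abs_mult mult_ac)
    finally show "ennreal (jp s) * ennreal (norm (sg xi * Kf chi2 \<bar>t * xi\<bar> 0 (xi - s)))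
     \<le> ennreal ((1 + \<bar>xi\<bar>) * norm (h xi) * \<bar>(1 + \<bar>xi - s\<bar>) * Om (xi - s)\<bar>)"
     unfolding ennreal_mult[OF jp_nonneg norm_ge_zero, symmetric] by (rule ennreal_leI)
   qed
   finally show "ennreal (norm (weighted 1 1 v s)) \<le> (NI xi. ennreal ((1 + \<bar>xi\<bar>) * norm (h xi) * \<bar>(1 + \<bar>xi - s\<bar>) * Om (xi - s)\<bar>))" .
  qed simp
  note vi = weighted_one[OF vw vm]
  have Omi: "intl Om"
  proof (rule lintegrable_bound[OF Om_integrable[OF Om(3)]])
   show "AE x in lborel. norm (Om x) \<le> norm ((1 + \<bar>x\<bar>) * Om x)"
   proof (rule AE_I2)
    fix x :: real
    have "1 * \<bar>Om x\<bar> \<le> (1 + \<bar>x\<bar>) * \<bar>Om x\<bar>" by (rule mult_right_mono) auto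
    then show "norm (Om x) \<le> norm ((1 + \<bar>x\<bar>) * Om x)" by (simp add: abs_mult)
   qed
  qed simp
  \<comment> \<open>Testing with \<open>phi\<close> and Fubini turn the convolution with the kernel
    of \<open>chi2\<close> into the kernel of \<open>chi2 phi\<close>, to which the uniform
    \<open>majorant\<close> applies.\<close>
  have dual: "norm (LI x. fourier v x * phi x) \<le> C * L2norm h * L2norm phi" if phi: "phi \<in> schwartz" for phi
  proof -
   define B where "B = (\<lambda>x. chi2 x * phi x)"
   have B: "B \<in> schwartz" and VB: "\<And>x. B x \<noteq> 0 ==> V x \<in> {a..b}" unfolding B_def using chi_mult[OF phi] by auto
   have fphi: "fourier phi \<in> schwartz" by (rule schwartz_fourier[OF phi])
   note [measurable] = schwartz_measurable[OF B] schwartz_measurable[OF fphi]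
   obtain mu where mu: "L2 mu" "L2norm mu \<le> C * L2norm B" "\<forall>zeta. 0 \<le> mu zeta"
    "\<forall>p\<ge>0. \<forall>zeta. norm (Kf B p 0 zeta) \<le> jp p powr m * mu zeta"
    using C(2)[OF schwartz_integrable[OF B] schwartz_L2[OF B] VB] unfolding majorant_def by blast
   have le: "norm (sg xi * Kf chi2 \<bar>t * xi\<bar> 0 (xi - s) * fourier phi s) \<le> norm (h xi) * \<bar>Om (xi - s)\<bar> * norm (fourier phi s)" for xi s
    using mult_right_mono[OF HK[of xi "xi - s"] norm_ge_zero[of "fourier phi s"]] Om(1)[of "xi - s"]
    unfolding norm_mult by simp
   have "(LI x. fourier v x * phi x) = (LI s. v s * fourier phi s)"
    by (rule fourier_pairing[OF vi(1) schwartz_integrable[OF phi]])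
   also have "... = (LI s. LI xi. sg xi * Kf chi2 \<bar>t * xi\<bar> 0 (xi - s) * fourier phi s)"
    unfolding v_eq by (simp only: integral_mult_left_zero)
   also have "... = (LI xi. LI s. sg xi * Kf chi2 \<bar>t * xi\<bar> 0 (xi - s) * fourier phi s)"
    by (rule young_Fubini[symmetric, OF hL schwartz_L2[OF fphi] Omi _ le]) measurable
   also have "... = (LI xi. sg xi * Kf B \<bar>t * xi\<bar> 0 xi)"
   proof (rule lintegral_cong[OF refl])
    fix xi
    have "(LI s. sg xi * Kf chi2 \<bar>t * xi\<bar> 0 (xi - s) * fourier phi s) = (LI s. sg xi * (fourier phi s * Kf chi2 \<bar>t * xi\<bar> 0 (xi - s)))"
     by (simp only: mult_ac)
    also have "... = sg xi * (LI s. fourier phi s * Kf chi2 \<bar>t * xi\<bar> 0 (xi - s))" by (simp only: integral_mult_right_zero)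
    also have "(LI s. fourier phi s * Kf chi2 \<bar>t * xi\<bar> 0 (xi - s)) = Kf B \<bar>t * xi\<bar> 0 xi"
     unfolding B_def using Kf_mult_schwartz[OF chi2 phi Vchi2, of "\<bar>t * xi\<bar>" 0 xi 0] by simp
    finally show "(LI s. sg xi * Kf chi2 \<bar>t * xi\<bar> 0 (xi - s) * fourier phi s) = sg xi * Kf B \<bar>t * xi\<bar> 0 xi" .
   qed
   finally have e: "(LI x. fourier v x * phi x) = ..." .
   have bd: "norm (sg xi * Kf B \<bar>t * xi\<bar> 0 xi) \<le> norm (h xi) * norm (mu xi)" for xi
   proof -
    have "norm (sg xi * Kf B \<bar>t * xi\<bar> 0 xi) \<le> norm (sg xi) * (jp \<bar>t * xi\<bar> powr m * mu xi)"
     unfolding norm_mult by (intro mult_left_mono mu(4)[rule_format]) auto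
    also have "... = (jp (t * xi) powr (- m) * jp (t * xi) powr m) * (norm (h xi) * mu xi)" unfolding nsg by simp
    finally show ?thesis unfolding jp_m_cancel using mu(3) by simp
   qed
   have ih: "intl (\<lambda>xi. norm (h xi) * norm (mu xi))" by (rule L2_norm_mult_integral_le(1)[OF hL mu(1)])
   have "intl (\<lambda>xi. sg xi * Kf B \<bar>t * xi\<bar> 0 xi)"
    by (rule lintegrable_bound[OF ih]) (use bd in auto)
   then have "norm (LI x. fourier v x * phi x) \<le> (LI xi. norm (h xi) * norm (mu xi))"
    unfolding e by (intro order_trans[OF integral_norm_bound integral_mono] integrable_norm ih bd)
   also have "... \<le> L2norm h * L2norm mu" by (rule L2_norm_mult_integral_le(2)[OF hL mu(1)])
   also have "... \<le> L2norm h * (C * L2norm phi)"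
    using mu(2) mult_left_mono[OF chi2_L2norm[OF phi] C(1)] unfolding B_def by (intro mult_left_mono) auto
   finally show ?thesis by (simp only: mult_ac)
  qed
  have fv: "L2 (fourier v)" by (rule bessel_fourier(1)[OF vi(1,2)])
  have fv_le: "L2norm (fourier v) \<le> C * L2norm h"
   by (rule L2norm_le_duality[OF fv _ dual]) (use C(1) in simp_all)
  \<comment> \<open>\<open>Ga\<close> carries the exact ratio of symbols, \<open>Gb\<close> its
    value 1 on the diagonal; the first integrates to \<open>Lamt t w v\<close>, the second to the
    pairing with \<open>z\<close>.\<close>
  define Ga where "Ga xi eta = w eta * (sg xi * Kf chi \<bar>t * xi\<bar> \<bar>t * eta\<bar> (xi - eta))" for xi eta
  define Gb where "Gb xi eta = w eta * (sg xi * fourier chi (xi - eta))" for xi eta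
  have mG: "(\<lambda>(xi, eta). Ga xi eta - Gb xi eta) \<in> BM2" "(\<lambda>(xi, eta). Gb xi eta) \<in> BM2"
   unfolding Ga_def Gb_def by measurable
  have bda: "norm (Ga xi eta - Gb xi eta) \<le> norm (h xi) * \<bar>t * k (xi - eta)\<bar> * norm (wm t w eta)" for xi eta
  proof -
   have "Ga xi eta - Gb xi eta = w eta * (sg xi * (Kf chi \<bar>t * xi\<bar> \<bar>t * eta\<bar> (xi - eta) - fourier chi (xi - eta)))"
    unfolding Ga_def Gb_def by (simp only: right_diff_distrib)
   then have "norm (Ga xi eta - Gb xi eta) = (norm (Kf chi \<bar>t * xi\<bar> \<bar>t * eta\<bar> (xi - eta) - fourier chi (xi - eta)) * jp (t * xi) powr (- m) * jp (t * eta) powr m1)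
     * (norm (h xi) * norm (wm t w eta))"
    by (simp only: norm_mult norm_eq_weighted[of w eta t m1] nsg mult_ac)
   also have "... \<le> (t * k (xi - eta)) * (norm (h xi) * norm (wm t w eta))"
    by (rule mult_right_mono[OF k(3)[OF t(1,3)]]) simp
   also have "... = norm (h xi) * \<bar>t * k (xi - eta)\<bar> * norm (wm t w eta)"
    using t k(2)[of "xi - eta"] by (simp add: abs_mult mult_ac)
   finally show ?thesis .
  qed
  have sgw: "L2 (weighted t m1 sg)"
  proof (rule compact_support_L2_integrable(1))
   show "weighted t m1 sg \<in> BM" unfolding weighted_def[abs_def] by measurable
   show "R < \<bar>x\<bar> ==> weighted t m1 sg x = 0" for x using h(3) by (simp add: weighted_def sg_def)
   show "norm (weighted t m1 sg x) \<le> (1 + \<bar>R\<bar>) ^ N1 * K" for x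
   proof (cases "R < \<bar>x\<bar>")
    case False
    have 1: "jp (t * x) powr m1 \<le> (1 + \<bar>R\<bar>) ^ N1" by (rule jp_powr_m1_le[OF t(2,3)]) (use False in simp)
    have "jp (t * x) powr (- m) * norm (h x) \<le> 1 * K" by (intro mult_mono jp_neg_m_le h) auto
    with 1 show ?thesis unfolding norm_weighted nsg by (intro mult_mono) auto
   qed (use h(3) K0 in \<open>simp add: weighted_def sg_def\<close>)
  qed
  have bdb: "norm (Gb xi eta) \<le> norm (weighted t m1 sg xi) * \<bar>(1 + \<bar>xi - eta\<bar>) ^ N1 * norm (fourier chi (xi - eta))\<bar> * norm (wm t w eta)" for xi eta
  proof -
   have "norm (Gb xi eta) \<le> (jp (t * xi) powr m1 * (1 + \<bar>xi - eta\<bar>) ^ N1 * norm (wm t w eta)) * (norm (sg xi) * norm (fourier chi (xi - eta)))"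
    unfolding Gb_def norm_mult by (intro mult_right_mono norm_w_le t) simp
   then show ?thesis unfolding norm_weighted[of t m1 sg] by (simp add: abs_mult mult_ac)
  qed
  have intd: "integrable (lborel \<Otimes>\<^sub>M lborel) (\<lambda>(xi, eta). Ga xi eta - Gb xi eta)"
   by (rule young_integrable[OF hL b integrable_mult_right[OF k(1)] mG(1) bda])
  have intb: "integrable (lborel \<Otimes>\<^sub>M lborel) (\<lambda>(xi, eta). Gb xi eta)"
   by (rule young_integrable[OF sgw b schwartz_weighted_integrable[OF fchi] mG(2) bdb])
  \<comment> \<open>\<open>Ga\<close> is not dominated directly; it is the sum of the small
    difference and of \<open>Gb\<close>, which are.\<close>
  have inta: "integrable (lborel \<Otimes>\<^sub>M lborel) (\<lambda>(xi, eta). Ga xi eta)"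
   using lintegrable_add[OF intd intb] by (simp add: case_prod_beta')
  have La: "Lamt t w v = (LI eta. LI xi. Ga xi eta)" unfolding Lamt_def
  proof (rule lintegral_cong[OF refl])
   fix eta
   let ?q = "\<bar>t * eta\<bar>"
   have Kq: "L2 (\<lambda>s. Kf chi 0 ?q (s - eta))"
   proof -
    have "L2 (Kf chi 0 ?q)"
     by (rule L2_bound(1)[OF L2_of_weighted(2)[OF Om1(3,2)], of _ "jp ?q powr sp"]) (use Om1(1) Om1(4)[of ?q] in auto)
    from L2_shift[OF this, of "- eta"] show ?thesis by simp
   qed
   have le: "norm (sg xi * Kf chi2 \<bar>t * xi\<bar> 0 (xi - s) * Kf chi 0 ?q (s - eta)) \<le> norm (h xi) * \<bar>Om (xi - s)\<bar> * norm (Kf chi 0 ?q (s - eta))" for xi s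
    using mult_right_mono[OF HK[of xi "xi - s"] norm_ge_zero[of "Kf chi 0 ?q (s - eta)"]] Om(1)[of "xi - s"]
    unfolding norm_mult by simp
   have "(LI s. v s * Kf chi 0 ?q (s - eta)) = (LI s. LI xi. sg xi * Kf chi2 \<bar>t * xi\<bar> 0 (xi - s) * Kf chi 0 ?q (s - eta))"
    unfolding v_eq by (simp only: integral_mult_left_zero)
   also have "... = (LI xi. LI s. sg xi * Kf chi2 \<bar>t * xi\<bar> 0 (xi - s) * Kf chi 0 ?q (s - eta))"
    by (rule young_Fubini[symmetric, OF hL Kq Omi _ le]) measurable
   also have "... = (LI xi. sg xi * Kf chi \<bar>t * xi\<bar> ?q (xi - eta))"
   proof (rule lintegral_cong[OF refl])
    fix xi
    have "(LI s. sg xi * Kf chi2 \<bar>t * xi\<bar> 0 (xi - s) * Kf chi 0 ?q (s - eta)) = (LI s. sg xi * (Kf chi 0 ?q (s - eta) * Kf chi2 \<bar>t * xi\<bar> 0 (xi - s)))"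
     by (simp only: mult_ac)
    then show "(LI s. sg xi * Kf chi2 \<bar>t * xi\<bar> 0 (xi - s) * Kf chi 0 ?q (s - eta)) = sg xi * Kf chi \<bar>t * xi\<bar> ?q (xi - eta)"
     unfolding Kf_factor[OF abs_ge_zero abs_ge_zero] by (simp only: integral_mult_right_zero)
   qed
   finally show "(LI s. w eta * (v s * Kf chi 0 ?q (s - eta))) = (LI xi. Ga xi eta)"
    unfolding Ga_def by (simp only: integral_mult_right_zero)
  qed
  have Lb: "(LI xi. sg xi * z w xi) = (LI xi. LI eta. Gb xi eta)"
  proof (rule lintegral_cong[OF refl])
   fix xi
   have "(LI eta. Gb xi eta) = (LI eta. sg xi * (fourier chi (xi - eta) * w eta))"
    unfolding Gb_def by (simp only: mult_ac)
   then show "sg xi * z w xi = (LI eta. Gb xi eta)" unfolding z_def by (simp only: integral_mult_right_zero)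
  qed
  have "(LI xi. sg xi * z w xi) = Lamt t w v - (LI xi. LI eta. Ga xi eta - Gb xi eta)"
   unfolding Lb La iterated_integral_diff[OF inta intb] using lborel_pair.Fubini_integral[OF inta] by simp
  then have "norm (LI xi. sg xi * z w xi) \<le> norm (Lamt t w v) + norm (LI xi. LI eta. Ga xi eta - Gb xi eta)"
   by (simp only: norm_triangle_ineq4)
  moreover have "norm (LI xi. LI eta. Ga xi eta - Gb xi eta) \<le> (LI zeta. \<bar>t * k zeta\<bar>) * L2norm h * L2norm (wm t w)"
   by (rule young_integral_le[OF hL b integrable_mult_right[OF k(1)] mG(1) bda])
  moreover have "(LI zeta. \<bar>t * k zeta\<bar>) = t * I" unfolding I_def abs_mult using t by (simp add: abs_of_pos)
  moreover have "norm (Lamt t w v) \<le> L2norm u * (C * L2norm h)"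
  proof -
   have e: "Lamt t w v = (LI x. u x * fourier v x)" by (rule Lamt_eq[OF r vw vm])
   have "norm (Lamt t w v) \<le> L2norm u * L2norm (fourier v)"
    unfolding e by (rule L2_mult_integral_le[OF u fv])
   also have "... \<le> L2norm u * (C * L2norm h)" by (rule mult_left_mono[OF fv_le]) simp
   finally show ?thesis .
  qed
  ultimately have "norm (LI xi. sg xi * z w xi) \<le> L2norm u * (C * L2norm h) + t * I * L2norm h * L2norm (wm t w)"
   by simp
  also have "... = (C * L2norm u + t * I * L2norm (wm t w)) * L2norm h" by (simp add: algebra_simps)
  finally show "norm (LI xi. of_real (jp (t * xi) powr (- m)) * h xi * z w xi)
    \<le> (C * L2norm u + t * I * L2norm (wm t w)) * L2norm h" unfolding sg_def .
 qed (use I0 C(1) in auto)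
qed

text \<open>The norm is recovered by testing with the function itself: for the truncations
  \<open>h n\<close> the tested integral is the square of their norm, division leaves a bound
  uniform in \<open>n\<close>, and Fatou passes it on. Truncation comes first because
  \<open>z\<close> is so far only polynomially bounded; its membership in the weighted
  \<open>L2\<close> space is a conclusion.\<close>

lemma Lam_lower:
 obtains C0 C1 where "0 \<le> C0" "0 \<le> C1"
  "\<And>t w u. Lrep t w u ==>
   L2 (weighted t (- m) (z w)) \<and>
   L2norm (weighted t (- m) (z w)) \<le> C1 * L2norm u + t * C0 * L2norm (wm t w)"
proof -
 obtain C0 C1 where C: "0 \<le> C0" "0 \<le> C1"
  "\<And>t w u h K R. Lrep t w u ==>
   h \<in> BM ==> (\<And>x. norm (h x) \<le> K) ==> (\<And>x. R < \<bar>x\<bar> ==> h x = 0) ==>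
   norm (LI xi. of_real (jp (t * xi) powr (- m)) * h xi * z w xi)
    \<le> (C1 * L2norm u + t * C0 * L2norm (wm t w)) * L2norm h" by (rule Lam_lower_test) blast
 show ?thesis
 proof (rule that[OF C(1,2)])
  fix t w u
  assume r: "Lrep t w u"
  then have w: "wdata t w" by (simp add: Lrep_def)
  have t: "0 < t" "0 \<le> t" "t \<le> 1" and [measurable]: "w \<in> BM" using w by (auto simp: wdata_def)
  define Q where "Q = C1 * L2norm u + t * C0 * L2norm (wm t w)"
  have Q0: "0 \<le> Q" unfolding Q_def using C(1,2) t by simp
  obtain Cz where Cz: "0 \<le> Cz" "\<And>xi. norm (z w xi) \<le> Cz * jp (t * xi) powr m1" by (rule z_bound[OF w]) blast
  define g where "g xi = of_real (jp (t * xi) powr (- m)) * cnj (z w xi)" for xi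
  have [measurable]: "g \<in> BM" unfolding g_def[abs_def] by measurable
  define h where "h n xi = (if \<bar>xi\<bar> \<le> real n then g xi else 0)" for n xi
  have hm: "h n \<in> BM" for n unfolding h_def[abs_def] by measurable
  have hR: "real n < \<bar>x\<bar> ==> h n x = 0" for n x by (simp add: h_def)
  have hK: "norm (h n x) \<le> Cz * (1 + real n) ^ N1" for n x
  proof (cases "\<bar>x\<bar> \<le> real n")
   case True
   have "Cz * jp (t * x) powr m1 \<le> Cz * (1 + real n) ^ N1"
    by (rule mult_left_mono[OF jp_powr_m1_le[OF t(2,3) True] Cz(1)])
   then have "norm (z w x) \<le> Cz * (1 + real n) ^ N1" using Cz(2)[of x] by linarith
   then have "jp (t * x) powr (- m) * norm (z w x) \<le> 1 * (Cz * (1 + real n) ^ N1)"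
    by (intro mult_mono jp_neg_m_le) auto
   then show ?thesis using True by (simp add: h_def g_def norm_mult)
  qed (use Cz(1) in \<open>simp add: h_def\<close>)
  have hL: "L2 (h n)" for n by (rule compact_support_L2_integrable(1)[OF hm hK hR])
  have hQ: "L2norm (h n) \<le> Q" for n
  proof -
   have "of_real (jp (t * xi) powr (- m)) * h n xi * z w xi = complex_of_real ((norm (h n xi))\<^sup>2)" for xi
   proof (cases "\<bar>xi\<bar> \<le> real n")
    case True
    have "complex_of_real ((norm (g xi))\<^sup>2) = g xi * cnj (g xi)" by (rule complex_norm_square)
    also have "... = of_real (jp (t * xi) powr (- m)) * g xi * z w xi" by (simp add: g_def mult_ac)
    finally show ?thesis using True by (simp add: h_def)
   qed (simp add: h_def)
   then have "(LI xi. of_real (jp (t * xi) powr (- m)) * h n xi * z w xi) = complex_of_real ((L2norm (h n))\<^sup>2)"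
    by (simp only: integral_complex_of_real L2norm_square)
   then have "norm (LI xi. of_real (jp (t * xi) powr (- m)) * h n xi * z w xi) = (L2norm (h n))\<^sup>2"
    by (simp only: norm_of_real abs_power2)
   then have "(L2norm (h n))\<^sup>2 \<le> Q * L2norm (h n)"
    using C(3)[OF r hm[of n] hK[of n] hR[of n]] unfolding Q_def by simp
   then show ?thesis
    using Q0 L2norm_nonneg[of "h n"] by (cases "L2norm (h n) = 0") (auto simp: power2_eq_square)
  qed
  have lim: "AE x in lborel. (\<lambda>n. h n x) ----> g x"
  proof (rule AE_I2, rule tendsto_eventually)
   fix x :: real
   show "\<forall>\<^sub>F n in sequentially. h n x = g x"
    using eventually_ge_at_top[of "nat \<lceil>\<bar>x\<bar>\<rceil>"] 
   proof eventually_elim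
    case (elim n)
    then have "\<bar>x\<bar> \<le> real n" by linarith
    then show "h n x = g x" by (simp add: h_def)
   qed
  qed
  have gL': "L2 g" "L2norm g \<le> Q" by (rule L2_fatou[OF hL hQ _ lim]; measurable)+
  have "weighted t (- m) (z w) \<in> BM" unfolding weighted_def[abs_def] by measurable
  moreover have "norm (weighted t (- m) (z w) xi) \<le> 1 * norm (g xi)" for xi
   unfolding norm_weighted by (simp add: g_def norm_mult)
  ultimately have "L2 (weighted t (- m) (z w))" "L2norm (weighted t (- m) (z w)) \<le> 1 * L2norm g"
   using L2_bound[OF gL'(1) _ zero_le_one] by blast+
  then show "L2 (weighted t (- m) (z w)) \<and> L2norm (weighted t (- m) (z w)) \<le> C1 * L2norm u + t * C0 * L2norm (wm t w)"
   using gL'(2) unfolding Q_def by simp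
 qed
qed

end

section \<open>The two-sided estimate for a fixed cutoff\<close>

context localized_symbol
begin

lemma localized_estimate:
 assumes c: "AE x in lebesgue. chi x \<noteq> 0 \<longrightarrow> c x = V x"
 shows "\<exists>C0>0. \<exists>C1>0. \<exists>C2>0. \<forall>t. 0 < t \<and> t \<le> 1 \<longrightarrow> (\<forall>f\<in>sobolev_space t (- m1).
   ereal C1 * sobolev_norm t (- m) (distr_mult chi f) - ereal (t * C0) * sobolev_norm t (- m1) f
    \<le> l2_norm (distr_mult chi (quant (p_inv c) t (- m1) f)) \<and>
   l2_norm (distr_mult chi (quant (p_inv c) t (- m1) f))
    \<le> ereal C2 * sobolev_norm t sp (distr_mult chi f) + ereal (t * C0) * sobolev_norm t (- m1) f)"
proof -
 obtain U0 U2 where U: "0 \<le> U0" "0 \<le> U2"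
  "\<And>t w psi. wdata t w ==> psi \<in> schwartz ==> L2 (weighted t sp (z w)) ==>
   norm (Lam t w psi) \<le> (U2 * L2norm (weighted t sp (z w)) + t * U0 * L2norm (wm t w)) * L2norm psi"
  by (rule Lam_upper) blast
 obtain D0 D1 where D: "0 \<le> D0" "0 \<le> D1"
  "\<And>t w u. Lrep t w u ==>
   L2 (weighted t (- m) (z w)) \<and>
   L2norm (weighted t (- m) (z w)) \<le> D1 * L2norm u + t * D0 * L2norm (wm t w)"
  by (rule Lam_lower) blast
 \<comment> \<open>\<open>C1\<close> divides the lower estimate by the constant in front of the norm
   of \<open>u\<close>; the added ones make all three constants positive, and \<open>C0\<close> is
   large enough for both inequalities.\<close>
 define C0 C1 C2 where "C0 = U0 + D0 + 1" and "C1 = 1 / (D1 + 1)" and "C2 = U2 + 1"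
 have pos: "0 < C0" "0 < C1" "0 < C2" unfolding C0_def C1_def C2_def using U(1,2) D(1,2) by auto
 show ?thesis
 proof (rule exI[of _ C0], rule conjI[OF pos(1)], rule exI[of _ C1], rule conjI[OF pos(2)],
   rule exI[of _ C2], rule conjI[OF pos(3)], intro allI impI ballI conjI)
  fix t f assume "0 < t \<and> t \<le> 1" and f: "f \<in> sobolev_space t (- m1)"
  then have t: "0 < t" "t \<le> 1" by auto
  have "sobolev_norm t (- m1) f < \<infinity>" using f by (simp add: sobolev_space_def)
  then obtain w where w: "w \<in> BM" "has_FT f w" "L2 (\<lambda>xi. wt t (- m1) xi * w xi)"
   "sobolev_norm t (- m1) f = ereal (L2norm (\<lambda>xi. wt t (- m1) xi * w xi))"
   by (rule sobolev_norm_finite) blast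
  have wd: "wdata t w" unfolding wdata_def weighted_def[abs_def] using t w by simp
  define bt where "bt = L2norm (wm t w)"
  have bt: "0 \<le> bt" "sobolev_norm t (- m1) f = ereal bt" using w(4) by (simp_all add: bt_def weighted_def[abs_def])
  let ?q = "distr_mult chi (quant (p_inv c) t (- m1) f)"
  have q: "?q psi = Lam t w psi" if "psi \<in> schwartz" for psi by (rule quant_eq_Lam[OF c wd w(2) that])
  show "ereal C1 * sobolev_norm t (- m) (distr_mult chi f) - ereal (t * C0) * sobolev_norm t (- m1) f \<le> l2_norm ?q"
  \<comment> \<open>If the middle norm is infinite there is nothing to prove. If it is finite it
    supplies the representative \<open>u\<close>, and finiteness of the localized norm on the left
    comes out of \<open>Lam_lower\<close>.\<close>
  proof (cases "l2_norm ?q < \<infinity>")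
   case True
   then obtain u where u: "L2 u" "\<And>phi. phi \<in> schwartz ==> ?q phi = (LI x. u x * phi x)" "l2_norm ?q = ereal (L2norm u)"
    by (rule l2_norm_less_top) blast
   have "Lrep t w u" unfolding Lrep_def using wd u q by simp
   note d = D(3)[OF this]
   have n: "sobolev_norm t (- m) (distr_mult chi f) = ereal (L2norm (weighted t (- m) (z w)))"
    using sobolev_norm_has_FT[OF has_FT_z[OF wd w(2)], of t "- m"] d unfolding weighted_def[abs_def] by simp
   have "C1 * L2norm (weighted t (- m) (z w)) \<le> C1 * (D1 * L2norm u + t * D0 * bt)"
    using d pos(2) unfolding bt_def by (intro mult_left_mono) auto
   also have "... = C1 * D1 * L2norm u + C1 * (t * D0 * bt)" by (simp add: algebra_simps)
   also have "... \<le> 1 * L2norm u + 1 * (t * C0 * bt)"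
   proof (intro add_mono mult_right_mono mult_mono)
    show "C1 * D1 \<le> 1" "C1 \<le> 1" unfolding C1_def using D(2) by auto
    show "D0 \<le> C0" unfolding C0_def using U(1) by simp
   qed (use t D(1) bt pos in auto)
   finally show ?thesis unfolding n bt(2) u(3) by simp
  qed simp
  show "l2_norm ?q \<le> ereal C2 * sobolev_norm t sp (distr_mult chi f) + ereal (t * C0) * sobolev_norm t (- m1) f"
  \<comment> \<open>The Riesz lemma asks for a finite bound; when the norm of order
    \<open>sp\<close> is infinite, positivity of \<open>C2\<close> makes the right side
    infinite.\<close>
  proof (cases "sobolev_norm t sp (distr_mult chi f) < \<infinity>")
   case True
   note zs = z_unique[OF wd w(2) True]
   define K where "K = U2 * L2norm (weighted t sp (z w)) + t * U0 * bt"
   have K: "0 \<le> K" unfolding K_def using U(1,2) t bt(1) by simp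
   obtain u F where u: "L2 u" "L2norm u \<le> K" "\<And>phi. phi \<in> schwartz ==> Lam t w phi = (LI x. u x * phi x)"
    "\<And>n::nat. F n \<in> schwartz" "(\<lambda>n. L2norm (\<lambda>x. F n x - cnj (u x))) ----> 0"
   proof (rule schwartz_riesz[of "Lam t w" K])
    show "\<And>phi. phi \<in> schwartz ==> norm (Lam t w phi) \<le> K * L2norm phi"
     unfolding K_def bt_def by (rule U(3)[OF wd _ zs(1)])
   qed (use K Lam_linear[OF wd] in blast)+
   have "l2_norm ?q \<le> ereal (L2norm u)" by (rule l2_norm_le[OF u(1)]) (simp add: q u(3))
   also have "... \<le> ereal (C2 * L2norm (weighted t sp (z w)) + t * C0 * bt)"
   proof -
    have "U2 * L2norm (weighted t sp (z w)) + t * U0 * bt \<le> C2 * L2norm (weighted t sp (z w)) + t * C0 * bt"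
     unfolding C0_def C2_def using t U(1) D(1) bt(1) by (intro add_mono mult_right_mono mult_left_mono) auto
    then show ?thesis using u(2) unfolding K_def by simp
   qed
   finally show ?thesis unfolding zs(2) bt(2) by simp
  next
   case False
   then have "sobolev_norm t sp (distr_mult chi f) = \<infinity>" by simp
   then show ?thesis using pos(3) unfolding bt(2) by simp
  qed
 qed
qed

end

section \<open>Choice of the parameters\<close>

lemma AE_lebesgue_open:
 fixes U :: "real set"
 assumes "AE x in lebesgue. P x" "open U" "U \<noteq> {}"
 obtains x where "x \<in> U" "P x"
proof -
 have "\<exists>x\<in>U. P x"
 proof (rule ccontr)
  assume n: "\<not> (\<exists>x\<in>U. P x)"
  obtain N where N: "N \<in> null_sets lebesgue" "{x \<in> space lebesgue. \<not> P x} \<subseteq> N"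
   using assms(1) by (auto simp: eventually_ae_filter)
  have "U \<subseteq> N" using n N(2) by auto
  then have "negligible U" using N(1) negligible_subset[of N U] by (simp add: negligible_iff_null_sets)
  then show False using open_not_negligible[OF assms(2,3)] by blast
 qed
 then show ?thesis using that by blast
qed

text \<open>A value of the continuous \<open>V\<close> outside the closed interval would persist on
  a nonempty open set, which contains a point where \<open>c\<close> and \<open>V\<close>
  agree.\<close>

lemma continuous_AE_range:
 fixes V c :: "real => real"
 assumes V: "continuous_on UNIV V" and ae: "AE x in lebesgue. x \<in> U \<longrightarrow> c x = V x"
  and c: "\<And>x. x \<in> U ==> c x \<in> {a..b}" and U: "open U" and x: "x \<in> U"
 shows "V x \<in> {a..b}"
proof (rule ccontr)
 assume "V x \<notin> {a..b}"
 then have ne: "U \<inter> V -` (- {a..b}) \<noteq> {}" using x by auto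
 have "open (V -` (- {a..b}))" by (rule open_vimage[OF _ V]) (simp add: open_Compl)
 then have "open (U \<inter> V -` (- {a..b}))" using U by (rule open_Int[rotated])
 from AE_lebesgue_open[OF ae this ne] obtain y where "y \<in> U \<inter> V -` (- {a..b})" "y \<in> U \<longrightarrow> c y = V y" by blast
 then show False using c[of y] by auto
qed

text \<open>The strict inequalities for infimum and supremum leave room for real bounds in between;
  the gaps \<open>a0 - c1\<close> and \<open>c2 - b0\<close> later limit \<epsilon>.\<close>

lemma admissible_bounds:
 assumes "admissible c1 c2 c"
 obtains a0 b0 where "c1 < a0" "b0 < c2" "\<And>x. a0 \<le> c x" "\<And>x. c x \<le> b0"
proof -
 have 1: "ereal c1 < (INF x. ereal (c x))" "(SUP x. ereal (c x)) < ereal c2"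
  using assms by (auto simp: admissible_def)
 obtain a0 where a0: "ereal c1 < ereal a0" "ereal a0 < (INF x. ereal (c x))" using ereal_dense2[OF 1(1)] by blast
 obtain b0 where b0: "(SUP x. ereal (c x)) < ereal b0" "ereal b0 < ereal c2" using ereal_dense2[OF 1(2)] by blast
 show ?thesis
 proof (rule that[of a0 b0])
  fix x
  have "ereal a0 \<le> ereal (c x)" by (rule order_trans[OF less_imp_le[OF a0(2)] INF_lower[OF UNIV_I]])
  then show "a0 \<le> c x" by simp
  have "ereal (c x) \<le> ereal b0" by (rule order_trans[OF SUP_upper[OF UNIV_I] less_imp_le[OF b0(1)]])
  then show "c x \<le> b0" by simp
 qed (use a0 b0 in auto)
qed

theorem theorem2:
  fixes c1 c2 m1 x0 :: real and c :: "real \<Rightarrow> real"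
  assumes "0 < c1" and "c1 < c2" and "c2 \<le> 2" and "1 / c1 - 1 / c2 \<le> 1"
    and "admissible c1 c2 c"
    and "m1 = 1 / c1"
  shows "\<exists>\<epsilon>0>0. \<forall>\<epsilon>. 0 < \<epsilon> \<and> \<epsilon> < \<epsilon>0 \<longrightarrow>
    (let s_minus = - 1 / c_minus c x0 \<epsilon>; s_plus = - 1 / c_plus c x0 \<epsilon> in
      \<exists>T. 0 < T \<and> T \<le> 1 \<and>
        (\<forall>\<eta>. bump_function_on {x0 - \<epsilon><..<x0 + \<epsilon>} \<eta> \<longrightarrow>
          (\<exists>C0>0. \<exists>C1>0. \<exists>C2>0. \<forall>t. 0 < t \<and> t \<le> T \<longrightarrow>
            (\<forall>f\<in>sobolev_space t (- m1).
              ereal C1 * sobolev_norm t s_minus (distr_mult (\<lambda>x. complex_of_real (\<eta> x)) f)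
                  - ereal (t * C0) * sobolev_norm t (- m1) f
                \<le> l2_norm (distr_mult (\<lambda>x. complex_of_real (\<eta> x)) (quant (p_inv c) t (- m1) f)) \<and>
              l2_norm (distr_mult (\<lambda>x. complex_of_real (\<eta> x)) (quant (p_inv c) t (- m1) f))
                \<le> ereal C2 * sobolev_norm t s_plus (distr_mult (\<lambda>x. complex_of_real (\<eta> x)) f)
                  + ereal (t * C0) * sobolev_norm t (- m1) f))))"
proof -
 obtain a0 b0 where ab0: "c1 < a0" "b0 < c2" "\<And>x. a0 \<le> c x" "\<And>x. c x \<le> b0"
  by (rule admissible_bounds[OF assms(5)]) blast
 obtain V V' M where V: "regular V V' M" "AE x in lebesgue. x \<in> {x0 - 1<..<x0 + 1} \<longrightarrow> c x = V x"
  by (rule admissible_regular[OF assms(1-3,5), of x0]) blast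
 interpret regular V V' M by (rule V(1))
 \<comment> \<open>Below 1 the interval stays inside the one on which \<open>c\<close> agrees with
   \<open>V\<close>; the two gaps ensure \<open>c1 < cm\<close> and \<open>cp < c2\<close> after the
   shifts by \<epsilon>.\<close>
 define e0 where "e0 = min 1 (min (a0 - c1) (c2 - b0))"
 have "0 < e0" using ab0(1,2) by (simp add: e0_def)
 show ?thesis
 proof (rule exI[of _ e0], intro conjI allI impI \<open>0 < e0\<close>, elim conjE, goal_cases)
  case e: (1 \<epsilon>)
  let ?I = "{x0 - \<epsilon><..<x0 + \<epsilon>}"
  define a b where "a = (INF x\<in>?I. c x)" and "b = (SUP x\<in>?I. c x)"
  have x0: "x0 \<in> ?I" using e by simp
  then have ne: "?I \<noteq> {}" by blast
  have bdd: "bdd_below (c ` ?I)" "bdd_above (c ` ?I)" using ab0(3,4) by (auto intro!: bdd_belowI2 bdd_aboveI2)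
  have cab: "c x \<in> {a..b}" if "x \<in> ?I" for x
   unfolding a_def b_def using cINF_lower[OF bdd(1) that] cSUP_upper[OF that bdd(2)] by simp
  have a0: "a0 \<le> a" unfolding a_def by (rule cINF_greatest[OF ne ab0(3)])
  have b0: "b \<le> b0" unfolding b_def by (rule cSUP_least[OF ne ab0(4)])
  have ab: "a \<le> b" using cab[OF x0] by simp
  define cm cp where "cm = a - \<epsilon>" and "cp = b + \<epsilon>"
  have cmp: "c_minus c x0 \<epsilon> = cm" "c_plus c x0 \<epsilon> = cp"
   by (simp_all add: c_minus_def c_plus_def cm_def cp_def a_def b_def)
  have e': "\<epsilon> < 1" "\<epsilon> < a0 - c1" "\<epsilon> < c2 - b0" using e by (auto simp: e0_def)
  have c: "0 < c1" "c1 < cm" "cm < a" "a \<le> b" "b < cp" "cp < c2"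
   using assms(1) e(1) e' a0 b0 ab by (auto simp: cm_def cp_def)
  have r: "1 / a < 1 / cm" "1 / cp < 1 / b" "1 / c2 < 1 / cp" "1 / c2 < 1 / b"
   using c by (auto intro!: divide_strict_left_mono mult_pos_pos)
  \<comment> \<open>The least of the slacks that \<open>symbol_bounds\<close> asks for. Those at
    \<open>1/cm\<close> and \<open>1/cp\<close> are positive because of the \<epsilon> in
    \<open>c_minus\<close> and \<open>c_plus\<close>; the one at \<open>1/c2\<close> turns
    \<open>1/c1 - 1/c2 \<le> 1\<close> into \<open>m1 + \<delta> \<le> 1 + 1/b\<close>.\<close>
  define \<delta> where "\<delta> = min (1 / cm - 1 / a) (min (1 / b - 1 / c2) (1 / b - 1 / cp))"
  have \<delta>: "0 < \<delta>" "\<delta> \<le> 1 / cm - 1 / a" "\<delta> \<le> 1 / b - 1 / c2" "\<delta> \<le> 1 / b - 1 / cp"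
   unfolding \<delta>_def using r by auto
  have sb: "symbol_bounds a b (1 / cm) m1 (- 1 / cp) \<delta>"
  proof
   show "m1 + \<delta> \<le> 1 + 1 / b" using assms(4,6) \<delta> by linarith
   show "\<delta> - 1 / b \<le> - 1 / cp" using \<delta>(4) by simp
  qed (use c \<delta> assms(1,6) in auto)
  show ?case unfolding Let_def
  \<comment> \<open>\<open>T = 1\<close>: the estimates hold for all \<open>t\<close> up to 1 with
    the same constants.\<close>
  proof (rule exI[of _ 1], intro conjI allI impI, goal_cases)
   case (3 \<eta>)
   then have \<eta>: "smooth \<eta>" "compact (closure {x. \<eta> x \<noteq> 0})" "closure {x. \<eta> x \<noteq> 0} \<subseteq> ?I"
    by (auto simp: bump_function_on_def)
   \<comment> \<open>Inserting \<open>x0\<close> keeps the compact set nonempty when the bump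
     vanishes identically. Its extreme points \<open>p\<close>, \<open>q\<close> lie strictly inside
     the interval, which leaves room for the plateau \<open>P\<close> that serves as the second
     cutoff.\<close>
   let ?K = "insert x0 (closure {x. \<eta> x \<noteq> 0})"
   have K: "compact ?K" "?K \<noteq> {}" "?K \<subseteq> ?I" using \<eta>(2,3) e(1) by auto
   obtain p where p: "p \<in> ?K" "\<And>x. x \<in> ?K ==> p \<le> x" using compact_attains_inf[OF K(1,2)] by blast
   obtain q where q: "q \<in> ?K" "\<And>x. x \<in> ?K ==> x \<le> q" using compact_attains_sup[OF K(1,2)] by blast
   have pq: "x0 - \<epsilon> < p" "p \<le> q" "q < x0 + \<epsilon>" using p q K(3) by auto
   have supp: "x \<in> {p..q}" if "\<eta> x \<noteq> 0" for x using that p(2)[of x] q(2)[of x] closure_subset[of "{x. \<eta> x \<noteq> 0}"] by auto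
   obtain P :: "real => real" where P: "smooth P" "\<And>x. x \<in> {p..q} ==> P x = 1"
    "\<And>x. x \<notin> ?I ==> P x = 0" "\<And>x. 0 \<le> P x" "\<And>x. P x \<le> 1"
    by (rule plateau_exists[OF pq]) blast
   have \<eta>I: "x \<in> ?I" if "\<eta> x \<noteq> 0" for x using supp[OF that] pq by auto
   have ae: "AE x in lebesgue. x \<in> ?I \<longrightarrow> c x = V x"
    using V(2) by eventually_elim (use e'(1) in auto)
   interpret localized_symbol V V' M a b "1 / cm" m1 "- 1 / cp" \<delta> "\<lambda>x. complex_of_real (\<eta> x)" "\<lambda>x. complex_of_real (P x)"
   proof (intro localized_symbol.intro V(1) sb localized_symbol_axioms.intro)
    show "(\<lambda>x. complex_of_real (\<eta> x)) \<in> schwartz"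
     by (rule plateau_schwartz[OF \<eta>(1), of "x0 - \<epsilon>" "x0 + \<epsilon>"]) (use \<eta>I in blast)
    show "(\<lambda>x. complex_of_real (P x)) \<in> schwartz" by (rule plateau_schwartz[OF P(1,3)])
    show "norm (complex_of_real (P x)) \<le> 1" for x using P(4,5)[of x] by simp
    show "complex_of_real (\<eta> x) * complex_of_real (P x) = complex_of_real (\<eta> x)" for x
     using P(2)[OF supp[of x]] by (cases "\<eta> x = 0") auto
    show "V x \<in> {a..b}" if "complex_of_real (P x) \<noteq> 0" for x
    proof (rule continuous_AE_range[OF cV ae cab])
     show "x \<in> ?I" using that P(3)[of x] by auto
    qed auto
    show "m1 + - 1 / cp \<le> 1" using assms(4,6) r(3) by simp
   qed
   have "AE x in lebesgue. complex_of_real (\<eta> x) \<noteq> 0 \<longrightarrow> c x = V x"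
    using ae by eventually_elim (use \<eta>I in auto)
   from localized_estimate[OF this] show ?case unfolding cmp minus_divide_left .
  qed auto
 qed
qed

end
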